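(* If $X\subseteq\mathbb{P}^n$ is closed, reduced and totally real with $\Sigma_X^*=P_X^*$, then $X$ is linearly joined and each of its irreducible components is a variety of minimal degree in its linear span.
   Context: $X$ totally real means $X(\mathbb{R})$ is Zariski dense in $X$. $P_X$ is the cone of quadrics in $R_2=(\mathbb{R}[x_0,\dots,x_n]/I(X))_2$ nonnegative on $X(\mathbb{R})$, $\Sigma_X$ the cone of sums of squares of elements of $R_1$, and $P_X^*,\Sigma_X^*$ their duals. A variety $V$ is of minimal degree in its span if $\deg V=\operatorname{codim}_{\langle V\rangle}V+1$. $X$ is linearly joined if its irreducible components can be ordered $X_1,\dots,X_r$ so that $X_j\cap\bigcup_{s<j}X_s=\langle X_j\rangle\cap\langle\bigcup_{s<j}X_s\rangle$ for $1<j\le r$, where $\langle\cdot\rangle$ denotes linear span. *)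

theory Defs
  imports "HOL-Analysis.Analysis"
begin

text \<open>Conventions. The ambient projective space is P^n over the complex numbers, with
homogeneous coordinates indexed by a finite type 'n (so n+1 = CARD('n)).
A subset of P^n is represented by its affine cone minus the origin, i.e. by a set of
nonzero vectors in complex^'n (closed under nonzero scaling when it is Zariski closed).\<close>

definition monom :: "('n::finite \<Rightarrow> nat) \<Rightarrow> 'a::comm_ring_1^'n \<Rightarrow> 'a" where
  "monom \<alpha> z = (\<Prod>i\<in>UNIV. z $ i ^ \<alpha> i)"

definition hom_poly :: "nat \<Rightarrow> (complex^'n::finite \<Rightarrow> complex) \<Rightarrow> bool" where
  "hom_poly d f \<longleftrightarrow> (\<exists>A c. finite A \<and> (\<forall>\<alpha>\<in>A. sum \<alpha> UNIV = d) \<and>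
      f = (\<lambda>z. \<Sum>\<alpha>\<in>A. c \<alpha> * monom \<alpha> z))"

definition real_hom_poly :: "nat \<Rightarrow> (complex^'n::finite \<Rightarrow> complex) \<Rightarrow> bool" where
  "real_hom_poly d f \<longleftrightarrow> (\<exists>A (c :: ('n \<Rightarrow> nat) \<Rightarrow> real). finite A \<and> (\<forall>\<alpha>\<in>A. sum \<alpha> UNIV = d) \<and>
      f = (\<lambda>z. \<Sum>\<alpha>\<in>A. complex_of_real (c \<alpha>) * monom \<alpha> z))"

definition proj_closed :: "(complex^'n::finite) set \<Rightarrow> bool" where
  "proj_closed S \<longleftrightarrow> (\<exists>F. (\<forall>f\<in>F. \<exists>d. hom_poly d f) \<and>
      S = {z. z \<noteq> 0 \<and> (\<forall>f\<in>F. f z = 0)})"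

text \<open>Closed subschemes of P^n_R that are reduced, given by their complex points:
zero loci of real homogeneous polynomials.\<close>
definition real_proj_closed :: "(complex^'n::finite) set \<Rightarrow> bool" where
  "real_proj_closed S \<longleftrightarrow> (\<exists>F. (\<forall>f\<in>F. \<exists>d. real_hom_poly d f) \<and>
      S = {z. z \<noteq> 0 \<and> (\<forall>f\<in>F. f z = 0)})"

definition cvec :: "real^'n::finite \<Rightarrow> complex^'n" where
  "cvec x = (\<chi> i. complex_of_real (x $ i))"

definition real_points :: "(complex^'n::finite) set \<Rightarrow> (real^'n) set" where
  "real_points X = {x. x \<noteq> 0 \<and> cvec x \<in> X}"

text \<open>Totally real: X(R) is Zariski dense in X, i.e. every homogeneous polynomial
vanishing on X(R) vanishes on X.\<close>
definition totally_real :: "(complex^'n::finite) set \<Rightarrow> bool" where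
  "totally_real X \<longleftrightarrow> (\<forall>d f. hom_poly d f \<and> (\<forall>x\<in>real_points X. f (cvec x) = 0)
      \<longrightarrow> (\<forall>z\<in>X. f z = 0))"

definition rqform :: "real^'n^'n \<Rightarrow> real^'n::finite \<Rightarrow> real" where
  "rqform A x = (\<Sum>i\<in>UNIV. \<Sum>j\<in>UNIV. A $ i $ j * x $ i * x $ j)"

definition cqform :: "real^'n^'n \<Rightarrow> complex^'n::finite \<Rightarrow> complex" where
  "cqform A z = (\<Sum>i\<in>UNIV. \<Sum>j\<in>UNIV. complex_of_real (A $ i $ j) * z $ i * z $ j)"

definition ideal2 :: "(complex^'n::finite) set \<Rightarrow> (real^'n^'n) set" where
  "ideal2 X = {A. \<forall>z\<in>X. cqform A z = 0}"

text \<open>Square of the linear form with coefficient vector l.\<close>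
definition outer_sq :: "real^'n::finite \<Rightarrow> real^'n^'n" where
  "outer_sq l = (\<chi> i j. l $ i * l $ j)"

text \<open>Sigma_X (representatives): quadrics congruent mod I(X)_2 to a sum of squares of linear forms.\<close>
definition SigmaX :: "(complex^'n::finite) set \<Rightarrow> (real^'n^'n) set" where
  "SigmaX X = {A. \<exists>ls. A - sum_list (map outer_sq ls) \<in> ideal2 X}"

text \<open>P_X (representatives): quadrics nonnegative on X(R).\<close>
definition PX :: "(complex^'n::finite) set \<Rightarrow> (real^'n^'n) set" where
  "PX X = {A. \<forall>x\<in>real_points X. rqform A x \<ge> 0}"

definition R2_dual :: "(complex^'n::finite) set \<Rightarrow> (real^'n^'n \<Rightarrow> real) set" where
  "R2_dual X = {l. linear l \<and> (\<forall>A\<in>ideal2 X. l A = 0)}"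

definition SigmaX_dual :: "(complex^'n::finite) set \<Rightarrow> (real^'n^'n \<Rightarrow> real) set" where
  "SigmaX_dual X = {l\<in>R2_dual X. \<forall>A\<in>SigmaX X. l A \<ge> 0}"

definition PX_dual :: "(complex^'n::finite) set \<Rightarrow> (real^'n^'n \<Rightarrow> real) set" where
  "PX_dual X = {l\<in>R2_dual X. \<forall>A\<in>PX X. l A \<ge> 0}"

definition proj_irreducible :: "(complex^'n::finite) set \<Rightarrow> bool" where
  "proj_irreducible S \<longleftrightarrow> proj_closed S \<and> S \<noteq> {} \<and>
     (\<forall>A B. proj_closed A \<and> proj_closed B \<and> S \<subseteq> A \<union> B \<longrightarrow> S \<subseteq> A \<or> S \<subseteq> B)"

definition irr_components :: "(complex^'n::finite) set \<Rightarrow> (complex^'n) set set" where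
  "irr_components X = {V. proj_irreducible V \<and> V \<subseteq> X \<and>
     (\<forall>W. proj_irreducible W \<and> V \<subseteq> W \<and> W \<subseteq> X \<longrightarrow> W = V)}"

definition pspan :: "(complex^'n::finite) set \<Rightarrow> (complex^'n) set" where
  "pspan S = vec.span S - {0}"

definition proj_dim :: "(complex^'n::finite) set \<Rightarrow> nat" where
  "proj_dim V = (GREATEST k. \<exists>C :: nat \<Rightarrow> (complex^'n) set.
      (\<forall>i\<le>k. proj_irreducible (C i)) \<and> (\<forall>i<k. C i \<subset> C (Suc i)) \<and> C k = V)"

definition proj_points :: "(complex^'n::finite) set \<Rightarrow> (complex^'n) set set" where
  "proj_points S = (\<lambda>z. {c *s z | c. c \<noteq> 0}) ` S"

definition lin_cut :: "nat \<Rightarrow> (complex^'n::finite) set \<Rightarrow> bool" where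
  "lin_cut k L \<longleftrightarrow> (\<exists>a :: nat \<Rightarrow> complex^'n.
      L = {z. z \<noteq> 0 \<and> (\<forall>i<k. (\<Sum>j\<in>UNIV. a i $ j * z $ j) = 0)})"

text \<open>Degree: the number of points in the intersection with a general linear subspace of
complementary dimension, i.e. the maximum number of points of a finite such intersection.\<close>
definition proj_degree :: "(complex^'n::finite) set \<Rightarrow> nat" where
  "proj_degree V = Max {card (proj_points (V \<inter> L)) | L.
      lin_cut (proj_dim V) L \<and> finite (proj_points (V \<inter> L))}"

text \<open>Minimal degree in its span: deg V = codim of V in its span + 1.\<close>
definition minimal_degree :: "(complex^'n::finite) set \<Rightarrow> bool" where
  "minimal_degree V \<longleftrightarrow>
     int (proj_degree V) = (int (vec.dim (vec.span V)) - 1 - int (proj_dim V)) + 1"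

definition linearly_joined :: "(complex^'n::finite) set \<Rightarrow> bool" where
  "linearly_joined X \<longleftrightarrow> (\<exists>Xs. distinct Xs \<and> set Xs = irr_components X \<and>
     (\<forall>j. 0 < j \<and> j < length Xs \<longrightarrow>
        Xs ! j \<inter> \<Union>(set (take j Xs)) = pspan (Xs ! j) \<inter> pspan (\<Union>(set (take j Xs)))))"

end

theory Submission
  imports Defs "HOL-Computational_Algebra.Fundamental_Theorem_Algebra"
begin

text \<open>Equality of the dual cones says that a positive semidefinite matrix orthogonal to the quadrics
  through \<open>X\<close> is a sum of squares of real points of \<open>X\<close>. Perturbing such decompositions shows that a
  real point in the span of other real points is not isolated in that span. Hence, on a component \<open>V\<close>,
  a maximal tuple \<open>Y\<^sub>0, \<dots>, Y\<^sub>c\<close> of generic real points that are independent modulo each other's tangent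
  spaces spans a subspace meeting \<open>X\<close> in these points only, and some quadrics through \<open>X\<close> are dual
  to the products of pairs. Projection from \<open>Y\<^sub>1, \<dots>, Y\<^sub>c\<close> identifies \<open>V\<close> birationally with the tangent
  space at \<open>Y\<^sub>0\<close>, of projective dimension \<open>D\<close>. Expanding along curves through the \<open>Y\<^sub>i\<close> shows that the
  coordinate ring is free over a polynomial ring in \<open>D + 1\<close> linear forms, with basis \<open>1\<close> and \<open>c\<close> linear
  forms. This persists for any \<open>D + 1\<close> linear forms without common zero on \<open>V\<close>, so every finite section
  has at most \<open>c + 1\<close> points; the span of the \<open>Y\<^sub>i\<close> attains this bound. The components are joined
  linearly because some component meets the span of the others in a linear subspace of a second
  component, and removing it preserves the hypothesis.\<close>

text \<open>Two obstacles shape the proof. The hypothesis speaks of quadrics only, whereas a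
  component is cut out by forms of all degrees. So the tangent space comes in two versions:
  \<open>T1\<close>, from all forms on the component, and the larger \<open>T2\<close>, from the
  quadrics through \<open>X\<close>. Limits of real points land in \<open>T1\<close>, dual quadrics
  give independence modulo \<open>T2\<close>, and together they turn an independence that holds in
  one order of the points into one that holds in every order. Secondly, the degree is a maximum over
  all finite linear sections, not only the general ones. One good section gives a lower bound; the
  upper bound needs freeness over every system of parameters, which is the Cohen-Macaulay property.
  It is reached by replacing parameters one at a time, each replacement being injective, hence
  bijective, on a finite-dimensional quotient. For the joining, the minimal branch of components
  attached to a single component is shown to consist of one component, by exchanging points in bases
  modulo the span of the attachment.\<close>

lemma hom_poly_zero: "hom_poly d (\<lambda>z. 0)"
  unfolding hom_poly_def by (rule exI[of _ "{}"]) auto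

lemma hom_poly_const: "hom_poly 0 (\<lambda>z. c)"
  unfolding hom_poly_def
  by (rule exI[of _ "{\<lambda>_. 0}"], rule exI[of _ "\<lambda>_. c"]) (auto simp: monom_def)

lemma hom_poly_add:
  assumes "hom_poly d f" "hom_poly d g" shows "hom_poly d (\<lambda>z. f z + g z)"
proof -
  obtain A a where A: "finite A" "\<forall>\<alpha>\<in>A. sum \<alpha> UNIV = d" "f = (\<lambda>z. \<Sum>\<alpha>\<in>A. a \<alpha> * monom \<alpha> z)"
    using assms(1) unfolding hom_poly_def by blast
  obtain B b where B: "finite B" "\<forall>\<alpha>\<in>B. sum \<alpha> UNIV = d" "g = (\<lambda>z. \<Sum>\<alpha>\<in>B. b \<alpha> * monom \<alpha> z)"
    using assms(2) unfolding hom_poly_def by blast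
  define c where "c \<alpha> = (if \<alpha> \<in> A then a \<alpha> else 0) + (if \<alpha> \<in> B then b \<alpha> else 0)" for \<alpha>
  have "f z + g z = (\<Sum>\<alpha>\<in>A \<union> B. c \<alpha> * monom \<alpha> z)" for z
  proof -
    have "f z = (\<Sum>\<alpha>\<in>A \<union> B. (if \<alpha> \<in> A then a \<alpha> else 0) * monom \<alpha> z)"
      unfolding A(3) by (rule sum.mono_neutral_cong_left) (use A B in auto)
    moreover have "g z = (\<Sum>\<alpha>\<in>A \<union> B. (if \<alpha> \<in> B then b \<alpha> else 0) * monom \<alpha> z)"
      unfolding B(3) by (rule sum.mono_neutral_cong_left) (use A B in auto)
    ultimately show ?thesis by (simp add: c_def algebra_simps sum.distrib)
  qed
  then show ?thesis unfolding hom_poly_def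
    by (intro exI[of _ "A \<union> B"] exI[of _ c]) (use A B in auto)
qed

lemma monom_fun_upd_Suc: "monom (\<alpha>(i := Suc (\<alpha> i))) z = z $ i * monom \<alpha> z"
proof -
  have "monom (\<alpha>(i := Suc (\<alpha> i))) z = z $ i ^ Suc (\<alpha> i) * (\<Prod>j\<in>UNIV - {i}. z $ j ^ \<alpha> j)"
    unfolding monom_def by (subst prod.remove[of _ i]) (auto intro!: prod.cong)
  also have "\<dots> = z $ i * monom \<alpha> z"
    unfolding monom_def by (subst (2) prod.remove[of _ i]) (auto simp: mult.assoc)
  finally show ?thesis .
qed

lemma sum_fun_upd_Suc: "sum (\<alpha>(i := Suc (\<alpha> i))) (UNIV :: 'n::finite set) = Suc (sum \<alpha> UNIV)"
proof -
  have "sum (\<alpha>(i := Suc (\<alpha> i))) UNIV = Suc (\<alpha> i) + sum \<alpha> (UNIV - {i})"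
    by (subst sum.remove[of _ i]) (auto intro!: sum.cong)
  also have "\<dots> = Suc (sum \<alpha> UNIV)" by (subst (2) sum.remove[of _ i]) auto
  finally show ?thesis .
qed

lemma hom_poly_coord:
  assumes "hom_poly d f" shows "hom_poly (Suc d) (\<lambda>z. z $ i * f z)"
proof -
  obtain A a where A: "finite A" "\<forall>\<alpha>\<in>A. sum \<alpha> UNIV = d" "f = (\<lambda>z. \<Sum>\<alpha>\<in>A. a \<alpha> * monom \<alpha> z)"
    using assms(1) unfolding hom_poly_def by blast
  define s where "s \<alpha> = \<alpha>(i := Suc (\<alpha> i))" for \<alpha> :: "'a \<Rightarrow> nat"
  have inj: "inj_on s A"
  proof (rule inj_onI)
    fix x y assume "s x = s y"
    then have "\<And>j. s x j = s y j" by simp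
    then show "x = y" unfolding s_def by (intro ext) (metis fun_upd_apply nat.inject)
  qed
  have "z $ i * f z = (\<Sum>\<alpha>\<in>s ` A. a (inv_into A s \<alpha>) * monom \<alpha> z)" for z
    unfolding A(3) sum.reindex[OF inj] sum_distrib_left
    by (rule sum.cong) (auto simp: inv_into_f_f[OF inj] s_def[of "_ :: 'a \<Rightarrow> nat", THEN arg_cong[of _ _ "\<lambda>\<beta>. monom \<beta> z"]] monom_fun_upd_Suc simp del: fun_upd_apply)
  moreover have "sum (s \<alpha>) UNIV = Suc d" if "\<alpha> \<in> A" for \<alpha>
    using A(2) that by (simp add: s_def sum_fun_upd_Suc del: fun_upd_apply)
  ultimately show ?thesis unfolding hom_poly_def
    by (intro exI[of _ "s ` A"] exI[of _ "\<lambda>\<alpha>. a (inv_into A s \<alpha>)"]) (use A in auto)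
qed

text \<open>Constants, multiplication by a coordinate and addition within one degree generate all
  forms. Arguing by this rule keeps exponents and coefficients out of nearly everything that
  follows.\<close>

lemma hom_poly_induct [consumes 1, case_names const coord add]:
  assumes "hom_poly d f"
    and const: "\<And>c. P 0 (\<lambda>z. c)"
    and coord: "\<And>d f i. hom_poly d f \<Longrightarrow> P d f \<Longrightarrow> P (Suc d) (\<lambda>z. z $ i * f z)"
    and add: "\<And>d f g. hom_poly d f \<Longrightarrow> hom_poly d g \<Longrightarrow> P d f \<Longrightarrow> P d g \<Longrightarrow> P d (\<lambda>z. f z + g z)"
  shows "P d f"
proof -
  \<comment> \<open>The empty sum is a form of every degree, so the zero map has to be reached in
    each degree separately.\<close>
  have zero: "P d (\<lambda>z. 0)" for d
  proof (induction d)
    case (Suc d)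
    show ?case using coord[OF hom_poly_zero Suc] by simp
  qed (rule const)
  have mon: "hom_poly d (\<lambda>z. c * monom \<alpha> z) \<and> P d (\<lambda>z. c * monom \<alpha> z)" if "sum \<alpha> UNIV = d" for d c \<alpha>
    using that
  proof (induction d arbitrary: \<alpha>)
    case 0
    then have "\<alpha> = (\<lambda>_. 0)" by auto
    then show ?case using const hom_poly_const by (simp add: monom_def)
  next
    case (Suc d)
    then obtain i where i: "\<alpha> i > 0" by (metis gr0I sum.neutral nat.distinct(1))
    define \<beta> where "\<beta> = \<alpha>(i := \<alpha> i - 1)"
    have \<alpha>: "\<alpha> = \<beta>(i := Suc (\<beta> i))" using i by (auto simp: \<beta>_def)
    have s: "sum \<beta> UNIV = d" using Suc(2) unfolding \<alpha> sum_fun_upd_Suc by simp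
    have "(\<lambda>z. c * monom \<alpha> z) = (\<lambda>z. z $ i * (c * monom \<beta> z))"
      by (subst \<alpha>) (auto simp: monom_fun_upd_Suc mult_ac simp del: fun_upd_apply)
    then show ?case using Suc(1)[OF s] coord hom_poly_coord by metis
  qed
  obtain A a where A: "finite A" "\<forall>\<alpha>\<in>A. sum \<alpha> UNIV = d" "f = (\<lambda>z. \<Sum>\<alpha>\<in>A. a \<alpha> * monom \<alpha> z)"
    using assms(1) unfolding hom_poly_def by blast
  have "hom_poly d (\<lambda>z. \<Sum>\<alpha>\<in>A. a \<alpha> * monom \<alpha> z) \<and> P d (\<lambda>z. \<Sum>\<alpha>\<in>A. a \<alpha> * monom \<alpha> z)"
    using A(1,2)
  proof (induction A rule: finite_induct)
    case empty then show ?case using zero hom_poly_zero by simp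
  next
    case (insert x F)
    then have m: "hom_poly d (\<lambda>z. a x * monom x z)" "P d (\<lambda>z. a x * monom x z)"
      using mon[of x d "a x"] by auto
    show ?case using insert
      by (simp add: hom_poly_add[OF m(1)] add[OF m(1) _ m(2)])
  qed
  then show ?thesis unfolding A(3) by simp
qed

lemma hom_poly_smult: "hom_poly d f \<Longrightarrow> hom_poly d (\<lambda>z. c * f z)"
proof (induction rule: hom_poly_induct)
  case (coord d f i)
  then show ?case using hom_poly_coord[OF coord(2), of i] by (simp add: mult_ac)
next
  case (add d f g)
  then show ?case using hom_poly_add[OF add(3,4)] by (simp add: algebra_simps)
qed (rule hom_poly_const)

lemma hom_poly_mult: "hom_poly d f \<Longrightarrow> hom_poly e g \<Longrightarrow> hom_poly (d + e) (\<lambda>z. f z * g z)"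
proof (induction rule: hom_poly_induct)
  case (coord d f i)
  then show ?case using hom_poly_coord[OF coord(2)[OF coord(3)], of i] by (simp add: mult_ac)
next
  case (add d f g)
  then show ?case using hom_poly_add[OF add(3,4)] by (simp add: algebra_simps)
qed (simp add: hom_poly_smult)

lemma hom_poly_uminus: "hom_poly d f \<Longrightarrow> hom_poly d (\<lambda>z. - f z)"
  using hom_poly_smult[of d f "-1"] by simp

lemma hom_poly_diff: "hom_poly d f \<Longrightarrow> hom_poly d g \<Longrightarrow> hom_poly d (\<lambda>z. f z - g z)"
  using hom_poly_add[OF _ hom_poly_uminus, of d f g] by simp

lemma hom_poly_sum: "(\<And>i. i \<in> I \<Longrightarrow> hom_poly d (f i)) \<Longrightarrow> hom_poly d (\<lambda>z. \<Sum>i\<in>I. f i z)"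
  by (induction I rule: infinite_finite_induct) (auto intro: hom_poly_zero hom_poly_add)

lemma hom_poly_prod:
  "(\<And>i. i \<in> I \<Longrightarrow> hom_poly (d i) (f i)) \<Longrightarrow> hom_poly (\<Sum>i\<in>I. d i) (\<lambda>z. \<Prod>i\<in>I. f i z)"
  by (induction I rule: infinite_finite_induct) (auto intro: hom_poly_const hom_poly_mult)

lemma hom_poly_power: "hom_poly d f \<Longrightarrow> hom_poly (d * k) (\<lambda>z. f z ^ k)"
  by (induction k) (auto intro: hom_poly_const dest: hom_poly_mult)

definition lf :: "complex^'n \<Rightarrow> complex^'n::finite \<Rightarrow> complex" where
  "lf a z = (\<Sum>j\<in>UNIV. a $ j * z $ j)"

lemma hom_poly_nth: "hom_poly 1 (\<lambda>z. z $ i)"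
  using hom_poly_coord[OF hom_poly_const[of 1]] by simp

lemma hom_poly_lf: "hom_poly 1 (lf a)"
  unfolding lf_def by (intro hom_poly_sum hom_poly_smult hom_poly_nth)

lemma lf_linear: "lf a (x + y) = lf a x + lf a y" "lf a (c *s x) = c * lf a x"
  "lf (a + b) x = lf a x + lf b x" "lf (c *s a) x = c * lf a x" "lf 0 x = 0" "lf a 0 = 0"
  by (simp_all add: lf_def algebra_simps sum.distrib sum_distrib_left)

lemma lf_sum: "lf a (\<Sum>i\<in>I. f i) = (\<Sum>i\<in>I. lf a (f i))"
  by (induction I rule: infinite_finite_induct) (auto simp: lf_linear)

lemma lf_sum_left: "lf (\<Sum>i\<in>I. f i) x = (\<Sum>i\<in>I. lf (f i) x)"
  by (induction I rule: infinite_finite_induct) (auto simp: lf_linear)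

lemma lf_axis: "lf (axis i 1) z = z $ i"
  by (simp add: lf_def axis_def if_distrib if_distribR sum.If_cases cong: if_cong)

lemma hom_poly_1_lf:
  assumes "hom_poly 1 f" shows "\<exists>a. f = lf a"
proof -
  have "d = 1 \<longrightarrow> (\<exists>a. f = lf a)" if "hom_poly d f" for d and f :: "complex^'a \<Rightarrow> complex"
    using that
  proof (induction rule: hom_poly_induct)
    case (coord d f i)
    show ?case
    proof
      assume "Suc d = 1"
      then have "d = 0" by simp
      have "e = 0 \<longrightarrow> (\<exists>c. h = (\<lambda>z. c))" if "hom_poly e h" for e and h :: "complex^'a \<Rightarrow> complex"
        using that by (induction rule: hom_poly_induct) auto
      then obtain c where "f = (\<lambda>z. c)" using coord(1) \<open>d = 0\<close> by blast
      then have "(\<lambda>z. z $ i * f z) = lf (c *s axis i 1)" by (auto simp: lf_linear lf_axis)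
      then show "\<exists>a. (\<lambda>z. z $ i * f z) = lf a" by blast
    qed
  next
    case (add d f g)
    show ?case
    proof
      assume "d = 1"
      then obtain a b where "f = lf a" "g = lf b" using add by blast
      then have "(\<lambda>z. f z + g z) = lf (a + b)" by (auto simp: lf_linear)
      then show "\<exists>a. (\<lambda>z. f z + g z) = lf a" by blast
    qed
  qed auto
  then show ?thesis using assms by blast
qed

lemma hom_poly_Suc_coords:
  assumes "hom_poly (Suc d) f"
  shows "\<exists>g. (\<forall>i. hom_poly d (g i)) \<and> f = (\<lambda>z. \<Sum>i\<in>UNIV. z $ i * g i z)"
proof -
  have "\<forall>d. e = Suc d \<longrightarrow> (\<exists>g. (\<forall>i. hom_poly d (g i)) \<and> f = (\<lambda>z. \<Sum>i\<in>UNIV. z $ i * g i z))"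
    if "hom_poly e f" for e and f :: "complex^'a \<Rightarrow> complex"
    using that
  proof (induction rule: hom_poly_induct)
    case (coord d f i)
    have "(\<lambda>z. z $ i * f z) = (\<lambda>z. \<Sum>k\<in>UNIV. z $ k * (if k = i then f z else 0))"
      by (simp add: if_distrib cong: if_cong)
    moreover have "hom_poly d (\<lambda>z. if k = i then f z else 0)" for k
      using coord(1) by (cases "k = i") (simp_all add: hom_poly_zero)
    ultimately show ?case
      by (intro allI impI exI[of _ "\<lambda>k z. if k = i then f z else 0"]) auto
  next
    case (add d f g)
    show ?case
    proof (intro allI impI)
      fix e assume "d = Suc e"
      then obtain h k where "\<forall>i. hom_poly e (h i)" "f = (\<lambda>z. \<Sum>i\<in>UNIV. z $ i * h i z)"
          "\<forall>i. hom_poly e (k i)" "g = (\<lambda>z. \<Sum>i\<in>UNIV. z $ i * k i z)" using add by blast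
      then show "\<exists>ga. (\<forall>i. hom_poly e (ga i)) \<and> (\<lambda>z. f z + g z) = (\<lambda>z. \<Sum>i\<in>UNIV. z $ i * ga i z)"
        by (intro exI[of _ "\<lambda>i z. h i z + k i z"]) (auto intro: hom_poly_add simp: algebra_simps sum.distrib)
    qed
  qed auto
  then show ?thesis using assms by blast
qed

lemma hom_poly_comp:
  assumes "hom_poly d f" and g: "\<And>i. hom_poly e (\<lambda>z. g z $ i)"
  shows "hom_poly (d * e) (\<lambda>z. f (g z))"
  using assms(1)
proof (induction rule: hom_poly_induct)
  case (coord d f i)
  then show ?case using hom_poly_mult[OF g coord(2)] by simp
qed (auto intro: hom_poly_const hom_poly_add)

lemma hom_poly_scale: "hom_poly d f \<Longrightarrow> f (c *s z) = c ^ d * f z"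
  by (induction rule: hom_poly_induct) (auto simp: algebra_simps)

lemma hom_poly_curve:
  assumes "hom_poly d f" and g: "\<And>i. \<exists>p. \<forall>t. g t $ i = poly p (t :: complex)"
  shows "\<exists>p. \<forall>t. f (g t) = poly p t"
  using assms(1)
proof (induction rule: hom_poly_induct)
  case (const c)
  show ?case by (rule exI[of _ "[:c:]"]) simp
next
  case (coord d f i)
  then obtain p q where "\<forall>t. f (g t) = poly p t" "\<forall>t. g t $ i = poly q t" using g by blast
  then show ?case by (intro exI[of _ "q * p"]) simp
next
  case (add d f h)
  then obtain p q where "\<forall>t. f (g t) = poly p t" "\<forall>t. h (g t) = poly q t" by blast
  then show ?case by (intro exI[of _ "p + q"]) simp
qed

lemma hom_poly_line:
  assumes "hom_poly d f" shows "\<exists>p. \<forall>t. f (x + t *s v) = poly p t"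
proof (rule hom_poly_curve[OF assms])
  fix i show "\<exists>p. \<forall>t. (x + t *s v) $ i = poly p t"
    by (rule exI[of _ "[:x $ i, v $ i:]"]) simp
qed

text \<open>The Frechet derivative is only real linear a priori. For forms it turns out to be the
  complex linear map \<open>lf (grad f z)\<close>, so its values at the coordinate vectors are the
  complex partial derivatives.\<close>

definition grad :: "(complex^'n::finite \<Rightarrow> complex) \<Rightarrow> complex^'n \<Rightarrow> complex^'n" where
  "grad f z = (\<chi> i. frechet_derivative f (at z) (axis i 1))"

text \<open>Homogeneity of the gradient, the derivative property and Euler's identity follow
  together from the product rule, in one induction over the generation of forms. Degree 0 needs a
  clause of its own because degrees are natural numbers.\<close>

lemma hom_poly_gradient_ex:
  assumes "hom_poly d f"
  shows "\<exists>g. (case d of 0 \<Rightarrow> g = (\<lambda>z. 0) | Suc e \<Rightarrow> \<forall>i. hom_poly e (\<lambda>z. g z $ i)) \<and>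
     (\<forall>z. (f has_derivative lf (g z)) (at z)) \<and> (\<forall>z. lf (g z) z = of_nat d * f z)"
  using assms
proof (induction rule: hom_poly_induct)
  case (const c)
  have "lf 0 = (\<lambda>v. 0)" by (auto simp: lf_linear)
  then show ?case by (intro exI[of _ "\<lambda>z. 0"]) (auto simp: lf_linear)
next
  case (coord d f i)
  then obtain g where g: "case d of 0 \<Rightarrow> g = (\<lambda>z. 0) | Suc e \<Rightarrow> \<forall>i. hom_poly e (\<lambda>z. g z $ i)"
     "\<forall>z. (f has_derivative lf (g z)) (at z)" "\<forall>z. lf (g z) z = of_nat d * f z" by blast
  define h where "h z = z $ i *s g z + f z *s axis i 1" for z
  have "hom_poly d (\<lambda>z. h z $ j)" for j
  proof -
    have "hom_poly d (\<lambda>z. z $ i * g z $ j)"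
      using g(1) hom_poly_zero hom_poly_coord[of _ "\<lambda>z. g z $ j" i] by (cases d) auto
    moreover have "hom_poly d (\<lambda>z. f z * axis i 1 $ j)"
      using hom_poly_smult[OF coord(1), of "axis i 1 $ j"] by (simp add: mult.commute)
    ultimately show ?thesis unfolding h_def using hom_poly_add by fastforce
  qed
  moreover have "((\<lambda>z. z $ i * f z) has_derivative lf (h z)) (at z)" for z
  proof -
    have "((\<lambda>z. z $ i * f z) has_derivative (\<lambda>v. z $ i * lf (g z) v + v $ i * f z)) (at z)"
      by (rule has_derivative_mult[OF _ g(2)[rule_format]])
        (rule bounded_linear_imp_has_derivative[OF bounded_linear_vec_nth])
    moreover have "(\<lambda>v. z $ i * lf (g z) v + v $ i * f z) = lf (h z)"
      by (auto simp: h_def lf_linear lf_axis)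
    ultimately show ?thesis by simp
  qed
  moreover have "lf (h z) z = of_nat (Suc d) * (z $ i * f z)" for z
    using g(3) by (simp add: h_def lf_linear lf_axis algebra_simps)
  ultimately show ?case by (intro exI[of _ h]) auto
next
  case (add d f f')
  then obtain g g' where g: "case d of 0 \<Rightarrow> g = (\<lambda>z. 0) | Suc e \<Rightarrow> \<forall>i. hom_poly e (\<lambda>z. g z $ i)"
     "\<forall>z. (f has_derivative lf (g z)) (at z)" "\<forall>z. lf (g z) z = of_nat d * f z"
     and g': "case d of 0 \<Rightarrow> g' = (\<lambda>z. 0) | Suc e \<Rightarrow> \<forall>i. hom_poly e (\<lambda>z. g' z $ i)"
     "\<forall>z. (f' has_derivative lf (g' z)) (at z)" "\<forall>z. lf (g' z) z = of_nat d * f' z" by blast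
  have "lf (g z + g' z) = (\<lambda>v. lf (g z) v + lf (g' z) v)" for z by (auto simp: lf_linear)
  then show ?case using g g'
    by (intro exI[of _ "\<lambda>z. g z + g' z"])
      (auto simp: lf_linear algebra_simps hom_poly_add has_derivative_add split: nat.splits)
qed

lemma has_derivative_lf_unique:
  assumes "(f has_derivative lf g) (at z)" shows "grad f z = g"
proof -
  have "frechet_derivative f (at z) = lf g" using frechet_derivative_at[OF assms] by simp
  then show ?thesis by (simp add: grad_def vec_eq_iff) (simp add: lf_def axis_def if_distrib cong: if_cong)
qed

lemma
  assumes "hom_poly d f"
  shows has_derivative_grad: "(f has_derivative lf (grad f z)) (at z)"
    and euler_grad: "lf (grad f z) z = of_nat d * f z"
proof -
  obtain g where g: "\<forall>z. (f has_derivative lf (g z)) (at z)" "\<forall>z. lf (g z) z = of_nat d * f z"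
    using hom_poly_gradient_ex[OF assms] by blast
  then have "grad f z = g z" using has_derivative_lf_unique by blast
  then show "(f has_derivative lf (grad f z)) (at z)" "lf (grad f z) z = of_nat d * f z" using g by auto
qed

lemma hom_poly_grad:
  assumes "hom_poly (Suc d) f" shows "hom_poly d (\<lambda>z. grad f z $ i)"
proof -
  obtain g where g: "\<forall>z. (f has_derivative lf (g z)) (at z)" "\<forall>i. hom_poly d (\<lambda>z. g z $ i)"
    using hom_poly_gradient_ex[OF assms] by auto
  then have "grad f = g" using has_derivative_lf_unique by blast
  then show ?thesis using g by auto
qed

lemma cvec_simps: "cvec (x + y) = cvec x + cvec y" "cvec (c *\<^sub>R x) = of_real c *s cvec x"
  "cvec (x - y) = cvec x - cvec y" "cvec 0 = 0" "cvec (- x) = - cvec x" "cvec x $ i = of_real (x $ i)"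
  by (simp_all add: cvec_def vec_eq_iff)

lemma cvec_sum: "cvec (\<Sum>i\<in>I. f i) = (\<Sum>i\<in>I. cvec (f i))"
  by (induction I rule: infinite_finite_induct) (auto simp: cvec_simps)

lemma cvec_inj: "cvec x = cvec y \<longleftrightarrow> x = y"
  by (simp add: cvec_def vec_eq_iff)

lemma lf_cvec: "lf (cvec a) (cvec x) = of_real (a \<bullet> x)"
  by (simp add: lf_def cvec_simps inner_vec_def)

lemma poly_zero_of_infinite_reals:
  fixes p :: "complex poly"
  assumes "infinite {t. poly p (of_real t) = 0}" shows "p = 0"
proof (rule ccontr)
  assume "p \<noteq> 0"
  then have "finite (of_real -` {x. poly p x = 0} :: real set)"
    by (intro finite_vimageI poly_roots_finite inj_of_real)
  then show False using assms by (simp add: vimage_def)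
qed

lemma hom_poly_real_line:
  assumes "hom_poly d f" shows "\<exists>p. \<forall>t. f (cvec (x + t *\<^sub>R v)) = poly p (of_real t)"
proof -
  obtain p where "\<forall>t. f (cvec x + t *s cvec v) = poly p t" using hom_poly_line[OF assms] by blast
  then show ?thesis by (intro exI[of _ p]) (simp add: cvec_simps)
qed

text \<open>On the line joining a point where \<open>f\<close> is nonzero to one where
  \<open>g\<close> is nonzero, both become nonzero polynomials in one variable whose product has
  infinitely many zeros. This is the source of irreducibility for images of linear spaces.\<close>

lemma subspace_forms_no_zero_divisors:
  assumes f: "hom_poly d f" and g: "hom_poly e g" and U: "subspace U"
    and 0: "\<And>x. x \<in> U \<Longrightarrow> f (cvec x) * g (cvec x) = 0"
  shows "(\<forall>x\<in>U. f (cvec x) = 0) \<or> (\<forall>x\<in>U. g (cvec x) = 0)"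
proof (rule ccontr)
  assume "\<not> ?thesis"
  then obtain x y where xy: "x \<in> U" "y \<in> U" "f (cvec x) \<noteq> 0" "g (cvec y) \<noteq> 0" by blast
  obtain p where p: "\<And>t. f (cvec (x + t *\<^sub>R (y - x))) = poly p (of_real t)"
    using hom_poly_real_line[OF f] by blast
  obtain q where q: "\<And>t. g (cvec (x + t *\<^sub>R (y - x))) = poly q (of_real t)"
    using hom_poly_real_line[OF g] by blast
  have "poly (p * q) (of_real t) = 0" for t
    using 0[of "x + t *\<^sub>R (y - x)"] p[of t] q[of t] xy U
    by (auto simp: subspace_add subspace_diff subspace_scale)
  then have "p * q = 0" by (intro poly_zero_of_infinite_reals) (simp add: infinite_UNIV_char_0)
  moreover have "p \<noteq> 0" using p[of 0] xy by auto
  moreover have "q \<noteq> 0" using q[of 1] xy by auto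
  ultimately show False by simp
qed

text \<open>The polar form without the factor 1/2, so its diagonal is twice the quadratic form. It
  is symmetrized because the matrices are not assumed symmetric.\<close>

definition rbf :: "real^'n^'n \<Rightarrow> real^'n::finite \<Rightarrow> real^'n \<Rightarrow> real" where
  "rbf A u v = (\<Sum>i\<in>UNIV. \<Sum>j\<in>UNIV. A $ i $ j * (u $ i * v $ j + v $ i * u $ j))"

lemma rbf_diag: "rbf A u u = 2 * rqform A u"
  by (simp add: rbf_def rqform_def algebra_simps sum_distrib_left)

lemma rbf_commute: "rbf A u v = rbf A v u"
  by (simp add: rbf_def algebra_simps)

lemma linear_rbf: "linear (rbf A u)"
  by (rule linearI) (simp_all add: rbf_def algebra_simps sum.distrib sum_distrib_left)

lemma linear_rbf_left: "linear (\<lambda>u. rbf A u v)"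
  using linear_rbf[of A v] by (simp add: rbf_commute[of A _ v])

lemma linear_rbf_matrix: "linear (\<lambda>A. rbf A u v)"
  by (rule linearI) (simp_all add: rbf_def algebra_simps sum.distrib sum_distrib_left)

lemma cqform_cvec: "cqform A (cvec x) = of_real (rqform A x)"
  by (simp add: cqform_def rqform_def cvec_simps)

lemma hom_poly_cqform: "hom_poly 2 (cqform A)"
proof -
  have "hom_poly (Suc 1) (\<lambda>z. z $ i * (z $ j :: complex))" for i j :: 'a
    by (rule hom_poly_coord[OF hom_poly_nth])
  from hom_poly_smult[OF this] have "hom_poly 2 (\<lambda>z. of_real (A $ i $ j) * z $ i * z $ j)" for i j
    by (simp add: mult.assoc numeral_2_eq_2)
  then show ?thesis unfolding cqform_def by (intro hom_poly_sum)
qed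

lemma rqform_add: "rqform A (u + v) = rqform A u + rbf A u v + rqform A v"
  by (simp add: rbf_def rqform_def algebra_simps sum.distrib)

lemma rqform_scale: "rqform A (c *\<^sub>R u) = c\<^sup>2 * rqform A u"
  by (simp add: rqform_def algebra_simps sum_distrib_left power2_eq_square)

section \<open>Dickson's lemma and the descending chain condition for closed sets\<close>

lemma nat_incseq_subseq:
  fixes X :: "nat \<Rightarrow> nat"
  shows "\<exists>r. strict_mono r \<and> incseq (X \<circ> r)"
proof -
  obtain r where r: "strict_mono r" "monoseq (X \<circ> r)"
    using seq_monosub[of X] by (auto simp: o_def)
  show ?thesis
  proof (cases "incseq (X \<circ> r)")
    case False
    then have dec: "decseq (X \<circ> r)" using r(2) by (simp add: monoseq_iff)
    obtain m where m: "\<And>n. X (r m) \<le> X (r n)"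
      using ex_has_least_nat[of "\<lambda>_. True" 0 "\<lambda>n. X (r n)"] by auto
    have eq: "X (r (m + n)) = X (r m)" for n
      using m[of "m + n"] decseqD[OF dec, of m "m + n"] by simp
    have "strict_mono (\<lambda>n. r (m + n))" using r(1) by (simp add: strict_mono_def)
    moreover have "incseq (X \<circ> (\<lambda>n. r (m + n)))" by (simp add: incseq_def eq)
    ultimately show ?thesis by blast
  qed (use r in blast)
qed

text \<open>Pass to subsequences that increase in one coordinate after the other; the first two
  members of the last one are comparable.\<close>

lemma dickson:
  fixes f :: "nat \<Rightarrow> 'n::finite \<Rightarrow> nat"
  shows "\<exists>i j. i < j \<and> f i \<le> f j"
proof -
  have "\<exists>r. strict_mono r \<and> (\<forall>k\<in>K. incseq (\<lambda>i. f (r i) k))" if "finite K" for K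
    using that
  proof (induction K rule: finite_induct)
    case empty show ?case by (rule exI[of _ id]) (auto simp: strict_mono_def)
  next
    case (insert k K)
    then obtain r where r: "strict_mono r" "\<forall>k\<in>K. incseq (\<lambda>i. f (r i) k)" by blast
    obtain s where s: "strict_mono s" "incseq (\<lambda>i. f (r (s i)) k)"
      using nat_incseq_subseq[of "\<lambda>i. f (r i) k"] by (auto simp: o_def)
    have "incseq (\<lambda>i. f (r (s i)) l)" if "l \<in> K" for l
      using r(2) that s(1) by (auto simp: incseq_def strict_mono_less_eq)
    then show ?case using s r(1) by (intro exI[of _ "\<lambda>i. r (s i)"]) (auto simp: strict_mono_def)
  qed
  from this[of UNIV] obtain r where r: "strict_mono r" "\<forall>k. incseq (\<lambda>i. f (r i) k)" by auto
  then show ?thesis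
    by (intro exI[of _ "r 0"] exI[of _ "r 1"]) (auto simp: strict_mono_def le_fun_def incseq_def)
qed

definition lexless :: "('n::finite \<Rightarrow> nat) \<Rightarrow> ('n \<Rightarrow> nat) \<Rightarrow> ('n \<Rightarrow> nat) \<Rightarrow> bool" where
  "lexless idx \<alpha> \<beta> \<longleftrightarrow> (\<exists>i. \<alpha> i < \<beta> i \<and> (\<forall>j. idx j < idx i \<longrightarrow> \<alpha> j = \<beta> j))"

context
  fixes idx :: "'n::finite \<Rightarrow> nat"
  assumes inj: "inj idx"
begin

lemma lexless_total: "\<alpha> \<noteq> \<beta> \<Longrightarrow> lexless idx \<alpha> \<beta> \<or> lexless idx \<beta> \<alpha>"
proof -
  assume "\<alpha> \<noteq> \<beta>"
  then obtain i0 where "\<alpha> i0 \<noteq> \<beta> i0" by blast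
  then obtain i where i: "\<alpha> i \<noteq> \<beta> i" "\<And>j. \<alpha> j \<noteq> \<beta> j \<Longrightarrow> idx i \<le> idx j"
    using ex_has_least_nat[of "\<lambda>i. \<alpha> i \<noteq> \<beta> i" i0 idx] by blast
  then have "\<forall>j. idx j < idx i \<longrightarrow> \<alpha> j = \<beta> j" by (meson not_le)
  then show ?thesis using i(1) unfolding lexless_def by (metis nat_neq_iff)
qed

lemma lexless_trans: "lexless idx \<alpha> \<beta> \<Longrightarrow> lexless idx \<beta> \<gamma> \<Longrightarrow> lexless idx \<alpha> \<gamma>"
proof -
  assume "lexless idx \<alpha> \<beta>" "lexless idx \<beta> \<gamma>"
  then obtain i k where i: "\<alpha> i < \<beta> i" "\<forall>j. idx j < idx i \<longrightarrow> \<alpha> j = \<beta> j"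
    and k: "\<beta> k < \<gamma> k" "\<forall>j. idx j < idx k \<longrightarrow> \<beta> j = \<gamma> j" unfolding lexless_def by blast
  consider "idx i < idx k" | "idx k < idx i" | "i = k" using inj by (metis injD nat_neq_iff)
  then show ?thesis unfolding lexless_def
  proof cases
    case 1 then show "\<exists>i. \<alpha> i < \<gamma> i \<and> (\<forall>j. idx j < idx i \<longrightarrow> \<alpha> j = \<gamma> j)" using i k by (intro exI[of _ i]) auto
  next
    case 2 then show "\<exists>i. \<alpha> i < \<gamma> i \<and> (\<forall>j. idx j < idx i \<longrightarrow> \<alpha> j = \<gamma> j)" using i k by (intro exI[of _ k]) auto
  next
    case 3 then show "\<exists>i. \<alpha> i < \<gamma> i \<and> (\<forall>j. idx j < idx i \<longrightarrow> \<alpha> j = \<gamma> j)" using i k by (intro exI[of _ k]) auto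
  qed
qed

lemma lexless_irrefl: "\<not> lexless idx \<alpha> \<alpha>"
  unfolding lexless_def by blast

lemma lexless_add: "lexless idx \<alpha> \<beta> \<Longrightarrow> lexless idx (\<lambda>i. \<alpha> i + \<gamma> i) (\<lambda>i. \<beta> i + \<gamma> i)"
  unfolding lexless_def by fastforce

lemma le_imp_lexless: "\<alpha> \<le> \<beta> \<Longrightarrow> \<alpha> = \<beta> \<or> lexless idx \<alpha> \<beta>"
  using lexless_total[of \<alpha> \<beta>] unfolding lexless_def by (auto simp: le_fun_def not_less[symmetric])

text \<open>By Dickson's lemma an infinite descent contains an exponent that is coordinatewise below
  a later one, hence equal to it or lexicographically below it, against the descent.\<close>

lemma wf_lexless: "wf {(\<alpha>, \<beta>). lexless idx \<alpha> \<beta>}"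
  unfolding wf_iff_no_infinite_down_chain
proof
  assume "\<exists>f. \<forall>i. (f (Suc i), f i) \<in> {(\<alpha>, \<beta>). lexless idx \<alpha> \<beta>}"
  then obtain f where f: "\<And>i. lexless idx (f (Suc i)) (f i)" by auto
  have dec: "lexless idx (f (Suc (i + k))) (f i)" for i k
  proof (induction k)
    case (Suc k)
    show ?case using lexless_trans[OF f[of "Suc (i + k)"] Suc] by simp
  qed (use f in simp)
  obtain i j where "i < j" "f i \<le> f j" using dickson[of f] by blast
  moreover from \<open>i < j\<close> obtain k where "j = Suc (i + k)" using less_imp_Suc_add by blast
  ultimately show False
    using dec[of i k] le_imp_lexless[of "f i" "f j"] lexless_trans[of "f j" "f i" "f j"] lexless_irrefl by auto
qed

lemma lexless_max_ex:
  assumes "finite A" "A \<noteq> {}"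
  shows "\<exists>\<mu>\<in>A. \<forall>\<alpha>\<in>A. \<alpha> = \<mu> \<or> lexless idx \<alpha> \<mu>"
  using assms
proof (induction A rule: finite_ne_induct)
  case (insert x F)
  then obtain \<mu> where "\<mu> \<in> F" "\<forall>\<alpha>\<in>F. \<alpha> = \<mu> \<or> lexless idx \<alpha> \<mu>" by blast
  have "lexless idx \<alpha> x" if "lexless idx \<mu> x" "\<alpha> \<in> F" for \<alpha>
    using \<open>\<forall>\<alpha>\<in>F. \<alpha> = \<mu> \<or> lexless idx \<alpha> \<mu>\<close>[rule_format, OF that(2)] lexless_trans[of \<alpha> \<mu> x] that(1)
    by (elim disjE) simp_all
  then show ?case using lexless_total[of x \<mu>] \<open>\<mu> \<in> F\<close> \<open>\<forall>\<alpha>\<in>F. \<alpha> = \<mu> \<or> lexless idx \<alpha> \<mu>\<close>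
    by (cases "x = \<mu> \<or> lexless idx x \<mu>") (auto intro: bexI[of _ \<mu>])
qed auto

end

text \<open>Leading exponents are read off coefficients. The chain argument therefore works with
  finitely supported coefficient functions and uses their values only to test membership in an
  ideal.\<close>

definition coeff_eval :: "(('n::finite \<Rightarrow> nat) \<Rightarrow> complex) \<Rightarrow> complex^'n \<Rightarrow> complex" where
  "coeff_eval c z = (\<Sum>\<alpha> | c \<alpha> \<noteq> 0. c \<alpha> * monom \<alpha> z)"

lemma coeff_eval_superset:
  assumes "finite A" "{\<alpha>. c \<alpha> \<noteq> 0} \<subseteq> A" shows "coeff_eval c z = (\<Sum>\<alpha>\<in>A. c \<alpha> * monom \<alpha> z)"
  unfolding coeff_eval_def by (rule sum.mono_neutral_left) (use assms in auto)

lemma coeff_eval_diff: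
  assumes "finite {\<alpha>. c \<alpha> \<noteq> 0}" "finite {\<alpha>. d \<alpha> \<noteq> 0}"
  shows "coeff_eval (\<lambda>\<alpha>. c \<alpha> - k * d \<alpha>) z = coeff_eval c z - k * coeff_eval d z"
proof -
  let ?A = "{\<alpha>. c \<alpha> \<noteq> 0} \<union> {\<alpha>. d \<alpha> \<noteq> 0}"
  have "coeff_eval (\<lambda>\<alpha>. c \<alpha> - k * d \<alpha>) z = (\<Sum>\<alpha>\<in>?A. (c \<alpha> - k * d \<alpha>) * monom \<alpha> z)"
    by (rule coeff_eval_superset) (use assms in auto)
  moreover have "coeff_eval c z = (\<Sum>\<alpha>\<in>?A. c \<alpha> * monom \<alpha> z)" "coeff_eval d z = (\<Sum>\<alpha>\<in>?A. d \<alpha> * monom \<alpha> z)"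
    by (rule coeff_eval_superset; use assms in auto)+
  ultimately show ?thesis by (simp add: algebra_simps sum_subtractf sum_distrib_left)
qed

definition coeff_shift :: "('n::finite \<Rightarrow> nat) \<Rightarrow> (('n \<Rightarrow> nat) \<Rightarrow> complex) \<Rightarrow> ('n \<Rightarrow> nat) \<Rightarrow> complex" where
  "coeff_shift \<gamma> c \<alpha> = (if \<gamma> \<le> \<alpha> then c (\<lambda>i. \<alpha> i - \<gamma> i) else 0)"

lemma coeff_shift_support:
  "{\<alpha>. coeff_shift \<gamma> c \<alpha> \<noteq> 0} = (\<lambda>\<alpha> i. \<alpha> i + \<gamma> i) ` {\<alpha>. c \<alpha> \<noteq> 0}"
proof -
  have 1: "\<alpha> = (\<lambda>i. (\<lambda>j. \<alpha> j - \<gamma> j) i + \<gamma> i)" if "\<gamma> \<le> \<alpha>" for \<alpha> using that by (auto simp: le_fun_def)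
  have 2: "\<gamma> \<le> (\<lambda>i. \<beta> i + \<gamma> i)" for \<beta> by (simp add: le_fun_def)
  show ?thesis
  proof (intro set_eqI iffI)
    fix \<alpha> assume "\<alpha> \<in> {\<alpha>. coeff_shift \<gamma> c \<alpha> \<noteq> 0}"
    then have "\<gamma> \<le> \<alpha>" "c (\<lambda>i. \<alpha> i - \<gamma> i) \<noteq> 0" by (auto simp: coeff_shift_def split: if_splits)
    then show "\<alpha> \<in> (\<lambda>\<alpha> i. \<alpha> i + \<gamma> i) ` {\<alpha>. c \<alpha> \<noteq> 0}"
      by (intro image_eqI[of _ _ "\<lambda>i. \<alpha> i - \<gamma> i"] 1) auto
  qed (auto simp: coeff_shift_def 2)
qed

lemma coeff_eval_shift: "coeff_eval (coeff_shift \<gamma> c) z = monom \<gamma> z * coeff_eval c z"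
proof -
  have inj: "inj_on (\<lambda>\<alpha> i. \<alpha> i + \<gamma> i) {\<alpha>. c \<alpha> \<noteq> 0}"
    by (rule inj_onI) (metis add_right_cancel ext)
  have "coeff_shift \<gamma> c (\<lambda>i. \<alpha> i + \<gamma> i) = c \<alpha>" for \<alpha> by (simp add: coeff_shift_def le_fun_def)
  then show ?thesis
    unfolding coeff_eval_def coeff_shift_support
    by (subst sum.reindex[OF inj])
      (auto simp: sum_distrib_left monom_def power_add prod.distrib mult_ac intro!: sum.cong)
qed

lemma proj_closed_form_separates:
  assumes "proj_closed B" "z \<notin> B" "z \<noteq> 0"
  shows "\<exists>d f. hom_poly d f \<and> (\<forall>x\<in>B. f x = 0) \<and> f z \<noteq> 0"
  using assms unfolding proj_closed_def by blast

text \<open>Hilbert's basis theorem, argued on coefficient functions: in every difference of consecutive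
  ideals choose an element with least leading exponent; by Dickson's lemma one of these exponents
  divides a later one, and subtracting a multiple lowers the later one.\<close>

lemma proj_closed_dcc:
  fixes V :: "nat \<Rightarrow> (complex^'n::finite) set"
  assumes V: "\<And>k. proj_closed (V k)" and desc: "\<And>k. V (Suc k) \<subset> V k"
  shows False
proof -
  obtain idx :: "'n \<Rightarrow> nat" where inj: "inj idx"
    using finite_imp_inj_to_nat_seg[of "UNIV :: 'n set"] by auto
  define J where "J k = {c. finite {\<alpha>. c \<alpha> \<noteq> 0} \<and> (\<forall>z\<in>V k. coeff_eval c z = 0)}" for k
  have V_anti: "V j \<subseteq> V i" if "i \<le> j" for i j
    using lift_Suc_antimono_le[of V i j] desc that by blast
  then have J_mono: "J i \<subseteq> J j" if "i \<le> j" for i j using that unfolding J_def by blast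
  have ex: "\<exists>c. c \<in> J (Suc k) - J k" for k
  proof -
    obtain z where z: "z \<in> V k" "z \<notin> V (Suc k)" using desc[of k] by blast
    moreover have "z \<noteq> 0" using V[of k] z(1) unfolding proj_closed_def by blast
    ultimately obtain d f where f: "hom_poly d f" "\<forall>x\<in>V (Suc k). f x = 0" "f z \<noteq> 0"
      using proj_closed_form_separates[OF V] by blast
    obtain A a where A: "finite A" "f = (\<lambda>z. \<Sum>\<alpha>\<in>A. a \<alpha> * monom \<alpha> z)"
      using f(1) unfolding hom_poly_def by blast
    define c where "c \<alpha> = (if \<alpha> \<in> A then a \<alpha> else 0)" for \<alpha>
    have sub: "{\<alpha>. c \<alpha> \<noteq> 0} \<subseteq> A" by (auto simp: c_def)
    have "coeff_eval c = f" unfolding A(2) coeff_eval_superset[OF A(1) sub]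
      using coeff_eval_superset[OF A(1) sub] by (intro ext) (simp add: c_def)
    then have "c \<in> J (Suc k) - J k" using f z finite_subset[OF sub A(1)] by (auto simp: J_def)
    then show ?thesis by blast
  qed
  define lead where "lead c \<mu> \<longleftrightarrow> c \<mu> \<noteq> 0 \<and> (\<forall>\<alpha>. c \<alpha> \<noteq> 0 \<longrightarrow> \<alpha> = \<mu> \<or> lexless idx \<alpha> \<mu>)"
    for c :: "('n \<Rightarrow> nat) \<Rightarrow> complex" and \<mu>
  have lead_ex: "\<exists>\<mu>. lead c \<mu>" if "c \<in> J (Suc k) - J k" for c k
  proof -
    have "{\<alpha>. c \<alpha> \<noteq> 0} \<noteq> {}"
    proof
      assume "{\<alpha>. c \<alpha> \<noteq> 0} = {}"
      then have "c \<in> J k" by (simp add: J_def coeff_eval_def)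
      then show False using that by simp
    qed
    moreover have "finite {\<alpha>. c \<alpha> \<noteq> 0}" using that by (simp add: J_def)
    ultimately show ?thesis using lexless_max_ex[OF inj, of "{\<alpha>. c \<alpha> \<noteq> 0}"] unfolding lead_def by simp
  qed
  have "\<exists>\<mu> c. c \<in> J (Suc k) - J k \<and> lead c \<mu> \<and> (\<forall>d \<nu>. d \<in> J (Suc k) - J k \<longrightarrow> lead d \<nu> \<longrightarrow> \<not> lexless idx \<nu> \<mu>)" for k
  proof -
    let ?Q = "{\<mu>. \<exists>c. c \<in> J (Suc k) - J k \<and> lead c \<mu>}"
    obtain \<mu>0 where "\<mu>0 \<in> ?Q" using ex[of k] lead_ex by blast
    from wfE_min[OF wf_lexless[OF inj] this]
    obtain \<mu> where \<mu>: "\<mu> \<in> ?Q" "\<And>\<nu>. (\<nu>, \<mu>) \<in> {(\<alpha>, \<beta>). lexless idx \<alpha> \<beta>} \<Longrightarrow> \<nu> \<notin> ?Q" by blast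
    obtain c where "c \<in> J (Suc k) - J k" "lead c \<mu>" using \<mu>(1) by blast
    then show ?thesis using \<mu>(2) by (intro exI[of _ \<mu>] exI[of _ c]) auto
  qed
  then have "\<exists>\<mu>. \<forall>k. \<exists>c. c \<in> J (Suc k) - J k \<and> lead c (\<mu> k) \<and> (\<forall>d \<nu>. d \<in> J (Suc k) - J k \<longrightarrow> lead d \<nu> \<longrightarrow> \<not> lexless idx \<nu> (\<mu> k))"
    by (intro choice allI)
  then obtain \<mu> where "\<forall>k. \<exists>c. c \<in> J (Suc k) - J k \<and> lead c (\<mu> k) \<and> (\<forall>d \<nu>. d \<in> J (Suc k) - J k \<longrightarrow> lead d \<nu> \<longrightarrow> \<not> lexless idx \<nu> (\<mu> k))"
    by (elim exE)
  then have "\<exists>c. \<forall>k. c k \<in> J (Suc k) - J k \<and> lead (c k) (\<mu> k) \<and> (\<forall>d \<nu>. d \<in> J (Suc k) - J k \<longrightarrow> lead d \<nu> \<longrightarrow> \<not> lexless idx \<nu> (\<mu> k))"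
    by (rule choice)
  then obtain c where c': "\<forall>k. c k \<in> J (Suc k) - J k \<and> lead (c k) (\<mu> k) \<and> (\<forall>d \<nu>. d \<in> J (Suc k) - J k \<longrightarrow> lead d \<nu> \<longrightarrow> \<not> lexless idx \<nu> (\<mu> k))"
    by (elim exE)
  have c: "\<And>k. c k \<in> J (Suc k) - J k" "\<And>k. lead (c k) (\<mu> k)"
     "\<And>k d \<nu>. d \<in> J (Suc k) - J k \<Longrightarrow> lead d \<nu> \<Longrightarrow> \<not> lexless idx \<nu> (\<mu> k)"
    using c' by simp_all
  obtain i j where ij: "i < j" "\<mu> i \<le> \<mu> j" using dickson[of \<mu>] by blast
  define \<gamma> where "\<gamma> = (\<lambda>k. \<mu> j k - \<mu> i k)"
  define s where "s = coeff_shift \<gamma> (c i)"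
  define r where "r = c j (\<mu> j) / c i (\<mu> i)"
  define d where "d \<alpha> = c j \<alpha> - r * s \<alpha>" for \<alpha>
  have \<mu>: "(\<lambda>k. \<mu> i k + \<gamma> k) = \<mu> j" using ij(2) by (auto simp: \<gamma>_def le_fun_def)
  have fin: "finite {\<alpha>. c k \<alpha> \<noteq> 0}" for k using c(1)[of k] by (simp add: J_def)
  have finS: "finite {\<alpha>. s \<alpha> \<noteq> 0}" unfolding s_def coeff_shift_support using fin by blast
  have ev: "coeff_eval d z = coeff_eval (c j) z - r * (monom \<gamma> z * coeff_eval (c i) z)" for z
    unfolding d_def coeff_eval_diff[OF fin finS] by (simp add: s_def coeff_eval_shift)
  have ci0: "coeff_eval (c i) z = 0" if "z \<in> V j" for z
    using c(1)[of i] J_mono[of "Suc i" j] ij(1) that by (auto simp: J_def)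
  have finD: "finite {\<alpha>. d \<alpha> \<noteq> 0}"
    by (rule finite_subset[OF _ finite_UnI[OF fin[of j] finS]]) (auto simp: d_def)
  \<comment> \<open>\<open>c i\<close> already vanishes on \<open>V j\<close>. Subtracting its
    multiple from \<open>c j\<close> therefore changes neither membership in
    \<open>J (Suc j)\<close> nor non-membership in \<open>J j\<close>; only the leading exponent
    drops.\<close>
  have "d \<in> J (Suc j)" using finD ev ci0 c(1)[of j] V_anti[of j "Suc j"] by (auto simp: J_def)
  moreover have "d \<notin> J j" using c(1)[of j] fin[of j] ev ci0 by (auto simp: J_def)
  ultimately have dJ: "d \<in> J (Suc j) - J j" by blast
  then obtain \<nu> where \<nu>: "lead d \<nu>" using lead_ex by blast
  have le: "\<alpha> = \<mu> j \<or> lexless idx \<alpha> (\<mu> j)" if "d \<alpha> \<noteq> 0" for \<alpha>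
  proof (cases "c j \<alpha> = 0")
    case True
    then have "s \<alpha> \<noteq> 0" using that by (auto simp: d_def)
    then obtain \<beta> where \<beta>: "c i \<beta> \<noteq> 0" "\<alpha> = (\<lambda>k. \<beta> k + \<gamma> k)"
      using coeff_shift_support[of \<gamma> "c i"] unfolding s_def by blast
    then show ?thesis using c(2)[of i] lexless_add[OF inj, of \<beta> "\<mu> i" \<gamma>] \<mu> unfolding lead_def by auto
  qed (use c(2)[of j] in \<open>auto simp: lead_def\<close>)
  have "s (\<mu> j) = c i (\<mu> i)" unfolding s_def \<mu>[symmetric] by (simp add: coeff_shift_def le_fun_def)
  then have "d (\<mu> j) = 0" using c(2)[of i] by (simp add: d_def r_def lead_def)
  then have "\<nu> \<noteq> \<mu> j" using \<nu> by (auto simp: lead_def)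
  then have "lexless idx \<nu> (\<mu> j)" using le[of \<nu>] \<nu> by (auto simp: lead_def)
  then show False using c(3)[OF dJ \<nu>] by blast
qed

section \<open>Closed sets, irreducibility and components\<close>

lemma proj_closed_Int: "proj_closed A \<Longrightarrow> proj_closed B \<Longrightarrow> proj_closed (A \<inter> B)"
  unfolding proj_closed_def
proof (elim exE conjE)
  fix F G assume "\<forall>f\<in>F. \<exists>d. hom_poly d f" "A = {z. z \<noteq> 0 \<and> (\<forall>f\<in>F. f z = 0)}"
    "\<forall>f\<in>G. \<exists>d. hom_poly d f" "B = {z. z \<noteq> 0 \<and> (\<forall>f\<in>G. f z = 0)}"
  then show "\<exists>F. (\<forall>f\<in>F. \<exists>d. hom_poly d f) \<and> A \<inter> B = {z. z \<noteq> 0 \<and> (\<forall>f\<in>F. f z = 0)}"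
    by (intro exI[of _ "F \<union> G"]) auto
qed

lemma proj_closed_Un:
  assumes "proj_closed A" "proj_closed B" shows "proj_closed (A \<union> B)"
proof -
  obtain F where F: "\<forall>f\<in>F. \<exists>d. hom_poly d f" "A = {z. z \<noteq> 0 \<and> (\<forall>f\<in>F. f z = 0)}"
    using assms(1) unfolding proj_closed_def by blast
  obtain G where G: "\<forall>f\<in>G. \<exists>d. hom_poly d f" "B = {z. z \<noteq> 0 \<and> (\<forall>f\<in>G. f z = 0)}"
    using assms(2) unfolding proj_closed_def by blast
  let ?H = "{\<lambda>z. f z * g z | f g. f \<in> F \<and> g \<in> G}"
  have "\<exists>d. hom_poly d h" if h: "h \<in> ?H" for h
  proof -
    obtain f g where fg: "h = (\<lambda>z. f z * g z)" "f \<in> F" "g \<in> G" using h by blast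
    then obtain d e where "hom_poly d f" "hom_poly e g" using F(1) G(1) by blast
    then show ?thesis unfolding fg(1) using hom_poly_mult by blast
  qed
  moreover have "A \<union> B = {z. z \<noteq> 0 \<and> (\<forall>f\<in>?H. f z = 0)}"
  proof (intro set_eqI iffI)
    fix z assume z: "z \<in> {z. z \<noteq> 0 \<and> (\<forall>f\<in>?H. f z = 0)}"
    have "f z * g z = 0" if "f \<in> F" "g \<in> G" for f g
    proof -
      have "(\<lambda>z. f z * g z) \<in> ?H" using that by blast
      moreover have "\<forall>h\<in>?H. h z = 0" using z by simp
      ultimately show ?thesis by (rule bspec[rotated])
    qed
    then have "(\<forall>f\<in>F. f z = 0) \<or> (\<forall>g\<in>G. g z = 0)" by (metis mult_eq_0_iff)
    then show "z \<in> A \<union> B" using z unfolding F(2) G(2) by simp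
  qed (auto simp: F(2) G(2))
  ultimately show ?thesis unfolding proj_closed_def by blast
qed

lemma proj_closed_zeros: "hom_poly d f \<Longrightarrow> proj_closed {z. z \<noteq> 0 \<and> f z = 0}"
  unfolding proj_closed_def by (rule exI[of _ "{f}"]) auto

lemma proj_closed_empty: "proj_closed {}"
  unfolding proj_closed_def using hom_poly_const[of 1] by (intro exI[of _ "{\<lambda>z. 1}"]) auto

lemma proj_closed_nonzero: "proj_closed V \<Longrightarrow> z \<in> V \<Longrightarrow> z \<noteq> 0"
  unfolding proj_closed_def by blast

lemma proj_closed_scale:
  assumes "proj_closed V" "z \<in> V" "c \<noteq> 0" shows "c *s z \<in> V"
proof -
  obtain F where F: "\<forall>f\<in>F. \<exists>d. hom_poly d f" "V = {z. z \<noteq> 0 \<and> (\<forall>f\<in>F. f z = 0)}"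
    using assms(1) unfolding proj_closed_def by blast
  have "f (c *s z) = 0" if "f \<in> F" for f
  proof -
    from bspec[OF F(1) that] obtain d where "hom_poly d f" by (elim exE)
    moreover have "f z = 0" using assms(2) that unfolding F(2) by simp
    ultimately show ?thesis using hom_poly_scale[of d f c z] by simp
  qed
  then show ?thesis using assms(2,3) unfolding F(2) by (simp add: vector_mul_eq_0)
qed

lemma proj_closed_Union: "finite \<C> \<Longrightarrow> (\<And>A. A \<in> \<C> \<Longrightarrow> proj_closed A) \<Longrightarrow> proj_closed (\<Union>\<C>)"
  by (induction \<C> rule: finite_induct) (auto intro: proj_closed_empty proj_closed_Un)

lemma proj_irreducible_forms:
  assumes V: "proj_irreducible V" and f: "hom_poly d f" and g: "hom_poly e g"
    and 0: "\<And>z. z \<in> V \<Longrightarrow> f z * g z = 0"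
  shows "(\<forall>z\<in>V. f z = 0) \<or> (\<forall>z\<in>V. g z = 0)"
proof -
  have nz: "z \<noteq> 0" if "z \<in> V" for z
    using V that proj_closed_nonzero unfolding proj_irreducible_def by blast
  have "V \<subseteq> {z. z \<noteq> 0 \<and> f z = 0} \<union> {z. z \<noteq> 0 \<and> g z = 0}" using 0 nz by auto
  then show ?thesis
    using V proj_closed_zeros[OF f] proj_closed_zeros[OF g] unfolding proj_irreducible_def by blast
qed

text \<open>The basis of every generic choice below: finitely many proper closed conditions on an
  irreducible set can be avoided at once.\<close>

lemma proj_irreducible_prod_forms:
  assumes V: "proj_irreducible V" and "finite I" and f: "\<And>i. i \<in> I \<Longrightarrow> hom_poly (d i) (f i)"
    and nz: "\<And>i. i \<in> I \<Longrightarrow> \<exists>z\<in>V. f i z \<noteq> 0"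
  shows "\<exists>z\<in>V. (\<Prod>i\<in>I. f i z) \<noteq> 0"
  using assms(2-)
proof (induction I rule: finite_induct)
  case empty
  then show ?case using V unfolding proj_irreducible_def by auto
next
  case (insert i I)
  have "hom_poly (sum d I) (\<lambda>z. \<Prod>i\<in>I. f i z)" by (rule hom_poly_prod) (use insert in auto)
  moreover have "\<exists>z\<in>V. (\<Prod>i\<in>I. f i z) \<noteq> 0" using insert by auto
  moreover have "hom_poly (d i) (f i)" "\<exists>z\<in>V. f i z \<noteq> 0" using insert(4,5) by blast+
  ultimately have "\<not> (\<forall>z\<in>V. f i z * (\<Prod>i\<in>I. f i z) = 0)"
    using proj_irreducible_forms[OF V, of "d i" "f i" "sum d I" "\<lambda>z. \<Prod>i\<in>I. f i z"] by blast
  then show ?case using insert(1,2) by simp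
qed

text \<open>Noetherian induction: a closed set that is neither empty nor irreducible is the union of
  two strictly smaller closed sets.\<close>

lemma proj_closed_irreducible_decomposition:
  fixes X :: "(complex^'n::finite) set"
  assumes "proj_closed X"
  shows "\<exists>\<C>. finite \<C> \<and> (\<forall>V\<in>\<C>. proj_irreducible V) \<and> X = \<Union>\<C>"
proof -
  let ?R = "{(A :: (complex^'n) set, B). proj_closed A \<and> proj_closed B \<and> A \<subset> B}"
  have "wf ?R"
    unfolding wf_iff_no_infinite_down_chain
  proof
    assume "\<exists>f. \<forall>i. (f (Suc i), f i) \<in> ?R"
    then obtain f where f: "\<And>i. (f (Suc i), f i) \<in> ?R" by blast
    show False by (rule proj_closed_dcc[of f]) (use f in auto)
  qed
  then have "proj_closed X \<longrightarrow> (\<exists>\<C>. finite \<C> \<and> (\<forall>V\<in>\<C>. proj_irreducible V) \<and> X = \<Union>\<C>)"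
  proof (induction X rule: wf_induct_rule)
    case (less X)
    show ?case
    proof
      assume X: "proj_closed X"
      show "\<exists>\<C>. finite \<C> \<and> (\<forall>V\<in>\<C>. proj_irreducible V) \<and> X = \<Union>\<C>"
      proof (cases "X = {} \<or> proj_irreducible X")
        case True
        then show ?thesis
        proof
          assume "X = {}" then show ?thesis by (intro exI[of _ "{}"]) auto
        next
          assume "proj_irreducible X" then show ?thesis by (intro exI[of _ "{X}"]) auto
        qed
      next
        case False
        then obtain A B where AB: "proj_closed A" "proj_closed B" "X \<subseteq> A \<union> B" "\<not> X \<subseteq> A" "\<not> X \<subseteq> B"
          using X unfolding proj_irreducible_def by blast
        have "(X \<inter> A, X) \<in> ?R" "(X \<inter> B, X) \<in> ?R" using AB X proj_closed_Int by auto
        from less[OF this(1)] less[OF this(2)]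
        obtain \<C> \<D> where "finite \<C>" "\<forall>V\<in>\<C>. proj_irreducible V" "X \<inter> A = \<Union>\<C>"
            "finite \<D>" "\<forall>V\<in>\<D>. proj_irreducible V" "X \<inter> B = \<Union>\<D>"
          using proj_closed_Int[OF X AB(1)] proj_closed_Int[OF X AB(2)] by blast
        moreover from this have "X = \<Union>(\<C> \<union> \<D>)" using AB(3) by blast
        ultimately show ?thesis by (intro exI[of _ "\<C> \<union> \<D>"]) blast
      qed
    qed
  qed
  then show ?thesis using assms by blast
qed

lemma proj_irreducible_subset_Union:
  assumes V: "proj_irreducible V" and "finite \<C>" "\<And>A. A \<in> \<C> \<Longrightarrow> proj_closed A" "V \<subseteq> \<Union>\<C>"
  shows "\<exists>A\<in>\<C>. V \<subseteq> A"
  using assms(2-)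
proof (induction \<C> rule: finite_induct)
  case empty then show ?case using V unfolding proj_irreducible_def by auto
next
  case (insert A \<C>)
  have "proj_closed (\<Union>\<C>)" by (rule proj_closed_Union) (use insert in auto)
  then have "V \<subseteq> A \<or> V \<subseteq> \<Union>\<C>" using V insert(4)[of A] insert(5) unfolding proj_irreducible_def by auto
  then show ?case using insert by auto
qed

text \<open>An irreducible subset of a finite union of closed sets lies in one of them, so an
  antichain of irreducible sets is its own list of components. It is applied again to the union that
  remains after a component is removed.\<close>

lemma irr_components_of_union:
  assumes fin: "finite \<C>" and irr: "\<And>V. V \<in> \<C> \<Longrightarrow> proj_irreducible V"
    and anti: "\<And>V W. V \<in> \<C> \<Longrightarrow> W \<in> \<C> \<Longrightarrow> V \<subseteq> W \<Longrightarrow> V = W"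
  shows "irr_components (\<Union>\<C>) = \<C>"
proof -
  have cl: "proj_closed V" if "V \<in> \<C>" for V using irr[OF that] unfolding proj_irreducible_def by blast
  have cov: "\<exists>A\<in>\<C>. W \<subseteq> A" if "proj_irreducible W" "W \<subseteq> \<Union>\<C>" for W
    using proj_irreducible_subset_Union[OF that(1) fin cl that(2)] by blast
  show ?thesis
  proof (intro set_eqI iffI)
    fix V assume V: "V \<in> irr_components (\<Union>\<C>)"
    then have V': "proj_irreducible V" "V \<subseteq> \<Union>\<C>"
        "\<And>W. proj_irreducible W \<Longrightarrow> V \<subseteq> W \<Longrightarrow> W \<subseteq> \<Union>\<C> \<Longrightarrow> W = V"
      by (simp_all add: irr_components_def)
    from cov[OF V'(1,2)] obtain A where "A \<in> \<C>" "V \<subseteq> A" by (elim bexE)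
    moreover from this have "A = V" using V'(3)[OF irr[of A]] by (simp add: Union_upper)
    ultimately show "V \<in> \<C>" by simp
  next
    fix V assume V: "V \<in> \<C>"
    have "W = V" if "proj_irreducible W" "V \<subseteq> W" "W \<subseteq> \<Union>\<C>" for W
    proof -
      from cov[OF that(1,3)] obtain A where "A \<in> \<C>" "W \<subseteq> A" by (elim bexE)
      then show ?thesis using anti[OF V, of A] that(2) by (metis subset_antisym subset_trans)
    qed
    then show "V \<in> irr_components (\<Union>\<C>)"
      using V irr[OF V] by (simp add: irr_components_def Union_upper)
  qed
qed

text \<open>The maximal members of a finite irreducible cover form an antichain with the same
  union.\<close>

lemma
  assumes "proj_closed X"
  shows finite_irr_components: "finite (irr_components X)"
    and Union_irr_components: "\<Union>(irr_components X) = X"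
proof -
  obtain \<C> where \<C>: "finite \<C>" "\<forall>V\<in>\<C>. proj_irreducible V" "X = \<Union>\<C>"
    using proj_closed_irreducible_decomposition[OF assms] by blast
  define \<D> where "\<D> = {V\<in>\<C>. \<forall>W\<in>\<C>. V \<subseteq> W \<longrightarrow> W = V}"
  have "\<exists>W\<in>\<D>. V \<subseteq> W" if "V \<in> \<C>" for V
  proof -
    obtain W where "W \<in> \<C>" "V \<subseteq> W" "\<forall>U\<in>\<C>. W \<subseteq> U \<longrightarrow> W = U"
      using finite_has_maximal2[of \<C> V] \<C>(1) \<open>V \<in> \<C>\<close> by blast
    then show ?thesis unfolding \<D>_def by blast
  qed
  then have un: "\<Union>\<D> = X" unfolding \<C>(3) \<D>_def by blast
  have "irr_components (\<Union>\<D>) = \<D>"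
    by (rule irr_components_of_union) (use \<C> in \<open>auto simp: \<D>_def\<close>)
  then have "irr_components X = \<D>" unfolding un .
  then show "finite (irr_components X)" "\<Union>(irr_components X) = X" using un \<C>(1) by (auto simp: \<D>_def)
qed

section \<open>From equality of the dual cones to decompositions into real points\<close>

lemma inner_outer_sq: "A \<bullet> outer_sq x = rqform A x"
  by (simp add: inner_vec_def outer_sq_def rqform_def sum_distrib_left mult_ac)

lemma inner_outer_sq2: "outer_sq x \<bullet> outer_sq y = (x \<bullet> y)\<^sup>2"
  by (simp add: inner_outer_sq rqform_def outer_sq_def inner_vec_def power2_eq_square sum_product mult_ac)

lemma inner_mat_1_outer_sq: "mat 1 \<bullet> outer_sq x = x \<bullet> (x :: real^'n::finite)"
proof -
  have "(\<Sum>j\<in>UNIV. (if i = j then 1 else 0) * (x $ i * x $ j)) = x $ i * x $ i" for i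
    by (simp add: if_distrib if_distribR cong: if_cong)
  then show ?thesis by (simp add: inner_vec_def outer_sq_def mat_def)
qed

lemma outer_sq_scale: "outer_sq (c *\<^sub>R x) = c\<^sup>2 *\<^sub>R outer_sq x"
  by (simp add: outer_sq_def vec_eq_iff power2_eq_square mult_ac)

lemma inner_sum_list_right: "a \<bullet> sum_list (map f xs) = (\<Sum>x\<leftarrow>xs. a \<bullet> f x)"
  for f :: "'b \<Rightarrow> 'a::real_inner"
  by (induction xs) (auto simp: inner_add_right)

lemma real_points_scale:
  assumes "proj_closed X" "x \<in> real_points X" "c \<noteq> 0" shows "c *\<^sub>R x \<in> real_points X"
  using assms proj_closed_scale[of X "cvec x" "of_real c"] by (auto simp: real_points_def cvec_simps)

lemma ideal2_real_points: "A \<in> ideal2 X \<Longrightarrow> x \<in> real_points X \<Longrightarrow> rqform A x = 0"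
  by (auto simp: ideal2_def real_points_def cqform_cvec dest!: bspec)

text \<open>Membership in a span is tested throughout by functionals, which then serve as linear
  forms, or as quadrics, on \<open>X\<close>.\<close>

lemma in_subspace_if_orthogonal:
  fixes x :: "'a::euclidean_space"
  assumes "subspace U" "\<And>l. (\<And>u. u \<in> U \<Longrightarrow> l \<bullet> u = 0) \<Longrightarrow> l \<bullet> x = 0" shows "x \<in> U"
proof -
  obtain y z where yz: "y \<in> span U" "\<And>w. w \<in> span U \<Longrightarrow> orthogonal z w" "x = y + z"
    using orthogonal_subspace_decomp_exists[of U x] by blast
  have "z \<bullet> x = 0" using assms(2)[of z] yz(2) span_base by (auto simp: orthogonal_def)
  moreover have "z \<bullet> y = 0" using yz by (auto simp: orthogonal_def)
  ultimately have "z = 0" using yz(3) by (simp add: inner_add_right)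
  then show ?thesis using yz(1,3) span_subspace[OF order_refl _ assms(1)] span_superset
    by (metis add.right_neutral assms(1) span_eq_iff)
qed

text \<open>The value is a sum of squares \<open>(l \<bullet> x)\<^sup>2\<close>, so each of them is
  0. Degenerate directions of a matrix thus confine the points of all its decompositions to a
  subspace.\<close>

lemma sum_list_outer_sq_kernel:
  assumes "outer_sq l \<bullet> sum_list (map outer_sq xs) = 0" "x \<in> set xs" shows "l \<bullet> x = 0"
proof -
  have "(\<Sum>x\<leftarrow>xs. (l \<bullet> x)\<^sup>2) = 0" using assms(1) by (simp add: inner_sum_list_right inner_outer_sq2)
  then have "\<forall>y\<in>set (map (\<lambda>x. (l \<bullet> x)\<^sup>2) xs). y = 0" by (subst (asm) sum_list_nonneg_eq_0_iff) auto
  then show ?thesis using assms(2) by auto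
qed

lemma continuous_on_hom_poly: "hom_poly d f \<Longrightarrow> continuous_on S f"
  by (intro continuous_at_imp_continuous_on ballI has_derivative_continuous[OF has_derivative_grad])

lemma continuous_on_cvec: "continuous_on S cvec"
  unfolding cvec_def by (intro continuous_intros)

lemma closed_real_points_unit:
  assumes "proj_closed X" shows "closed {x. norm x = 1 \<and> cvec x \<in> X}"
proof -
  obtain F where F: "\<forall>f\<in>F. \<exists>d. hom_poly d f" "X = {z. z \<noteq> 0 \<and> (\<forall>f\<in>F. f z = 0)}"
    using assms unfolding proj_closed_def by blast
  have "cvec x \<noteq> 0" if "norm x = 1" for x :: "real^'a" using that by (metis cvec_inj cvec_simps(4) norm_zero zero_neq_one)
  then have "{x. norm x = 1 \<and> cvec x \<in> X} = {x. norm x = 1} \<inter> (\<Inter>f\<in>F. {x. f (cvec x) = 0})"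
    unfolding F(2) by auto
  moreover have "closed {x. f (cvec x) = 0}" if "f \<in> F" for f
  proof -
    from bspec[OF F(1) that] obtain d where "hom_poly d f" by (elim exE)
    then show ?thesis
      by (intro closed_Collect_eq continuous_on_const continuous_on_compose2[OF continuous_on_hom_poly continuous_on_cvec]) auto
  qed
  moreover have "closed {x :: real^'a. norm x = 1}" by (intro closed_Collect_eq continuous_intros)
  ultimately show ?thesis by (simp add: closed_Int closed_INT)
qed

definition sq_sums :: "(complex^'n::finite) set \<Rightarrow> (real^'n^'n) set" where
  "sq_sums X = {sum_list (map outer_sq xs) | xs. set xs \<subseteq> real_points X}"

lemma sq_sums_add: "M \<in> sq_sums X \<Longrightarrow> M' \<in> sq_sums X \<Longrightarrow> M + M' \<in> sq_sums X"
  unfolding sq_sums_def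
proof (clarsimp)
  fix xs ys assume "set xs \<subseteq> real_points X" "set ys \<subseteq> real_points X"
  then show "\<exists>zs. sum_list (map outer_sq xs) + sum_list (map outer_sq ys) = sum_list (map outer_sq zs) \<and> set zs \<subseteq> real_points X"
    by (intro exI[of _ "xs @ ys"]) auto
qed

lemma sq_sums_scale:
  assumes "proj_closed X" "M \<in> sq_sums X" "c \<ge> 0" shows "c *\<^sub>R M \<in> sq_sums X"
proof (cases "c = 0")
  case True
  then show ?thesis unfolding sq_sums_def by (auto intro!: exI[of _ "[]"])
next
  case False
  obtain xs where xs: "M = sum_list (map outer_sq xs)" "set xs \<subseteq> real_points X"
    using assms(2) unfolding sq_sums_def by blast
  have "c *\<^sub>R sum_list (map outer_sq xs) = sum_list (map outer_sq (map (\<lambda>x. sqrt c *\<^sub>R x) xs))"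
    using assms(3) by (induction xs) (auto simp: outer_sq_scale scaleR_add_right)
  moreover have "set (map (\<lambda>x. sqrt c *\<^sub>R x) xs) \<subseteq> real_points X"
    using xs(2) real_points_scale[OF assms(1)] False assms(3) by auto
  ultimately show ?thesis unfolding sq_sums_def xs(1) by blast
qed

text \<open>An element of the dual cone outside the compact convex hull of the squares of unit real points
  could be separated from it by a quadric nonnegative on the real points.\<close>

lemma psd_decomposition_of_duals:
  fixes X :: "(complex^'n::finite) set"
  assumes X: "proj_closed X" and dual: "SigmaX_dual X = PX_dual X"
    and I: "\<And>A. A \<in> ideal2 X \<Longrightarrow> A \<bullet> M = 0" and psd: "\<And>l. outer_sq l \<bullet> M \<ge> 0"
  shows "M \<in> sq_sums X"
proof -
  have "linear (\<lambda>A. A \<bullet> M)" by (auto intro!: linearI simp: inner_add_left)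
  then have R2: "(\<lambda>A. A \<bullet> M) \<in> R2_dual X" using I by (auto simp: R2_dual_def)
  have "A \<bullet> M \<ge> 0" if A: "A \<in> SigmaX X" for A
  proof -
    obtain ls where ls: "A - sum_list (map outer_sq ls) \<in> ideal2 X" using A by (auto simp: SigmaX_def)
    have "A \<bullet> M = sum_list (map outer_sq ls) \<bullet> M" using I[OF ls] by (simp add: inner_diff_left)
    also have "\<dots> \<ge> 0" by (induction ls) (auto simp: inner_add_left psd)
    finally show ?thesis .
  qed
  then have "(\<lambda>A. A \<bullet> M) \<in> PX_dual X" using R2 dual by (auto simp: SigmaX_dual_def)
  then have pos: "A \<bullet> M \<ge> 0" if "\<And>x. x \<in> real_points X \<Longrightarrow> rqform A x \<ge> 0" for A
    using that by (auto simp: PX_dual_def PX_def)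
  define t where "t = mat 1 \<bullet> M"
  have t: "t \<ge> 0" unfolding t_def by (rule pos) (simp add: inner_outer_sq[symmetric] inner_mat_1_outer_sq)
  show ?thesis
  proof (cases "t = 0")
    case True
    \<comment> \<open>With trace 0 no normalization is possible. This test quadric is nonnegative
      everywhere by Cauchy-Schwarz and pairs with \<open>M\<close> to minus the square of its norm,
      so \<open>M\<close> is 0.\<close>
    have "(norm M *\<^sub>R mat 1 - M) \<bullet> M \<ge> 0"
    proof (rule pos)
      fix x :: "real^'n"
      have "norm (outer_sq x) = x \<bullet> x"
        using inner_outer_sq2[of x x] by (simp add: norm_eq_sqrt_inner)
      then have "M \<bullet> outer_sq x \<le> norm M * (x \<bullet> x)" using norm_cauchy_schwarz[of M "outer_sq x"] by simp
      then show "0 \<le> rqform (norm M *\<^sub>R mat 1 - M) x"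
        by (simp add: inner_outer_sq[symmetric] inner_diff_left inner_mat_1_outer_sq)
    qed
    then have "M \<bullet> M \<le> 0" using True by (simp add: inner_diff_left t_def)
    then have "M = 0" by (metis inner_eq_zero_iff inner_ge_zero order_antisym)
    then show ?thesis unfolding sq_sums_def by (auto intro!: exI[of _ "[]"])
  next
    case False
    let ?U = "{x. norm x = 1 \<and> cvec x \<in> X}"
    define K where "K = outer_sq ` ?U"
    have "compact ?U" using closed_real_points_unit[OF X] by (auto simp: compact_eq_bounded_closed bounded_iff)
    moreover have "continuous_on ?U outer_sq" unfolding outer_sq_def by (intro continuous_intros)
    ultimately have "compact K" unfolding K_def by (intro compact_continuous_image)
    then have comp: "compact (convex hull K)" by (rule compact_convex_hull)
    have "(1 / t) *\<^sub>R M \<in> convex hull K"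
    proof (rule ccontr)
      assume "(1 / t) *\<^sub>R M \<notin> convex hull K"
      then obtain a b where ab: "a \<bullet> ((1 / t) *\<^sub>R M) < b" "\<forall>x\<in>convex hull K. a \<bullet> x > b"
        using separating_hyperplane_closed_point[OF convex_convex_hull compact_imp_closed[OF comp]] by blast
      \<comment> \<open>\<open>mat 1\<close> evaluates to the squared norm, so subtracting
        \<open>b\<close> times it makes the separating inequality homogeneous and thus valid at all
        real points instead of unit ones.\<close>
      have "(a - b *\<^sub>R mat 1) \<bullet> M \<ge> 0"
      proof (rule pos)
        fix x assume x: "x \<in> real_points X"
        then have nx: "norm x > 0" by (auto simp: real_points_def)
        define y where "y = (1 / norm x) *\<^sub>R x"
        have "y \<in> real_points X" unfolding y_def by (rule real_points_scale[OF X x]) (use nx in simp)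
        then have "outer_sq y \<in> convex hull K"
          using nx by (intro hull_inc) (auto simp: K_def real_points_def y_def)
        then have "a \<bullet> outer_sq y > b" using ab(2) by blast
        moreover have "outer_sq x = (norm x)\<^sup>2 *\<^sub>R outer_sq y" using nx by (simp add: y_def outer_sq_scale power_divide)
        ultimately show "0 \<le> rqform (a - b *\<^sub>R mat 1) x"
          using nx by (simp add: inner_outer_sq[symmetric] inner_diff_left inner_mat_1_outer_sq y_def
              power2_norm_eq_inner[symmetric] power_divide)
      qed
      then have "a \<bullet> M \<ge> b * t" by (simp add: inner_diff_left t_def)
      moreover have "(a \<bullet> M) / t < b" using ab(1) by simp
      ultimately show False using t False by (simp add: divide_less_eq)
    qed
    moreover have "convex hull K \<subseteq> sq_sums X"
    proof (rule hull_minimal)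
      show "K \<subseteq> sq_sums X"
      proof
        fix k assume "k \<in> K"
        then obtain x where "k = outer_sq x" "norm x = 1" "cvec x \<in> X" by (auto simp: K_def)
        then show "k \<in> sq_sums X" unfolding sq_sums_def by (auto simp: real_points_def intro!: exI[of _ "[x]"])
      qed
      show "convex (sq_sums X)"
        unfolding convex_def using sq_sums_add sq_sums_scale[OF X] by blast
    qed
    ultimately have "t *\<^sub>R ((1 / t) *\<^sub>R M) \<in> sq_sums X" using sq_sums_scale[OF X] t by blast
    then show ?thesis using False by simp
  qed
qed

lemma dual_vector_exists:
  fixes B :: "'a::euclidean_space set"
  assumes "independent B" shows "\<exists>l. \<forall>v\<in>B. l \<bullet> v = a v"
proof -
  obtain g :: "'a \<Rightarrow> real" where g: "linear g" "\<forall>x\<in>B. g x = a x"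
    using linear_independent_extend[OF assms, of a] by blast
  then have "v \<bullet> adjoint g 1 = a v" if "v \<in> B" for v using adjoint_works[OF g(1), of v 1] that by simp
  then show ?thesis by (intro exI[of _ "adjoint g 1"]) (simp add: inner_commute)
qed

text \<open>The assumption \<open>psd\<close> is the form in which the equality of the duals is
  used. It is abstracted because it has to be re-established after a component has been
  removed.\<close>

locale sos =
  fixes X :: "(complex^'n::finite) set"
  assumes closed: "proj_closed X"
    and dense: "totally_real X"
    and psd: "\<And>M. (\<And>A. A \<in> ideal2 X \<Longrightarrow> A \<bullet> M = 0) \<Longrightarrow> (\<And>l. outer_sq l \<bullet> M \<ge> 0) \<Longrightarrow> M \<in> sq_sums X"
begin

abbreviation "RX \<equiv> real_points X"

lemma psd_in_subspace:
  assumes "\<And>A. A \<in> ideal2 X \<Longrightarrow> A \<bullet> M = 0" "\<And>l. outer_sq l \<bullet> M \<ge> 0"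
    and U: "subspace U" "\<And>l. (\<And>u. u \<in> U \<Longrightarrow> l \<bullet> u = 0) \<Longrightarrow> outer_sq l \<bullet> M = 0"
  shows "\<exists>xs. set xs \<subseteq> RX \<inter> U \<and> M = sum_list (map outer_sq xs)"
proof -
  obtain xs where xs: "set xs \<subseteq> RX" "M = sum_list (map outer_sq xs)"
    using psd[OF assms(1,2)] by (auto simp: sq_sums_def)
  have "x \<in> U" if "x \<in> set xs" for x
    by (rule in_subspace_if_orthogonal[OF U(1)]) (use U(2) sum_list_outer_sq_kernel that xs(2) in blast)
  then show ?thesis using xs by blast
qed

text \<open>The square of \<open>x\<close> is orthogonal to all quadrics through \<open>X\<close>,
  so it decomposes into squares of real points, and these must lie on the line of
  \<open>x\<close>.\<close>

lemma quadrics_cut_real_points: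
  assumes "x \<noteq> 0" "\<And>A. A \<in> ideal2 X \<Longrightarrow> rqform A x = 0" shows "x \<in> RX"
proof -
  have "\<exists>xs. set xs \<subseteq> RX \<inter> span {x} \<and> outer_sq x = sum_list (map outer_sq xs)"
    by (rule psd_in_subspace) (auto simp: inner_outer_sq2 span_base, simp add: inner_outer_sq assms(2))
  then obtain xs where xs: "set xs \<subseteq> RX \<inter> span {x}" "outer_sq x = sum_list (map outer_sq xs)" by blast
  have "outer_sq x \<noteq> 0" using inner_outer_sq2[of x x] assms(1) by auto
  then have "xs \<noteq> []" using xs(2) by auto
  then obtain y where y: "y \<in> RX" "y \<in> span {x}" using xs(1) by (metis Int_iff list.set_sel(1) subsetD)
  then obtain c where c: "y = c *\<^sub>R x" by (auto simp: span_singleton)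
  then have "c \<noteq> 0" using y(1) by (auto simp: real_points_def)
  then show ?thesis using real_points_scale[OF closed y(1), of "1 / c"] c by simp
qed

text \<open>A point in the span of other points is a limit of real points of that span: perturb its square
  by small multiples of the others, move to the boundary of the cone, where the matrix is singular,
  and decompose; one summand is close to the given point but lies in the kernel hyperplane.\<close>

lemma not_isolated:
  assumes y: "y \<in> RX" and B: "finite B" "B \<subseteq> RX" "y \<in> span B" and np: "\<And>x. x \<in> B \<Longrightarrow> x \<notin> span {y}"
    and \<eta>: "\<eta> > 0"
  shows "\<exists>u. u \<noteq> 0 \<and> u \<bullet> y = 0 \<and> norm u < \<eta> \<and> u \<in> span B \<and> y + u \<in> RX"
proof -
  have y0: "y \<noteq> 0" using y by (auto simp: real_points_def)
  obtain C where C: "C \<subseteq> B" "independent C" "span C = span B"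
    using maximal_independent_subset[of B] span_mono[of _ B] span_minimal[OF _ subspace_span, of B]
    by (metis subset_antisym)
  have finC: "finite C" using C(1) B(1) finite_subset by blast
  obtain \<beta> where \<beta>: "y = (\<Sum>v\<in>C. \<beta> v *\<^sub>R v)" using B(3) C(3) span_finite[OF finC] by auto
  have "\<exists>x0\<in>C. \<beta> x0 \<noteq> 0"
  proof (rule ccontr)
    assume "\<not> ?thesis"
    then have "y = 0" unfolding \<beta> by (intro sum.neutral) auto
    then show False using y0 by simp
  qed
  then obtain x0 where x0: "x0 \<in> C" "\<beta> x0 \<noteq> 0" by blast
  define s where "s = (\<Sum>v\<in>C. (\<beta> v)\<^sup>2)"
  \<comment> \<open>Strictness is where \<open>np\<close> enters: equality would make
    \<open>y\<close> a multiple of \<open>x0\<close>. It keeps the denominator of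
    \<open>\<delta>\<close> positive down to \<open>e = 0\<close>.\<close>
  have s_gt: "s > (\<beta> x0)\<^sup>2"
  proof (rule ccontr)
    assume "\<not> s > (\<beta> x0)\<^sup>2"
    then have "(\<Sum>v\<in>C - {x0}. (\<beta> v)\<^sup>2) \<le> 0" unfolding s_def sum.remove[OF finC x0(1)] by simp
    then have "(\<Sum>v\<in>C - {x0}. (\<beta> v)\<^sup>2) = 0" by (simp add: order.antisym sum_nonneg)
    then have "\<forall>v\<in>C - {x0}. \<beta> v = 0" using finC by (subst (asm) sum_nonneg_eq_0_iff) auto
    then have "y = \<beta> x0 *\<^sub>R x0" unfolding \<beta> sum.remove[OF finC x0(1)] by (simp add: sum.neutral)
    then have "x0 = (1 / \<beta> x0) *\<^sub>R y" using x0(2) by simp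
    then have "x0 \<in> span {y}" by (metis span_base span_scale singletonI)
    then show False using np x0 C(1) by blast
  qed
  have s0: "s > 0" using s_gt x0(2) by (metis less_trans zero_less_power2)
  \<comment> \<open>\<open>1 - \<theta>\<close> is the squared cosine of the angle whose tangent is
    \<open>\<eta> / norm y\<close>. A vector at a smaller angle to \<open>y\<close>, rescaled to
    \<open>y + u\<close> with \<open>u\<close> orthogonal to \<open>y\<close>, has
    \<open>norm u < \<eta>\<close>.\<close>
  define \<theta> where "\<theta> = \<eta>\<^sup>2 / (\<eta>\<^sup>2 + (norm y)\<^sup>2)"
  have \<theta>: "0 < \<theta>" "\<theta> < 1" using \<eta> y0 by (auto simp: \<theta>_def field_simps add_pos_pos)
  \<comment> \<open>The largest multiple of the square of \<open>x0\<close> that can be subtracted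
    from the perturbed square of \<open>y\<close> without losing semidefiniteness. It tends to 0
    with \<open>e\<close>.\<close>
  define \<delta> where "\<delta> e = e * (e + s) / (e + s - (\<beta> x0)\<^sup>2)" for e
  define n4 where "n4 = ((norm y)\<^sup>2)\<^sup>2"
  define w where "w = (\<Sum>v\<in>C. v \<bullet> v)"
  \<comment> \<open>For small \<open>e\<close> the value of the matrix at \<open>y\<close> exceeds
    the bound that would hold if every summand made a large angle with \<open>y\<close>; this later
    produces a summand close to the line of \<open>y\<close>.\<close>
  have "((\<lambda>e. n4 - \<delta> e * (x0 \<bullet> y)\<^sup>2 - (1 - \<theta>) * (norm y)\<^sup>2 * ((norm y)\<^sup>2 + e * w)) \<longlongrightarrow>
     n4 - 0 * (0 + s) / (0 + s - (\<beta> x0)\<^sup>2) * (x0 \<bullet> y)\<^sup>2 - (1 - \<theta>) * (norm y)\<^sup>2 * ((norm y)\<^sup>2 + 0 * w)) (at_right 0)"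
    unfolding \<delta>_def by (intro tendsto_intros) (use s_gt in auto)
  moreover have "n4 - 0 * (0 + s) / (0 + s - (\<beta> x0)\<^sup>2) * (x0 \<bullet> y)\<^sup>2 - (1 - \<theta>) * (norm y)\<^sup>2 * ((norm y)\<^sup>2 + 0 * w) > 0"
    using \<theta> y0 by (simp add: n4_def power2_eq_square algebra_simps)
  ultimately have "\<forall>\<^sub>F e in at_right 0. n4 - \<delta> e * (x0 \<bullet> y)\<^sup>2 - (1 - \<theta>) * (norm y)\<^sup>2 * ((norm y)\<^sup>2 + e * w) > 0"
    by (rule order_tendstoD(1))
  then obtain e where e: "e > 0" and close: "n4 - \<delta> e * (x0 \<bullet> y)\<^sup>2 - (1 - \<theta>) * (norm y)\<^sup>2 * ((norm y)\<^sup>2 + e * w) > 0"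
    using eventually_happens'[OF trivial_limit_at_right_real eventually_conj[OF eventually_at_right_less[of 0]]] by blast
  have den: "e + s - (\<beta> x0)\<^sup>2 > 0" using e s_gt by simp
  have \<delta>0: "\<delta> e \<ge> 0" using e s0 den by (simp add: \<delta>_def)
  define Q where "Q p q = (y \<bullet> p) * (y \<bullet> q) + e * (\<Sum>v\<in>C. (v \<bullet> p) * (v \<bullet> q))" for p q
  \<comment> \<open>In the coordinates of \<open>C\<close> the form \<open>Q\<close> has matrix
    \<open>e\<close> times the identity plus the rank one matrix of \<open>\<beta>\<close>. The
    values of \<open>l\<close> are the column of its inverse belonging to \<open>x0\<close>, by the
    Sherman-Morrison formula, so that \<open>Q l\<close> is the pairing with
    \<open>x0\<close>.\<close>
  obtain l where "\<forall>v\<in>C. l \<bullet> v = ((if v = x0 then 1 else 0) - \<beta> x0 * \<beta> v / (e + s)) / e"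
    using dual_vector_exists[OF C(2), of "\<lambda>v. ((if v = x0 then 1 else 0) - \<beta> x0 * \<beta> v / (e + s)) / e"] by blast
  then have l: "\<forall>v\<in>C. v \<bullet> l = ((if v = x0 then 1 else 0) - \<beta> x0 * \<beta> v / (e + s)) / e"
    by (subst inner_commute)
  have yl: "y \<bullet> l = \<beta> x0 / (e + s)"
  proof -
    have "y \<bullet> l = (\<Sum>v\<in>C. \<beta> v * (v \<bullet> l))" unfolding \<beta> by (simp add: inner_sum_left)
    also have "\<dots> = (\<Sum>v\<in>C. (if v = x0 then \<beta> v / e else 0) - \<beta> x0 / (e * (e + s)) * (\<beta> v)\<^sup>2)"
      using l by (intro sum.cong) (simp_all add: diff_divide_distrib right_diff_distrib power2_eq_square mult_ac)
    also have "\<dots> = \<beta> x0 / e - \<beta> x0 / (e * (e + s)) * s"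
      using finC x0 by (simp add: sum_subtractf s_def sum_distrib_left)
    also have "\<dots> = \<beta> x0 / (e + s)" using e s0 by (simp add: divide_simps) (simp add: algebra_simps)
    finally show ?thesis .
  qed
  have Ql: "Q l q = x0 \<bullet> q" for q
  proof -
    have "y \<bullet> q = (\<Sum>v\<in>C. \<beta> v * (v \<bullet> q))" unfolding \<beta> by (simp add: inner_sum_left)
    then have "Q l q = (\<Sum>v\<in>C. \<beta> x0 / (e + s) * \<beta> v * (v \<bullet> q)) + (\<Sum>v\<in>C. e * (v \<bullet> l) * (v \<bullet> q))"
      by (simp add: Q_def yl sum_distrib_left mult.assoc)
    also have "\<dots> = (\<Sum>v\<in>C. if v = x0 then v \<bullet> q else 0)"
      unfolding sum.distrib[symmetric]
    proof (rule sum.cong[OF refl])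
      fix v assume "v \<in> C"
      then have "e * (v \<bullet> l) = (if v = x0 then 1 else 0) - \<beta> x0 / (e + s) * \<beta> v" using l e by simp
      then have "\<beta> x0 / (e + s) * \<beta> v + e * (v \<bullet> l) = (if v = x0 then 1 else 0)" by simp
      then show "\<beta> x0 / (e + s) * \<beta> v * (v \<bullet> q) + e * (v \<bullet> l) * (v \<bullet> q) = (if v = x0 then v \<bullet> q else 0)"
        unfolding distrib_right[symmetric] by simp
    qed
    also have "\<dots> = x0 \<bullet> q" using finC x0 by simp
    finally show ?thesis .
  qed
  have "1 - (\<beta> x0)\<^sup>2 / (e + s) = (e + s - (\<beta> x0)\<^sup>2) / (e + s)" using e s0 by (simp add: diff_divide_distrib)
  then have x0l: "x0 \<bullet> l = (e + s - (\<beta> x0)\<^sup>2) / (e + s) / e" using l x0(1) by (simp add: power2_eq_square)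
  have \<delta>l: "\<delta> e * (x0 \<bullet> l) = 1" unfolding \<delta>_def x0l using den e s0 by simp
  define M where "M = outer_sq y + e *\<^sub>R (\<Sum>v\<in>C. outer_sq v) - \<delta> e *\<^sub>R outer_sq x0"
  have M: "A \<bullet> M = rqform A y + e * (\<Sum>v\<in>C. rqform A v) - \<delta> e * rqform A x0" for A
    by (simp add: M_def inner_diff_right inner_add_right inner_sum_right inner_outer_sq)
  have MQ: "outer_sq q \<bullet> M = Q q q - \<delta> e * (x0 \<bullet> q)\<^sup>2" for q
    by (simp add: M_def inner_diff_right inner_add_right inner_sum_right inner_outer_sq2 Q_def
        power2_eq_square inner_commute)
  have Qpos: "Q q q \<ge> 0" for q
    using e by (simp add: Q_def sum_nonneg flip: power2_eq_square)
  have Qd: "Q (a - t *\<^sub>R b) p = Q a p - t * Q b p" for a b p t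
  proof -
    have "e * (\<Sum>v\<in>C. (v \<bullet> a - t * (v \<bullet> b)) * (v \<bullet> p)) = e * ((\<Sum>v\<in>C. (v \<bullet> a) * (v \<bullet> p)) - t * (\<Sum>v\<in>C. (v \<bullet> b) * (v \<bullet> p)))"
      by (simp add: left_diff_distrib sum_subtractf sum_distrib_left mult.assoc)
    then show ?thesis unfolding Q_def by (simp add: inner_diff_right left_diff_distrib right_diff_distrib distrib_left)
  qed
  have Qs: "Q a b = Q b a" for a b by (simp add: Q_def mult.commute)
  have psdM: "outer_sq q \<bullet> M \<ge> 0" for q
  proof -
    \<comment> \<open>\<open>r\<close> is \<open>q\<close> made \<open>Q\<close>-orthogonal to
      \<open>l\<close>, and \<open>Q r r\<close> is the value of \<open>M\<close> at
      \<open>q\<close>. Semidefiniteness is thus Cauchy-Schwarz for \<open>Q\<close>, with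
      \<open>l\<close> in the kernel.\<close>
    define r where "r = q - (\<delta> e * (x0 \<bullet> q)) *\<^sub>R l"
    have rq: "Q r q = Q q q - \<delta> e * (x0 \<bullet> q) * (x0 \<bullet> q)" unfolding r_def Qd Ql ..
    have "x0 \<bullet> r = x0 \<bullet> q - (x0 \<bullet> q) * (\<delta> e * (x0 \<bullet> l))" by (simp add: r_def inner_diff_right)
    then have rl: "Q l r = 0" unfolding \<delta>l Ql by simp
    have "Q r r = Q q r - \<delta> e * (x0 \<bullet> q) * Q l r" using Qd[of q "\<delta> e * (x0 \<bullet> q)" l r] by (simp add: r_def)
    also have "\<dots> = outer_sq q \<bullet> M" unfolding rl Qs[of q r] rq MQ by (simp add: power2_eq_square)
    finally show ?thesis using Qpos[of r] by simp
  qed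
  have "\<exists>xs. set xs \<subseteq> RX \<inter> span B \<and> M = sum_list (map outer_sq xs)"
  proof (rule psd_in_subspace)
    fix A assume A: "A \<in> ideal2 X"
    have "rqform A v = 0" if "v \<in> C" for v using ideal2_real_points[OF A] that C(1) B(2) by blast
    then show "A \<bullet> M = 0" using ideal2_real_points[OF A y] x0(1) by (simp add: M)
  next
    fix q assume "\<And>u. u \<in> span B \<Longrightarrow> q \<bullet> u = 0"
    then have "\<And>u. u \<in> span B \<Longrightarrow> u \<bullet> q = 0" by (metis inner_commute)
    then have "y \<bullet> q = 0" "\<forall>v\<in>C. v \<bullet> q = 0" using B(3) C(1) span_base by blast+
    then show "outer_sq q \<bullet> M = 0" using x0(1) unfolding MQ Q_def by simp
  next
    fix q show "0 \<le> outer_sq q \<bullet> M" by (rule psdM)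
  next
    show "subspace (span B)" by (rule subspace_span)
  qed
  then obtain xs where xs: "set xs \<subseteq> RX \<inter> span B" "M = sum_list (map outer_sq xs)" by blast
  have ker: "l \<bullet> x = 0" if "x \<in> set xs" for x
  proof (rule sum_list_outer_sq_kernel[OF _ that])
    show "outer_sq l \<bullet> sum_list (map outer_sq xs) = 0"
      unfolding xs(2)[symmetric] MQ Ql using \<delta>l by (simp add: power2_eq_square)
  qed
  have "\<exists>x\<in>set xs. (y \<bullet> x)\<^sup>2 > (1 - \<theta>) * (norm y)\<^sup>2 * (norm x)\<^sup>2"
  proof (rule ccontr)
    assume "\<not> ?thesis"
    then have le: "\<And>x. x \<in> set xs \<Longrightarrow> (y \<bullet> x)\<^sup>2 \<le> (1 - \<theta>) * (norm y)\<^sup>2 * (norm x)\<^sup>2" by fastforce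
    have "outer_sq y \<bullet> M = (\<Sum>x\<leftarrow>xs. (y \<bullet> x)\<^sup>2)" unfolding xs(2) by (simp add: inner_sum_list_right inner_outer_sq2)
    also have "\<dots> \<le> (\<Sum>x\<leftarrow>xs. (1 - \<theta>) * (norm y)\<^sup>2 * (norm x)\<^sup>2)" by (rule sum_list_mono) (rule le)
    also have "\<dots> = (1 - \<theta>) * (norm y)\<^sup>2 * (mat 1 \<bullet> M)"
      unfolding xs(2) by (simp add: inner_sum_list_right inner_mat_1_outer_sq power2_norm_eq_inner sum_list_const_mult)
    also have "mat 1 \<bullet> M = (norm y)\<^sup>2 + e * w - \<delta> e * (norm x0)\<^sup>2"
      by (simp add: M_def inner_diff_right inner_add_right inner_sum_right inner_mat_1_outer_sq w_def power2_norm_eq_inner)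
    also have "(1 - \<theta>) * (norm y)\<^sup>2 * ((norm y)\<^sup>2 + e * w - \<delta> e * (norm x0)\<^sup>2) \<le> (1 - \<theta>) * (norm y)\<^sup>2 * ((norm y)\<^sup>2 + e * w)"
      using \<delta>0 \<theta> by (intro mult_left_mono) auto
    finally have 1: "outer_sq y \<bullet> M \<le> (1 - \<theta>) * (norm y)\<^sup>2 * ((norm y)\<^sup>2 + e * w)" .
    have "e * (\<Sum>v\<in>C. (v \<bullet> y) * (v \<bullet> y)) \<ge> 0" using e by (intro mult_nonneg_nonneg sum_nonneg zero_le_square) auto
    then have "Q y y \<ge> n4" unfolding Q_def n4_def power2_norm_eq_inner by (simp add: power2_eq_square)
    then have "outer_sq y \<bullet> M \<ge> n4 - \<delta> e * (x0 \<bullet> y)\<^sup>2" unfolding MQ by simp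
    then show False using 1 close by linarith
  qed
  then obtain x where x: "x \<in> set xs" "(y \<bullet> x)\<^sup>2 > (1 - \<theta>) * (norm y)\<^sup>2 * (norm x)\<^sup>2" by (elim bexE)
  have "(1 - \<theta>) * (norm y)\<^sup>2 * (norm x)\<^sup>2 \<ge> 0" using \<theta> by simp
  then have yx: "y \<bullet> x \<noteq> 0" using x(2) by auto
  define c where "c = (norm y)\<^sup>2 / (y \<bullet> x)"
  define u where "u = c *\<^sub>R x - y"
  have c0: "c \<noteq> 0" using yx y0 by (simp add: c_def)
  have cyx: "c * (y \<bullet> x) = y \<bullet> y" using yx by (simp add: c_def power2_norm_eq_inner)
  have "u \<bullet> y = 0" using cyx by (simp add: u_def inner_diff_left inner_commute[of x y])
  \<comment> \<open>All summands are orthogonal to the kernel vector \<open>l\<close>, but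
    \<open>y\<close> is not, so the summand close to \<open>y\<close> is not proportional to
    it.\<close>
  moreover have "u \<noteq> 0"
  proof
    assume "u = 0"
    then have "y = c *\<^sub>R x" by (simp add: u_def)
    then have "l \<bullet> y = c * (l \<bullet> x)" by simp
    then show False using ker[OF x(1)] yl x0(2) e s0 by (simp add: inner_commute)
  qed
  moreover have "y + u \<in> RX" using xs(1) x(1) real_points_scale[OF closed _ c0] by (auto simp: u_def)
  moreover have "u \<in> span B" unfolding u_def using xs(1) x(1) B(3) by (intro span_diff span_scale) auto
  moreover have "norm u < \<eta>"
  proof -
    have "(norm u)\<^sup>2 = c\<^sup>2 * (norm x)\<^sup>2 - (norm y)\<^sup>2"
    proof -
      have "(norm u)\<^sup>2 = c\<^sup>2 * (x \<bullet> x) - 2 * (c * (y \<bullet> x)) + y \<bullet> y"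
        unfolding u_def power2_norm_eq_inner inner_diff_left inner_diff_right
        by (simp add: inner_commute[of x y] power2_eq_square)
      then show ?thesis unfolding cyx by (simp add: power2_norm_eq_inner)
    qed
    moreover have "c\<^sup>2 * (norm x)\<^sup>2 * (1 - \<theta>) < (norm y)\<^sup>2"
    proof -
      have "c\<^sup>2 * (norm x)\<^sup>2 * (1 - \<theta>) = (norm y)\<^sup>2 * ((1 - \<theta>) * (norm y)\<^sup>2 * (norm x)\<^sup>2) / (y \<bullet> x)\<^sup>2"
        by (simp add: c_def power2_eq_square)
      also have "\<dots> < (norm y)\<^sup>2 * (y \<bullet> x)\<^sup>2 / (y \<bullet> x)\<^sup>2"
        using x(2) y0 yx by (intro divide_strict_right_mono mult_strict_left_mono) auto
      finally show ?thesis using yx by simp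
    qed
    ultimately have "((norm u)\<^sup>2 + (norm y)\<^sup>2) * (1 - \<theta>) < (norm y)\<^sup>2" by simp
    moreover have "1 - \<theta> = (norm y)\<^sup>2 / (\<eta>\<^sup>2 + (norm y)\<^sup>2)"
      using \<eta> y0 by (simp add: \<theta>_def field_simps add_pos_pos)
    moreover have "\<eta>\<^sup>2 + (norm y)\<^sup>2 > 0" "(norm y)\<^sup>2 > 0" using \<eta> y0 by (auto simp: add_pos_pos)
    ultimately have "((norm u)\<^sup>2 + (norm y)\<^sup>2) * (norm y)\<^sup>2 < (\<eta>\<^sup>2 + (norm y)\<^sup>2) * (norm y)\<^sup>2"
      by (simp add: divide_less_eq mult.commute)
    then have "(norm u)\<^sup>2 < \<eta>\<^sup>2" using y0 by simp
    then show ?thesis using \<eta> by (simp add: power2_less_imp_less)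
  qed
  ultimately show ?thesis by blast
qed

end

section \<open>Independence modulo a subspace\<close>

lemma span_image_sum:
  fixes w :: "'i \<Rightarrow> 'a::real_vector"
  assumes "finite J" "x \<in> span (w ` J)" shows "\<exists>a. x = (\<Sum>j\<in>J. a j *\<^sub>R w j)"
  using assms(2)
proof (induction rule: span_induct_alt)
  case base
  show ?case by (rule exI[of _ "\<lambda>_. 0"]) simp
next
  case (step c x y)
  then obtain a j where a: "y = (\<Sum>j\<in>J. a j *\<^sub>R w j)" "j \<in> J" "x = w j" by blast
  have "c *\<^sub>R x + y = (\<Sum>k\<in>J. (a(j := a j + c)) k *\<^sub>R w k)"
  proof -
    have "(\<Sum>k\<in>J. (a(j := a j + c)) k *\<^sub>R w k) = (a j + c) *\<^sub>R w j + (\<Sum>k\<in>J - {j}. a k *\<^sub>R w k)"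
      using a(2) assms(1) by (subst sum.remove[of _ j]) auto
    moreover have "y = a j *\<^sub>R w j + (\<Sum>k\<in>J - {j}. a k *\<^sub>R w k)"
      unfolding a(1) by (rule sum.remove[OF assms(1) a(2)])
    ultimately show ?thesis by (simp add: a(3) algebra_simps)
  qed
  then show ?case by blast
qed

text \<open>Linear independence in the quotient by \<open>U\<close>, stated for an indexed family:
  on a finite index set a repeated value makes it false.\<close>

definition indmod :: "'a::real_vector set \<Rightarrow> ('i \<Rightarrow> 'a) \<Rightarrow> 'i set \<Rightarrow> bool" where
  "indmod U w J \<longleftrightarrow> (\<forall>a. (\<Sum>j\<in>J. a j *\<^sub>R w j) \<in> U \<longrightarrow> (\<forall>j\<in>J. a j = 0))"

lemma indmodD: "indmod U w J \<Longrightarrow> (\<Sum>j\<in>J. a j *\<^sub>R w j) \<in> U \<Longrightarrow> j \<in> J \<Longrightarrow> a j = 0"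
  unfolding indmod_def by blast

lemma indmod_mono:
  assumes "indmod U w J" "U' \<subseteq> U" "J' \<subseteq> J" "finite J" shows "indmod U' w J'"
  unfolding indmod_def
proof (intro allI impI ballI)
  fix a j assume a: "(\<Sum>j\<in>J'. a j *\<^sub>R w j) \<in> U'" and j: "j \<in> J'"
  have "(\<Sum>j\<in>J. (if j \<in> J' then a j else 0) *\<^sub>R w j) = (\<Sum>j\<in>J'. a j *\<^sub>R w j)"
    using assms by (intro sum.mono_neutral_cong_right) auto
  then have "(\<Sum>j\<in>J. (if j \<in> J' then a j else 0) *\<^sub>R w j) \<in> U" using a assms(2) by auto
  from indmodD[OF assms(1) this, of j] show "a j = 0" using assms(3) j by auto
qed

lemma indmod_cong: "(\<And>j. j \<in> J \<Longrightarrow> w j = w' j) \<Longrightarrow> indmod U w J \<longleftrightarrow> indmod U w' J"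
  unfolding indmod_def by (simp cong: sum.cong)

lemma indmod_reindex:
  assumes "inj_on \<pi> J" "indmod U w (\<pi> ` J)" shows "indmod U (w \<circ> \<pi>) J"
  unfolding indmod_def
proof (intro allI impI ballI)
  fix a j assume a: "(\<Sum>j\<in>J. a j *\<^sub>R (w \<circ> \<pi>) j) \<in> U" and j: "j \<in> J"
  have "(\<Sum>k\<in>\<pi> ` J. a (inv_into J \<pi> k) *\<^sub>R w k) = (\<Sum>j\<in>J. a j *\<^sub>R (w \<circ> \<pi>) j)"
    unfolding sum.reindex[OF assms(1)] by (rule sum.cong) (auto simp: inv_into_f_f[OF assms(1)])
  then have "a (inv_into J \<pi> (\<pi> j)) = 0"
    using indmodD[OF assms(2), of "\<lambda>k. a (inv_into J \<pi> k)" "\<pi> j"] a j by simp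
  then show "a j = 0" using inv_into_f_f[OF assms(1) j] by simp
qed

lemma indmod_insert:
  assumes "subspace U" "finite J" "k \<notin> J" "indmod U w J"
    and "\<And>a u. u \<in> U \<Longrightarrow> w k \<noteq> u + (\<Sum>j\<in>J. a j *\<^sub>R w j)"
  shows "indmod U w (insert k J)"
  unfolding indmod_def
proof (intro allI impI ballI)
  fix a j assume a: "(\<Sum>j\<in>insert k J. a j *\<^sub>R w j) \<in> U" and j: "j \<in> insert k J"
  have eq: "(\<Sum>j\<in>insert k J. a j *\<^sub>R w j) = a k *\<^sub>R w k + (\<Sum>j\<in>J. a j *\<^sub>R w j)"
    using assms by simp
  have "a k = 0"
  proof (rule ccontr)
    assume ak: "a k \<noteq> 0"
    let ?u = "(1 / a k) *\<^sub>R (\<Sum>j\<in>insert k J. a j *\<^sub>R w j)"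
    have "w k = ?u + (\<Sum>j\<in>J. (- a j / a k) *\<^sub>R w j)"
      unfolding eq using ak by (simp add: algebra_simps scaleR_sum_right sum_negf divide_inverse)
    moreover have "?u \<in> U" using assms(1) a subspace_scale by blast
    ultimately show False using assms(5)[of ?u "\<lambda>j. - a j / a k"] by simp
  qed
  then show "a j = 0" using a eq assms(4) j unfolding indmod_def by auto
qed

text \<open>Separate \<open>w i\<close> by a functional from the sum of \<open>U\<close> and the
  span of the other vectors, then normalize.\<close>

lemma indmod_dual:
  fixes w :: "'i \<Rightarrow> 'a::euclidean_space"
  assumes "subspace U" "finite J" "indmod U w J"
  shows "\<exists>p. \<forall>i\<in>J. (\<forall>u\<in>U. p i \<bullet> u = 0) \<and> (\<forall>k\<in>J. p i \<bullet> w k = (if k = i then 1 else 0))"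
proof (intro bchoice ballI)
  fix i assume i: "i \<in> J"
  let ?W = "{u + v | u v. u \<in> U \<and> v \<in> span (w ` (J - {i}))}"
  have "w i \<notin> ?W"
  proof
    assume "w i \<in> ?W"
    then obtain u v where uv: "w i = u + v" "u \<in> U" "v \<in> span (w ` (J - {i}))" by blast
    then obtain a where a: "v = (\<Sum>j\<in>J - {i}. a j *\<^sub>R w j)" using span_image_sum[of "J - {i}"] assms(2) by blast
    have "(\<Sum>j\<in>J. (if j = i then 1 else - a j) *\<^sub>R w j) = w i + (\<Sum>j\<in>J - {i}. - a j *\<^sub>R w j)"
      using i assms(2) by (subst sum.remove[of _ i]) (auto intro!: sum.cong)
    also have "\<dots> = u" unfolding uv(1) a by (simp add: sum_negf)
    finally have "(\<Sum>j\<in>J. (if j = i then 1 else - a j) *\<^sub>R w j) \<in> U" using uv(2) by simp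
    then show False using indmodD[OF assms(3) _ i] by fastforce
  qed
  moreover have W: "subspace ?W" using assms(1) by (intro subspace_sums) auto
  ultimately obtain l where l: "\<And>u. u \<in> ?W \<Longrightarrow> l \<bullet> u = 0" "l \<bullet> w i \<noteq> 0"
    using in_subspace_if_orthogonal[OF W, of "w i"] by blast
  have lU: "l \<bullet> u = 0" if "u \<in> U" for u
  proof -
    have "u + 0 \<in> ?W" using that span_zero by blast
    then show ?thesis using l(1) by simp
  qed
  have lw: "l \<bullet> w k = 0" if "k \<in> J" "k \<noteq> i" for k
  proof -
    have "0 + w k \<in> ?W" using that span_base[of "w k" "w ` (J - {i})"] subspace_0[OF assms(1)] by blast
    then show ?thesis using l(1) by simp
  qed
  show "\<exists>y. (\<forall>u\<in>U. y \<bullet> u = 0) \<and> (\<forall>k\<in>J. y \<bullet> w k = (if k = i then 1 else 0))"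
    using lU lw l(2) by (intro exI[of _ "(1 / (l \<bullet> w i)) *\<^sub>R l"]) auto
qed

lemma indmod_zero_independent:
  assumes "indmod {0} w J" "finite J" shows "inj_on w J" "independent (w ` J)"
proof -
  show inj: "inj_on w J"
  proof (rule inj_onI, rule ccontr)
    fix i j assume ij: "i \<in> J" "j \<in> J" "w i = w j" "i \<noteq> j"
    have "(\<Sum>k\<in>J. (if k = i then 1 else if k = j then -1 else 0) *\<^sub>R w k)
        = w i + (- w j + (\<Sum>k\<in>J - {i} - {j}. (if k = i then 1 else if k = j then -1 else 0) *\<^sub>R w k))"
      using ij assms(2) by (subst sum.remove[of _ i], simp, simp, subst sum.remove[of _ j]) auto
    also have "(\<Sum>k\<in>J - {i} - {j}. (if k = i then 1 else if k = j then -1 else 0) *\<^sub>R w k) = 0"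
      by (intro sum.neutral) auto
    finally have "(\<Sum>k\<in>J. (if k = i then 1 else if k = j then -1 else 0) *\<^sub>R w k) \<in> {0}" using ij by simp
    then show False using indmodD[OF assms(1) _ ij(1)] by fastforce
  qed
  show "independent (w ` J)"
  proof (rule independent_if_scalars_zero)
    fix f x assume f: "(\<Sum>x\<in>w ` J. f x *\<^sub>R x) = 0" and "x \<in> w ` J"
    then obtain j where j: "j \<in> J" "x = w j" by blast
    have "(\<Sum>j\<in>J. f (w j) *\<^sub>R w j) \<in> {0}" using f unfolding sum.reindex[OF inj] by simp
    then have "f (w j) = 0" using indmodD[OF assms(1), of "\<lambda>j. f (w j)"] j(1) by blast
    then show "f x = 0" using j by simp
  qed (use assms in auto)
qed

lemma real_line_vector_derivative:
  assumes "hom_poly d f"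
  shows "((\<lambda>t. f (cvec (y + t *\<^sub>R v))) has_vector_derivative lf (grad f (cvec y)) (cvec v)) (at 0)"
proof -
  have sc: "of_real t *s cvec v = t *\<^sub>R cvec v" for t by (simp add: vec_eq_iff) (simp add: scaleR_conv_of_real)
  have 1: "((\<lambda>t. cvec (y + t *\<^sub>R v)) has_derivative (\<lambda>t. t *\<^sub>R cvec v)) (at 0)"
    unfolding cvec_simps sc by (auto intro!: derivative_eq_intros)
  have "((\<lambda>t. f (cvec (y + t *\<^sub>R v))) has_derivative (\<lambda>t. lf (grad f (cvec y)) (t *\<^sub>R cvec v))) (at 0)"
    using has_derivative_compose[OF 1, of f "lf (grad f (cvec y))"] has_derivative_grad[OF assms, of "cvec y"]
    by (simp add: cvec_simps)
  moreover have "lf (grad f (cvec y)) (t *\<^sub>R cvec v) = t *\<^sub>R lf (grad f (cvec y)) (cvec v)" for t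
    unfolding sc[symmetric] by (simp add: lf_linear scaleR_conv_of_real)
  ultimately show ?thesis unfolding has_vector_derivative_def by simp
qed

lemma grad_cqform: "lf (grad (cqform A) (cvec y)) (cvec v) = of_real (rbf A y v)"
proof -
  have "((\<lambda>t. of_real (rqform A y + t * rbf A y v + t\<^sup>2 * rqform A v) :: complex) has_vector_derivative of_real (rbf A y v)) (at 0)"
    by (rule has_vector_derivative_of_real) (auto intro!: derivative_eq_intros)
  moreover have "cqform A (cvec (y + t *\<^sub>R v)) = of_real (rqform A y + t * rbf A y v + t\<^sup>2 * rqform A v)" for t
    unfolding cqform_cvec rqform_add rqform_scale using linear_scale[OF linear_rbf[of A y]] by simp
  ultimately show ?thesis
    using vector_derivative_unique_at[OF real_line_vector_derivative[OF hom_poly_cqform, of A y v]] by simp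
qed

lemma grad_lf: "grad (lf a) z = a"
proof (rule has_derivative_lf_unique)
  have "bounded_linear (lf a)" unfolding lf_def
    by (intro bounded_linear_sum bounded_linear_const_mult bounded_linear_vec_nth)
  then show "(lf a has_derivative lf a) (at z)" by (rule bounded_linear_imp_has_derivative)
qed

lemma norm_cvec: "norm (cvec x) = norm x"
  by (simp add: norm_vec_def cvec_simps)

lemma ideal2_subspace: "subspace (ideal2 X)"
  unfolding subspace_def ideal2_def cqform_def
  by (simp add: algebra_simps sum.distrib) (simp add: sum_distrib_left[symmetric] mult.assoc)

section \<open>A single component: generic real points and tangent spaces\<close>

locale component = sos X for X :: "(complex^'n::finite) set" +
  fixes V :: "(complex^'n) set"
  assumes V: "V \<in> irr_components X"
begin

lemma V_irr: "proj_irreducible V" and V_sub: "V \<subseteq> X" and V_closed: "proj_closed V"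
  using V by (auto simp: irr_components_def proj_irreducible_def)

abbreviation "RV \<equiv> real_points V"
definition "S = span RV"

lemma subspace_S: "subspace S" by (simp add: S_def)

text \<open>For each other component take a form that vanishes on it but not on \<open>V\<close>.
  The product of these forms is still nonzero on \<open>V\<close> by irreducibility.\<close>

lemma other_components_form:
  "\<exists>G. (\<exists>d. hom_poly d G) \<and> (\<forall>W\<in>irr_components X - {V}. \<forall>z\<in>W. G z = 0) \<and> (\<exists>z\<in>V. G z \<noteq> 0)"
proof -
  have "\<exists>f. \<exists>d. hom_poly d f \<and> (\<forall>z\<in>W. f z = 0) \<and> (\<exists>z\<in>V. f z \<noteq> 0)" if W: "W \<in> irr_components X - {V}" for W
  proof -
    have W': "proj_irreducible W" "W \<subseteq> X" using W by (auto simp: irr_components_def)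
    have "\<not> V \<subseteq> W" using V W W' by (auto simp: irr_components_def)
    then obtain z where z: "z \<in> V" "z \<notin> W" by blast
    moreover have "z \<noteq> 0" using proj_closed_nonzero[OF V_closed z(1)] .
    ultimately show ?thesis
      using proj_closed_form_separates[of W z] W'(1) unfolding proj_irreducible_def by blast
  qed
  then have "\<forall>W\<in>irr_components X - {V}. \<exists>f. \<exists>d. hom_poly d f \<and> (\<forall>z\<in>W. f z = 0) \<and> (\<exists>z\<in>V. f z \<noteq> 0)" by blast
  from bchoice[OF this] obtain f where "\<forall>W\<in>irr_components X - {V}. \<exists>d. hom_poly d (f W) \<and> (\<forall>z\<in>W. f W z = 0) \<and> (\<exists>z\<in>V. f W z \<noteq> 0)"
    by (elim exE)
  from bchoice[OF this] obtain d where fd: "\<forall>W\<in>irr_components X - {V}. hom_poly (d W) (f W) \<and> (\<forall>z\<in>W. f W z = 0) \<and> (\<exists>z\<in>V. f W z \<noteq> 0)"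
    by (elim exE)
  let ?I = "irr_components X - {V}"
  have fin: "finite ?I" using finite_irr_components[OF closed] by simp
  have "hom_poly (sum d ?I) (\<lambda>z. \<Prod>W\<in>?I. f W z)" by (rule hom_poly_prod) (use fd in simp)
  moreover have "\<exists>z\<in>V. (\<Prod>W\<in>?I. f W z) \<noteq> 0"
    by (rule proj_irreducible_prod_forms[OF V_irr fin, of d f]) (use fd in simp_all)
  moreover have "(\<Prod>W\<in>?I. f W z) = 0" if "W \<in> ?I" "z \<in> W" for W z
    using fd that fin by (intro prod_zero) auto
  ultimately show ?thesis by (intro exI[of _ "\<lambda>z. \<Prod>W\<in>?I. f W z"] conjI exI[of _ "sum d ?I"]) auto
qed

definition "G0 = (SOME G. (\<exists>d. hom_poly d G) \<and> (\<forall>W\<in>irr_components X - {V}. \<forall>z\<in>W. G z = 0) \<and> (\<exists>z\<in>V. G z \<noteq> 0))"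

lemma G0: "\<exists>d. hom_poly d G0" "\<And>W z. W \<in> irr_components X \<Longrightarrow> W \<noteq> V \<Longrightarrow> z \<in> W \<Longrightarrow> G0 z = 0" "\<exists>z\<in>V. G0 z \<noteq> 0"
  using someI_ex[OF other_components_form] unfolding G0_def[symmetric] by simp_all

text \<open>The real points where \<open>G0\<close> is nonzero: they lie on no other component, and
  since the condition is open, the real points of \<open>X\<close> near them belong to
  \<open>V\<close>.\<close>

definition "P = {y \<in> RX. G0 (cvec y) \<noteq> 0}"

lemma P_subset: "P \<subseteq> RV" "P \<subseteq> RX"
proof -
  show "P \<subseteq> RX" by (auto simp: P_def)
  show "P \<subseteq> RV"
  proof
    fix y assume y: "y \<in> P"
    then have "cvec y \<in> \<Union>(irr_components X)" using Union_irr_components[OF closed] by (auto simp: P_def real_points_def)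
    then obtain W where W: "W \<in> irr_components X" "cvec y \<in> W" by blast
    have "W = V" using G0(2)[OF W(1) _ W(2)] y by (auto simp: P_def)
    then show "y \<in> RV" using W y by (auto simp: P_def real_points_def)
  qed
qed

lemma RV_subset: "RV \<subseteq> RX" "RV \<subseteq> S"
  using V_sub by (auto simp: real_points_def S_def intro!: span_base)

lemma P_S: "P \<subseteq> S" using P_subset RV_subset by blast

text \<open>The product with \<open>G0\<close> vanishes at all real points of \<open>X\<close>,
  hence on \<open>X\<close>; on the irreducible \<open>V\<close> the factor \<open>G0\<close>
  cancels.\<close>

lemma P_dense:
  assumes f: "hom_poly d f" "\<And>y. y \<in> P \<Longrightarrow> f (cvec y) = 0" and z: "z \<in> V" shows "f z = 0"
proof -
  from G0(1) obtain e where e: "hom_poly e G0" by (elim exE)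
  have "f (cvec x) * G0 (cvec x) = 0" if "x \<in> RX" for x using f(2) that by (auto simp: P_def)
  moreover have fG: "hom_poly (d + e) (\<lambda>z. f z * G0 z)" by (rule hom_poly_mult[OF f(1) e])
  ultimately have "\<forall>z\<in>X. f z * G0 z = 0"
    using dense[unfolded totally_real_def, rule_format, of "d + e" "\<lambda>z. f z * G0 z"] by blast
  then have "\<And>z. z \<in> V \<Longrightarrow> f z * G0 z = 0" using V_sub by blast
  from proj_irreducible_forms[OF V_irr f(1) e this] show ?thesis using G0(3) z by blast
qed

lemma RV_dense:
  assumes "hom_poly d f" "\<And>y. y \<in> RV \<Longrightarrow> f (cvec y) = 0" "z \<in> V" shows "f z = 0"
  using P_dense[OF assms(1) _ assms(3)] assms(2) P_subset by blast

lemma generic_point: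
  assumes "finite I" "\<And>i. i \<in> I \<Longrightarrow> hom_poly (d i) (f i)" "\<And>i. i \<in> I \<Longrightarrow> \<exists>z\<in>V. f i z \<noteq> 0"
  shows "\<exists>y\<in>P. \<forall>i\<in>I. f i (cvec y) \<noteq> 0"
proof -
  have h: "hom_poly (sum d I) (\<lambda>z. \<Prod>i\<in>I. f i z)" by (rule hom_poly_prod) (use assms(2) in simp)
  have "\<exists>z\<in>V. (\<Prod>i\<in>I. f i z) \<noteq> 0" by (rule proj_irreducible_prod_forms[OF V_irr assms(1), of d f]) (use assms in simp_all)
  then obtain y where "y \<in> P" "(\<Prod>i\<in>I. f i (cvec y)) \<noteq> 0" using P_dense[OF h] by blast
  then show ?thesis using assms(1) by (intro bexI[of _ y]) auto
qed

lemma S_form: "(\<forall>s\<in>S. l \<bullet> s = 0) \<longleftrightarrow> (\<forall>z\<in>V. lf (cvec l) z = 0)"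
proof (intro iffI ballI)
  fix z assume l: "\<forall>s\<in>S. l \<bullet> s = 0" and "z \<in> V"
  then show "lf (cvec l) z = 0"
    using RV_dense[OF hom_poly_lf[of "cvec l"]] RV_subset(2) by (auto simp: lf_cvec)
next
  fix s assume l: "\<forall>z\<in>V. lf (cvec l) z = 0" and "s \<in> S"
  from \<open>s \<in> S\<close> have "s \<in> span RV" by (simp add: S_def)
  then show "l \<bullet> s = 0"
  proof (induction rule: span_induct)
    case base
    show ?case by (rule subspace_hyperplane)
  next
    case (step x)
    then have "lf (cvec l) (cvec x) = 0" using l by (auto simp: real_points_def)
    then show ?case by (simp add: lf_cvec)
  qed
qed

text \<open>A subspace that does not contain \<open>S\<close> lies in a hyperplane whose linear form
  is not identically 0 on \<open>V\<close>. Avoiding it is again avoiding the zeros of a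
  form.\<close>

lemma generic_point_avoiding:
  assumes "finite I" "\<And>i. i \<in> I \<Longrightarrow> subspace (U i)" "\<And>i. i \<in> I \<Longrightarrow> \<not> S \<subseteq> U i"
    and G: "hom_poly e G" "\<exists>z\<in>V. G z \<noteq> 0"
  shows "\<exists>y\<in>P. G (cvec y) \<noteq> 0 \<and> (\<forall>i\<in>I. y \<notin> U i)"
proof -
  have "\<forall>i\<in>I. \<exists>l. (\<forall>u\<in>U i. l \<bullet> u = 0) \<and> (\<exists>z\<in>V. lf (cvec l) z \<noteq> 0)"
  proof
    fix i assume i: "i \<in> I"
    then obtain s where s: "s \<in> S" "s \<notin> U i" using assms(3) by blast
    then obtain l where "\<And>u. u \<in> U i \<Longrightarrow> l \<bullet> u = 0" "l \<bullet> s \<noteq> 0"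
      using in_subspace_if_orthogonal[OF assms(2)[OF i], of s] by blast
    then show "\<exists>l. (\<forall>u\<in>U i. l \<bullet> u = 0) \<and> (\<exists>z\<in>V. lf (cvec l) z \<noteq> 0)"
      using S_form[of l] s(1) by blast
  qed
  from bchoice[OF this] obtain l where l: "\<forall>i\<in>I. (\<forall>u\<in>U i. l i \<bullet> u = 0) \<and> (\<exists>z\<in>V. lf (cvec (l i)) z \<noteq> 0)" by blast
  define f where "f i = (case i of None \<Rightarrow> G | Some j \<Rightarrow> lf (cvec (l j)))" for i
  define d where "d i = (case i of None \<Rightarrow> e | Some j \<Rightarrow> if j \<in> I then 1 else 1)" for i
  have "\<exists>y\<in>P. \<forall>i\<in>insert None (Some ` I). f i (cvec y) \<noteq> 0"
  proof (rule generic_point[of "insert None (Some ` I)" d f])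
    fix i assume i: "i \<in> insert None (Some ` I)"
    show "hom_poly (d i) (f i)" using i G(1) hom_poly_lf by (auto simp: f_def d_def)
    show "\<exists>z\<in>V. f i z \<noteq> 0" using i G(2) l by (auto simp: f_def)
  qed (use assms(1) in simp)
  then obtain y where y: "y \<in> P" "\<forall>i\<in>insert None (Some ` I). f i (cvec y) \<noteq> 0" by blast
  then have "G (cvec y) \<noteq> 0" "\<forall>i\<in>I. l i \<bullet> y \<noteq> 0" by (auto simp: f_def lf_cvec)
  then show ?thesis using y(1) l by blast
qed

lemma generic_avoiding:
  assumes "finite I" "\<And>i. i \<in> I \<Longrightarrow> subspace (U i)" "\<And>i. i \<in> I \<Longrightarrow> \<not> S \<subseteq> U i"
  shows "\<exists>y\<in>P. \<forall>i\<in>I. y \<notin> U i"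
proof -
  have "\<exists>z\<in>V. (1::complex) \<noteq> 0" using V_irr by (auto simp: proj_irreducible_def)
  from generic_point_avoiding[of I U 0 "\<lambda>z. 1", OF assms(1) _ _ hom_poly_const this] assms(2,3)
  show ?thesis by auto
qed

text \<open>The real Zariski tangent space of the affine cone over \<open>V\<close>; it contains
  \<open>y\<close> itself when \<open>y\<close> is a real point of \<open>V\<close>.
  \<open>T2\<close> uses only the quadrics through \<open>X\<close>, hence is larger, but it can be
  controlled by the dual quadrics.\<close>

definition "T1 y = {v. \<forall>d f. hom_poly d f \<and> (\<forall>z\<in>V. f z = 0) \<longrightarrow> lf (grad f (cvec y)) (cvec v) = 0}"
definition "T2 y = {v. \<forall>A\<in>ideal2 X. rbf A y v = 0}"

lemma T1D: "v \<in> T1 y \<Longrightarrow> hom_poly d f \<Longrightarrow> (\<And>z. z \<in> V \<Longrightarrow> f z = 0) \<Longrightarrow> lf (grad f (cvec y)) (cvec v) = 0"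
  unfolding T1_def by blast

lemma T1I:
  assumes "\<And>d f. hom_poly d f \<Longrightarrow> (\<And>z. z \<in> V \<Longrightarrow> f z = 0) \<Longrightarrow> lf (grad f (cvec y)) (cvec v) = 0"
  shows "v \<in> T1 y"
  unfolding T1_def mem_Collect_eq
proof (intro allI impI, elim conjE)
  fix d f assume "hom_poly d f" and f: "\<forall>z\<in>V. f z = 0"
  then show "lf (grad f (cvec y)) (cvec v) = 0" by (intro assms) simp_all
qed

lemma subspace_T1: "subspace (T1 y)"
proof (rule subspaceI)
  show "0 \<in> T1 y" by (rule T1I) (simp add: cvec_simps lf_linear)
  show "u + v \<in> T1 y" if "u \<in> T1 y" "v \<in> T1 y" for u v
  proof (rule T1I)
    fix d f assume "hom_poly d f" "\<And>z. z \<in> V \<Longrightarrow> f z = 0"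
    from T1D[OF that(1) this] T1D[OF that(2) this] show "lf (grad f (cvec y)) (cvec (u + v)) = 0"
      by (simp add: cvec_simps lf_linear)
  qed
  show "c *\<^sub>R v \<in> T1 y" if "v \<in> T1 y" for c v
  proof (rule T1I)
    fix d f assume "hom_poly d f" "\<And>z. z \<in> V \<Longrightarrow> f z = 0"
    from T1D[OF that(1) this] show "lf (grad f (cvec y)) (cvec (c *\<^sub>R v)) = 0"
      by (simp add: cvec_simps lf_linear)
  qed
qed

lemma subspace_T2: "subspace (T2 y)"
  unfolding subspace_def T2_def
  by (simp add: linear_0[OF linear_rbf] linear_add[OF linear_rbf] linear_scale[OF linear_rbf])

lemma T1_T2: "T1 y \<subseteq> T2 y"
proof
  fix v assume v: "v \<in> T1 y"
  have "rbf A y v = 0" if A: "A \<in> ideal2 X" for A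
  proof -
    have "lf (grad (cqform A) (cvec y)) (cvec v) = 0"
      by (rule T1D[OF v hom_poly_cqform]) (use A V_sub in \<open>auto simp: ideal2_def\<close>)
    then show ?thesis by (simp add: grad_cqform)
  qed
  then show "v \<in> T2 y" by (simp add: T2_def)
qed

lemma T1_S: "T1 y \<subseteq> S"
proof
  fix v assume v: "v \<in> T1 y"
  show "v \<in> S"
  proof (rule in_subspace_if_orthogonal[OF subspace_S])
    fix l assume "\<And>u. u \<in> S \<Longrightarrow> l \<bullet> u = 0"
    then have "\<And>z. z \<in> V \<Longrightarrow> lf (cvec l) z = 0" using S_form[of l] by blast
    from T1D[OF v hom_poly_lf this] have "lf (cvec l) (cvec v) = 0" by (simp add: grad_lf)
    then show "l \<bullet> v = 0" by (simp add: lf_cvec)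
  qed
qed

lemma self_T1: assumes "y \<in> RV" shows "y \<in> T1 y"
  unfolding T1_def
proof (clarify)
  fix d f assume f: "hom_poly d f" "\<forall>z\<in>V. f z = 0"
  have "cvec y \<in> V" using assms by (simp add: real_points_def)
  then have "f (cvec y) = 0" using f(2) by simp
  then show "lf (grad f (cvec y)) (cvec y) = 0" using euler_grad[OF f(1)] by simp
qed

text \<open>Unit secant directions accumulate by compactness. Near \<open>y\<close> the points of
  \<open>X\<close> lie on \<open>V\<close>, so a limit direction is tangent to \<open>V\<close>.
  Orthogonality to \<open>y\<close> survives the limit and excludes the radial direction, which is
  always tangent.\<close>

lemma limit_direction:
  assumes y: "y \<in> P" and U: "subspace U"
    and u: "\<And>\<eta>. \<eta> > 0 \<Longrightarrow> \<exists>u. u \<noteq> 0 \<and> u \<bullet> y = 0 \<and> norm u < \<eta> \<and> u \<in> U \<and> y + u \<in> RX"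
  shows "\<exists>v\<in>U. v \<noteq> 0 \<and> v \<bullet> y = 0 \<and> v \<in> T1 y"
proof -
  have "\<forall>n. \<exists>u. u \<noteq> 0 \<and> u \<bullet> y = 0 \<and> norm u < 1 / real (Suc n) \<and> u \<in> U \<and> y + u \<in> RX"
    using u by simp
  from choice[OF this] obtain h where h: "\<And>n. h n \<noteq> 0" "\<And>n. h n \<bullet> y = 0" "\<And>n. norm (h n) < 1 / real (Suc n)"
     "\<And>n. h n \<in> U" "\<And>n. y + h n \<in> RX" by blast
  have h0: "h \<longlonglongrightarrow> 0"
    by (rule tendsto_0_le[OF LIMSEQ_inverse_real_of_nat, of _ 1])
      (use h(3) in \<open>auto simp: inverse_eq_divide less_imp_le\<close>)
  define w where "w n = (1 / norm (h n)) *\<^sub>R h n" for n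
  have "w n \<in> sphere 0 1" for n using h(1) by (simp add: w_def)
  then obtain v r where v: "v \<in> sphere 0 1" "strict_mono r" "(w \<circ> r) \<longlonglongrightarrow> v"
    using compact_sphere[of 0 1, unfolded compact_def] by blast
  have "v \<in> U"
    by (rule closed_sequentially[OF closed_subspace[OF U] _ v(3)]) (use h(4) U in \<open>auto simp: w_def subspace_scale\<close>)
  moreover have "v \<bullet> y = 0"
  proof -
    have "(\<lambda>n. (w \<circ> r) n \<bullet> y) \<longlonglongrightarrow> v \<bullet> y" by (intro tendsto_intros v(3))
    moreover have "(w \<circ> r) n \<bullet> y = 0" for n by (simp add: w_def h(2))
    ultimately show ?thesis by (simp add: LIMSEQ_const_iff)
  qed
  moreover have "v \<in> T1 y"
    unfolding T1_def
  proof (clarify)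
    fix d f assume f: "hom_poly d f" "\<forall>z\<in>V. f z = 0"
    from G0(1) obtain e where e: "hom_poly e G0" by (elim exE)
    have conv: "(\<lambda>n. cvec (y + h n)) \<longlonglongrightarrow> cvec (y + 0)"
      by (rule continuous_on_tendsto_compose[OF continuous_on_cvec[of UNIV]]) (intro tendsto_intros h0, auto)
    have "(\<lambda>n. G0 (cvec (y + h n))) \<longlonglongrightarrow> G0 (cvec (y + 0))"
      by (rule continuous_on_tendsto_compose[OF continuous_on_hom_poly[OF e, of UNIV] conv]) auto
    moreover have "G0 (cvec (y + 0)) \<noteq> 0" using y by (simp add: P_def)
    ultimately have "\<forall>\<^sub>F n in sequentially. G0 (cvec (y + h n)) \<noteq> 0" by (rule tendsto_imp_eventually_ne)
    then have ev: "\<forall>\<^sub>F n in sequentially. f (cvec y + cvec (h n)) = 0"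
    proof eventually_elim
      case (elim n)
      then have "y + h n \<in> P" using h(5) by (simp add: P_def)
      then have "cvec (y + h n) \<in> V" using P_subset(1) by (auto simp: real_points_def)
      then show ?case using f(2) by (simp add: cvec_simps)
    qed
    let ?D = "lf (grad f (cvec y))"
    have fy: "f (cvec y) = 0" using f(2) y P_subset(1) by (auto simp: real_points_def)
    have "(\<lambda>h. norm (f (cvec y + h) - f (cvec y) - ?D h) / norm h) \<midarrow>0\<rightarrow> 0"
      by (rule has_derivative_grad[OF f(1), of "cvec y", unfolded has_derivative_at, THEN conjunct2])
    moreover have "filterlim (\<lambda>n. cvec (h n)) (at 0) sequentially"
    proof -
      have "(\<lambda>n. cvec (h n)) \<longlonglongrightarrow> cvec 0"
        by (rule continuous_on_tendsto_compose[OF continuous_on_cvec[of UNIV] h0]) auto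
      moreover have "cvec (h n) \<noteq> 0" for n using h(1)[of n] by (metis cvec_inj cvec_simps(4))
      ultimately show ?thesis by (simp add: filterlim_at cvec_simps)
    qed
    ultimately have "(\<lambda>n. norm (f (cvec y + cvec (h n)) - f (cvec y) - ?D (cvec (h n))) / norm (cvec (h n))) \<longlonglongrightarrow> 0"
      by (rule filterlim_compose)
    moreover have "\<forall>\<^sub>F n in sequentially. norm (f (cvec y + cvec (h n)) - f (cvec y) - ?D (cvec (h n))) / norm (cvec (h n)) = norm (?D (cvec (w n)))"
      using ev
    proof eventually_elim
      case (elim n)
      then show ?case by (simp add: fy w_def cvec_simps lf_linear norm_mult norm_divide norm_cvec)
    qed
    ultimately have "(\<lambda>n. norm (?D (cvec (w n)))) \<longlonglongrightarrow> 0" by (rule Lim_transform_eventually)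
    from LIMSEQ_subseq_LIMSEQ[OF this v(2)] have lim0: "(\<lambda>n. norm (?D (cvec ((w \<circ> r) n)))) \<longlonglongrightarrow> 0" by (simp add: o_def)
    have "(\<lambda>n. cvec ((w \<circ> r) n)) \<longlonglongrightarrow> cvec v"
      by (rule continuous_on_tendsto_compose[OF continuous_on_cvec[of UNIV] v(3)]) auto
    then have "(\<lambda>n. ?D (cvec ((w \<circ> r) n))) \<longlonglongrightarrow> ?D (cvec v)"
      by (rule continuous_on_tendsto_compose[OF continuous_on_hom_poly[OF hom_poly_lf, of UNIV]]) auto
    then have "(\<lambda>n. norm (?D (cvec ((w \<circ> r) n)))) \<longlonglongrightarrow> norm (?D (cvec v))" by (rule tendsto_norm)
    from LIMSEQ_unique[OF this lim0] show "?D (cvec v) = 0" by simp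
  qed
  moreover have "v \<noteq> 0" using v(1) by auto
  ultimately show ?thesis by blast
qed

lemma dependent_tangent:
  assumes y: "y \<in> P" and B: "finite B" "B \<subseteq> RX" "y \<in> span B" "\<And>x. x \<in> B \<Longrightarrow> x \<notin> span {y}"
  shows "\<exists>v\<in>span B. v \<noteq> 0 \<and> v \<bullet> y = 0 \<and> v \<in> T1 y"
proof (rule limit_direction[OF y subspace_span])
  fix \<eta> :: real assume "\<eta> > 0"
  moreover have "y \<in> RX" using y P_subset by blast
  ultimately show "\<exists>u. u \<noteq> 0 \<and> u \<bullet> y = 0 \<and> norm u < \<eta> \<and> u \<in> span B \<and> y + u \<in> RX"
    using not_isolated[OF _ B] by blast
qed

end

lemma indmod_not_mem:
  assumes "indmod U w J" "finite J" "j \<in> J" shows "w j \<notin> U"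
proof
  assume "w j \<in> U"
  then have "(\<Sum>k\<in>J. (if k = j then 1 else 0) *\<^sub>R w k) \<in> U" using assms(2,3) by (simp add: if_distrib if_distribR cong: if_cong)
  from indmodD[OF assms(1) this assms(3)] show False by simp
qed

lemma scaleR_complex: "r *\<^sub>R (z :: complex) = of_real r * z"
  by (rule scaleR_conv_of_real)

definition sym_prod :: "real^'n::finite \<Rightarrow> real^'n \<Rightarrow> real^'n^'n" where
  "sym_prod u v = (\<chi> a b. u $ a * v $ b + v $ a * u $ b)"

lemma inner_sym_prod: "F \<bullet> sym_prod u v = rbf F u v"
  by (simp add: inner_vec_def sym_prod_def rbf_def)

lemma outer_sq_inner_sym_prod: "outer_sq q \<bullet> sym_prod u v = 2 * (q \<bullet> u) * (q \<bullet> v)"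
proof -
  have "outer_sq q \<bullet> sym_prod u v = (\<Sum>a\<in>UNIV. \<Sum>b\<in>UNIV. (q $ a * u $ a) * (q $ b * v $ b)) + (\<Sum>a\<in>UNIV. \<Sum>b\<in>UNIV. (q $ a * v $ a) * (q $ b * u $ b))"
    by (simp add: inner_vec_def sym_prod_def outer_sq_def algebra_simps sum.distrib)
  also have "\<dots> = (q \<bullet> u) * (q \<bullet> v) + (q \<bullet> v) * (q \<bullet> u)" by (simp add: inner_vec_def sum_product)
  finally show ?thesis by simp
qed

section \<open>Maximal independent tuples of real points and their dual quadrics\<close>

context component
begin

text \<open>The triangular condition can be maintained by appending generic points, since a new
  point is constrained only by the tangent spaces at the earlier ones. The tuple has
  \<open>c + 1\<close> members.\<close>

definition "flagged c Y \<longleftrightarrow> (\<forall>i\<le>c. Y i \<in> P) \<and> (\<forall>i\<le>c. indmod (T1 (Y i)) Y {i<..c})" for c :: nat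
text \<open>The symmetric version, with the larger tangent spaces. It does not depend on the order
  of the points, so any of them may be put first.\<close>

definition "strong c Y \<longleftrightarrow> (\<forall>i\<le>c. Y i \<in> P) \<and> (\<forall>i\<le>c. indmod (T2 (Y i)) Y ({..c} - {i}))" for c :: nat

lemma P_nonzero: "y \<in> P \<Longrightarrow> y \<noteq> 0" using P_subset by (auto simp: real_points_def)

lemma strong_flagged:
  assumes "strong c Y" shows "flagged c Y"
  unfolding flagged_def
proof (intro conjI allI impI)
  fix i assume "i \<le> c"
  then have "indmod (T2 (Y i)) Y ({..c} - {i})" using assms by (auto simp: strong_def)
  then show "indmod (T1 (Y i)) Y {i<..c}" by (rule indmod_mono) (use T1_T2 in auto)
qed (use assms in \<open>auto simp: strong_def\<close>)

lemma flagged_independent: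
  assumes "flagged c Y" shows "indmod {0} Y {..c}"
  unfolding indmod_def
proof (intro allI impI)
  fix a assume a: "(\<Sum>j\<le>c. a j *\<^sub>R Y j) \<in> {0}"
  have Y0: "Y 0 \<in> P" using assms by (auto simp: flagged_def)
  have eq: "(\<Sum>j\<le>c. a j *\<^sub>R Y j) = a 0 *\<^sub>R Y 0 + (\<Sum>j\<in>{0<..c}. a j *\<^sub>R Y j)"
  proof -
    have "{..c} - {0} = {0<..c}" by auto
    then show ?thesis by (subst sum.remove[of _ 0]) auto
  qed
  then have "(\<Sum>j\<in>{0<..c}. a j *\<^sub>R Y j) = (- a 0) *\<^sub>R Y 0" using a by (simp add: add_eq_0_iff)
  then have "(\<Sum>j\<in>{0<..c}. a j *\<^sub>R Y j) \<in> T1 (Y 0)"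
    using self_T1[of "Y 0"] Y0 P_subset subspace_scale[OF subspace_T1] by (metis subsetD)
  moreover have "indmod (T1 (Y 0)) Y {0<..c}" using assms by (auto simp: flagged_def)
  ultimately have pos: "\<forall>j\<in>{0<..c}. a j = 0" by (intro ballI indmodD)
  then have "a 0 *\<^sub>R Y 0 = 0" using eq a by simp
  then have "a 0 = 0" using P_nonzero[OF Y0] by simp
  then show "\<forall>j\<in>{..c}. a j = 0" using pos
  proof (intro ballI)
    fix j assume "j \<in> {..c}"
    then show "a j = 0" using pos \<open>a 0 = 0\<close> by (cases "j = 0") auto
  qed
qed

text \<open>Any other real point of the span would put some \<open>Y i\<close> into the span of
  itself and the later points. Since \<open>Y i\<close> is then not isolated, the span of
  \<open>Y i\<close> and the later points contains a tangent vector at \<open>Y i\<close> that is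
  orthogonal to \<open>Y i\<close>; independence modulo \<open>T1 (Y i)\<close> makes it a multiple
  of \<open>Y i\<close>.\<close>

lemma flagged_span_points:
  assumes fl: "flagged c Y" and x: "x \<in> RX" "x \<in> span (Y ` {..c})"
  shows "\<exists>i\<le>c. x \<in> span {Y i}"
proof (rule ccontr)
  assume no: "\<not> ?thesis"
  obtain a where a: "x = (\<Sum>j\<le>c. a j *\<^sub>R Y j)" using span_image_sum[OF _ x(2)] by auto
  have "\<exists>j. j \<le> c \<and> a j \<noteq> 0"
  proof (rule ccontr)
    assume "\<nexists>j. j \<le> c \<and> a j \<noteq> 0"
    then have "x = 0" unfolding a by (intro sum.neutral) auto
    then show False using x(1) by (simp add: real_points_def)
  qed
  \<comment> \<open>The least index in the support is chosen so that only points after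
    \<open>Y i\<close> occur besides it, as the triangular condition requires.\<close>
  then obtain i where i: "i \<le> c" "a i \<noteq> 0" "\<And>j. j < i \<Longrightarrow> \<not> (j \<le> c \<and> a j \<noteq> 0)"
    using exists_least_iff[of "\<lambda>j. j \<le> c \<and> a j \<noteq> 0"] by blast
  have ins: "{i..c} = insert i {i<..c}" using i(1) by auto
  have "(\<Sum>j\<le>c. a j *\<^sub>R Y j) = (\<Sum>j\<in>{i..c}. a j *\<^sub>R Y j)"
    using i(3) by (intro sum.mono_neutral_right) auto
  then have xi: "x = a i *\<^sub>R Y i + (\<Sum>j\<in>{i<..c}. a j *\<^sub>R Y j)" unfolding a ins by simp
  define B where "B = insert x (Y ` {i<..c})"
  have Yi: "Y i \<in> P" and YP: "\<And>j. j \<le> c \<Longrightarrow> Y j \<in> P" using fl i(1) by (auto simp: flagged_def)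
  have ind: "indmod (T1 (Y i)) Y {i<..c}" using fl i(1) by (auto simp: flagged_def)
  have selfT: "Y i \<in> T1 (Y i)" using self_T1 Yi P_subset by blast
  have "Y i = (1 / a i) *\<^sub>R (x - (\<Sum>j\<in>{i<..c}. a j *\<^sub>R Y j))" unfolding xi using i(2) by simp
  also have "\<dots> \<in> span B"
    by (intro span_scale span_diff span_sum) (auto simp: B_def intro: span_base)
  finally have spanB: "Y i \<in> span B" .
  have notin: "b \<notin> span {Y i}" if b: "b \<in> B" for b
  proof (cases "b = x")
    case True then show ?thesis using no i(1) by blast
  next
    case False
    then obtain j where j: "j \<in> {i<..c}" "b = Y j" using b by (auto simp: B_def)
    have "Y j \<notin> T1 (Y i)" by (rule indmod_not_mem[OF ind _ j(1)]) simp
    moreover have "span {Y i} \<subseteq> T1 (Y i)" by (rule span_minimal) (use selfT subspace_T1 in auto)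
    ultimately show ?thesis using j(2) by blast
  qed
  have BX: "B \<subseteq> RX" using x(1) YP P_subset by (auto simp: B_def)
  have "finite B" by (simp add: B_def)
  from dependent_tangent[OF Yi this BX spanB notin]
  obtain v where v: "v \<in> span B" "v \<noteq> 0" "v \<bullet> Y i = 0" "v \<in> T1 (Y i)" by blast
  have "B \<subseteq> span (Y ` {i..c})"
  proof -
    have "x \<in> span (Y ` {i..c})" unfolding xi using i(1) by (intro span_add span_scale span_sum) (auto intro: span_base)
    then show ?thesis by (auto simp: B_def intro: span_base)
  qed
  then have "v \<in> span (Y ` {i..c})" using v(1) span_minimal[OF _ subspace_span] by blast
  then obtain b where b: "v = (\<Sum>j\<in>{i..c}. b j *\<^sub>R Y j)" using span_image_sum[of "{i..c}" v Y] by auto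
  then have vb: "v = b i *\<^sub>R Y i + (\<Sum>j\<in>{i<..c}. b j *\<^sub>R Y j)" unfolding ins by simp
  then have "(\<Sum>j\<in>{i<..c}. b j *\<^sub>R Y j) = v - b i *\<^sub>R Y i" by simp
  then have "(\<Sum>j\<in>{i<..c}. b j *\<^sub>R Y j) \<in> T1 (Y i)"
    using v(4) selfT by (simp add: subspace_diff[OF subspace_T1] subspace_scale[OF subspace_T1])
  from indmodD[OF ind this] have "v = b i *\<^sub>R Y i" using vb by simp
  then show False using v(2,3) P_nonzero[OF Yi] by simp
qed

text \<open>Otherwise, by duality, the product of \<open>Y i\<close> and \<open>Y j\<close> minus a
  combination of the other products, squares included, is orthogonal to the quadrics through
  \<open>X\<close>. Adding a large multiple of all squares makes it semidefinite, hence a sum of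
  squares of real points of the span. By \<open>flagged_span_points\<close> these are multiples of
  the \<open>Y k\<close>, so no mixed term can occur.\<close>

lemma flagged_quadric:
  assumes fl: "flagged c Y" and ij: "i \<le> c" "j \<le> c" "i \<noteq> j"
  shows "\<exists>F\<in>ideal2 X. rbf F (Y i) (Y j) = 1 \<and> (\<forall>k\<le>c. \<forall>l\<le>c. {k, l} \<noteq> {i, j} \<longrightarrow> rbf F (Y k) (Y l) = 0)"
proof (rule ccontr)
  assume no: "\<not> ?thesis"
  define Pi where "Pi = {(k, l). k \<le> c \<and> l \<le> c \<and> {k, l} \<noteq> {i, j}}"
  have finPi: "finite Pi" by (rule finite_subset[of _ "{..c} \<times> {..c}"]) (auto simp: Pi_def)
  define N where "N = (\<lambda>(k, l). sym_prod (Y k) (Y l))"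
  define Ip where "Ip = {M. \<forall>A\<in>ideal2 X. A \<bullet> M = 0}"
  have Ip: "subspace Ip" by (auto simp: subspace_def Ip_def inner_add_right)
  let ?U = "{m + w | m w. m \<in> Ip \<and> w \<in> span (N ` Pi)}"
  have U: "subspace ?U" by (intro subspace_sums Ip subspace_span)
  have "N (i, j) \<in> ?U"
  proof (rule in_subspace_if_orthogonal[OF U])
    fix F assume F: "\<And>u. u \<in> ?U \<Longrightarrow> F \<bullet> u = 0"
    have Fm: "F \<bullet> m = 0" if "m \<in> Ip" for m
    proof -
      have "m + 0 \<in> ?U" using that span_zero by blast
      then show ?thesis using F by simp
    qed
    have Fw: "F \<bullet> N p = 0" if "p \<in> Pi" for p
    proof -
      have "0 + N p \<in> ?U" using that span_base[of "N p" "N ` Pi"] subspace_0[OF Ip] by blast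
      then show ?thesis using F by simp
    qed
    have FI: "F \<in> ideal2 X"
    proof (rule in_subspace_if_orthogonal[OF ideal2_subspace])
      fix m assume "\<And>A. A \<in> ideal2 X \<Longrightarrow> m \<bullet> A = 0"
      then have "m \<in> Ip" by (simp add: Ip_def inner_commute)
      then show "m \<bullet> F = 0" using Fm[of m] inner_commute[of m F] by simp
    qed
    show "F \<bullet> N (i, j) = 0"
    proof (rule ccontr)
      assume nz: "F \<bullet> N (i, j) \<noteq> 0"
      let ?F = "(1 / rbf F (Y i) (Y j)) *\<^sub>R F"
      have "?F \<in> ideal2 X" using FI subspace_scale[OF ideal2_subspace] by blast
      moreover have "rbf ?F (Y i) (Y j) = 1" using nz by (simp add: N_def inner_sym_prod linear_scale[OF linear_rbf_matrix])
      moreover have "rbf ?F (Y k) (Y l) = 0" if "k \<le> c" "l \<le> c" "{k, l} \<noteq> {i, j}" for k l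
        using Fw[of "(k, l)"] that by (simp add: Pi_def N_def inner_sym_prod linear_scale[OF linear_rbf_matrix])
      ultimately have "\<exists>F\<in>ideal2 X. rbf F (Y i) (Y j) = 1 \<and> (\<forall>k\<le>c. \<forall>l\<le>c. {k, l} \<noteq> {i, j} \<longrightarrow> rbf F (Y k) (Y l) = 0)"
        by (intro bexI[of _ ?F]) simp_all
      then show False using no by simp
    qed
  qed
  then obtain m w where mw: "N (i, j) = m + w" "m \<in> Ip" "w \<in> span (N ` Pi)" by blast
  obtain d where d: "w = (\<Sum>p\<in>Pi. d p *\<^sub>R N p)" using span_image_sum[OF finPi mw(3)] by blast
  have m: "m = N (i, j) - (\<Sum>p\<in>Pi. d p *\<^sub>R N p)" using mw(1) d by simp
  \<comment> \<open>With \<open>s\<close> the sum of the squares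
    \<open>(q \<bullet> Y k)\<^sup>2\<close>, every product has absolute value at most
    \<open>2 * s\<close> at \<open>q\<close>. The summand 2 covers the leading product, the rest the
    weights \<open>d\<close>.\<close>
  define t where "t = 2 + 2 * (\<Sum>p\<in>Pi. \<bar>d p\<bar>)"
  define M where "M = m + t *\<^sub>R (\<Sum>k\<le>c. outer_sq (Y k))"
  have "\<exists>xs. set xs \<subseteq> RX \<inter> span (Y ` {..c}) \<and> M = sum_list (map outer_sq xs)"
  proof (rule psd_in_subspace)
    fix A assume A: "A \<in> ideal2 X"
    have "rqform A (Y k) = 0" if "k \<le> c" for k
      by (rule ideal2_real_points[OF A]) (use fl that P_subset in \<open>auto simp: flagged_def\<close>)
    then show "A \<bullet> M = 0" using mw(2) A by (simp add: M_def Ip_def inner_add_right inner_sum_right inner_outer_sq)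
  next
    fix q
    define s where "s = (\<Sum>k\<le>c. (q \<bullet> Y k)\<^sup>2)"
    have le: "\<bar>outer_sq q \<bullet> N (k, l)\<bar> \<le> 2 * s" if "k \<le> c" "l \<le> c" for k l
    proof -
      have "(q \<bullet> Y k)\<^sup>2 \<le> s" "(q \<bullet> Y l)\<^sup>2 \<le> s" unfolding s_def using that by (auto intro!: member_le_sum)
      moreover have "\<bar>2 * (q \<bullet> Y k) * (q \<bullet> Y l)\<bar> \<le> (q \<bullet> Y k)\<^sup>2 + (q \<bullet> Y l)\<^sup>2"
        using sum_squares_bound[of "\<bar>q \<bullet> Y k\<bar>" "\<bar>q \<bullet> Y l\<bar>"] by (simp add: abs_mult)
      ultimately show ?thesis by (simp add: N_def outer_sq_inner_sym_prod)
    qed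
    have "(\<Sum>p\<in>Pi. d p * (outer_sq q \<bullet> N p)) \<le> (\<Sum>p\<in>Pi. \<bar>d p\<bar> * (2 * s))"
    proof (rule sum_mono)
      fix p assume "p \<in> Pi"
      then have "\<bar>outer_sq q \<bullet> N p\<bar> \<le> 2 * s" using le by (auto simp: Pi_def)
      then show "d p * (outer_sq q \<bullet> N p) \<le> \<bar>d p\<bar> * (2 * s)"
        using abs_ge_self[of "d p * (outer_sq q \<bullet> N p)"] mult_left_mono[of "\<bar>outer_sq q \<bullet> N p\<bar>" "2 * s" "\<bar>d p\<bar>"]
        unfolding abs_mult by linarith
    qed
    then have "outer_sq q \<bullet> m \<ge> - 2 * s - (\<Sum>p\<in>Pi. \<bar>d p\<bar>) * (2 * s)"
      using le[OF ij(1,2)] unfolding m by (simp add: inner_diff_right inner_sum_right sum_distrib_right)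
    moreover have "t * s = 2 * s + (\<Sum>p\<in>Pi. \<bar>d p\<bar>) * (2 * s)" by (simp add: t_def algebra_simps)
    ultimately show "outer_sq q \<bullet> M \<ge> 0"
      by (simp add: M_def inner_add_right inner_sum_right inner_outer_sq2 s_def[symmetric])
  next
    fix q assume q: "\<And>u. u \<in> span (Y ` {..c}) \<Longrightarrow> q \<bullet> u = 0"
    have q0: "q \<bullet> Y k = 0" if "k \<le> c" for k using q[of "Y k"] that by (auto intro: span_base)
    have "outer_sq q \<bullet> N p = 0" if "p \<in> Pi" for p
      using that q0 by (auto simp: Pi_def N_def outer_sq_inner_sym_prod)
    then show "outer_sq q \<bullet> M = 0" unfolding M_def m using ij q0
      by (simp add: inner_add_right inner_diff_right inner_sum_right inner_outer_sq2 N_def outer_sq_inner_sym_prod)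
  qed (rule subspace_span)
  then obtain xs where xs: "set xs \<subseteq> RX \<inter> span (Y ` {..c})" "M = sum_list (map outer_sq xs)" by blast
  obtain p where p: "\<And>k l. k \<le> c \<Longrightarrow> l \<le> c \<Longrightarrow> p k \<bullet> Y l = (if l = k then 1 else 0)"
    using indmod_dual[OF subspace_single_0 _ flagged_independent[OF fl]] by auto
  \<comment> \<open>Polarization extracts the mixed coefficient of \<open>Y i\<close> and
    \<open>Y j\<close>: it is 0 on the square of every \<open>Y k\<close> and 2 on the product of
    \<open>Y i\<close> and \<open>Y j\<close>.\<close>
  define D where "D M = outer_sq (p i + p j) \<bullet> M - outer_sq (p i) \<bullet> M - outer_sq (p j) \<bullet> M" for M
  have Dsq: "D (outer_sq x) = 2 * (p i \<bullet> x) * (p j \<bullet> x)" for x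
    by (simp add: D_def inner_outer_sq2 inner_add_left power2_eq_square algebra_simps)
  have Dlin: "D (A + B) = D A + D B" "D (r *\<^sub>R A) = r * D A" "D (A - B) = D A - D B" for A B r
    by (simp_all add: D_def inner_add_right inner_diff_right algebra_simps)
  have Dsum: "finite K \<Longrightarrow> D (\<Sum>k\<in>K. f k) = (\<Sum>k\<in>K. D (f k))" for f :: "'z \<Rightarrow> _" and K
  proof (induction K rule: finite_induct)
    case empty show ?case by (simp add: D_def)
  next
    case (insert x F) then show ?case by (simp add: Dlin)
  qed
  have DN: "D (N (k, l)) = (if {k, l} = {i, j} then 2 else 0)" if "k \<le> c" "l \<le> c" for k l
  proof -
    have "D (N (k, l)) = 2 * ((p i \<bullet> Y k) * (p j \<bullet> Y l) + (p j \<bullet> Y k) * (p i \<bullet> Y l))"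
      by (simp add: D_def N_def outer_sq_inner_sym_prod inner_add_left algebra_simps)
    then show ?thesis using p ij that by (auto simp: doubleton_eq_iff)
  qed
  have "D x = 0" if x: "x \<in> set (map outer_sq xs)" for x
  proof -
    obtain y where y: "y \<in> RX" "y \<in> span (Y ` {..c})" "x = outer_sq y" using x xs(1) by auto
    obtain k where k: "k \<le> c" "y \<in> span {Y k}" using flagged_span_points[OF fl y(1,2)] by blast
    then obtain r where r: "y = r *\<^sub>R Y k" by (auto simp: span_singleton)
    have "(p i \<bullet> Y k) * (p j \<bullet> Y k) = 0" unfolding p[OF ij(1) k(1)] p[OF ij(2) k(1)] using ij(3) by simp
    then show ?thesis unfolding y(3) Dsq r by auto
  qed
  then have "D (sum_list (map outer_sq xs)) = 0"
  proof (induction xs)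
    case Nil show ?case by (simp add: D_def)
  next
    case (Cons x xs) then show ?case by (simp add: Dlin)
  qed
  then have D0: "D M = 0" using xs(2) by simp
  have "D (N q) = 0" if q: "q \<in> Pi" for q
  proof -
    obtain k l where kl: "q = (k, l)" "k \<le> c" "l \<le> c" "{k, l} \<noteq> {i, j}" using q unfolding Pi_def by blast
    then show ?thesis using DN[OF kl(2,3)] by simp
  qed
  then have "D m = 2" unfolding m Dlin Dsum[OF finPi] using DN[OF ij(1,2)] by simp
  moreover have "D (outer_sq (Y k)) = 0" if "k \<le> c" for k unfolding Dsq using p[OF ij(1) that] p[OF ij(2) that] ij(3) by auto
  then have "D (\<Sum>k\<le>c. outer_sq (Y k)) = 0" by (simp add: Dsum)
  ultimately have "D M = 2" by (simp add: M_def Dlin)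
  then show False using D0 by simp
qed

text \<open>Pairing a combination that lies in \<open>T2 (Y i)\<close> with the quadric dual to the
  pair \<open>i\<close>, \<open>j\<close> leaves only its coefficient at \<open>Y j\<close>.\<close>

lemma flagged_strong:
  assumes fl: "flagged c Y" shows "strong c Y"
  unfolding strong_def
proof (intro conjI allI impI)
  fix i assume i: "i \<le> c"
  show "indmod (T2 (Y i)) Y ({..c} - {i})"
    unfolding indmod_def
  proof (intro allI impI ballI)
    fix a j assume a: "(\<Sum>k\<in>{..c} - {i}. a k *\<^sub>R Y k) \<in> T2 (Y i)" and j: "j \<in> {..c} - {i}"
    obtain F where F: "F \<in> ideal2 X" "rbf F (Y i) (Y j) = 1" "\<And>k l. k \<le> c \<Longrightarrow> l \<le> c \<Longrightarrow> {k, l} \<noteq> {i, j} \<Longrightarrow> rbf F (Y k) (Y l) = 0"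
      using flagged_quadric[OF fl i, of j] j by auto
    have "0 = rbf F (Y i) (\<Sum>k\<in>{..c} - {i}. a k *\<^sub>R Y k)" using a F(1) by (simp add: T2_def)
    also have "\<dots> = (\<Sum>k\<in>{..c} - {i}. a k * rbf F (Y i) (Y k))"
      by (simp add: linear_sum[OF linear_rbf] linear_scale[OF linear_rbf])
    also have "\<dots> = (\<Sum>k\<in>{..c} - {i}. if k = j then a j else 0)"
      using F(2) F(3)[OF i] by (intro sum.cong) (auto simp: doubleton_eq_iff)
    also have "\<dots> = a j" using j by simp
    finally show "a j = 0" by simp
  qed
qed (use fl in \<open>auto simp: flagged_def\<close>)

lemma strong_bound: "strong c Y \<Longrightarrow> c \<le> CARD('n)"
proof -
  assume "strong c Y"
  then have ind: "indmod {0} Y {..c}" using strong_flagged flagged_independent by blast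
  have "card (Y ` {..c}) \<le> DIM(real^'n)"
    using independent_bound[OF indmod_zero_independent(2)[OF ind]] by simp
  then show ?thesis using card_image[OF indmod_zero_independent(1)[OF ind]] by simp
qed

text \<open>This will be the codimension of \<open>V\<close> in its span, and \<open>Suc cm\<close>
  its degree.\<close>

definition "cm = (GREATEST c. \<exists>Y. strong c Y)"

lemma ex_strong: "\<exists>Y. strong cm Y"
  unfolding cm_def
proof (rule GreatestI_ex_nat)
  obtain y where "y \<in> P" using generic_avoiding[of "{}"] by auto
  then have "strong 0 (\<lambda>_. y)" by (auto simp: strong_def indmod_def)
  then show "\<exists>c Y. strong c Y" by blast
next
  fix c assume "\<exists>Y. strong c Y"
  then show "c \<le> CARD('n)" using strong_bound by (elim exE)
qed

lemma cm_max: "strong c Y \<Longrightarrow> c \<le> cm"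
  unfolding cm_def
proof (rule Greatest_le_nat[of "\<lambda>c. \<exists>Y. strong c Y" _ "CARD('n)"])
  assume "strong c Y" then show "\<exists>Y. strong c Y" by (rule exI[of _ Y])
next
  fix c assume "\<exists>Y. strong c Y"
  then show "c \<le> CARD('n)" using strong_bound by (elim exE)
qed

lemma strong_reindex:
  assumes s: "strong c Y" and \<pi>: "inj_on \<pi> {..c}" "\<pi> ` {..c} = {..c}" shows "strong c (Y \<circ> \<pi>)"
  unfolding strong_def
proof (intro conjI allI impI)
  fix i assume i: "i \<le> c"
  then have "\<pi> i \<le> c" using \<pi>(2) by auto
  then show "(Y \<circ> \<pi>) i \<in> P" using s by (simp add: strong_def)
  have "\<pi> ` ({..c} - {i}) = {..c} - {\<pi> i}" using \<pi> i by (auto simp: inj_on_def)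
  moreover have "indmod (T2 (Y (\<pi> i))) Y ({..c} - {\<pi> i})" using s \<open>\<pi> i \<le> c\<close> by (simp add: strong_def)
  ultimately show "indmod (T2 ((Y \<circ> \<pi>) i)) (Y \<circ> \<pi>) ({..c} - {i})"
    using indmod_reindex[of \<pi> "{..c} - {i}"] \<pi>(1) by (auto simp: inj_on_diff)
qed

text \<open>If for every \<open>i\<close> the sum of \<open>T1 (Y i)\<close> and the span of the
  later points missed part of \<open>S\<close>, a generic real point could be appended. So one such
  sum contains \<open>S\<close>. For \<open>i > 0\<close> it cannot contain \<open>Y 0\<close>, by
  strong independence at \<open>Y i\<close>.\<close>

lemma strong_max_spans_0:
  assumes s: "strong cm Y" shows "S \<subseteq> {t + w | t w. t \<in> T1 (Y 0) \<and> w \<in> span (Y ` ({..cm} - {0}))}"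
proof -
  define U where "U i = {t + w | t w. t \<in> T1 (Y i) \<and> w \<in> span (Y ` {i<..cm})}" for i
  have U: "subspace (U i)" for i unfolding U_def by (intro subspace_sums subspace_T1 subspace_span)
  have fl: "flagged cm Y" using strong_flagged[OF s] .
  have "\<exists>i\<le>cm. S \<subseteq> U i"
  proof (rule ccontr)
    assume "\<not> ?thesis"
    then obtain y where y: "y \<in> P" "\<forall>i\<in>{..cm}. y \<notin> U i" using generic_avoiding[of "{..cm}" U] U by auto
    define Y' where "Y' = Y(Suc cm := y)"
    have "flagged (Suc cm) Y'" unfolding flagged_def
    proof (intro conjI allI impI)
      fix i assume i: "i \<le> Suc cm"
      show "Y' i \<in> P" using y(1) fl i by (auto simp: Y'_def flagged_def)
      show "indmod (T1 (Y' i)) Y' {i<..Suc cm}"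
      proof (cases "i = Suc cm")
        case True then show ?thesis by (simp add: indmod_def)
      next
        case False
        then have i: "i \<le> cm" using i by simp
        have J: "{i<..Suc cm} = insert (Suc cm) {i<..cm}" using i by auto
        have "indmod (T1 (Y i)) Y {i<..cm}" using fl i by (simp add: flagged_def)
        then have "indmod (T1 (Y i)) Y' {i<..cm}" by (subst indmod_cong[of _ Y' Y]) (auto simp: Y'_def)
        moreover have "Y' (Suc cm) \<noteq> u + (\<Sum>j\<in>{i<..cm}. a j *\<^sub>R Y' j)" if u: "u \<in> T1 (Y i)" for a u
        proof
          assume eq: "Y' (Suc cm) = u + (\<Sum>j\<in>{i<..cm}. a j *\<^sub>R Y' j)"
          have "(\<Sum>j\<in>{i<..cm}. a j *\<^sub>R Y' j) = (\<Sum>j\<in>{i<..cm}. a j *\<^sub>R Y j)" by (rule sum.cong) (auto simp: Y'_def)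
          moreover have "(\<Sum>j\<in>{i<..cm}. a j *\<^sub>R Y j) \<in> span (Y ` {i<..cm})" by (intro span_sum span_scale span_base) auto
          ultimately have "y \<in> U i" using eq u unfolding U_def Y'_def by auto
          then show False using y(2) i by simp
        qed
        ultimately have "indmod (T1 (Y i)) Y' (insert (Suc cm) {i<..cm})"
          by (intro indmod_insert subspace_T1) auto
        then show ?thesis using i unfolding J by (simp add: Y'_def)
      qed
    qed
    then have "Suc cm \<le> cm" using flagged_strong cm_max by blast
    then show False by simp
  qed
  then obtain i where i: "i \<le> cm" "S \<subseteq> U i" by blast
  have "i = 0"
  proof (rule ccontr)
    assume i0: "i \<noteq> 0"
    have "Y 0 \<in> S" using s P_S by (auto simp: strong_def)
    then obtain t w where tw: "Y 0 = t + w" "t \<in> T1 (Y i)" "w \<in> span (Y ` {i<..cm})" using i(2) unfolding U_def by blast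
    obtain a where a: "w = (\<Sum>j\<in>{i<..cm}. a j *\<^sub>R Y j)" using span_image_sum[OF _ tw(3)] by auto
    have "indmod (T2 (Y i)) Y ({..cm} - {i})" using s i(1) by (simp add: strong_def)
    then have ind: "indmod (T2 (Y i)) Y (insert 0 {i<..cm})" by (rule indmod_mono) (use i0 i(1) in auto)
    have "(\<Sum>j\<in>insert 0 {i<..cm}. (if j = 0 then 1 else - a j) *\<^sub>R Y j) = Y 0 + (\<Sum>j\<in>{i<..cm}. - a j *\<^sub>R Y j)"
      using i0 by (subst sum.insert) (auto intro!: sum.cong)
    also have "\<dots> = t" unfolding tw(1) a by (simp add: sum_negf)
    finally have "(\<Sum>j\<in>insert 0 {i<..cm}. (if j = 0 then 1 else - a j) *\<^sub>R Y j) \<in> T2 (Y i)" using tw(2) T1_T2 by auto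
    from indmodD[OF ind this, of 0] show False by simp
  qed
  moreover have "{0<..cm} = {..cm} - {0}" by auto
  ultimately show ?thesis using i(2) unfolding U_def by simp
qed

lemma strong_max_spans:
  assumes s: "strong cm Y" and i: "i \<le> cm" and x: "x \<in> S"
  shows "\<exists>t\<in>T1 (Y i). \<exists>a. x = t + (\<Sum>j\<in>{..cm} - {i}. a j *\<^sub>R Y j)"
proof -
  define \<pi> where "\<pi> k = (if k = 0 then i else if k = i then 0 else k)" for k
  have pp: "\<pi> (\<pi> k) = k" for k by (simp add: \<pi>_def)
  have le: "\<pi> k \<le> cm" if "k \<le> cm" for k using that i by (simp add: \<pi>_def)
  have inj: "inj_on \<pi> {..cm}" by (rule inj_on_inverseI[of _ \<pi>]) (rule pp)
  have sur: "\<pi> ` {..cm} = {..cm}"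
  proof
    show "\<pi> ` {..cm} \<subseteq> {..cm}" using le by auto
    show "{..cm} \<subseteq> \<pi> ` {..cm}"
    proof
      fix k assume "k \<in> {..cm}"
      then show "k \<in> \<pi> ` {..cm}" using le[of k] by (intro image_eqI[of _ _ "\<pi> k"]) (simp_all add: pp)
    qed
  qed
  note \<pi> = inj sur
  have "\<pi> ` ({..cm} - {0}) = {..cm} - {i}"
  proof -
    have "\<pi> ` ({..cm} - {0}) = \<pi> ` {..cm} - \<pi> ` {0}" by (rule inj_on_image_set_diff[OF inj]) auto
    then show ?thesis unfolding sur by (simp add: \<pi>_def)
  qed
  then have im: "(Y \<circ> \<pi>) ` ({..cm} - {0}) = Y ` ({..cm} - {i})" unfolding image_comp[symmetric] by simp
  have "(Y \<circ> \<pi>) 0 = Y i" by (simp add: \<pi>_def)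
  then obtain t w where "x = t + w" "t \<in> T1 (Y i)" "w \<in> span (Y ` ({..cm} - {i}))"
    using strong_max_spans_0[OF strong_reindex[OF s \<pi>]] x unfolding im by auto
  moreover from span_image_sum[OF _ this(3)] obtain a where "w = (\<Sum>j\<in>{..cm} - {i}. a j *\<^sub>R Y j)" by auto
  ultimately show ?thesis by (intro bexI[of _ t] exI[of _ a]) simp_all
qed

definition cbf :: "real^'n^'n \<Rightarrow> complex^'n \<Rightarrow> real^'n \<Rightarrow> complex" where
  "cbf A z v = (\<Sum>i\<in>UNIV. \<Sum>j\<in>UNIV. of_real (A $ i $ j) * (z $ i * of_real (v $ j) + of_real (v $ i) * z $ j))"

lemma cbf_cvec: "cbf A (cvec y) v = of_real (rbf A y v)"
  by (simp add: cbf_def rbf_def cvec_simps)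

lemma hom_poly_cbf: "hom_poly 1 (\<lambda>z. cbf A z v)"
proof -
  have "hom_poly 1 (\<lambda>z. of_real (A $ i $ j) * (of_real (v $ j) * z $ i + of_real (v $ i) * z $ j))" for i j
    by (intro hom_poly_smult hom_poly_add hom_poly_nth)
  then show ?thesis unfolding cbf_def by (intro hom_poly_sum) (simp add: mult.commute)
qed

text \<open>Independence modulo the tangent space is a Zariski open condition: Gaussian elimination with
  polynomial coefficients produces functionals vanishing on the tangent space that are dual to the
  given vectors up to a common polynomial factor.\<close>

lemma indmod_T2_dual_forms:
  assumes "finite J" "indmod (T2 y0) w J"
  shows "\<exists>e G L. hom_poly e G \<and> G (cvec y0) \<noteq> 0 \<and> (\<forall>i\<in>J. \<forall>v. hom_poly e (\<lambda>z. L i z v)) \<and>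
     (\<forall>i\<in>J. \<forall>y. linear (L i (cvec y)) \<and> (\<forall>v\<in>T2 y. L i (cvec y) v = 0)) \<and>
     (\<forall>i\<in>J. \<forall>j\<in>J. \<forall>z. L i z (w j) = (if i = j then G z else 0))"
  using assms
proof (induction J rule: finite_induct)
  case empty
  show ?case by (rule exI[of _ 0], rule exI[of _ "\<lambda>z. 1"]) (auto intro: hom_poly_const)
next
  case (insert k J)
  have "indmod (T2 y0) w J" by (rule indmod_mono[OF insert(4)]) (use insert in auto)
  from insert(3)[OF this] obtain e G L where G: "hom_poly e G" "G (cvec y0) \<noteq> 0"
    and Lh: "\<forall>i\<in>J. \<forall>v. hom_poly e (\<lambda>z. L i z v)"
    and Ll: "\<forall>i\<in>J. \<forall>y. linear (L i (cvec y)) \<and> (\<forall>v\<in>T2 y. L i (cvec y) v = 0)"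
    and Ld: "\<forall>i\<in>J. \<forall>j\<in>J. \<forall>z. L i z (w j) = (if i = j then G z else 0)"
    by (elim exE conjE)
  define N where "N A z v = G z * cbf A z v - (\<Sum>i\<in>J. cbf A z (w i) * L i z v)" for A z v
  have "\<exists>A\<in>ideal2 X. N A (cvec y0) (w k) \<noteq> 0"
  proof (rule ccontr)
    assume no: "\<not> ?thesis"
    define \<gamma> where "\<gamma> i = Re (L i (cvec y0) (w k) / G (cvec y0))" for i
    have "rbf A y0 (w k - (\<Sum>i\<in>J. \<gamma> i *\<^sub>R w i)) = 0" if A: "A \<in> ideal2 X" for A
    proof -
      have "N A (cvec y0) (w k) = 0" using no A by blast
      then have "of_real (rbf A y0 (w k)) = (\<Sum>i\<in>J. of_real (rbf A y0 (w i)) * L i (cvec y0) (w k)) / G (cvec y0)"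
        using G(2) by (simp add: N_def cbf_cvec field_simps)
      also have "\<dots> = (\<Sum>i\<in>J. of_real (rbf A y0 (w i)) * (L i (cvec y0) (w k) / G (cvec y0)))"
        by (simp add: sum_divide_distrib)
      finally have "Re (of_real (rbf A y0 (w k))) = Re (\<Sum>i\<in>J. of_real (rbf A y0 (w i)) * (L i (cvec y0) (w k) / G (cvec y0)))" by (rule arg_cong)
      moreover have "Re (of_real r * u) = r * Re u" for r u by simp
      ultimately have "rbf A y0 (w k) = (\<Sum>i\<in>J. rbf A y0 (w i) * \<gamma> i)"
        unfolding Re_sum \<gamma>_def by (simp only: Re_complex_of_real)
      then show ?thesis
        by (simp add: linear_diff[OF linear_rbf] linear_sum[OF linear_rbf] linear_scale[OF linear_rbf] mult.commute)
    qed
    then have in2: "w k - (\<Sum>i\<in>J. \<gamma> i *\<^sub>R w i) \<in> T2 y0" by (simp add: T2_def)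
    have "(\<Sum>j\<in>insert k J. (if j = k then 1 else - \<gamma> j) *\<^sub>R w j) = w k + (\<Sum>j\<in>J. - \<gamma> j *\<^sub>R w j)"
      using insert(1,2) by (subst sum.insert) (auto intro!: sum.cong)
    also have "\<dots> = w k - (\<Sum>i\<in>J. \<gamma> i *\<^sub>R w i)" by (simp add: sum_negf)
    finally have "(\<Sum>j\<in>insert k J. (if j = k then 1 else - \<gamma> j) *\<^sub>R w j) \<in> T2 y0" using in2 by simp
    from indmodD[OF insert(4) this, of k] show False by simp
  qed
  then obtain A where A: "A \<in> ideal2 X" "N A (cvec y0) (w k) \<noteq> 0" by blast
  have Nh: "hom_poly (e + 1) (\<lambda>z. N A z v)" for v
  proof -
    have "hom_poly (e + 1) (\<lambda>z. cbf A z (w i) * L i z v)" if "i \<in> J" for i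
      using hom_poly_mult[OF hom_poly_cbf[of A "w i"], of e "\<lambda>z. L i z v"] Lh that by (simp add: add.commute)
    then show ?thesis unfolding N_def by (intro hom_poly_diff hom_poly_mult[OF G(1) hom_poly_cbf] hom_poly_sum)
  qed
  have cb: "linear (cbf A (cvec y))" for y unfolding cbf_cvec
    by (rule linearI) (simp_all add: linear_add[OF linear_rbf] linear_scale[OF linear_rbf] scaleR_complex)
  have Nl: "linear (N A (cvec y))" for y
  proof (rule linearI)
    fix u v
    have "L i (cvec y) (u + v) = L i (cvec y) u + L i (cvec y) v" if "i \<in> J" for i
      using Ll that linear_add[of "L i (cvec y)" u v] by simp
    then have "(\<Sum>i\<in>J. cbf A (cvec y) (w i) * L i (cvec y) (u + v)) = (\<Sum>i\<in>J. cbf A (cvec y) (w i) * L i (cvec y) u) + (\<Sum>i\<in>J. cbf A (cvec y) (w i) * L i (cvec y) v)"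
      by (simp add: distrib_left sum.distrib)
    then show "N A (cvec y) (u + v) = N A (cvec y) u + N A (cvec y) v"
      by (simp add: N_def linear_add[OF cb] distrib_left)
  next
    fix r v
    have "L i (cvec y) (r *\<^sub>R v) = of_real r * L i (cvec y) v" if "i \<in> J" for i
      using Ll that linear_scale[of "L i (cvec y)" r v] by (simp add: scaleR_complex)
    then have "(\<Sum>i\<in>J. cbf A (cvec y) (w i) * L i (cvec y) (r *\<^sub>R v)) = of_real r * (\<Sum>i\<in>J. cbf A (cvec y) (w i) * L i (cvec y) v)"
      by (simp add: sum_distrib_left mult_ac)
    then show "N A (cvec y) (r *\<^sub>R v) = r *\<^sub>R N A (cvec y) v"
      by (simp add: N_def linear_scale[OF cb] scaleR_complex right_diff_distrib)
  qed
  have N0: "N A (cvec y) v = 0" if "v \<in> T2 y" for y v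
    using Ll that A(1) by (simp add: N_def cbf_cvec T2_def)
  have Nw: "N A z (w j) = 0" if "j \<in> J" for z j
  proof -
    have "(\<Sum>i\<in>J. cbf A z (w i) * L i z (w j)) = (\<Sum>i\<in>J. if i = j then cbf A z (w j) * G z else 0)"
      using Ld that by (intro sum.cong) auto
    then show ?thesis using that insert(1) by (simp add: N_def mult.commute)
  qed
  \<comment> \<open>One elimination step without division: \<open>N A\<close> kills the old vectors
    and its value at \<open>w k\<close> is the pivot, which multiplies the old functionals before
    their value at \<open>w k\<close> is removed.\<close>
  define L' where "L' i z v = (if i = k then G z * N A z v else N A z (w k) * L i z v - L i z (w k) * N A z v)" for i z v
  have nk: "i \<noteq> k" if "i \<in> J" for i using that insert(2) by blast
  show ?case
  proof (rule exI[of _ "e + (e + 1)"], rule exI[of _ "\<lambda>z. G z * N A z (w k)"], rule exI[of _ L'], intro conjI ballI allI)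
    show "hom_poly (e + (e + 1)) (\<lambda>z. G z * N A z (w k))" by (rule hom_poly_mult[OF G(1) Nh])
    show "G (cvec y0) * N A (cvec y0) (w k) \<noteq> 0" using G(2) A(2) by simp
    fix i assume i: "i \<in> insert k J"
    show "hom_poly (e + (e + 1)) (\<lambda>z. L' i z v)" for v
    proof (cases "i = k")
      case True then show ?thesis unfolding L'_def using hom_poly_mult[OF G(1) Nh] by simp
    next
      case False
      then have iJ: "i \<in> J" using i by simp
      have "hom_poly ((e + 1) + e) (\<lambda>z. N A z (w k) * L i z v)" by (rule hom_poly_mult[OF Nh]) (use Lh iJ in simp)
      moreover have "hom_poly (e + (e + 1)) (\<lambda>z. L i z (w k) * N A z v)" by (rule hom_poly_mult[OF _ Nh]) (use Lh iJ in simp)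
      ultimately show ?thesis unfolding L'_def using False hom_poly_diff by (simp add: add.commute add.left_commute)
    qed
    show "linear (L' i (cvec y))" for y
    proof (cases "i = k")
      case True
      have "linear (\<lambda>v. G (cvec y) * N A (cvec y) v)"
        by (rule linearI) (simp_all add: linear_add[OF Nl] linear_scale[OF Nl] distrib_left scaleR_complex)
      then show ?thesis using True by (simp add: L'_def[abs_def])
    next
      case False
      then have li: "linear (L i (cvec y))" using i Ll by simp
      have "linear (\<lambda>v. N A (cvec y) (w k) * L i (cvec y) v - L i (cvec y) (w k) * N A (cvec y) v)"
        by (rule linearI) (simp_all add: linear_add[OF Nl] linear_scale[OF Nl] linear_add[OF li] linear_scale[OF li]
            distrib_left scaleR_complex right_diff_distrib)
      then show ?thesis using False by (simp add: L'_def[abs_def])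
    qed
    show "L' i (cvec y) v = 0" if "v \<in> T2 y" for y v
      using Ll N0[OF that] that i by (auto simp: L'_def)
    fix j z assume j: "j \<in> insert k J"
    show "L' i z (w j) = (if i = j then G z * N A z (w k) else 0)"
      using i j nk Nw Ld by (auto simp: L'_def)
  qed
qed

lemma indmod_T2_open:
  assumes "finite J" "indmod (T2 y0) w J"
  shows "\<exists>e G. hom_poly e G \<and> G (cvec y0) \<noteq> 0 \<and> (\<forall>y. G (cvec y) \<noteq> 0 \<longrightarrow> indmod (T2 y) w J)"
proof -
  from indmod_T2_dual_forms[OF assms] obtain e G L where G: "hom_poly e G" "G (cvec y0) \<noteq> 0"
    and Ll: "\<forall>i\<in>J. \<forall>y. linear (L i (cvec y)) \<and> (\<forall>v\<in>T2 y. L i (cvec y) v = 0)"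
    and Ld: "\<forall>i\<in>J. \<forall>j\<in>J. \<forall>z. L i z (w j) = (if i = j then G z else 0)"
    by (elim exE conjE)
  have "indmod (T2 y) w J" if "G (cvec y) \<noteq> 0" for y
    unfolding indmod_def
  proof (intro allI impI ballI)
    fix a j assume a: "(\<Sum>j\<in>J. a j *\<^sub>R w j) \<in> T2 y" and j: "j \<in> J"
    have li: "linear (L j (cvec y))" using Ll j by blast
    have "0 = L j (cvec y) (\<Sum>j\<in>J. a j *\<^sub>R w j)" using Ll j a by simp
    also have "\<dots> = (\<Sum>k\<in>J. a k *\<^sub>R L j (cvec y) (w k))" by (simp add: linear_sum[OF li] linear_scale[OF li])
    also have "\<dots> = (\<Sum>k\<in>J. if k = j then a j *\<^sub>R G (cvec y) else 0)" using Ld j by (intro sum.cong) auto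
    also have "\<dots> = a j *\<^sub>R G (cvec y)" using assms(1) j by simp
    finally show "a j = 0" using that by simp
  qed
  then show ?thesis using G by (intro exI[of _ e] exI[of _ G]) simp
qed

end

lemma forms_cut_closed:
  assumes "proj_closed V" "z \<noteq> 0" "\<And>d f. hom_poly d f \<Longrightarrow> (\<And>x. x \<in> V \<Longrightarrow> f x = 0) \<Longrightarrow> f z = 0"
  shows "z \<in> V"
proof (rule ccontr)
  assume "z \<notin> V"
  from proj_closed_form_separates[OF assms(1) this assms(2)] obtain d f where "hom_poly d f" "\<forall>x\<in>V. f x = 0" "f z \<noteq> 0"
    by (elim exE conjE)
  then show False using assms(3)[of d f] by simp
qed

section \<open>The birational chart given by a maximal tuple\<close>

locale chart = component X V for X V :: "(complex^'n::finite) set" +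
  fixes Y :: "nat \<Rightarrow> real^'n"
  assumes strong: "strong cm Y"
begin

abbreviation "J \<equiv> {Suc 0..cm}"

lemma J_eq: "{..cm} - {0} = J" by auto

lemma fl: "flagged cm Y" using strong_flagged[OF strong] .

lemma Y_P: "i \<le> cm \<Longrightarrow> Y i \<in> P" using strong by (simp add: strong_def)

lemma Y_S: "i \<le> cm \<Longrightarrow> Y i \<in> S" using Y_P P_S by blast

lemma Y_RV: "i \<le> cm \<Longrightarrow> Y i \<in> RV" using Y_P P_subset by blast

definition Fq :: "nat \<Rightarrow> nat \<Rightarrow> real^'n^'n" where
  "Fq i j = (SOME F. F \<in> ideal2 X \<and> rbf F (Y i) (Y j) = 1 \<and> (\<forall>k\<le>cm. \<forall>l\<le>cm. {k, l} \<noteq> {i, j} \<longrightarrow> rbf F (Y k) (Y l) = 0))"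

lemma Fq:
  assumes "i \<le> cm" "j \<le> cm" "i \<noteq> j"
  shows "Fq i j \<in> ideal2 X" "rbf (Fq i j) (Y i) (Y j) = 1"
    "\<And>k l. k \<le> cm \<Longrightarrow> l \<le> cm \<Longrightarrow> {k, l} \<noteq> {i, j} \<Longrightarrow> rbf (Fq i j) (Y k) (Y l) = 0"
proof -
  have "\<exists>F. F \<in> ideal2 X \<and> rbf F (Y i) (Y j) = 1 \<and> (\<forall>k\<le>cm. \<forall>l\<le>cm. {k, l} \<noteq> {i, j} \<longrightarrow> rbf F (Y k) (Y l) = 0)"
    using flagged_quadric[OF fl assms] by (simp add: Bex_def)
  from someI_ex[OF this, folded Fq_def]
  show "Fq i j \<in> ideal2 X" "rbf (Fq i j) (Y i) (Y j) = 1"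
    "\<And>k l. k \<le> cm \<Longrightarrow> l \<le> cm \<Longrightarrow> {k, l} \<noteq> {i, j} \<Longrightarrow> rbf (Fq i j) (Y k) (Y l) = 0"
    by simp_all
qed

abbreviation "F \<equiv> Fq 0"

lemma F: "i \<in> J \<Longrightarrow> F i \<in> ideal2 X" using Fq(1)[of 0 i] by auto

text \<open>The slope of the quadric \<open>F i\<close> in the direction of \<open>Y i\<close>. It
  is 1 at \<open>Y 0\<close>, 0 at the other \<open>Y k\<close> and 0 on the tangent space at
  \<open>Y i\<close>.\<close>

definition h :: "nat \<Rightarrow> real^'n \<Rightarrow> real" where "h i v = rbf (F i) v (Y i)"

lemma linear_h: "linear (h i)" unfolding h_def by (rule linear_rbf_left)

text \<open>Decompose \<open>v\<close> into a tangent vector at \<open>Y j\<close> and the points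
  other than \<open>Y j\<close>: the first is polar to \<open>Y j\<close> for every quadric through
  \<open>X\<close>, the others by duality, as \<open>{j, k}\<close> is never
  \<open>{0, i}\<close>.\<close>

lemma rbf_F_Y:
  assumes "i \<in> J" "j \<in> J" "j \<noteq> i" "v \<in> S" shows "rbf (F i) v (Y j) = 0"
proof -
  obtain t a where ta: "t \<in> T1 (Y j)" "v = t + (\<Sum>k\<in>{..cm} - {j}. a k *\<^sub>R Y k)"
    using strong_max_spans[OF strong _ assms(4), of j] assms(2) by auto
  have "rbf (F i) (Y j) t = 0" using ta(1) T1_T2 F[OF assms(1)] by (auto simp: T2_def)
  moreover have "rbf (F i) (Y j) (Y k) = 0" if "k \<in> {..cm} - {j}" for k
    by (rule Fq(3)) (use assms that in \<open>auto simp: doubleton_eq_iff\<close>)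
  ultimately have "rbf (F i) (Y j) v = 0" unfolding ta(2)
    by (simp add: linear_add[OF linear_rbf] linear_sum[OF linear_rbf] linear_scale[OF linear_rbf])
  then show ?thesis by (simp add: rbf_commute)
qed

lemma h_Y: "i \<in> J \<Longrightarrow> k \<in> J \<Longrightarrow> h i (Y k) = 0" "i \<in> J \<Longrightarrow> h i (Y 0) = 1"
  using Fq(2)[of 0 i] Fq(3)[of 0 i k i] by (auto simp: h_def doubleton_eq_iff)

lemma h_T2: "i \<in> J \<Longrightarrow> v \<in> T2 (Y i) \<Longrightarrow> h i v = 0"
  using F by (simp add: h_def T2_def rbf_commute)

lemma h_shift: "i \<in> J \<Longrightarrow> h i (v + (\<Sum>j\<in>J. s j *\<^sub>R Y j)) = h i v"
  by (simp add: linear_add[OF linear_h] linear_sum[OF linear_h] linear_scale[OF linear_h] h_Y)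

text \<open>Along a fibre of the projection from the \<open>Y j\<close> each quadric
  \<open>F i\<close> depends on its own parameter only, and affinely. The equations of the fibre can
  thus be solved one by one.\<close>

lemma rqform_shift:
  assumes i: "i \<in> J" and v: "v \<in> S"
  shows "rqform (F i) (v + (\<Sum>j\<in>J. s j *\<^sub>R Y j)) = rqform (F i) v + s i * h i v"
proof -
  let ?w = "\<Sum>j\<in>J. s j *\<^sub>R Y j"
  have "rbf (F i) u ?w = s i * h i u" if "u \<in> S" for u
  proof -
    have "rbf (F i) u ?w = (\<Sum>j\<in>J. s j * rbf (F i) u (Y j))"
      by (simp add: linear_sum[OF linear_rbf] linear_scale[OF linear_rbf])
    also have "\<dots> = (\<Sum>j\<in>J. if j = i then s i * h i u else 0)"
      using rbf_F_Y[OF i _ _ that] by (intro sum.cong) (auto simp: h_def)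
    finally show ?thesis using i by simp
  qed
  moreover have "?w \<in> S" using Y_S by (intro subspace_sum[OF subspace_S] subspace_scale[OF subspace_S]) auto
  moreover have "h i ?w = 0" using h_shift[OF i, of 0 s] linear_0[OF linear_h] by simp
  ultimately have "rbf (F i) v ?w = s i * h i v" "rbf (F i) ?w ?w = 0" using v by auto
  then show ?thesis by (simp add: rqform_add rbf_diag)
qed

lemma indmod_T1_J: "indmod (T1 (Y 0)) Y J"
proof -
  have "indmod (T2 (Y 0)) Y ({..cm} - {0})" using strong by (simp add: strong_def)
  then show ?thesis unfolding J_eq by (rule indmod_mono) (use T1_T2 in auto)
qed

definition "pd = (SOME p. \<forall>i\<in>J. (\<forall>u\<in>T1 (Y 0). p i \<bullet> u = 0) \<and> (\<forall>k\<in>J. p i \<bullet> Y k = (if k = i then 1 else 0)))"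

lemma pd: "i \<in> J \<Longrightarrow> u \<in> T1 (Y 0) \<Longrightarrow> pd i \<bullet> u = 0" "i \<in> J \<Longrightarrow> k \<in> J \<Longrightarrow> pd i \<bullet> Y k = (if k = i then 1 else 0)"
  using someI_ex[OF indmod_dual[OF subspace_T1 _ indmod_T1_J]] unfolding pd_def[symmetric] by auto

definition Xi :: "real^'n \<Rightarrow> real^'n" where "Xi x = x - (\<Sum>j\<in>J. (pd j \<bullet> x) *\<^sub>R Y j)"

lemma Xi_id: "u \<in> T1 (Y 0) \<Longrightarrow> Xi u = u" by (simp add: Xi_def pd)

lemma linear_Xi: "linear Xi"
  unfolding Xi_def by (rule linearI) (simp_all add: inner_add_right algebra_simps sum.distrib scaleR_sum_right)

lemma Xi_Y: "k \<in> J \<Longrightarrow> Xi (Y k) = 0"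
  by (simp add: Xi_def pd if_distrib if_distribR cong: if_cong)

lemma Xi_S: "x \<in> S \<Longrightarrow> Xi x \<in> T1 (Y 0)"
proof -
  assume "x \<in> S"
  then obtain t a where ta: "t \<in> T1 (Y 0)" "x = t + (\<Sum>j\<in>J. a j *\<^sub>R Y j)"
    using strong_max_spans[OF strong, of 0] unfolding J_eq by blast
  then have "Xi x = t"
    by (simp add: linear_add[OF linear_Xi] linear_sum[OF linear_Xi] linear_scale[OF linear_Xi] Xi_id Xi_Y)
  then show ?thesis using ta by simp
qed

lemma Xi_decomp: "x = Xi x + (\<Sum>j\<in>J. (pd j \<bullet> x) *\<^sub>R Y j)" by (simp add: Xi_def)

definition XiC :: "complex^'n \<Rightarrow> complex^'n" where
  "XiC z = z - (\<Sum>j\<in>J. lf (cvec (pd j)) z *s cvec (Y j))"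

lemma XiC_cvec: "XiC (cvec x) = cvec (Xi x)"
  by (simp add: XiC_def Xi_def cvec_simps cvec_sum lf_cvec)

lemma hom_poly_XiC: "hom_poly 1 (\<lambda>z. XiC z $ k)"
proof -
  have "hom_poly 1 (\<lambda>z. z $ k - (\<Sum>j\<in>J. cvec (Y j) $ k * lf (cvec (pd j)) z))"
    by (intro hom_poly_diff hom_poly_nth hom_poly_sum hom_poly_smult hom_poly_lf)
  then show ?thesis by (simp add: XiC_def sum_component mult.commute)
qed

lemma hom_poly_comp_XiC: "hom_poly d g \<Longrightarrow> hom_poly d (\<lambda>z. g (XiC z))"
  using hom_poly_comp[of d g 1 XiC] hom_poly_XiC by simp

text \<open>The tangent spaces at generic points project isomorphically onto the one at the base point,
  so a polynomial relation between the projected coordinates can be differentiated in all directions.\<close>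

lemma dominant:
  assumes "hom_poly d g" "\<And>y. y \<in> P \<Longrightarrow> g (cvec (Xi y)) = 0" "u \<in> T1 (Y 0)"
  shows "g (cvec u) = 0"
  using assms
proof (induction d arbitrary: g u)
  case 0
  have "g z = g 0" for z using hom_poly_scale[OF 0(1), of 0 z] by simp
  moreover obtain y where "y \<in> P" using Y_P[of 0] by auto
  ultimately show ?case using 0(2)[of y] by metis
next
  case (Suc d)
  \<comment> \<open>The derivative of \<open>g\<close> in the direction \<open>w\<close> has degree
    one less, so the induction hypothesis applies once it vanishes at the projected points.\<close>
  define gw where "gw w z = lf (grad g z) (cvec w)" for w z
  have gw: "hom_poly d (gw w)" for w
    unfolding gw_def[abs_def] lf_def
    using hom_poly_sum[of UNIV d "\<lambda>i z. cvec w $ i * grad g z $ i"] hom_poly_smult[OF hom_poly_grad[OF Suc(2)]]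
    by (simp add: mult.commute)
  have gw0: "gw w (cvec v) = 0" if w: "w \<in> T1 (Y 0)" and v: "v \<in> T1 (Y 0)" for w v
  proof (rule Suc(1)[OF gw _ v])
    fix y0 assume y0: "y0 \<in> P"
    have indJ: "indmod (T2 (Y 0)) Y J" using strong J_eq by (auto simp: strong_def)
    from indmod_T2_open[OF _ indJ] obtain e G where G: "hom_poly e G" "G (cvec (Y 0)) \<noteq> 0"
        "\<forall>y. G (cvec y) \<noteq> 0 \<longrightarrow> indmod (T2 y) Y J" by (auto elim!: exE)
    have van: "gw w (cvec (Xi y)) = 0" if y: "y \<in> P" "G (cvec y) \<noteq> 0" for y
    proof -
      define Y' where "Y' = Y(0 := y)"
      \<comment> \<open>With \<open>y\<close> as new base point the tuple stays flagged, so the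
        tangent space at \<open>y\<close> together with the same \<open>Y j\<close> still spans
        \<open>S\<close> and projects onto the one at \<open>Y 0\<close>.\<close>
      have "flagged cm Y'"
        unfolding flagged_def
      proof (intro conjI allI impI)
        fix i assume i: "i \<le> cm"
        show "Y' i \<in> P" using y Y_P i by (simp add: Y'_def)
        have "indmod (T1 (Y' i)) Y {i<..cm}"
        proof (cases "i = 0")
          case True
          have "indmod (T2 y) Y J" using G(3) y(2) by simp
          then have "indmod (T1 y) Y {0<..cm}" by (rule indmod_mono) (use T1_T2 in auto)
          then show ?thesis using True by (simp add: Y'_def)
        next
          case False
          then show ?thesis using fl i by (simp add: flagged_def Y'_def)
        qed
        then show "indmod (T1 (Y' i)) Y' {i<..cm}" by (subst indmod_cong[of _ Y' Y]) (auto simp: Y'_def)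
      qed
      from strong_max_spans[OF flagged_strong[OF this], of 0 w]
      obtain t a where ta: "t \<in> T1 y" "w = t + (\<Sum>j\<in>J. a j *\<^sub>R Y' j)"
        using w T1_S unfolding J_eq by (auto simp: Y'_def)
      have "(\<Sum>j\<in>J. a j *\<^sub>R Y' j) = (\<Sum>j\<in>J. a j *\<^sub>R Y j)" by (rule sum.cong) (auto simp: Y'_def)
      then have "Xi w = Xi t" unfolding ta(2)
        by (simp add: linear_add[OF linear_Xi] linear_sum[OF linear_Xi] linear_scale[OF linear_Xi] Xi_Y)
      then have wt: "Xi t = w" using Xi_id[OF w] by simp
      have hc: "hom_poly (Suc d) (\<lambda>z. g (XiC z))" by (rule hom_poly_comp_XiC[OF Suc(2)])
      have "lf (grad (\<lambda>z. g (XiC z)) (cvec y)) (cvec t) = 0"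
      proof (rule T1D[OF ta(1) hc])
        fix z assume "z \<in> V"
        then show "g (XiC z) = 0" using P_dense[OF hc _ \<open>z \<in> V\<close>] Suc(3) by (simp add: XiC_cvec)
      qed
      moreover have "((\<lambda>s. g (cvec (Xi y + s *\<^sub>R Xi t))) has_vector_derivative lf (grad (\<lambda>z. g (XiC z)) (cvec y)) (cvec t)) (at 0)"
        using real_line_vector_derivative[OF hc, of y t]
        by (simp add: XiC_cvec linear_add[OF linear_Xi] linear_scale[OF linear_Xi])
      ultimately show ?thesis
        using vector_derivative_unique_at[OF real_line_vector_derivative[OF Suc(2), of "Xi y" "Xi t"]] wt by (simp add: gw_def)
    qed
    have "gw w (XiC z) * G z = 0" if "z \<in> V" for z
    proof (rule P_dense[OF hom_poly_mult[OF hom_poly_comp_XiC[OF gw] G(1)] _ that])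
      fix y assume "y \<in> P"
      then show "gw w (XiC (cvec y)) * G (cvec y) = 0" using van[of y] by (cases "G (cvec y) = 0") (simp_all add: XiC_cvec)
    qed
    from proj_irreducible_forms[OF V_irr hom_poly_comp_XiC[OF gw] G(1) this]
    have "\<forall>z\<in>V. gw w (XiC z) = 0" using G(2) Y_RV[of 0] by (auto simp: real_points_def)
    then show "gw w (cvec (Xi y0)) = 0" using y0 P_subset(1) XiC_cvec by (force simp: real_points_def)
  qed
  \<comment> \<open>Euler's identity in positive degree recovers \<open>g\<close> from its
    directional derivatives.\<close>
  have "of_nat (Suc d) * g (cvec u) = 0"
    using euler_grad[OF Suc(2), of "cvec u"] gw0[OF Suc(4) Suc(4)] by (simp add: gw_def)
  then show ?case by (simp del: of_nat_Suc)
qed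

text \<open>The inverse of the projection \<open>Xi\<close>. Solving the quadrics \<open>F i\<close>
  on the fibre over \<open>x\<close> gives the shifts \<open>- rqform (F i) x / h i x\<close>; the
  result is multiplied by the product of all \<open>h j\<close> to make it polynomial.\<close>

definition psi :: "real^'n \<Rightarrow> real^'n" where
  "psi x = (\<Prod>j\<in>J. h j x) *\<^sub>R x - (\<Sum>i\<in>J. (rqform (F i) x * (\<Prod>j\<in>J - {i}. h j x)) *\<^sub>R Y i)"

definition psiC :: "complex^'n \<Rightarrow> complex^'n" where
  "psiC z = (\<Prod>j\<in>J. cbf (F j) z (Y j)) *s z - (\<Sum>i\<in>J. (cqform (F i) z * (\<Prod>j\<in>J - {i}. cbf (F j) z (Y j))) *s cvec (Y i))"

lemma psiC_cvec: "psiC (cvec x) = cvec (psi x)"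
  by (simp add: psiC_def psi_def cvec_simps cvec_sum cbf_cvec cqform_cvec h_def)

lemma hom_poly_psiC: "hom_poly (Suc cm) (\<lambda>z. psiC z $ k)"
proof -
  have 1: "hom_poly (Suc cm) (\<lambda>z. (\<Prod>j\<in>J. cbf (F j) z (Y j)) * z $ k)"
    using hom_poly_mult[OF hom_poly_prod[of J "\<lambda>_. 1"] hom_poly_nth] hom_poly_cbf by fastforce
  have "hom_poly (Suc cm) (\<lambda>z. cqform (F i) z * (\<Prod>j\<in>J - {i}. cbf (F j) z (Y j)))" if i: "i \<in> J" for i
  proof -
    have "hom_poly (2 + (\<Sum>j\<in>J - {i}. 1)) (\<lambda>z. cqform (F i) z * (\<Prod>j\<in>J - {i}. cbf (F j) z (Y j)))"
      by (intro hom_poly_mult hom_poly_cqform hom_poly_prod hom_poly_cbf)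
    moreover have "2 + (\<Sum>j\<in>J - {i}. 1) = Suc cm" using i by simp
    ultimately show ?thesis by simp
  qed
  from hom_poly_smult[OF this] have 2: "hom_poly (Suc cm) (\<lambda>z. \<Sum>i\<in>J. cvec (Y i) $ k * (cqform (F i) z * (\<Prod>j\<in>J - {i}. cbf (F j) z (Y j))))"
    by (intro hom_poly_sum)
  have "(\<lambda>z. psiC z $ k) = (\<lambda>z. (\<Prod>j\<in>J. cbf (F j) z (Y j)) * z $ k - (\<Sum>i\<in>J. cvec (Y i) $ k * (cqform (F i) z * (\<Prod>j\<in>J - {i}. cbf (F j) z (Y j)))))"
    by (rule ext) (simp add: psiC_def sum_component mult.commute)
  then show ?thesis using hom_poly_diff[OF 1 2] by simp
qed

lemma psi_Xi:
  assumes x: "x \<in> S" "\<And>i. i \<in> J \<Longrightarrow> rqform (F i) x = 0"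
  shows "psi (Xi x) = (\<Prod>j\<in>J. h j x) *\<^sub>R x"
proof -
  have XS: "Xi x \<in> S" using Xi_S[OF x(1)] T1_S by blast
  have hX: "h i (Xi x) = h i x" if "i \<in> J" for i using h_shift[OF that, of "Xi x" "\<lambda>j. pd j \<bullet> x"] by (simp flip: Xi_decomp)
  have FX: "rqform (F i) (Xi x) = - (pd i \<bullet> x) * h i x" if "i \<in> J" for i
    using rqform_shift[OF that XS, of "\<lambda>j. pd j \<bullet> x"] x(2)[OF that] hX[OF that] by (simp flip: Xi_decomp)
  have prod: "(\<Prod>j\<in>J. h j (Xi x)) = (\<Prod>j\<in>J. h j x)" by (rule prod.cong) (auto simp: hX)
  have "(\<Sum>i\<in>J. (rqform (F i) (Xi x) * (\<Prod>j\<in>J - {i}. h j (Xi x))) *\<^sub>R Y i) = (\<Sum>i\<in>J. (- ((pd i \<bullet> x) * (\<Prod>j\<in>J. h j x))) *\<^sub>R Y i)"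
  proof (rule sum.cong[OF refl])
    fix i assume i: "i \<in> J"
    have "(\<Prod>j\<in>J - {i}. h j (Xi x)) = (\<Prod>j\<in>J - {i}. h j x)" by (rule prod.cong) (auto simp: hX)
    moreover have "(\<Prod>j\<in>J. h j x) = h i x * (\<Prod>j\<in>J - {i}. h j x)" by (rule prod.remove) (use i in auto)
    ultimately show "(rqform (F i) (Xi x) * (\<Prod>j\<in>J - {i}. h j (Xi x))) *\<^sub>R Y i = (- ((pd i \<bullet> x) * (\<Prod>j\<in>J. h j x))) *\<^sub>R Y i"
      using FX[OF i] by simp
  qed
  also have "\<dots> = - ((\<Prod>j\<in>J. h j x) *\<^sub>R (\<Sum>i\<in>J. (pd i \<bullet> x) *\<^sub>R Y i))"
    by (simp add: scaleR_sum_right sum_negf mult.commute)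
  finally have "psi (Xi x) = (\<Prod>j\<in>J. h j x) *\<^sub>R (Xi x + (\<Sum>i\<in>J. (pd i \<bullet> x) *\<^sub>R Y i))"
    unfolding psi_def prod by (simp add: scaleR_add_right)
  then show ?thesis by (simp flip: Xi_decomp)
qed

text \<open>At the projection of a point of \<open>P\<close> the map \<open>psi\<close> returns a
  multiple of that point, so the pulled back form vanishes there; \<open>dominant\<close> extends
  this to the whole tangent space.\<close>

lemma psi_forms:
  assumes f: "hom_poly d f" "\<And>z. z \<in> V \<Longrightarrow> f z = 0" and u: "u \<in> T1 (Y 0)"
  shows "f (cvec (psi u)) = 0"
proof -
  have "hom_poly (d * Suc cm) (\<lambda>z. f (psiC z))" by (rule hom_poly_comp[OF f(1) hom_poly_psiC])
  then have "f (psiC (cvec u)) = 0"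
  proof (rule dominant[OF _ _ u])
    fix y assume y: "y \<in> P"
    have "psi (Xi y) = (\<Prod>j\<in>J. h j y) *\<^sub>R y"
    proof (rule psi_Xi)
      show "y \<in> S" using y P_S by blast
      fix i assume "i \<in> J"
      then show "rqform (F i) y = 0" using ideal2_real_points[OF F, of i y] y P_subset(2) by blast
    qed
    then have "f (psiC (cvec (Xi y))) = of_real (\<Prod>j\<in>J. h j y) ^ d * f (cvec y)"
      unfolding psiC_cvec by (simp only: cvec_simps hom_poly_scale[OF f(1)])
    moreover have "f (cvec y) = 0" using f(2) y P_subset by (auto simp: real_points_def)
    ultimately show "f (psiC (cvec (Xi y))) = 0" by simp
  qed
  then show ?thesis by (simp add: psiC_cvec)
qed

text \<open>Such a point is a nonzero multiple of \<open>psi\<close> of its projection, where all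
  forms of \<open>V\<close> vanish. Off the zeros of the \<open>h i\<close>, the component is
  therefore defined inside \<open>S\<close> by \<open>cm\<close> quadrics.\<close>

lemma graph:
  assumes z: "z \<in> S" "z \<noteq> 0" "\<And>i. i \<in> J \<Longrightarrow> rqform (F i) z = 0" "\<And>i. i \<in> J \<Longrightarrow> h i z \<noteq> 0"
  shows "z \<in> RV"
proof -
  have "cvec z \<in> V"
  proof (rule forms_cut_closed[OF V_closed])
    show "cvec z \<noteq> 0" using z(2) by (metis cvec_inj cvec_simps(4))
    fix d f assume f: "hom_poly d f" "\<And>x. x \<in> V \<Longrightarrow> f x = 0"
    have eq: "psi (Xi z) = (\<Prod>j\<in>J. h j z) *\<^sub>R z" by (rule psi_Xi) (use z in simp_all)
    have "f (cvec (psi (Xi z))) = 0" by (rule psi_forms[OF f Xi_S[OF z(1)]])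
    then have "of_real (\<Prod>j\<in>J. h j z) ^ d * f (cvec z) = 0"
      unfolding eq cvec_simps hom_poly_scale[OF f(1)] .
    moreover have "(\<Prod>j\<in>J. h j z) \<noteq> 0" using z(4) by simp
    ultimately show "f (cvec z) = 0" by simp
  qed
  then show ?thesis using z(2) by (simp add: real_points_def)
qed

end

section \<open>Which real points of the span of a component lie on it\<close>

context component
begin

definition "Ys = (SOME Y. strong cm Y)"

lemma strong_Ys: "strong cm Ys" unfolding Ys_def by (rule someI_ex[OF ex_strong])

text \<open>Compared with a fixed maximal tuple, the condition says that \<open>T2 y\<close> leaves
  room for \<open>cm\<close> independent directions of \<open>S\<close>. It holds on a nonempty open
  part of the component.\<close>

definition "regular y \<longleftrightarrow> indmod (T2 y) Ys {Suc 0..cm}"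

lemma regular_open: "\<exists>e G. hom_poly e G \<and> (\<exists>z\<in>V. G z \<noteq> 0) \<and> (\<forall>y. G (cvec y) \<noteq> 0 \<longrightarrow> regular y)"
proof -
  have "{..cm} - {0} = {Suc 0..cm}" by auto
  then have ind: "indmod (T2 (Ys 0)) Ys {Suc 0..cm}" and Y0: "Ys 0 \<in> P" using strong_Ys by (auto simp: strong_def)
  from indmod_T2_open[OF _ ind] obtain e G where G: "hom_poly e G" "G (cvec (Ys 0)) \<noteq> 0"
    "\<forall>y. G (cvec y) \<noteq> 0 \<longrightarrow> indmod (T2 y) Ys {Suc 0..cm}" by (auto elim!: exE)
  moreover have "cvec (Ys 0) \<in> V" using Y0 P_subset by (auto simp: real_points_def)
  ultimately show ?thesis unfolding regular_def by (intro exI[of _ e] exI[of _ G]) auto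
qed

text \<open>Otherwise the \<open>cm\<close> reference points, independent modulo
  \<open>T2 y\<close>, would be congruent modulo \<open>T2 y\<close> to independent vectors in a
  span of fewer than \<open>cm\<close> vectors.\<close>

lemma regular_proper:
  fixes w :: "'i \<Rightarrow> real^'n"
  assumes y: "regular y" and K: "finite K" "card K < cm"
  shows "\<not> S \<subseteq> {t + v | t v. t \<in> T2 y \<and> v \<in> span (w ` K)}"
proof
  assume sub: "S \<subseteq> {t + v | t v. t \<in> T2 y \<and> v \<in> span (w ` K)}"
  have "\<forall>j\<in>{Suc 0..cm}. \<exists>v. v \<in> span (w ` K) \<and> Ys j - v \<in> T2 y"
  proof
    fix j assume "j \<in> {Suc 0..cm}"
    then have "Ys j \<in> S" using strong_Ys P_S by (auto simp: strong_def)
    then obtain t v where "Ys j = t + v" "t \<in> T2 y" "v \<in> span (w ` K)" using sub by blast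
    then show "\<exists>v. v \<in> span (w ` K) \<and> Ys j - v \<in> T2 y" by (intro exI[of _ v]) simp
  qed
  from bchoice[OF this] obtain v where v: "\<And>j. j \<in> {Suc 0..cm} \<Longrightarrow> v j \<in> span (w ` K)"
    "\<And>j. j \<in> {Suc 0..cm} \<Longrightarrow> Ys j - v j \<in> T2 y" by blast
  have "indmod {0} v {Suc 0..cm}"
    unfolding indmod_def
  proof (intro allI impI ballI)
    fix a j assume a: "(\<Sum>j=Suc 0..cm. a j *\<^sub>R v j) \<in> {0}" and j: "j \<in> {Suc 0..cm}"
    have "(\<Sum>j=Suc 0..cm. a j *\<^sub>R Ys j) = (\<Sum>j=Suc 0..cm. a j *\<^sub>R (Ys j - v j))"
      using a by (simp add: scaleR_diff_right sum_subtractf)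
    also have "\<dots> \<in> T2 y" using v(2) by (intro subspace_sum[OF subspace_T2] subspace_scale[OF subspace_T2])
    finally show "a j = 0" using y[unfolded regular_def] j by (intro indmodD)
  qed
  from indmod_zero_independent[OF this]
  have "independent (v ` {Suc 0..cm})" "inj_on v {Suc 0..cm}" by simp_all
  moreover have "v ` {Suc 0..cm} \<subseteq> span (w ` K)" using v(1) by blast
  ultimately have "card (v ` {Suc 0..cm}) \<le> card (w ` K)" using independent_span_bound[of "w ` K"] K(1) by simp
  then have "cm \<le> card (w ` K)" using card_image[OF \<open>inj_on v {Suc 0..cm}\<close>] by simp
  then show False using card_image_le[OF K(1), of w] K(2) by simp
qed

text \<open>The auxiliary point \<open>p\<close> stands in for a generic point: independence modulo
  \<open>T2 p\<close> is an open condition, hence passes to the tangent space at the point to be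
  added. Regularity leaves room for the remaining choices.\<close>

lemma good_tuple_step:
  assumes w: "\<And>i. i \<in> {Suc 0..r} \<Longrightarrow> w i \<in> P \<and> regular (w i)" and p: "regular p" "p \<in> P" and r: "r < cm"
    and A: "\<And>i. i \<in> {Suc 0..r} \<Longrightarrow> indmod (T2 (w i)) w ({..r} - {i})"
    and B: "indmod (T2 p) w {..r}" and B': "indmod (T2 p) w {Suc 0..r}"
  shows "\<exists>y. y \<in> P \<and> regular y \<and> (\<forall>i\<in>{Suc 0..Suc r}. indmod (T2 ((w(Suc r := y)) i)) (w(Suc r := y)) ({..Suc r} - {i})) \<and>
    (Suc r < cm \<longrightarrow> indmod (T2 p) (w(Suc r := y)) {..Suc r}) \<and> indmod (T2 p) (w(Suc r := y)) {Suc 0..Suc r}"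
proof -
  from regular_open obtain e1 G1 where G1: "hom_poly e1 G1" "\<exists>z\<in>V. G1 z \<noteq> 0" "\<forall>y. G1 (cvec y) \<noteq> 0 \<longrightarrow> regular y"
    by (elim exE conjE)
  from indmod_T2_open[OF _ B] obtain e2 G2 where G2: "hom_poly e2 G2" "G2 (cvec p) \<noteq> 0" "\<forall>y. G2 (cvec y) \<noteq> 0 \<longrightarrow> indmod (T2 y) w {..r}"
    by (auto elim!: exE)
  have pV: "cvec p \<in> V" using p(2) P_subset by (auto simp: real_points_def)
  \<comment> \<open>Index 0 preserves \<open>B'\<close>, an index in \<open>{1..r}\<close> preserves
    \<open>A\<close> at \<open>w i\<close>, and index \<open>Suc r\<close> preserves
    \<open>B\<close>. The last is possible only while at most \<open>cm\<close> vectors are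
    involved; afterwards \<open>{0}\<close> is a harmless default.\<close>
  define U where "U i = (if i = 0 then {t + v | t v. t \<in> T2 p \<and> v \<in> span (w ` {Suc 0..r})}
     else if i \<le> r then {t + v | t v. t \<in> T2 (w i) \<and> v \<in> span (w ` ({..r} - {i}))}
     else if Suc r < cm then {t + v | t v. t \<in> T2 p \<and> v \<in> span (w ` {..r})} else {0})" for i
  have sub: "subspace (U i)" for i unfolding U_def by (auto intro!: subspace_sums subspace_T2)
  have S0: "\<not> S \<subseteq> {0}" using p(2) P_S P_nonzero by blast
  have npr: "\<not> S \<subseteq> U i" for i
    using regular_proper[OF p(1), of "{Suc 0..r}" w] regular_proper[OF p(1), of "{..r}" w] S0 r
      regular_proper[of "w i" "{..r} - {i}" w] w[of i] unfolding U_def by auto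
  have GG: "hom_poly (e1 + e2) (\<lambda>z. G1 z * G2 z)" by (rule hom_poly_mult[OF G1(1) G2(1)])
  have nz: "\<exists>z\<in>V. G1 z * G2 z \<noteq> 0"
  proof (rule ccontr)
    assume "\<not> ?thesis"
    then have "\<And>z. z \<in> V \<Longrightarrow> G1 z * G2 z = 0" by blast
    from proj_irreducible_forms[OF V_irr G1(1) G2(1) this] show False using G1(2) G2(2) pV by blast
  qed
  from generic_point_avoiding[of "{..Suc r}" U, OF _ sub npr GG nz]
  obtain y where y: "y \<in> P" "G1 (cvec y) * G2 (cvec y) \<noteq> 0" "\<forall>i\<in>{..Suc r}. y \<notin> U i" by auto
  define w' where "w' = w(Suc r := y)"
  have reg: "regular y" and indy: "indmod (T2 y) w {..r}" using G1(3) G2(3) y(2) by auto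
  have ins: "indmod T w' (insert (Suc r) K)" if T: "subspace T" and K: "K \<subseteq> {..r}" and ind: "indmod T w K"
    and ny: "y \<notin> {t + v | t v. t \<in> T \<and> v \<in> span (w ` K)}" for T K
  proof (rule indmod_insert[OF T])
    show "finite K" using K finite_subset by blast
    show "Suc r \<notin> K" using K by auto
    have eq: "\<And>j. j \<in> K \<Longrightarrow> w' j = w j" using K by (auto simp: w'_def)
    show "indmod T w' K" using ind indmod_cong[of K w' w T] eq by simp
    fix a u assume u: "u \<in> T"
    have "(\<Sum>j\<in>K. a j *\<^sub>R w' j) = (\<Sum>j\<in>K. a j *\<^sub>R w j)" by (rule sum.cong) (auto simp: eq)
    moreover have "(\<Sum>j\<in>K. a j *\<^sub>R w j) \<in> span (w ` K)" by (intro span_sum span_scale span_base) auto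
    ultimately show "w' (Suc r) \<noteq> u + (\<Sum>j\<in>K. a j *\<^sub>R w' j)" using ny u by (auto simp: w'_def)
  qed
  have c1: "indmod (T2 (w' i)) w' ({..Suc r} - {i})" if i: "i \<in> {Suc 0..Suc r}" for i
  proof (cases "i = Suc r")
    case True
    have "{..Suc r} - {i} = {..r}" using True by auto
    moreover have "indmod (T2 y) w' {..r} = indmod (T2 y) w {..r}" by (rule indmod_cong) (simp add: w'_def)
    ultimately show ?thesis using True indy by (simp add: w'_def)
  next
    case False
    then have i': "i \<in> {Suc 0..r}" using i by auto
    have "indmod (T2 (w i)) w' (insert (Suc r) ({..r} - {i}))"
    proof (rule ins[OF subspace_T2 _ A[OF i']])
      show "y \<notin> {t + v | t v. t \<in> T2 (w i) \<and> v \<in> span (w ` ({..r} - {i}))}"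
        using y(3)[rule_format, of i] i' by (simp add: U_def)
    qed auto
    moreover have "insert (Suc r) ({..r} - {i}) = {..Suc r} - {i}" using i' by auto
    ultimately show ?thesis using i' by (simp add: w'_def)
  qed
  have c2: "indmod (T2 p) w' {..Suc r}" if "Suc r < cm"
  proof -
    have "indmod (T2 p) w' (insert (Suc r) {..r})"
      by (rule ins[OF subspace_T2 _ B]) (use y(3)[rule_format, of "Suc r"] that in \<open>simp_all add: U_def\<close>)
    then show ?thesis by (simp add: atMost_Suc)
  qed
  have c3: "indmod (T2 p) w' {Suc 0..Suc r}"
  proof -
    have "indmod (T2 p) w' (insert (Suc r) {Suc 0..r})"
      by (rule ins[OF subspace_T2 _ B']) (use y(3)[rule_format, of 0] in \<open>auto simp: U_def\<close>)
    moreover have "insert (Suc r) {Suc 0..r} = {Suc 0..Suc r}" by auto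
    ultimately show ?thesis by simp
  qed
  show ?thesis using y(1) reg c1 c2 c3 unfolding w'_def by (intro exI[of _ y]) blast
qed

lemma good_tuple_partial:
  assumes p: "regular p" "p \<in> P" "z \<notin> T2 p" and r: "r \<le> cm"
  shows "\<exists>w. w 0 = z \<and> (\<forall>i\<in>{Suc 0..r}. w i \<in> P \<and> regular (w i)) \<and>
    (\<forall>i\<in>{Suc 0..r}. indmod (T2 (w i)) w ({..r} - {i})) \<and> (r < cm \<longrightarrow> indmod (T2 p) w {..r}) \<and> indmod (T2 p) w {Suc 0..r}"
  using r
proof (induction r)
  case 0
  have "indmod (T2 p) (\<lambda>_::nat. z) {..0}"
    unfolding indmod_def
  proof (intro allI impI ballI)
    fix a :: "nat \<Rightarrow> real" and j :: nat assume a: "(\<Sum>j\<le>0. a j *\<^sub>R z) \<in> T2 p" "j \<in> {..0}"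
    show "a j = 0"
    proof (rule ccontr)
      assume "a j \<noteq> 0"
      then have "z = (1 / a 0) *\<^sub>R (a 0 *\<^sub>R z)" using a(2) by simp
      then have "z \<in> T2 p" using a(1) subspace_scale[OF subspace_T2, of "a 0 *\<^sub>R z" p "1 / a 0"] by simp
      then show False using p(3) by simp
    qed
  qed
  then show ?case by (intro exI[of _ "\<lambda>_. z"]) (simp add: indmod_def)
next
  case (Suc r)
  then have r: "r < cm" by simp
  then have "r \<le> cm" by simp
  from Suc(1)[OF this] obtain w where w: "w 0 = z" "\<forall>i\<in>{Suc 0..r}. w i \<in> P \<and> regular (w i)"
    "\<forall>i\<in>{Suc 0..r}. indmod (T2 (w i)) w ({..r} - {i})" "r < cm \<longrightarrow> indmod (T2 p) w {..r}" "indmod (T2 p) w {Suc 0..r}"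
    by (elim exE conjE)
  from good_tuple_step[of r w p] w r p obtain y where y: "y \<in> P" "regular y"
    "\<forall>i\<in>{Suc 0..Suc r}. indmod (T2 ((w(Suc r := y)) i)) (w(Suc r := y)) ({..Suc r} - {i})"
    "Suc r < cm \<longrightarrow> indmod (T2 p) (w(Suc r := y)) {..Suc r}" "indmod (T2 p) (w(Suc r := y)) {Suc 0..Suc r}"
    by (simp only: simp_thms) blast
  have "\<forall>i\<in>{Suc 0..Suc r}. (w(Suc r := y)) i \<in> P \<and> regular ((w(Suc r := y)) i)" using w(2) y(1,2) by auto
  moreover have "(w(Suc r := y)) 0 = z" using w(1) by simp
  ultimately show ?case using y(3-5) by (intro exI[of _ "w(Suc r := y)"] conjI)
qed

text \<open>Points are chosen around the given vector \<open>z\<close>, so that \<open>z\<close> can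
  replace the base point without losing independence at the other points. This makes the
  denominators \<open>h i\<close> of the chart nonzero at \<open>z\<close>.\<close>

lemma good_tuple:
  assumes z: "p0 \<in> P" "z \<notin> T2 p0"
  shows "\<exists>Y. strong cm Y \<and> (\<forall>i\<in>{Suc 0..cm}. indmod (T2 (Y i)) (Y(0 := z)) ({..cm} - {i}))"
proof -
  from regular_open obtain e1 G1 where G1: "hom_poly e1 G1" "\<exists>z\<in>V. G1 z \<noteq> 0" "\<forall>y. G1 (cvec y) \<noteq> 0 \<longrightarrow> regular y"
    by (elim exE conjE)
  obtain A where A: "A \<in> ideal2 X" "rbf A p0 z \<noteq> 0" using z(2) by (auto simp: T2_def)
  have p0V: "cvec p0 \<in> V" using z(1) P_subset by (auto simp: real_points_def)
  have nz: "\<exists>x\<in>V. G1 x * cbf A x z \<noteq> 0"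
  proof (rule ccontr)
    assume "\<not> ?thesis"
    then have "\<And>x. x \<in> V \<Longrightarrow> G1 x * cbf A x z = 0" by blast
    from proj_irreducible_forms[OF V_irr G1(1) hom_poly_cbf this] show False using G1(2) p0V A(2) by (auto simp: cbf_cvec dest: bspec)
  qed
  obtain p where p: "p \<in> P" "G1 (cvec p) * cbf A (cvec p) z \<noteq> 0"
    using generic_point_avoiding[of "{}" "\<lambda>_. {0}", OF _ _ _ hom_poly_mult[OF G1(1) hom_poly_cbf] nz] by auto
  have p': "regular p" "z \<notin> T2 p" using p(2) G1(3) A(1) by (auto simp: cbf_cvec T2_def)
  from good_tuple_partial[OF p'(1) p(1) p'(2) order_refl] obtain w where w: "w 0 = z"
    "\<forall>i\<in>{Suc 0..cm}. w i \<in> P \<and> regular (w i)" "\<forall>i\<in>{Suc 0..cm}. indmod (T2 (w i)) w ({..cm} - {i})"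
    "indmod (T2 p) w {Suc 0..cm}" by (elim exE conjE)
  from indmod_T2_open[OF _ w(4)] obtain e2 G2 where G2: "hom_poly e2 G2" "G2 (cvec p) \<noteq> 0" "\<forall>y. G2 (cvec y) \<noteq> 0 \<longrightarrow> indmod (T2 y) w {Suc 0..cm}"
    by (auto elim!: exE)
  define U where "U i = {t + v | t v. t \<in> T2 (w i) \<and> v \<in> span (w ` ({Suc 0..cm} - {i}))}" for i
  have sub: "subspace (U i)" for i unfolding U_def by (intro subspace_sums subspace_T2 subspace_span)
  have npr: "\<not> S \<subseteq> U i" if "i \<in> {Suc 0..cm}" for i
  proof -
    have "card ({Suc 0..cm} - {i}) < cm" using that by (simp add: card_Diff_singleton) 
    then show ?thesis unfolding U_def using w(2) that by (intro regular_proper) auto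
  qed
  have "\<exists>z\<in>V. G2 z \<noteq> 0" using G2(2) p(1) P_subset by (auto simp: real_points_def)
  from generic_point_avoiding[of "{Suc 0..cm}" U, OF _ sub npr G2(1) this]
  obtain y where y: "y \<in> P" "G2 (cvec y) \<noteq> 0" "\<forall>i\<in>{Suc 0..cm}. y \<notin> U i" by auto
  define Y where "Y = w(0 := y)"
  have "strong cm Y" unfolding strong_def
  proof (intro conjI allI impI)
    fix i assume i: "i \<le> cm"
    show "Y i \<in> P" using y(1) w(2) i by (auto simp: Y_def Suc_le_eq)
    show "indmod (T2 (Y i)) Y ({..cm} - {i})"
    proof (cases "i = 0")
      case True
      have "{..cm} - {i} = {Suc 0..cm}" using True by auto
      moreover have "indmod (T2 y) Y {Suc 0..cm} = indmod (T2 y) w {Suc 0..cm}" by (rule indmod_cong) (simp add: Y_def)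
      ultimately show ?thesis using True G2(3) y(2) by (simp add: Y_def)
    next
      case False
      then have i': "i \<in> {Suc 0..cm}" using i by auto
      have eq: "\<And>j. j \<in> {Suc 0..cm} - {i} \<Longrightarrow> Y j = w j" by (auto simp: Y_def)
      have "indmod (T2 (w i)) w ({Suc 0..cm} - {i})"
        by (rule indmod_mono[OF w(3)[rule_format, OF i']]) auto
      then have ind: "indmod (T2 (w i)) Y ({Suc 0..cm} - {i})"         using indmod_cong[of "{Suc 0..cm} - {i}" Y w "T2 (w i)"] eq by simp
      have "indmod (T2 (w i)) Y (insert 0 ({Suc 0..cm} - {i}))"
      proof (rule indmod_insert[OF subspace_T2 _ _ ind])
        fix a u assume u: "u \<in> T2 (w i)"
        have "(\<Sum>j\<in>{Suc 0..cm} - {i}. a j *\<^sub>R Y j) = (\<Sum>j\<in>{Suc 0..cm} - {i}. a j *\<^sub>R w j)"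
          by (rule sum.cong) (auto simp: Y_def)
        moreover have "(\<Sum>j\<in>{Suc 0..cm} - {i}. a j *\<^sub>R w j) \<in> span (w ` ({Suc 0..cm} - {i}))"
          by (intro span_sum span_scale span_base) auto
        ultimately have "u + (\<Sum>j\<in>{Suc 0..cm} - {i}. a j *\<^sub>R Y j) \<in> U i" unfolding U_def using u by auto
        then show "Y 0 \<noteq> u + (\<Sum>j\<in>{Suc 0..cm} - {i}. a j *\<^sub>R Y j)" using y(3) i' by (auto simp: Y_def)
      qed auto
      moreover have "insert 0 ({Suc 0..cm} - {i}) = {..cm} - {i}" using False by auto
      ultimately show ?thesis using False by (simp add: Y_def)
    qed
  qed
  moreover have "Y(0 := z) = w" using w(1) by (auto simp: Y_def)
  then have "\<forall>i\<in>{Suc 0..cm}. indmod (T2 (Y i)) (Y(0 := z)) ({..cm} - {i})" using w(3) by (auto simp: Y_def)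
  ultimately show ?thesis by blast
qed

lemma span_P: "span P = S"
proof
  show "span P \<subseteq> S" using span_minimal[OF P_S subspace_S] .
  show "S \<subseteq> span P"
  proof
    fix s assume s: "s \<in> S"
    show "s \<in> span P"
    proof (rule in_subspace_if_orthogonal[OF subspace_span])
      fix l assume l: "\<And>u. u \<in> span P \<Longrightarrow> l \<bullet> u = 0"
      have "\<forall>z\<in>V. lf (cvec l) z = 0" using P_dense[OF hom_poly_lf[of "cvec l"]] l span_base by (auto simp: lf_cvec)
      then show "l \<bullet> s = 0" using S_form s by blast
    qed
  qed
qed

text \<open>By linearity \<open>z\<close> is polar to all of \<open>S\<close> for every quadric
  through \<open>X\<close>. If \<open>z\<close> is not on the line of \<open>Y 0\<close>, the points
  \<open>z + s Y 0\<close> with \<open>s\<close> nonzero satisfy the conditions of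
  \<open>graph\<close>, and a polynomial in \<open>s\<close> that vanishes for all nonzero real
  \<open>s\<close> vanishes at 0.\<close>

lemma vertex_in_V:
  assumes z: "z \<in> S" "z \<noteq> 0" and vx: "\<And>p. p \<in> P \<Longrightarrow> z \<in> T2 p"
  shows "z \<in> RV"
proof -
  interpret chart X V Ys by unfold_locales (rule strong_Ys)
  have rb: "rbf A x z = 0" if A: "A \<in> ideal2 X" and x: "x \<in> S" for A x
  proof -
    have "x \<in> span P" using x span_P by simp
    then show ?thesis
    proof (induction rule: span_induct)
      case base
      show ?case
        by (auto simp: subspace_def linear_0[OF linear_rbf_left] linear_add[OF linear_rbf_left] linear_scale[OF linear_rbf_left])
    next
      case (step x)
      then show ?case using vx A by (auto simp: T2_def)
    qed
  qed
  show ?thesis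
  proof (cases "z \<in> span {Ys 0}")
    case True
    then obtain k where k: "z = k *\<^sub>R Ys 0" by (auto simp: span_singleton)
    then show ?thesis using z(2) real_points_scale[OF V_closed Y_RV[of 0], of k] by auto
  next
    case False
    have "cvec z \<in> V"
    proof (rule forms_cut_closed[OF V_closed])
      show "cvec z \<noteq> 0" using z(2) by (metis cvec_inj cvec_simps(4))
      fix d f assume f: "hom_poly d f" "\<And>x. x \<in> V \<Longrightarrow> f x = 0"
      have van: "f (cvec (z + s *\<^sub>R Ys 0)) = 0" if s: "s \<noteq> 0" for s
      proof -
        define x where "x = z + s *\<^sub>R Ys 0"
        have xS: "x \<in> S" unfolding x_def using z(1) Y_S[of 0] by (simp add: subspace_add[OF subspace_S] subspace_scale[OF subspace_S])
        have "x \<noteq> 0"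
        proof
          assume "x = 0"
          then have "z = (- s) *\<^sub>R Ys 0" by (simp add: x_def eq_neg_iff_add_eq_0)
          then show False using False by (metis span_base span_scale singletonI)
        qed
        moreover have "rqform (F i) x = 0" if i: "i \<in> J" for i
        proof -
          have "rqform (F i) (Ys 0) = 0" using ideal2_real_points[OF F[OF i], of "Ys 0"] Y_P[of 0] P_subset by auto
          moreover have "rbf (F i) z z = 0" "rbf (F i) (Ys 0) z = 0" using rb[OF F[OF i]] z(1) Y_S[of 0] by auto
          ultimately show ?thesis unfolding x_def rqform_add rqform_scale
            by (simp add: rbf_diag linear_scale[OF linear_rbf] rbf_commute[of _ z])
        qed
        moreover have "h i x \<noteq> 0" if i: "i \<in> J" for i
        proof -
          have "h i z = 0" by (rule h_T2[OF i]) (use vx Y_P i in auto)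
          then show ?thesis unfolding x_def using s h_Y(2)[OF i] by (simp add: linear_add[OF linear_h] linear_scale[OF linear_h])
        qed
        ultimately have "x \<in> RV" using graph[OF xS] by blast
        then show ?thesis using f(2) by (simp add: real_points_def x_def)
      qed
      obtain q where q: "\<And>t. f (cvec (z + t *\<^sub>R Ys 0)) = poly q (of_real t)" using hom_poly_real_line[OF f(1)] by blast
      have "infinite {t. poly q (of_real t) = 0}"
      proof (rule infinite_super)
        show "- {0::real} \<subseteq> {t. poly q (of_real t) = 0}" using van q by auto
        show "infinite (- {0::real})" by (simp add: infinite_UNIV_char_0 Compl_eq_Diff_UNIV)
      qed
      then have "q = 0" by (rule poly_zero_of_infinite_reals)
      then show "f (cvec z) = 0" using q[of 0] by simp
    qed
    then show ?thesis using z(2) by (simp add: real_points_def)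
  qed
qed

text \<open>Shift \<open>z\<close> along the \<open>Y j\<close> to a point \<open>w\<close> of
  \<open>V\<close>. If a shift at some \<open>Y i\<close> were nonzero, \<open>Y i\<close> would
  depend on \<open>w\<close>, \<open>Q\<close> and the other \<open>Y j\<close>; the resulting
  tangent vector contradicts independence of \<open>z\<close> and the other \<open>Y j\<close>
  modulo \<open>T2 (Y i)\<close>.\<close>

lemma separation:
  assumes z: "z \<in> S" "z \<noteq> 0" and Q: "finite Q" "Q \<subseteq> RX" "z \<in> span Q" "\<And>x. x \<in> span Q \<Longrightarrow> x \<in> S \<Longrightarrow> x \<in> span {z}"
  shows "z \<in> RV"
proof (cases "\<exists>p0\<in>P. z \<notin> T2 p0")
  case False
  then show ?thesis using vertex_in_V[OF z] by blast
next
  case True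
  then obtain p0 where "p0 \<in> P" "z \<notin> T2 p0" by blast
  from good_tuple[OF this] obtain Y where Y: "strong cm Y" "\<forall>i\<in>{Suc 0..cm}. indmod (T2 (Y i)) (Y(0 := z)) ({..cm} - {i})"
    by (elim exE conjE)
  interpret chart X V Y by unfold_locales (rule Y(1))
  \<comment> \<open>\<open>h i z\<close> is the coefficient of \<open>Y 0\<close> in the
    decomposition of \<open>z\<close> at \<open>Y i\<close>. If it were 0, then \<open>z\<close>
    would depend on the other \<open>Y j\<close> modulo \<open>T2 (Y i)\<close>, against the choice
    of the tuple.\<close>
  have hz: "h i z \<noteq> 0" if i: "i \<in> J" for i
  proof
    assume h0: "h i z = 0"
    obtain t a where ta: "t \<in> T1 (Y i)" "z = t + (\<Sum>j\<in>{..cm} - {i}. a j *\<^sub>R Y j)"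
      using strong_max_spans[OF strong _ z(1), of i] i by auto
    have K: "{..cm} - {i} = insert 0 (J - {i})" using i by auto
    have zt: "z = t + a 0 *\<^sub>R Y 0 + (\<Sum>j\<in>J - {i}. a j *\<^sub>R Y j)" using ta(2) unfolding K by simp
    have "h i (\<Sum>j\<in>J - {i}. a j *\<^sub>R Y j) = 0"
      using h_Y(1)[OF i] by (simp add: linear_sum[OF linear_h] linear_scale[OF linear_h])
    then have "h i z = a 0" unfolding zt using h_T2[OF i] ta(1) T1_T2 h_Y(2)[OF i]
      by (simp add: linear_add[OF linear_h] linear_scale[OF linear_h] subset_iff)
    then have a0: "a 0 = 0" using h0 by simp
    have "(\<Sum>j\<in>{..cm} - {i}. (if j = 0 then 1 else - a j) *\<^sub>R (Y(0 := z)) j) = z + (\<Sum>j\<in>J - {i}. - a j *\<^sub>R Y j)"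
      unfolding K by (subst sum.insert) (auto intro!: sum.cong)
    also have "\<dots> = t" unfolding zt a0 by (simp add: sum_negf)
    finally have "(\<Sum>j\<in>{..cm} - {i}. (if j = 0 then 1 else - a j) *\<^sub>R (Y(0 := z)) j) \<in> T2 (Y i)" using ta(1) T1_T2 by auto
    from indmodD[OF Y(2)[rule_format, OF i] this, of 0] show False using i by auto
  qed
  \<comment> \<open>By \<open>rqform_shift\<close> these are the only shifts for which all quadrics
    \<open>F i\<close> vanish at \<open>w\<close>.\<close>
  define s where "s i = - rqform (F i) z / h i z" for i
  define w where "w = z + (\<Sum>j\<in>J. s j *\<^sub>R Y j)"
  have sumS: "(\<Sum>j\<in>J. s j *\<^sub>R Y j) \<in> S" using Y_S by (intro subspace_sum[OF subspace_S] subspace_scale[OF subspace_S]) auto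
  have wS: "w \<in> S" unfolding w_def using z(1) sumS subspace_add[OF subspace_S] by blast
  have hw: "h i w = h i z" if "i \<in> J" for i unfolding w_def by (rule h_shift[OF that])
  have "w \<noteq> 0"
  proof (cases "J = {}")
    case True then show ?thesis using z(2) unfolding w_def True by simp
  next
    case False
    then obtain i where "i \<in> J" by blast
    then show ?thesis using hw[of i] hz[of i] linear_0[OF linear_h] by auto
  qed
  moreover have "rqform (F i) w = 0" if "i \<in> J" for i
    unfolding w_def rqform_shift[OF that z(1)] s_def using hz[OF that] by simp
  ultimately have wRV: "w \<in> RV" using graph[OF wS] hw hz by auto
  show ?thesis
  proof (cases "(\<forall>j\<in>J. s j = 0) \<or> (\<exists>i\<in>J. z \<in> span {Y i})")
    case True
    then show ?thesis
    proof
      assume "\<forall>j\<in>J. s j = 0"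
      then have "w = z" by (simp add: w_def)
      then show ?thesis using wRV by simp
    next
      assume "\<exists>i\<in>J. z \<in> span {Y i}"
      then obtain i where "i \<in> J" "z \<in> span {Y i}" by blast
      moreover from this obtain k where "z = k *\<^sub>R Y i" by (auto simp: span_singleton)
      ultimately have "i \<in> J" "z = k *\<^sub>R Y i" by simp_all
      then show ?thesis using z(2) real_points_scale[OF V_closed Y_RV[of i], of k] by auto
    qed
  next
    case False
    then obtain i where i: "i \<in> J" "s i \<noteq> 0" "z \<notin> span {Y i}" by blast
    have ic: "i \<le> cm" using i(1) by simp
    \<comment> \<open>\<open>B\<close> collects what expresses \<open>Y i\<close>: the point
      \<open>w\<close>, the points of \<open>Q\<close> that span \<open>z\<close>, and the other
      \<open>Y j\<close>. None of them is on the line of \<open>Y i\<close>.\<close>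
    define B where "B = insert w (Q \<union> Y ` (J - {i}))"
    have "(\<Sum>j\<in>J. s j *\<^sub>R Y j) = s i *\<^sub>R Y i + (\<Sum>j\<in>J - {i}. s j *\<^sub>R Y j)" by (rule sum.remove) (use i in auto)
    then have "Y i = (1 / s i) *\<^sub>R (w - z - (\<Sum>j\<in>J - {i}. s j *\<^sub>R Y j))" using i(2) by (simp add: w_def)
    also have "\<dots> \<in> span B"
    proof -
      have "z \<in> span B" using Q(3) span_mono[of Q B] by (auto simp: B_def)
      moreover have "w \<in> span B" by (rule span_base) (simp add: B_def)
      moreover have "(\<Sum>j\<in>J - {i}. s j *\<^sub>R Y j) \<in> span B" by (intro span_sum span_scale span_base) (auto simp: B_def)
      ultimately show ?thesis by (intro span_scale span_diff)
    qed
    finally have YB: "Y i \<in> span B" .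
    have nB: "x \<notin> span {Y i}" if x: "x \<in> B" for x
    proof
      assume xs: "x \<in> span {Y i}"
      then obtain k where k: "x = k *\<^sub>R Y i" by (auto simp: span_singleton)
      consider "x = w" | "x \<in> Q" | j where "j \<in> J - {i}" "x = Y j" using x unfolding B_def by blast
      then show False
      proof cases
        case 1
        then have "h i w = k * h i (Y i)" using k linear_scale[OF linear_h, of i k "Y i"] by simp
        then have "h i w = 0" using h_Y(1)[OF i(1) i(1)] by simp
        then show False using hw[OF i(1)] hz[OF i(1)] by simp
      next
        case 2
        have "x \<in> S" using k Y_S[OF ic] subspace_scale[OF subspace_S] by blast
        then have "x \<in> span {z}" using Q(4) 2 span_base by blast
        then obtain m where m: "x = m *\<^sub>R z" by (auto simp: span_singleton)
        have "x \<noteq> 0" using 2 Q(2) by (auto simp: real_points_def)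
        then have "m \<noteq> 0" using m by auto
        then have "z = (1 / m) *\<^sub>R x" using m by simp
        also have "\<dots> \<in> span {Y i}" using xs by (rule span_scale)
        finally show False using i(3) by simp
      next
        case 3
        have "indmod {0} Y {..cm}" using flagged_independent[OF fl] .
        then have ind: "indmod {0} Y {i, j}" by (rule indmod_mono) (use 3 i in auto)
        have "(\<Sum>l\<in>{i, j}. (if l = j then 1 else - k) *\<^sub>R Y l) \<in> {0}" using 3 k by auto
        from indmodD[OF ind this, of j] show False by simp
      qed
    qed
    have finB: "finite B" using Q(1) by (simp add: B_def)
    have "Y ` (J - {i}) \<subseteq> RX" using Y_P P_subset(2) by fastforce
    then have BX: "B \<subseteq> RX" using wRV RV_subset(1) Q(2) unfolding B_def by blast
    from dependent_tangent[OF Y_P[OF ic] finB BX YB nB]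
    obtain v where v: "v \<in> span B" "v \<noteq> 0" "v \<bullet> Y i = 0" "v \<in> T1 (Y i)" by blast
    let ?W = "{a + b | a b. a \<in> span Q \<and> b \<in> span (Y ` J)}"
    have "span B \<subseteq> ?W"
    proof (rule span_minimal)
      show "subspace ?W" by (intro subspace_sums subspace_span)
      have Y0: "0 + Y j \<in> ?W" if "j \<in> J" for j using that span_zero[of Q] span_base[of "Y j" "Y ` J"] by blast
      have Q0: "q + 0 \<in> ?W" if "q \<in> Q" for q using that span_zero[of "Y ` J"] span_base[of q Q] by blast
      have "(\<Sum>j\<in>J. s j *\<^sub>R Y j) \<in> span (Y ` J)" by (intro span_sum span_scale span_base) auto
      then have "w \<in> ?W" unfolding w_def using Q(3) by blast
      then show "B \<subseteq> ?W" using Y0 Q0 by (auto simp: B_def)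
    qed
    then obtain a b where ab: "v = a + b" "a \<in> span Q" "b \<in> span (Y ` J)" using v(1) by blast
    have "Y ` J \<subseteq> S" using Y_S by fastforce
    then have "b \<in> S" using ab(3) span_minimal[OF _ subspace_S] by blast
    moreover have "v \<in> S" using v(4) T1_S by blast
    \<comment> \<open>Tangent vectors and the \<open>Y j\<close> lie in \<open>S\<close>, so the
      part of \<open>v\<close> from the span of \<open>Q\<close> lies in \<open>S\<close> as well
      and is a multiple of \<open>z\<close>. Then \<open>v\<close> is a combination of
      \<open>z\<close> and the \<open>Y j\<close>.\<close>
    ultimately have "a \<in> S" using ab(1) subspace_diff[OF subspace_S, of v b] by simp
    then obtain k where k: "a = k *\<^sub>R z" using Q(4)[OF ab(2)] by (auto simp: span_singleton)
    from span_image_sum[OF _ ab(3)] obtain \<beta> where \<beta>: "b = (\<Sum>j\<in>J. \<beta> j *\<^sub>R Y j)" by auto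
    have b: "b = \<beta> i *\<^sub>R Y i + (\<Sum>j\<in>J - {i}. \<beta> j *\<^sub>R Y j)" unfolding \<beta> by (rule sum.remove) (use i in auto)
    have K: "{..cm} - {i} = insert 0 (J - {i})" using i by auto
    have "(\<Sum>j\<in>{..cm} - {i}. (if j = 0 then k else \<beta> j) *\<^sub>R (Y(0 := z)) j) = k *\<^sub>R z + (\<Sum>j\<in>J - {i}. \<beta> j *\<^sub>R Y j)"
      unfolding K by (subst sum.insert) (auto intro!: sum.cong)
    also have "\<dots> = v - \<beta> i *\<^sub>R Y i" unfolding ab(1) k b by simp
    also have "\<dots> \<in> T2 (Y i)"
      using v(4) self_T1[OF Y_RV[OF ic]] T1_T2[of "Y i"] by (intro subspace_diff[OF subspace_T2] subspace_scale[OF subspace_T2]) auto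
    finally have in2: "(\<Sum>j\<in>{..cm} - {i}. (if j = 0 then k else \<beta> j) *\<^sub>R (Y(0 := z)) j) \<in> T2 (Y i)" .
    have zero: "(if j = 0 then k else \<beta> j) = 0" if "j \<in> {..cm} - {i}" for j
      using indmodD[OF Y(2)[rule_format, OF i(1)] in2 that] .
    have "k = 0" using zero[of 0] i(1) by auto
    moreover have "\<beta> j = 0" if "j \<in> J - {i}" for j using zero[of j] that by auto
    ultimately have "v = \<beta> i *\<^sub>R Y i" unfolding ab(1) k b by simp
    then show ?thesis using v(2,3) P_nonzero[OF Y_P[OF ic]] by simp
  qed
qed

lemma X_real_span: "x \<in> RX \<Longrightarrow> x \<in> S \<Longrightarrow> x \<in> RV"
  using separation[of x "{x}"] by (auto simp: span_base real_points_def)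

end

section \<open>Configurations of components and the search for a removable one\<close>

context sos
begin

abbreviation "CC \<equiv> irr_components X"
definition "RB B = (\<Union>V\<in>B. real_points V)" for B :: "(complex^'n) set set"
definition "Sp V = span (real_points V)" for V :: "(complex^'n) set"

lemma comp: "V \<in> CC \<Longrightarrow> component X V"
  by unfold_locales

lemma finite_CC: "finite CC" by (rule finite_irr_components[OF closed])

lemma RX_RB: "RX = RB CC"
proof -
  have "real_points (\<Union>CC) = RB CC" by (auto simp: RB_def real_points_def)
  then show ?thesis unfolding Union_irr_components[OF closed] .
qed

lemma RB_subset: "B \<subseteq> CC \<Longrightarrow> RB B \<subseteq> RX" unfolding RX_RB by (auto simp: RB_def)

lemma Sp_subset: "V \<in> B \<Longrightarrow> Sp V \<subseteq> span (RB B)"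
  unfolding Sp_def RB_def by (intro span_mono) blast

lemma comp_closed: "V \<in> CC \<Longrightarrow> proj_closed V"
  using component.V_closed[OF comp] .

lemma comp_separation:
  assumes "V \<in> CC" "z \<in> Sp V" "z \<noteq> 0" "finite Q" "Q \<subseteq> RX" "z \<in> span Q" "\<And>x. x \<in> span Q \<Longrightarrow> x \<in> Sp V \<Longrightarrow> x \<in> span {z}"
  shows "z \<in> real_points V"
  using component.separation[OF comp[OF assms(1)], of z Q] assms unfolding component.S_def[OF comp[OF assms(1)]] Sp_def by blast

lemma comp_real_span: "V \<in> CC \<Longrightarrow> x \<in> RX \<Longrightarrow> x \<in> Sp V \<Longrightarrow> x \<in> real_points V"
  using component.X_real_span[OF comp] component.S_def[OF comp] unfolding Sp_def by blast

lemma comp_generic: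
  assumes V: "V \<in> CC" and "finite I" "\<And>i. i \<in> I \<Longrightarrow> subspace (U i)" "\<And>i. i \<in> I \<Longrightarrow> \<not> Sp V \<subseteq> U i"
  shows "\<exists>y\<in>real_points V. \<forall>i\<in>I. y \<notin> U i"
proof -
  interpret component X V by (rule comp[OF V])
  have "S = Sp V" by (simp add: S_def Sp_def)
  then show ?thesis using generic_avoiding[of I U] assms P_subset(1) by blast
qed

lemma comp_generic2:
  assumes V: "V \<in> CC" and "subspace U" "subspace W" "\<not> Sp V \<subseteq> U" "\<not> Sp V \<subseteq> W"
  shows "\<exists>y\<in>real_points V. y \<notin> U \<and> y \<notin> W"
proof -
  have "\<exists>y\<in>real_points V. \<forall>i\<in>UNIV. y \<notin> (if i then U else W)"
  proof (rule comp_generic[OF V])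
    fix i show "subspace (if i then U else W)" "\<not> Sp V \<subseteq> (if i then U else W)" using assms by simp_all
  qed simp
  then obtain y where "y \<in> real_points V" "\<forall>i\<in>UNIV. y \<notin> (if i then U else W)" by (elim bexE)
  moreover from this(2) have "y \<notin> (if True then U else W)" "y \<notin> (if False then U else W)" by (blast intro: UNIV_I)+
  ultimately show ?thesis by (intro bexI[of _ y]) simp_all
qed

text \<open>Real points of \<open>X\<close> in the span of \<open>W\<close> belong to
  \<open>W\<close>. Containment of spans thus passes to real points and, by density, to the
  components, against their maximality.\<close>

lemma comp_not_in_span:
  assumes "V \<in> CC" "W \<in> CC" "V \<noteq> W" shows "\<not> Sp V \<subseteq> Sp W"
proof
  assume sub: "Sp V \<subseteq> Sp W"
  have "real_points V \<subseteq> real_points W"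
  proof
    fix x assume x: "x \<in> real_points V"
    then have "x \<in> Sp W" using sub span_base unfolding Sp_def by blast
    moreover have "x \<in> RX" using x RB_subset[of "{V}"] assms(1) by (auto simp: RB_def)
    ultimately show "x \<in> real_points W" using comp_real_span[OF assms(2)] by blast
  qed
  have "V \<subseteq> W"
  proof
    fix z assume z: "z \<in> V"
    show "z \<in> W"
    proof (rule forms_cut_closed[OF comp_closed[OF assms(2)]])
      show "z \<noteq> 0" by (rule proj_closed_nonzero[OF comp_closed[OF assms(1)] z])
      fix d f assume f: "hom_poly d f" "\<And>x. x \<in> W \<Longrightarrow> f x = 0"
      show "f z = 0"
        by (rule component.RV_dense[OF comp[OF assms(1)] f(1) _ z])
          (use f(2) \<open>real_points V \<subseteq> real_points W\<close> in \<open>auto simp: real_points_def\<close>)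
    qed
  qed
  moreover have "proj_irreducible W" "W \<subseteq> X" using assms(2) by (auto simp: irr_components_def)
  ultimately have "W = V" using assms(1) by (simp add: irr_components_def)
  then show False using assms(3) by simp
qed

lemma real_points_closed_set:
  fixes V :: "(complex^'n) set"
  assumes "proj_closed V" shows "\<exists>Z. Topological_Spaces.closed Z \<and> real_points V = Z - {0}"
proof -
  obtain F where F: "\<forall>f\<in>F. \<exists>d. hom_poly d f" "V = {z. z \<noteq> 0 \<and> (\<forall>f\<in>F. f z = 0)}"
    using assms unfolding proj_closed_def by blast
  let ?Z = "\<Inter>f\<in>F. {x. f (cvec x) = 0}"
  have "Topological_Spaces.closed {x. f (cvec x) = 0}" if "f \<in> F" for f
  proof -
    from bspec[OF F(1) that] obtain d where "hom_poly d f" by (elim exE)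
    then show ?thesis
      by (intro closed_Collect_eq continuous_on_const continuous_on_compose2[OF continuous_on_hom_poly continuous_on_cvec]) auto
  qed
  then have "Topological_Spaces.closed ?Z" by (intro closed_INT) simp
  moreover have c0: "cvec x = 0 \<longleftrightarrow> x = 0" for x :: "real^'n" by (metis cvec_inj cvec_simps(4))
  have "real_points V = ?Z - {0}" unfolding F(2) by (auto simp: real_points_def c0)
  ultimately show ?thesis by blast
qed

end

text \<open>\<open>B\<close> is a branch attached to \<open>V1\<close>: its span meets the span of
  the remaining components inside that of \<open>V1\<close>. Cardinality is minimal over all
  branches at all components, so a smaller branch attached anywhere else is a contradiction
  too.\<close>

locale leaf_pair = sos X for X :: "(complex^'n::finite) set" +
  fixes V1 :: "(complex^'n) set" and B :: "(complex^'n) set set"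
  assumes V1: "V1 \<in> irr_components X" and B: "B \<subseteq> irr_components X" "V1 \<notin> B" "B \<noteq> {}"
    and pair: "\<And>x. x \<in> span (RB B) \<Longrightarrow> x \<in> span (RB (irr_components X - B)) \<Longrightarrow> x \<in> Sp V1"
    and minimal: "\<And>V' B'. V' \<in> irr_components X \<Longrightarrow> B' \<subseteq> irr_components X \<Longrightarrow> V' \<notin> B' \<Longrightarrow> B' \<noteq> {} \<Longrightarrow>
      (\<And>x. x \<in> span (RB B') \<Longrightarrow> x \<in> span (RB (irr_components X - B')) \<Longrightarrow> x \<in> Sp V') \<Longrightarrow> card B \<le> card B'"
begin

definition "S1 = Sp V1"
definition "R = RB B - S1"

lemma subspace_S1: "subspace S1" by (simp add: S1_def Sp_def)

lemma finite_B: "finite B" using B(1) finite_CC finite_subset by blast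

lemma R_RX: "R \<subseteq> RX" using RB_subset[OF B(1)] by (auto simp: R_def)

lemma comp_span_off_S1:
  assumes k: "k \<in> B" shows "real_points k \<subseteq> span (real_points k - S1)"
proof (rule ccontr)
  assume "\<not> ?thesis"
  then have "\<not> Sp k \<subseteq> span (real_points k - S1)" unfolding Sp_def using span_superset by blast
  moreover have "\<not> Sp k \<subseteq> S1" unfolding S1_def using comp_not_in_span[of k V1] k B V1 by blast
  ultimately obtain y where "y \<in> real_points k" "y \<notin> span (real_points k - S1)" "y \<notin> S1"
    using comp_generic2[of k "span (real_points k - S1)" S1] k B(1) subspace_S1 by auto
  then show False using span_base[of y "real_points k - S1"] by auto
qed

lemma span_R: "span R = span (RB B)"
proof
  show "span R \<subseteq> span (RB B)" by (rule span_mono) (auto simp: R_def)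
  have "RB B \<subseteq> span R"
  proof
    fix x assume "x \<in> RB B"
    then obtain k where k: "k \<in> B" "x \<in> real_points k" by (auto simp: RB_def)
    have "span (real_points k - S1) \<subseteq> span R" by (rule span_mono) (use k in \<open>auto simp: R_def RB_def\<close>)
    then show "x \<in> span R" using comp_span_off_S1[OF k(1)] k(2) by blast
  qed
  then show "span (RB B) \<subseteq> span R" by (rule span_minimal) (rule subspace_span)
qed

text \<open>A basis modulo \<open>S1\<close> consisting of real points of the branch. Its members
  are points of \<open>X\<close>, so an exchange of members has geometric consequences.\<close>

definition "base b \<longleftrightarrow> finite b \<and> b \<subseteq> R \<and> indmod S1 (\<lambda>v. v) b \<and> (\<forall>x\<in>R. \<exists>a. x - (\<Sum>v\<in>b. a v *\<^sub>R v) \<in> S1)"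

definition "co b = (SOME p. \<forall>v\<in>b. (\<forall>u\<in>S1. p v \<bullet> u = 0) \<and> (\<forall>w\<in>b. p v \<bullet> w = (if w = v then 1 else 0)))"

text \<open>What remains of \<open>x\<close> after its \<open>b\<close>-part is removed, a vector of
  \<open>S1\<close> when \<open>x\<close> is in \<open>R\<close>. These remainders measure how the
  branch meets \<open>S1\<close>.\<close>

definition "zz b x = x - (\<Sum>v\<in>b. (co b v \<bullet> x) *\<^sub>R v)"

lemma co:
  assumes "base b" "v \<in> b"
  shows "u \<in> S1 \<Longrightarrow> co b v \<bullet> u = 0" "w \<in> b \<Longrightarrow> co b v \<bullet> w = (if w = v then 1 else 0)"
proof -
  have "\<exists>p. \<forall>i\<in>b. (\<forall>u\<in>S1. p i \<bullet> u = 0) \<and> (\<forall>k\<in>b. p i \<bullet> k = (if k = i then 1 else 0))"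
    by (rule indmod_dual[OF subspace_S1]) (use assms(1) in \<open>auto simp: base_def\<close>)
  from someI_ex[OF this, folded co_def] assms(2)
  show "u \<in> S1 \<Longrightarrow> co b v \<bullet> u = 0" "w \<in> b \<Longrightarrow> co b v \<bullet> w = (if w = v then 1 else 0)" by simp_all
qed

lemma base_unique:
  assumes b: "base b" and x: "x = (\<Sum>v\<in>b. a v *\<^sub>R v) + z" "z \<in> S1"
  shows "v \<in> b \<Longrightarrow> co b v \<bullet> x = a v" "zz b x = z"
proof -
  have fin: "finite b" using b by (simp add: base_def)
  have co': "co b v \<bullet> x = a v" if "v \<in> b" for v
  proof -
    have "co b v \<bullet> x = (\<Sum>w\<in>b. a w * (co b v \<bullet> w))"
      unfolding x(1) using co(1)[OF b that x(2)] by (simp add: inner_add_right inner_sum_right)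
    also have "\<dots> = (\<Sum>w\<in>b. if w = v then a v else 0)" using co(2)[OF b that] by (intro sum.cong) auto
    finally show ?thesis using fin that by simp
  qed
  then show "v \<in> b \<Longrightarrow> co b v \<bullet> x = a v" .
  have "(\<Sum>v\<in>b. (co b v \<bullet> x) *\<^sub>R v) = (\<Sum>v\<in>b. a v *\<^sub>R v)" by (rule sum.cong) (auto simp: co')
  then show "zz b x = z" unfolding zz_def x(1) by simp
qed

lemma zz_decomp: "x = (\<Sum>v\<in>b. (co b v \<bullet> x) *\<^sub>R v) + zz b x" by (simp add: zz_def)

lemma linear_zz: "linear (zz b)"
  unfolding zz_def by (rule linearI) (simp_all add: inner_add_right algebra_simps sum.distrib scaleR_sum_right)

lemma zz_S1: "base b \<Longrightarrow> u \<in> S1 \<Longrightarrow> zz b u = u"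
  using base_unique(2)[of b u "\<lambda>_. 0" u] by simp

lemma zz_in_S1: assumes b: "base b" and x: "x \<in> R" shows "zz b x \<in> S1"
proof -
  obtain a where a: "x - (\<Sum>v\<in>b. a v *\<^sub>R v) \<in> S1" using b x by (auto simp: base_def)
  have "zz b x = x - (\<Sum>v\<in>b. a v *\<^sub>R v)"
    by (rule base_unique(2)[OF b _ a]) simp
  then show ?thesis using a by simp
qed

lemma base_exists: assumes "e \<in> R" shows "\<exists>b. base b \<and> e \<in> b"
proof -
  let ?Q = "\<lambda>b. finite b \<and> b \<subseteq> R \<and> e \<in> b \<and> indmod S1 (\<lambda>v. v) b"
  have bound: "card b \<le> CARD('n)" if "?Q b" for b
  proof -
    have "indmod {0} (\<lambda>v. v) b" by (rule indmod_mono[of S1 _ b]) (use that subspace_0[OF subspace_S1] in auto)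
    from indmod_zero_independent(2)[OF this] have "independent b" using that by simp
    then show ?thesis using independent_bound[of b] by simp
  qed
  have "indmod S1 (\<lambda>v. v) {e}" unfolding indmod_def
  proof (intro allI impI ballI)
    fix a j assume a: "(\<Sum>j\<in>{e}. a j *\<^sub>R j) \<in> S1" "j \<in> {e}"
    show "a j = 0"
    proof (rule ccontr)
      assume "a j \<noteq> 0"
      then have "e = (1 / a e) *\<^sub>R (a e *\<^sub>R e)" using a(2) by simp
      moreover have "(1 / a e) *\<^sub>R (a e *\<^sub>R e) \<in> S1" by (rule subspace_scale[OF subspace_S1]) (use a(1) in simp)
      ultimately show False using assms by (simp add: R_def)
    qed
  qed
  then have "?Q {e}" using assms by simp
  then have ex: "\<exists>n b. ?Q b \<and> card b = n" by blast
  have bd: "\<And>n. \<exists>b. ?Q b \<and> card b = n \<Longrightarrow> n \<le> CARD('n)" using bound by blast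
  from GreatestI_ex_nat[OF ex bd] obtain b where b: "?Q b" "card b = (GREATEST n. \<exists>b. ?Q b \<and> card b = n)" by blast
  have max: "card b' \<le> card b" if "?Q b'" for b'
  proof -
    have "\<exists>b. ?Q b \<and> card b = card b'" by (intro exI[of _ b'] conjI refl) (use that in simp_all)
    from Greatest_le_nat[of "\<lambda>n. \<exists>b. ?Q b \<and> card b = n", OF this bd] show ?thesis unfolding b(2) .
  qed
  have "\<exists>a. x - (\<Sum>v\<in>b. a v *\<^sub>R v) \<in> S1" if x: "x \<in> R" for x
  proof (rule ccontr)
    assume no: "\<not> ?thesis"
    have nb: "x \<notin> b"
    proof
      assume "x \<in> b"
      then have "(\<Sum>v\<in>b. (if v = x then 1 else 0) *\<^sub>R v) = x" using b(1) by (simp add: if_distrib if_distribR cong: if_cong)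
      then have "x - (\<Sum>v\<in>b. (if v = x then 1 else 0) *\<^sub>R v) \<in> S1" using subspace_0[OF subspace_S1] by simp
      then show False using no by (elim notE) (rule exI)
    qed
    have "indmod S1 (\<lambda>v. v) (insert x b)"
    proof (rule indmod_insert[OF subspace_S1])
      fix a u assume u: "u \<in> S1"
      show "x \<noteq> u + (\<Sum>j\<in>b. a j *\<^sub>R j)"
      proof
        assume "x = u + (\<Sum>j\<in>b. a j *\<^sub>R j)"
        then have "x - (\<Sum>j\<in>b. a j *\<^sub>R j) \<in> S1" using u by simp
        then show False using no by (elim notE) (rule exI)
      qed
    qed (use b(1) nb in auto)
    then have "card (insert x b) \<le> card b" using b(1) x by (intro max) auto
    then show False using b(1) nb by simp
  qed
  then show ?thesis using b(1) by (intro exI[of _ b]) (simp add: base_def)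
qed

lemma swap:
  assumes b: "base b" and v1: "v1 \<in> b" and x1: "x1 \<in> R" and nz: "co b v1 \<bullet> x1 \<noteq> 0"
  defines "b' \<equiv> insert x1 (b - {v1})"
  shows "base b'"
    and "x \<in> span R \<Longrightarrow> v \<in> b - {v1} \<Longrightarrow> co b' v \<bullet> x = co b v \<bullet> x - (co b v1 \<bullet> x / (co b v1 \<bullet> x1)) * (co b v \<bullet> x1)"
    and "x \<in> span R \<Longrightarrow> zz b' x = zz b x - (co b v1 \<bullet> x / (co b v1 \<bullet> x1)) *\<^sub>R zz b x1"
proof -
  have fin: "finite b" and bR: "b \<subseteq> R" using b by (auto simp: base_def)
  have x1b: "x1 \<notin> b - {v1}"
  proof
    assume "x1 \<in> b - {v1}"
    then have "co b v1 \<bullet> x1 = 0" using co(2)[OF b v1, of x1] by auto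
    then show False using nz by simp
  qed
  have sum': "(\<Sum>v\<in>b'. f v) = f x1 + (\<Sum>v\<in>b - {v1}. f v)" for f :: "real^'n \<Rightarrow> real^'n"
    unfolding b'_def using fin x1b by simp
  define a' where "a' x v = (if v = x1 then co b v1 \<bullet> x / (co b v1 \<bullet> x1)
     else co b v \<bullet> x - (co b v1 \<bullet> x / (co b v1 \<bullet> x1)) * (co b v \<bullet> x1))" for x v
  define z' where "z' x = zz b x - (co b v1 \<bullet> x / (co b v1 \<bullet> x1)) *\<^sub>R zz b x1" for x
  have dec: "x = (\<Sum>v\<in>b'. a' x v *\<^sub>R v) + z' x" for x
  proof -
    let ?r = "co b v1 \<bullet> x / (co b v1 \<bullet> x1)"
    have "(\<Sum>v\<in>b - {v1}. a' x v *\<^sub>R v) = (\<Sum>v\<in>b - {v1}. (co b v \<bullet> x) *\<^sub>R v - ?r *\<^sub>R ((co b v \<bullet> x1) *\<^sub>R v))"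
      using x1b by (intro sum.cong) (auto simp: a'_def scaleR_diff_left)
    then have s: "(\<Sum>v\<in>b - {v1}. a' x v *\<^sub>R v) = (\<Sum>v\<in>b - {v1}. (co b v \<bullet> x) *\<^sub>R v) - ?r *\<^sub>R (\<Sum>v\<in>b - {v1}. (co b v \<bullet> x1) *\<^sub>R v)"
      by (simp add: sum_subtractf scaleR_sum_right)
    have rem: "(\<Sum>v\<in>b. (co b v \<bullet> y) *\<^sub>R v) = (co b v1 \<bullet> y) *\<^sub>R v1 + (\<Sum>v\<in>b - {v1}. (co b v \<bullet> y) *\<^sub>R v)" for y
      by (rule sum.remove[OF fin v1])
    have e1: "zz b x1 = x1 - (co b v1 \<bullet> x1) *\<^sub>R v1 - (\<Sum>v\<in>b - {v1}. (co b v \<bullet> x1) *\<^sub>R v)" unfolding zz_def rem by simp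
    have e2: "zz b x = x - (co b v1 \<bullet> x) *\<^sub>R v1 - (\<Sum>v\<in>b - {v1}. (co b v \<bullet> x) *\<^sub>R v)" unfolding zz_def rem by simp
    have "?r *\<^sub>R ((co b v1 \<bullet> x1) *\<^sub>R v1) = (co b v1 \<bullet> x) *\<^sub>R v1" using nz by simp
    then have "?r *\<^sub>R zz b x1 = ?r *\<^sub>R x1 - (co b v1 \<bullet> x) *\<^sub>R v1 - ?r *\<^sub>R (\<Sum>v\<in>b - {v1}. (co b v \<bullet> x1) *\<^sub>R v)"
      unfolding e1 by (simp only: scaleR_diff_right)
    then show ?thesis unfolding sum' s z'_def e2 by (simp add: a'_def)
  qed
  have zR: "z' x \<in> S1" if "x \<in> R" for x
    unfolding z'_def using zz_in_S1[OF b that] zz_in_S1[OF b x1]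
    by (simp add: subspace_diff[OF subspace_S1] subspace_scale[OF subspace_S1])
  have lin: "linear z'"
    unfolding z'_def
    by (rule linearI) (simp_all add: linear_add[OF linear_zz] linear_scale[OF linear_zz] inner_add_right add_divide_distrib scaleR_add_left scaleR_diff_right)
  have zspan: "z' x \<in> S1" if "x \<in> span R" for x
    using that
  proof (induction rule: span_induct)
    case base
    show ?case using subspace_S1 by (auto simp: subspace_def linear_0[OF lin] linear_add[OF lin] linear_scale[OF lin])
  qed (rule zR)
  have ind: "indmod S1 (\<lambda>v. v) b'"
    unfolding indmod_def
  proof (intro allI impI ballI)
    fix a j assume a: "(\<Sum>j\<in>b'. a j *\<^sub>R j) \<in> S1" and j: "j \<in> b'"
    let ?y = "\<Sum>j\<in>b'. a j *\<^sub>R j"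
    have y: "co b v \<bullet> ?y = a x1 * (co b v \<bullet> x1) + (\<Sum>w\<in>b - {v1}. a w * (co b v \<bullet> w))" for v
      unfolding sum' by (simp add: inner_add_right inner_sum_right)
    have "(\<Sum>w\<in>b - {v1}. a w * (co b v1 \<bullet> w)) = 0" using co(2)[OF b v1] by (intro sum.neutral) auto
    then have "a x1 * (co b v1 \<bullet> x1) = 0" using y[of v1] co(1)[OF b v1 a] by simp
    then have ax: "a x1 = 0" using nz by simp
    show "a j = 0"
    proof (cases "j = x1")
      case False
      then have jb: "j \<in> b - {v1}" using j by (simp add: b'_def)
      have "(\<Sum>w\<in>b - {v1}. a w * (co b j \<bullet> w)) = (\<Sum>w\<in>b - {v1}. if w = j then a j else 0)"
        using co(2)[OF b, of j] jb by (intro sum.cong) auto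
      then have "co b j \<bullet> ?y = a j" unfolding y ax using jb fin by simp
      then show ?thesis using co(1)[OF b _ a, of j] jb by simp
    qed (use ax in simp)
  qed
  show base': "base b'"
    unfolding base_def
  proof (intro conjI ballI ind)
    show "finite b'" "b' \<subseteq> R" using fin bR x1 by (auto simp: b'_def)
    fix x assume "x \<in> R"
    then have "z' x \<in> S1" by (rule zR)
    moreover have "x - (\<Sum>v\<in>b'. a' x v *\<^sub>R v) = z' x" using dec[of x] by (metis add_diff_cancel_left')
    ultimately show "\<exists>a. x - (\<Sum>v\<in>b'. a v *\<^sub>R v) \<in> S1" by (intro exI[of _ "a' x"]) simp
  qed
  show "co b' v \<bullet> x = co b v \<bullet> x - (co b v1 \<bullet> x / (co b v1 \<bullet> x1)) * (co b v \<bullet> x1)" if "x \<in> span R" "v \<in> b - {v1}"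
  proof -
    have "v \<in> b'" "v \<noteq> x1" using that(2) x1b by (auto simp: b'_def)
    then show ?thesis using base_unique(1)[OF base' dec zspan[OF that(1)], of v] by (simp add: a'_def)
  qed
  show "zz b' x = zz b x - (co b v1 \<bullet> x / (co b v1 \<bullet> x1)) *\<^sub>R zz b x1" if "x \<in> span R"
    using base_unique(2)[OF base' dec zspan[OF that]] by (simp add: z'_def)
qed

text \<open>\<open>x\<close> and the basis points in its support have a span that meets
  \<open>S1\<close> exactly in the line of the remainder, so \<open>separation\<close> puts the
  remainder on \<open>V1\<close>. It is also not isolated in that span; nearby points are off
  \<open>S1\<close>, hence on components of \<open>B\<close>, and these are closed and finite in
  number.\<close>

lemma key1:
  assumes b: "base b" and x: "x \<in> R" and nz: "zz b x \<noteq> 0"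
  shows "zz b x \<in> real_points V1" "\<exists>k\<in>B. zz b x \<in> real_points k"
proof -
  define z where "z = zz b x"
  define s where "s = {v\<in>b. co b v \<bullet> x \<noteq> 0}"
  have fin: "finite b" and bR: "b \<subseteq> R" using b by (auto simp: base_def)
  have fs: "finite s" and sb: "s \<subseteq> b" using fin by (auto simp: s_def)
  have zS: "z \<in> S1" unfolding z_def by (rule zz_in_S1[OF b x])
  have dec: "x = (\<Sum>v\<in>s. (co b v \<bullet> x) *\<^sub>R v) + z"
  proof -
    have "(\<Sum>v\<in>b. (co b v \<bullet> x) *\<^sub>R v) = (\<Sum>v\<in>s. (co b v \<bullet> x) *\<^sub>R v)"
      by (rule sum.mono_neutral_right) (use fin in \<open>auto simp: s_def\<close>)
    then show ?thesis using zz_decomp[of x b] by (simp add: z_def)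
  qed
  define Q where "Q = insert x s"
  have finQ: "finite Q" and QX: "Q \<subseteq> RX" using fs sb bR x R_RX by (auto simp: Q_def)
  have xs: "x \<notin> s"
  proof
    assume xs: "x \<in> s"
    have "x = (\<Sum>v\<in>b. (if v = x then 1 else 0) *\<^sub>R v) + 0" using fin xs sb by (auto simp: if_distrib if_distribR cong: if_cong)
    from base_unique(2)[OF b this subspace_0[OF subspace_S1]] show False using nz by simp
  qed
  have zx: "x - (\<Sum>v\<in>s. (co b v \<bullet> x) *\<^sub>R v) = z" using dec by (metis add_diff_cancel_left')
  have zQ: "z \<in> span Q" unfolding zx[symmetric]
    by (intro span_diff span_sum span_scale span_base) (auto simp: Q_def)
  \<comment> \<open>The support is independent modulo \<open>S1\<close>, so up to a factor the only
    relation modulo \<open>S1\<close> is the one that defines \<open>z\<close>.\<close>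
  have cap: "y \<in> span {z}" if y: "y \<in> span Q" "y \<in> S1" for y
  proof -
    have "y \<in> span ((\<lambda>v. v) ` Q)" using y(1) by simp
    from span_image_sum[OF finQ this] obtain m where m: "y = (\<Sum>v\<in>Q. m v *\<^sub>R v)" by blast
    have m': "y = m x *\<^sub>R x + (\<Sum>v\<in>s. m v *\<^sub>R v)" unfolding m Q_def using fs xs by simp
    have "m v = - m x * (co b v \<bullet> x)" if v: "v \<in> s" for v
    proof -
      have vb: "v \<in> b" using v sb by blast
      have "(\<Sum>w\<in>s. m w * (co b v \<bullet> w)) = (\<Sum>w\<in>s. if w = v then m v else 0)"
        using co(2)[OF b vb] sb by (intro sum.cong) auto
      then have "co b v \<bullet> y = m x * (co b v \<bullet> x) + m v"
        unfolding m' using fs v by (simp add: inner_add_right inner_sum_right)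
      then show ?thesis using co(1)[OF b vb y(2)] by simp
    qed
    then have "(\<Sum>v\<in>s. m v *\<^sub>R v) = - (m x *\<^sub>R (\<Sum>v\<in>s. (co b v \<bullet> x) *\<^sub>R v))"
      by (simp add: scaleR_sum_right sum_negf[symmetric])
    then have "y = m x *\<^sub>R (x - (\<Sum>v\<in>s. (co b v \<bullet> x) *\<^sub>R v))" unfolding m' by (simp add: scaleR_diff_right)
    also have "\<dots> = m x *\<^sub>R z" unfolding zx ..
    finally show ?thesis by (simp add: span_base span_scale)
  qed
  have z0: "z \<noteq> 0" using nz by (simp add: z_def)
  have z1: "z \<in> real_points V1"
    by (rule comp_separation[OF V1 _ z0 finQ QX zQ]) (use zS cap in \<open>auto simp: S1_def\<close>)
  then show "zz b x \<in> real_points V1" by (simp add: z_def)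
  have zX: "z \<in> RX" using z1 RB_subset[of "{V1}"] V1 by (auto simp: RB_def)
  have Qn: "q \<notin> span {z}" if "q \<in> Q" for q
  proof
    assume "q \<in> span {z}"
    then have "q \<in> S1" using zS span_minimal[of "{z}" S1] subspace_S1 by blast
    then show False using that sb bR x by (auto simp: Q_def R_def)
  qed
  have QR: "span Q \<subseteq> span (RB B)" unfolding span_R[symmetric] by (rule span_mono) (use sb bR x in \<open>auto simp: Q_def\<close>)
  have "\<forall>k\<in>B. \<exists>Z. Topological_Spaces.closed Z \<and> real_points k = Z - {0}"
    using real_points_closed_set comp_closed B(1) by blast
  from bchoice[OF this] obtain Z where Z: "\<forall>k\<in>B. Topological_Spaces.closed (Z k) \<and> real_points k = Z k - {0}" by (elim exE)
  have clZ: "Topological_Spaces.closed (\<Union>k\<in>B. Z k)" using Z finite_B by (intro closed_UN) auto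
  have "z \<in> closure (\<Union>k\<in>B. Z k)"
    unfolding closure_approachable
  proof (intro allI impI)
    fix \<eta> :: real assume "\<eta> > 0"
    have "\<exists>u. u \<noteq> 0 \<and> u \<bullet> z = 0 \<and> norm u < \<eta> \<and> u \<in> span Q \<and> z + u \<in> RX"
      by (rule not_isolated[OF zX finQ QX zQ _ \<open>\<eta> > 0\<close>]) (rule Qn)
    then obtain u where u: "u \<noteq> 0" "u \<bullet> z = 0" "norm u < \<eta>" "u \<in> span Q" "z + u \<in> RX"
      by (elim exE conjE)
    have zu: "z + u \<in> span Q" using zQ u(4) span_add by blast
    have nS: "z + u \<notin> S1"
    proof
      assume "z + u \<in> S1"
      then have "z + u \<in> span {z}" by (rule cap[OF zu])
      then obtain c where "z + u = c *\<^sub>R z" by (auto simp: span_singleton)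
      then have uc: "u = (c - 1) *\<^sub>R z" by (metis add_diff_cancel_left' scaleR_diff_left scaleR_one)
      then have "(c - 1) * (z \<bullet> z) = 0" using u(2) by simp
      then have "c - 1 = 0" using z0 by simp
      then show False using uc u(1) by simp
    qed
    obtain k where k: "k \<in> CC" "z + u \<in> real_points k" using u(5) RX_RB by (auto simp: RB_def)
    \<comment> \<open>A point of the span of \<open>B\<close> on a component outside
      \<open>B\<close> lies in \<open>S1\<close> by \<open>pair\<close>, but \<open>z + u\<close>
      does not.\<close>
    have "k \<in> B"
    proof (rule ccontr)
      assume "k \<notin> B"
      then have "z + u \<in> span (RB (CC - B))" using k by (intro span_base) (auto simp: RB_def)
      then have "z + u \<in> S1" unfolding S1_def using pair zu QR by blast
      then show False using nS by simp
    qed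
    then have "z + u \<in> (\<Union>k\<in>B. Z k)" using Z k(2) by blast
    then show "\<exists>y\<in>\<Union>k\<in>B. Z k. dist y z < \<eta>" using u(3) by (intro bexI[of _ "z + u"]) (simp_all add: dist_norm)
  qed
  then have "z \<in> (\<Union>k\<in>B. Z k)" using closure_closed[OF clZ] by simp
  then obtain k where "k \<in> B" "z \<in> Z k" by blast
  then have "z \<in> real_points k" using Z z0 by simp
  then show "\<exists>k\<in>B. zz b x \<in> real_points k" using \<open>k \<in> B\<close> by (auto simp: z_def)
qed

end

text \<open>\<open>V2\<close> has an overlap with \<open>S1\<close> of maximal dimension in the
  branch, so that an inclusion of its overlap into that of another component is an equality.\<close>

locale leaf_max = leaf_pair X V1 B for X :: "(complex^'n::finite) set" and V1 B +
  fixes V2 :: "(complex^'n) set" and e :: "real^'n"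
  assumes V2: "V2 \<in> B" and V2_max: "\<And>k. k \<in> B \<Longrightarrow> dim (S1 \<inter> Sp k) \<le> dim (S1 \<inter> Sp V2)"
    and e: "e \<in> real_points V2" "e \<notin> S1"
begin

abbreviation "Lam k \<equiv> S1 \<inter> Sp k"

lemma subspace_Lam: "subspace (Lam k)"
  by (intro subspace_inter subspace_S1) (simp add: Sp_def)

lemma e_R: "e \<in> R" using e V2 by (auto simp: R_def RB_def)

lemma V2_CC: "V2 \<in> CC" using V2 B by blast

lemma zz_basis: assumes b: "base b" and v: "v \<in> b" shows "zz b v = 0"
proof -
  have "v = (\<Sum>w\<in>b. (if w = v then 1 else 0) *\<^sub>R w) + 0"
    using b v by (simp add: base_def if_distrib if_distribR cong: if_cong)
  from base_unique(2)[OF b this subspace_0[OF subspace_S1]] show ?thesis .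
qed

lemma off_hyperplane_R:
  assumes b: "base b" "e \<in> b" and y: "y \<in> real_points V2" "co b e \<bullet> y \<noteq> 0" shows "y \<in> R"
proof -
  have "y \<notin> S1" using co(1)[OF b, of y] y(2) by blast
  then show ?thesis using y(1) V2 by (auto simp: R_def RB_def)
qed

text \<open>Exchange \<open>e\<close> for a generic point \<open>y\<close> of \<open>V2\<close>. Up
  to a factor the new remainder of \<open>x\<close> is \<open>\<phi> y\<close>, which lies in some
  \<open>Lam k\<close> by \<open>key1\<close>. As there are finitely many \<open>k\<close>, one of
  them serves all of \<open>Sp V2\<close>, and the value at \<open>y = e\<close> is the old
  remainder.\<close>

lemma key2:
  assumes b: "base b" "e \<in> b" and x: "x \<in> R" "co b e \<bullet> x \<noteq> 0" shows "zz b x \<in> Lam V2"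
proof -
  define \<alpha> where "\<alpha> = co b e \<bullet> x"
  define \<phi> where "\<phi> y = (co b e \<bullet> y) *\<^sub>R zz b x - \<alpha> *\<^sub>R zz b y" for y
  have lin: "linear \<phi>" unfolding \<phi>_def
    by (rule linearI) (simp_all add: linear_add[OF linear_zz] linear_scale[OF linear_zz] inner_add_right algebra_simps)
  define U where "U i = (case i of None \<Rightarrow> {y. co b e \<bullet> y = 0} | Some k \<Rightarrow> \<phi> -` Lam k)" for i
  have ee: "co b e \<bullet> e = 1" using co(2)[OF b b(2)] by simp
  have eS: "e \<in> Sp V2" unfolding Sp_def using e(1) by (rule span_base)
  have "\<exists>k\<in>B. Sp V2 \<subseteq> \<phi> -` Lam k"
  proof (rule ccontr)
    assume no: "\<not> ?thesis"
    have "\<exists>y\<in>real_points V2. \<forall>i\<in>insert None (Some ` B). y \<notin> U i"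
    proof (rule comp_generic[OF V2_CC])
      show "finite (insert None (Some ` B))" using finite_B by simp
      fix i assume i: "i \<in> insert None (Some ` B)"
      show "subspace (U i)"
        using subspace_hyperplane[of "co b e"] linear_subspace_vimage[OF lin subspace_Lam] by (cases i) (simp_all add: U_def)
      show "\<not> Sp V2 \<subseteq> U i" using i no ee eS by (cases i) (auto simp: U_def)
    qed
    then obtain y where y: "y \<in> real_points V2" "\<forall>i\<in>insert None (Some ` B). y \<notin> U i" by (elim bexE)
    have a: "co b e \<bullet> y \<noteq> 0" using y(2) by (auto simp: U_def)
    have nL: "\<phi> y \<notin> Lam k" if "k \<in> B" for k
    proof -
      have "Some k \<in> insert None (Some ` B)" using that by simp
      then have "y \<notin> U (Some k)" using y(2) by blast
      then show ?thesis by (simp add: U_def)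
    qed
    have yR: "y \<in> R" by (rule off_hyperplane_R[OF b y(1) a])
    let ?b' = "insert y (b - {e})"
    have b': "base ?b'" by (rule swap(1)[OF b yR a])
    have zz': "zz ?b' x = zz b x - (\<alpha> / (co b e \<bullet> y)) *\<^sub>R zz b y"
      unfolding \<alpha>_def by (rule swap(3)[OF b yR a]) (rule span_base[OF x(1)])
    have \<phi>y: "\<phi> y = (co b e \<bullet> y) *\<^sub>R zz ?b' x" unfolding zz' \<phi>_def using a by (simp add: scaleR_diff_right)
    have "\<exists>k\<in>B. zz ?b' x \<in> Lam k"
    proof (cases "zz ?b' x = 0")
      case True
      obtain k where "k \<in> B" using B(3) by blast
      then show ?thesis using True subspace_0[OF subspace_Lam] by (intro bexI[of _ k]) simp_all
    next
      case False
      then obtain k where k: "k \<in> B" "zz ?b' x \<in> real_points k" using key1(2)[OF b' x(1)] by blast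
      then have "zz ?b' x \<in> Sp k" unfolding Sp_def by (intro span_base)
      then show ?thesis using k(1) zz_in_S1[OF b' x(1)] by blast
    qed
    then obtain k where k: "k \<in> B" "zz ?b' x \<in> Lam k" by blast
    then have "\<phi> y \<in> Lam k" unfolding \<phi>y using subspace_scale[OF subspace_Lam] by blast
    then show False using nL[OF k(1)] by simp
  qed
  then obtain k where k: "k \<in> B" "Sp V2 \<subseteq> \<phi> -` Lam k" by blast
  \<comment> \<open>On the overlap \<open>Lam V2\<close> the map \<open>\<phi>\<close> is
    multiplication by \<open>- \<alpha>\<close>, which is nonzero; maximality then gives equality of
    the overlaps.\<close>
  have "Lam V2 \<subseteq> Lam k"
  proof
    fix l assume l: "l \<in> Lam V2"
    then have "\<phi> l = (- \<alpha>) *\<^sub>R l" using co(1)[OF b, of l] zz_S1[OF b(1), of l] by (simp add: \<phi>_def)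
    moreover have "\<phi> l \<in> Lam k" using k(2) l by blast
    ultimately have "(1 / - \<alpha>) *\<^sub>R ((- \<alpha>) *\<^sub>R l) \<in> Lam k" using subspace_scale[OF subspace_Lam] by metis
    then show "l \<in> Lam k" using x(2) by (simp add: \<alpha>_def)
  qed
  then have eq: "Lam V2 = Lam k"
    by (intro subspace_dim_equal subspace_Lam) (use V2_max[OF k(1)] in auto)
  have "\<phi> e = zz b x" using ee zz_basis[OF b] by (simp add: \<phi>_def)
  then show ?thesis using k(2) eS unfolding eq by auto
qed

lemma zz_quadric:
  assumes b: "base b" and x: "x \<in> R" and A: "A \<in> ideal2 X" shows "rqform A (zz b x) = 0"
proof (cases "zz b x = 0")
  case True then show ?thesis by (simp add: rqform_def)
next
  case False
  then have "zz b x \<in> RX" using key1(1)[OF b x] RB_subset[of "{V1}"] V1 by (auto simp: RB_def)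
  then show ?thesis by (rule ideal2_real_points[OF A])
qed

text \<open>After exchanging \<open>e\<close> for \<open>y\<close>, the remainder of
  \<open>x\<close> is a combination of the two old remainders, with both coefficients nonzero. All
  three are zeros of the quadric, so the mixed term vanishes.\<close>

lemma zz_polar:
  assumes b: "base b" "e \<in> b" and x: "x \<in> R" "co b e \<bullet> x \<noteq> 0" and y: "y \<in> R" "co b e \<bullet> y \<noteq> 0" and A: "A \<in> ideal2 X"
  shows "rbf A (zz b x) (zz b y) = 0"
proof -
  let ?b' = "insert y (b - {e})" and ?t = "- (co b e \<bullet> x / (co b e \<bullet> y))"
  have b': "base ?b'" by (rule swap(1)[OF b y])
  have "zz ?b' x = zz b x + ?t *\<^sub>R zz b y"
    using swap(3)[OF b y span_base[OF x(1)]] by simp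
  then have "rqform A (zz b x + ?t *\<^sub>R zz b y) = 0" using zz_quadric[OF b' x(1) A] by simp
  then have "?t * rbf A (zz b x) (zz b y) = 0"
    unfolding rqform_add rqform_scale linear_scale[OF linear_rbf]
      zz_quadric[OF b(1) x(1) A] zz_quadric[OF b(1) y(1) A] by simp
  then show ?thesis using x(2) y(2) by simp
qed

text \<open>\<open>l\<close> lies in the span of points of \<open>V2\<close> with nonzero coordinate
  at \<open>e\<close>, and \<open>zz b\<close> fixes it. Remainders of such points are pairwise
  polar, so every quadric through \<open>X\<close> vanishes at \<open>l\<close>.\<close>

lemma Lam_RX: assumes l: "l \<in> Lam V2" "l \<noteq> 0" shows "l \<in> RX"
proof -
  obtain b where b: "base b" "e \<in> b" using base_exists[OF e_R] by blast
  define R2 where "R2 = {y\<in>real_points V2. co b e \<bullet> y \<noteq> 0}"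
  have R2R: "y \<in> R \<and> co b e \<bullet> y \<noteq> 0" if "y \<in> R2" for y
    using that off_hyperplane_R[OF b] by (simp add: R2_def)
  have "Sp V2 \<subseteq> span R2"
  proof (rule ccontr)
    assume "\<not> ?thesis"
    moreover have "\<not> Sp V2 \<subseteq> {y. co b e \<bullet> y = 0}"
    proof
      assume "Sp V2 \<subseteq> {y. co b e \<bullet> y = 0}"
      moreover have "e \<in> Sp V2" unfolding Sp_def using e(1) by (rule span_base)
      ultimately show False using co(2)[OF b b(2)] by auto
    qed
    ultimately obtain y where "y \<in> real_points V2" "y \<notin> span R2" "y \<notin> {y. co b e \<bullet> y = 0}"
      using comp_generic2[OF V2_CC subspace_span subspace_hyperplane] by blast
    then show False using span_base[of y R2] by (simp add: R2_def)
  qed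
  then have lR: "l \<in> span R2" using l(1) by blast
  show ?thesis
  proof (rule quadrics_cut_real_points[OF l(2)])
    fix A assume A: "A \<in> ideal2 X"
    have 1: "rbf A (zz b x) (zz b y) = 0" if x: "x \<in> R2" and y: "y \<in> span R2" for x y
      using y
    proof (induction rule: span_induct)
      case base
      show ?case by (auto simp: subspace_def linear_0[OF linear_zz] linear_add[OF linear_zz] linear_scale[OF linear_zz]
          linear_0[OF linear_rbf] linear_add[OF linear_rbf] linear_scale[OF linear_rbf])
    next
      case (step y)
      then show ?case using zz_polar[OF b _ _ _ _ A] R2R x by blast
    qed
    have "rbf A (zz b l) (zz b y) = 0" if y: "y \<in> span R2" for y
      using lR
    proof (induction rule: span_induct)
      case base
      show ?case by (auto simp: subspace_def linear_0[OF linear_zz] linear_add[OF linear_zz] linear_scale[OF linear_zz]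
          linear_0[OF linear_rbf_left] linear_add[OF linear_rbf_left] linear_scale[OF linear_rbf_left])
    qed (use 1 y in blast)
    then have "rbf A l l = 0" using zz_S1[OF b(1)] l(1) lR by fastforce
    then show "rqform A l = 0" by (simp add: rbf_diag)
  qed
qed

text \<open>Points of \<open>R\<close> are adjacent if some basis vector occurs in both; each pair
  records such a basis vector and the next point.\<close>

primrec path :: "(real^'n) set \<Rightarrow> real^'n \<Rightarrow> ((real^'n) \<times> (real^'n)) list \<Rightarrow> bool" where
  "path b x [] = True"
| "path b x (p # ps) = (fst p \<in> b \<and> co b (fst p) \<bullet> x \<noteq> 0 \<and> co b (fst p) \<bullet> snd p \<noteq> 0 \<and> snd p \<in> R \<and> path b (snd p) ps)"

primrec endp :: "real^'n \<Rightarrow> ((real^'n) \<times> (real^'n)) list \<Rightarrow> real^'n" where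
  "endp x [] = x"
| "endp x (p # ps) = endp (snd p) ps"

lemma path_snoc:
  "path b x (ps @ [p]) \<longleftrightarrow> path b x ps \<and> fst p \<in> b \<and> co b (fst p) \<bullet> endp x ps \<noteq> 0 \<and> co b (fst p) \<bullet> snd p \<noteq> 0 \<and> snd p \<in> R"
  "endp x (ps @ [p]) = snd p"
  by (induction ps arbitrary: x) auto

lemma path_drop:
  "path b x (as @ p # cs) \<Longrightarrow> fst p \<in> b \<and> co b (fst p) \<bullet> snd p \<noteq> 0 \<and> snd p \<in> R \<and> path b (snd p) cs"
  "endp x (as @ p # cs) = endp (snd p) cs"
  by (induction as arbitrary: x) auto

lemma path_end_R: "x \<in> R \<Longrightarrow> path b x ps \<Longrightarrow> endp x ps \<in> R"
  by (induction ps arbitrary: x) auto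

lemma path_transfer:
  assumes "path b x ps" "x \<in> R" "\<And>p y. p \<in> set ps \<Longrightarrow> y \<in> R \<Longrightarrow> fst p \<in> b' \<and> co b' (fst p) \<bullet> y = co b (fst p) \<bullet> y"
  shows "path b' x ps"
  using assms by (induction ps arbitrary: x) auto

text \<open>Along a path from the point \<open>e\<close>, either a shortcut exists or the first basis vector can be exchanged
  for the first point of the path, which shortens the path with respect to the new basis.\<close>

lemma path_Lam:
  assumes "base b" "e \<in> b" "x \<in> R" "co b e \<bullet> x \<noteq> 0" "path b x ps"
  shows "zz b (endp x ps) \<in> Lam V2"
  using assms
proof (induction "length ps" arbitrary: ps b x rule: less_induct)
  case less
  note IH = less(1) and b = less(2,3) and x = less(4,5) and p = less(6)
  show ?case
  proof (cases ps)
    case Nil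
    then show ?thesis using key2[OF b x] by simp
  next
    case (Cons q ps')
    obtain v1 x2 where q: "q = (v1, x2)" by (cases q)
    have p1: "v1 \<in> b" "co b v1 \<bullet> x \<noteq> 0" "co b v1 \<bullet> x2 \<noteq> 0" "x2 \<in> R" "path b x2 ps'" using p Cons q by auto
    have en: "endp x ps = endp x2 ps'" using Cons q by simp
    consider (a) "co b e \<bullet> x2 \<noteq> 0" | (b) "co b e \<bullet> x2 = 0" "\<exists>p\<in>set ps'. co b (fst p) \<bullet> x \<noteq> 0"
      | (c) "co b e \<bullet> x2 = 0" "\<forall>p\<in>set ps'. co b (fst p) \<bullet> x = 0" by blast
    then show ?thesis
    proof cases
      case a
      then show ?thesis unfolding en by (intro IH[OF _ b p1(4) _ p1(5)]) (simp_all add: Cons)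
    next
      case b': b
      then obtain p where pp: "p \<in> set ps'" "co b (fst p) \<bullet> x \<noteq> 0" by blast
      from split_list[OF pp(1)] obtain as cs where ac: "ps' = as @ p # cs" by blast
      have "path b x (p # cs)" using path_drop(1)[of b x2 as p cs] p1(5) pp(2) ac by simp
      moreover have "endp x ps = endp x (p # cs)" unfolding en ac path_drop(2) by simp
      moreover have "length (p # cs) < length ps" by (simp add: Cons ac)
      ultimately show ?thesis using IH[of "p # cs", OF _ b x] by simp
    next
      case c
      let ?b' = "insert x (b - {v1})"
      have ne: "v1 \<noteq> e" using c(1) p1(3) by auto
      have b': "base ?b'" by (rule swap(1)[OF b(1) p1(1) x(1) p1(2)])
      have eb': "e \<in> ?b'" using b(2) ne by simp
      have co': "co ?b' v \<bullet> y = co b v \<bullet> y - (co b v1 \<bullet> y / (co b v1 \<bullet> x)) * (co b v \<bullet> x)" if "y \<in> R" "v \<in> b - {v1}" for v y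
        by (rule swap(2)[OF b(1) p1(1) x(1) p1(2) span_base[OF that(1)] that(2)])
      have "co ?b' e \<bullet> x2 \<noteq> 0" using co'[OF p1(4), of e] b(2) ne c(1) p1(2,3) x(2) by simp
      moreover have "path ?b' x2 ps'"
      proof (rule path_transfer[OF p1(5,4)])
        fix p y assume p: "p \<in> set ps'" "y \<in> R"
        from split_list[OF p(1)] obtain as cs where ac: "ps' = as @ p # cs" by blast
        have "fst p \<in> b" using path_drop(1)[of b x2 as p cs] p1(5) ac by simp
        moreover have "co b (fst p) \<bullet> x = 0" using c(2) p(1) by blast
        moreover from this have "fst p \<noteq> v1" using p1(2) by auto
        ultimately show "fst p \<in> ?b' \<and> co ?b' (fst p) \<bullet> y = co b (fst p) \<bullet> y" using co'[OF p(2), of "fst p"] by simp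
      qed
      ultimately have "zz ?b' (endp x2 ps') \<in> Lam V2" by (intro IH[OF _ b' eb' p1(4)]) (simp_all add: Cons)
      moreover have "zz ?b' (endp x2 ps') = zz b (endp x2 ps') - (co b v1 \<bullet> endp x2 ps' / (co b v1 \<bullet> x)) *\<^sub>R zz b x"
        by (rule swap(3)[OF b(1) p1(1) x(1) p1(2)]) (rule span_base[OF path_end_R[OF p1(4,5)]])
      moreover have "zz b x \<in> Lam V2" by (rule key2[OF b x])
      ultimately have "zz ?b' (endp x2 ps') + (co b v1 \<bullet> endp x2 ps' / (co b v1 \<bullet> x)) *\<^sub>R zz b x \<in> Lam V2"
        by (intro subspace_add[OF subspace_Lam] subspace_scale[OF subspace_Lam])
      then show ?thesis unfolding en \<open>zz ?b' (endp x2 ps') = _\<close> by simp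
    qed
  qed
qed

text \<open>If some basis vectors could not be reached from \<open>e\<close>, each component of the
  branch would avoid either the reached or the unreached ones, and the former kind would leave a
  smaller branch at \<open>V1\<close>. So every point is the end of a path, and
  \<open>path_Lam\<close> applies.\<close>

lemma all_zz:
  assumes b: "base b" "e \<in> b" and x: "x \<in> R" shows "zz b x \<in> Lam V2"
proof -
  have fin: "finite b" and bR: "b \<subseteq> R" using b by (auto simp: base_def)
  define b1 where "b1 = {v\<in>b. \<exists>x ps. x \<in> R \<and> co b e \<bullet> x \<noteq> 0 \<and> path b x ps \<and> co b v \<bullet> endp x ps \<noteq> 0}"
  have reach: "\<exists>x ps. x \<in> R \<and> co b e \<bullet> x \<noteq> 0 \<and> path b x ps \<and> endp x ps = y" if y: "y \<in> R" "v \<in> b1" "co b v \<bullet> y \<noteq> 0" for v y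
  proof -
    obtain x ps where xp: "x \<in> R" "co b e \<bullet> x \<noteq> 0" "path b x ps" "co b v \<bullet> endp x ps \<noteq> 0" "v \<in> b"
      using y(2) unfolding b1_def by blast
    then have "path b x (ps @ [(v, y)])" "endp x (ps @ [(v, y)]) = y" unfolding path_snoc using y by simp_all
    then show ?thesis using xp by blast
  qed
  have closed1: "w \<in> b1" if "y \<in> R" "v \<in> b1" "co b v \<bullet> y \<noteq> 0" "w \<in> b" "co b w \<bullet> y \<noteq> 0" for v w y
    using reach[OF that(1-3)] that(4,5) unfolding b1_def by blast
  have ee: "co b e \<bullet> e = 1" using co(2)[OF b b(2)] by simp
  have eb1: "e \<in> b1" unfolding b1_def using b(2) e_R ee
    by (intro CollectI conjI exI[of _ e] exI[of _ "[]"]) simp_all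
  define b2 where "b2 = b - b1"
  define U1 where "U1 = {y. \<forall>v\<in>b2. co b v \<bullet> y = 0}"
  define U2 where "U2 = {y. \<forall>v\<in>b1. co b v \<bullet> y = 0}"
  have sub: "subspace U1" "subspace U2" by (auto simp: subspace_def U1_def U2_def inner_add_right)
  have S1U: "S1 \<subseteq> U1" "S1 \<subseteq> U2" using co(1)[OF b(1)] by (auto simp: U1_def U2_def b1_def b2_def)
  have RU: "y \<in> U1 \<or> y \<in> U2" if "y \<in> R" for y
    using closed1[OF that] unfolding U1_def U2_def b2_def by blast
  have b12: "b1 \<subseteq> b" "b = b1 \<union> b2" by (auto simp: b1_def b2_def)
  have spanR: "y \<in> S1" if y: "y \<in> span R" "y \<in> U1" "y \<in> U2" for y
  proof -
    have "zz b y \<in> S1" using y(1)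
    proof (induction rule: span_induct)
      case base
      show ?case using subspace_S1 by (auto simp: subspace_def linear_0[OF linear_zz] linear_add[OF linear_zz] linear_scale[OF linear_zz])
    qed (rule zz_in_S1[OF b(1)])
    moreover have "(\<Sum>v\<in>b. (co b v \<bullet> y) *\<^sub>R v) = 0" using y(2,3) b12 unfolding U1_def U2_def by (intro sum.neutral) auto
    ultimately show ?thesis using zz_decomp[of y b] by simp
  qed
  have "b2 = {}"
  proof (rule ccontr)
    assume "b2 \<noteq> {}"
    then obtain v2 where v2: "v2 \<in> b2" by blast
    \<comment> \<open>The components supported on reached basis vectors. \<open>V2\<close> belongs
      to them because it contains \<open>e\<close>; a component through an unreached basis vector
      does not.\<close>
    define B' where "B' = {k\<in>B. Sp k \<subseteq> U1}"
    have part: "Sp k \<subseteq> U1 \<or> Sp k \<subseteq> U2" if k: "k \<in> B" for k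
    proof (rule ccontr)
      assume "\<not> ?thesis"
      then obtain y where y: "y \<in> real_points k" "y \<notin> U1" "y \<notin> U2" using comp_generic2[of k U1 U2] sub k B(1) by blast
      then have "y \<in> R" using k S1U by (auto simp: R_def RB_def)
      then show False using RU y by blast
    qed
    have "V2 \<in> B'"
    proof -
      have "e \<in> Sp V2" unfolding Sp_def using e(1) by (rule span_base)
      then have "\<not> Sp V2 \<subseteq> U2" using ee eb1 by (auto simp: U2_def)
      then show ?thesis using part[OF V2] V2 by (simp add: B'_def)
    qed
    have ne: "B' \<noteq> B"
    proof
      assume eq: "B' = B"
      obtain k where k: "k \<in> B" "v2 \<in> real_points k" using v2 bR by (auto simp: b2_def R_def RB_def)
      then have "v2 \<in> U1" using eq span_base[of v2 "real_points k"] by (auto simp: B'_def Sp_def)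
      then show False using v2 co(2)[OF b(1), of v2 v2] by (auto simp: U1_def b2_def)
    qed
    have B'B: "B' \<subseteq> B" by (auto simp: B'_def)
    have "card B \<le> card B'"
    proof (rule minimal[OF V1])
      show "B' \<subseteq> CC" "V1 \<notin> B'" "B' \<noteq> {}" using B'B B \<open>V2 \<in> B'\<close> by auto
      fix y assume y: "y \<in> span (RB B')" "y \<in> span (RB (CC - B'))"
      have yR: "y \<in> span R" unfolding span_R using y(1) span_mono[of "RB B'" "RB B"] B'B by (auto simp: RB_def)
      have yU1: "y \<in> U1"
      proof -
        have "RB B' \<subseteq> U1" using span_base by (fastforce simp: RB_def B'_def Sp_def)
        then show ?thesis using y(1) span_minimal[OF _ sub(1)] by blast
      qed
      \<comment> \<open>The complement of \<open>B'\<close> consists of the old complement, which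
        contributes only vectors of \<open>S1\<close>, and the rest of \<open>B\<close>, contained
        in \<open>U2\<close>. Within the span of \<open>R\<close>, the spaces \<open>U1\<close> and
        \<open>U2\<close> meet inside \<open>S1\<close>.\<close>
      have "RB (CC - B') \<subseteq> RB (B - B') \<union> RB (CC - B)" by (auto simp: RB_def)
      then have "y \<in> span (RB (B - B') \<union> RB (CC - B))" using y(2) span_mono by blast
      then obtain u r where ur: "y = u + r" "u \<in> span (RB (B - B'))" "r \<in> span (RB (CC - B))" unfolding span_Un by blast
      have uU2: "u \<in> U2"
      proof -
        have "RB (B - B') \<subseteq> U2" using part span_base by (fastforce simp: RB_def B'_def Sp_def)
        then show ?thesis using ur(2) span_minimal[OF _ sub(2)] by blast
      qed
      have uR: "u \<in> span R" unfolding span_R using ur(2) span_mono[of "RB (B - B')" "RB B"] by (auto simp: RB_def)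
      have "r = y - u" using ur(1) by simp
      then have "r \<in> span (RB B)" using span_diff[OF yR uR] span_R by simp
      then have "r \<in> S1" using pair ur(3) by (simp add: S1_def)
      then have "y \<in> U2" unfolding ur(1) using uU2 S1U(2) subspace_add[OF sub(2)] by blast
      then show "y \<in> Sp V1" using spanR[OF yR yU1] by (simp add: S1_def)
    qed
    moreover have "card B' < card B" using finite_B B'B ne by (intro psubset_card_mono) auto
    ultimately show False by simp
  qed
  then have bb: "b = b1" using b12 by simp
  have "\<exists>v\<in>b. co b v \<bullet> x \<noteq> 0"
  proof (rule ccontr)
    assume "\<not> ?thesis"
    then have "zz b x = x" by (simp add: zz_def)
    then have "x \<in> S1" using zz_in_S1[OF b(1) x] by simp
    then show False using x by (simp add: R_def)
  qed
  then obtain v where "v \<in> b1" "co b v \<bullet> x \<noteq> 0" using bb by blast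
  from reach[OF x this] obtain x0 ps where "x0 \<in> R" "co b e \<bullet> x0 \<noteq> 0" "path b x0 ps" "endp x0 ps = x" by blast
  then show ?thesis using path_Lam[OF b, of x0 ps] by simp
qed

lemma S1_span: assumes "x \<in> S1" "x \<in> span (RB B)" shows "x \<in> Lam V2"
proof -
  obtain b where b: "base b" "e \<in> b" using base_exists[OF e_R] by blast
  have "x \<in> span R" using assms(2) span_R by simp
  then have "zz b x \<in> Lam V2"
  proof (induction rule: span_induct)
    case base
    show ?case using subspace_Lam[of V2] by (auto simp: subspace_def linear_0[OF linear_zz] linear_add[OF linear_zz] linear_scale[OF linear_zz])
  qed (rule all_zz[OF b])
  then show ?thesis using zz_S1[OF b(1) assms(1)] by simp
qed

text \<open>Otherwise \<open>B - {V2}\<close> would be a smaller branch, attached to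
  \<open>V2\<close>: what its span shares with the rest differs from a vector of
  \<open>Sp V2\<close> by a vector of \<open>S1\<close> in the span of \<open>B\<close>, and
  \<open>S1_span\<close> puts that into \<open>Sp V2\<close>.\<close>

lemma B_single: "B = {V2}"
proof (rule ccontr)
  assume ne: "B \<noteq> {V2}"
  have "card B \<le> card (B - {V2})"
  proof (rule minimal[OF V2_CC])
    show "B - {V2} \<subseteq> CC" "V2 \<notin> B - {V2}" "B - {V2} \<noteq> {}" using B ne V2 by auto
    fix x assume x: "x \<in> span (RB (B - {V2}))" "x \<in> span (RB (CC - (B - {V2})))"
    have "RB (CC - (B - {V2})) \<subseteq> real_points V2 \<union> RB (CC - B)" by (auto simp: RB_def)
    then have "x \<in> span (real_points V2 \<union> RB (CC - B))" using x(2) span_mono by blast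
    then obtain s r where sr: "x = s + r" "s \<in> Sp V2" "r \<in> span (RB (CC - B))" unfolding span_Un Sp_def by blast
    have "x \<in> span (RB B)" using x(1) span_mono[of "RB (B - {V2})" "RB B"] by (auto simp: RB_def)
    moreover have "s \<in> span (RB B)" using sr(2) Sp_subset[OF V2] by blast
    ultimately have rB: "r \<in> span (RB B)" using span_diff[of x "RB B" s] sr(1) by simp
    then have "r \<in> S1" using pair sr(3) by (simp add: S1_def)
    then have "r \<in> Sp V2" using S1_span[OF _ rB] by blast
    then show "x \<in> Sp V2" using sr(1,2) by (simp add: Sp_def span_add)
  qed
  moreover have "card (B - {V2}) < card B" using finite_B V2 by (intro psubset_card_mono) auto
  ultimately show False by simp
qed

lemma leaf:
  assumes "x \<noteq> 0" "x \<in> Sp V2" "x \<in> span (RB (CC - {V2}))"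
  shows "x \<in> real_points V1 \<and> x \<in> real_points V2"
proof -
  have "RB B = real_points V2" using B_single by (simp add: RB_def)
  then have "x \<in> span (RB B)" using assms(2) by (simp add: Sp_def)
  then have "x \<in> S1" using pair assms(3) B_single by (simp add: S1_def)
  then have "x \<in> RX" using Lam_RX assms by blast
  then show ?thesis using comp_real_span[OF V1] comp_real_span[OF V2_CC] \<open>x \<in> S1\<close> assms(2) by (simp add: S1_def)
qed

end

context sos
begin

text \<open>A branch of least cardinality exists; a member with the largest overlap then turns out
  to be the whole branch.\<close>

lemma leaf_exists:
  assumes "card CC \<ge> 2"
  shows "\<exists>V2\<in>CC. \<exists>V1\<in>CC - {V2}. \<forall>x. x \<noteq> 0 \<longrightarrow> x \<in> Sp V2 \<longrightarrow> x \<in> span (RB (CC - {V2})) \<longrightarrow> x \<in> real_points V1 \<and> x \<in> real_points V2"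
proof -
  let ?Q = "\<lambda>V1 B. V1 \<in> CC \<and> B \<subseteq> CC \<and> V1 \<notin> B \<and> B \<noteq> {} \<and> (\<forall>x. x \<in> span (RB B) \<longrightarrow> x \<in> span (RB (CC - B)) \<longrightarrow> x \<in> Sp V1)"
  obtain V where V: "V \<in> CC" using assms by fastforce
  have "CC - {V} \<noteq> {}"
  proof
    assume "CC - {V} = {}"
    then have "card CC \<le> card {V}" by (intro card_mono) auto
    then show False using assms by simp
  qed
  moreover have "CC - (CC - {V}) = {V}" using V by blast
  \<comment> \<open>All components but one form a branch attached to the remaining one, so the
    search is not over an empty set.\<close>
  ultimately have "?Q V (CC - {V})" using V by (auto simp: RB_def Sp_def)
  then have ex: "\<exists>n V1 B. ?Q V1 B \<and> card B = n" by blast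
  define n where "n = (LEAST n. \<exists>V1 B. ?Q V1 B \<and> card B = n)"
  from LeastI_ex[OF ex] obtain V1 B where VB: "?Q V1 B" "card B = n" unfolding n_def by blast
  have least: "n \<le> card B'" if "?Q V' B'" for V' B'
    unfolding n_def by (rule Least_le) (intro exI[of _ V'] exI[of _ B'] conjI refl; use that in blast)
  interpret leaf_pair X V1 B
  proof unfold_locales
    fix V' B' assume "V' \<in> CC" "B' \<subseteq> CC" "V' \<notin> B'" "B' \<noteq> {}" "\<And>x. x \<in> span (RB B') \<Longrightarrow> x \<in> span (RB (CC - B')) \<Longrightarrow> x \<in> Sp V'"
    then show "card B \<le> card B'" unfolding VB(2) by (intro least[of V']) blast
  qed (use VB in blast)+
  obtain V2 where V2: "V2 \<in> B" "\<And>k. k \<in> B \<Longrightarrow> dim (S1 \<inter> Sp k) \<le> dim (S1 \<inter> Sp V2)"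
  proof -
    have "Max ((\<lambda>k. dim (S1 \<inter> Sp k)) ` B) \<in> (\<lambda>k. dim (S1 \<inter> Sp k)) ` B" using finite_B B(3) by (intro Max_in) auto
    then obtain V2 where "V2 \<in> B" "dim (S1 \<inter> Sp V2) = Max ((\<lambda>k. dim (S1 \<inter> Sp k)) ` B)" by auto
    then show ?thesis using finite_B by (intro that[of V2]) auto
  qed
  have "\<not> real_points V2 \<subseteq> S1"
  proof
    assume "real_points V2 \<subseteq> S1"
    then have "Sp V2 \<subseteq> Sp V1" unfolding Sp_def[of V2] using span_minimal[OF _ subspace_S1] by (simp add: S1_def)
    then show False using comp_not_in_span[of V2 V1] V2(1) B V1 by blast
  qed
  then obtain e where e: "e \<in> real_points V2" "e \<notin> S1" by blast
  interpret leaf_max X V1 B V2 e by unfold_locales (use V2 e in auto)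
  have "V1 \<in> CC - {V2}" using V1 B(2) V2(1) by blast
  then show ?thesis using leaf V2_CC by (intro bexI[of _ V2] bexI[of _ V1]) auto
qed

end

section \<open>Passage from real to complex spans, and linear joining\<close>

definition re_vec :: "complex^'n::finite \<Rightarrow> real^'n" where "re_vec z = (\<chi> i. Re (z $ i))"
definition im_vec :: "complex^'n::finite \<Rightarrow> real^'n" where "im_vec z = (\<chi> i. Im (z $ i))"

lemma re_im_decomp: "z = cvec (re_vec z) + \<i> *s cvec (im_vec z)"
  by (simp add: vec_eq_iff re_vec_def im_vec_def cvec_simps complex_eq[symmetric])

lemma lf_cvec_re_im: "lf (cvec l) z = of_real (l \<bullet> re_vec z) + \<i> * of_real (l \<bullet> im_vec z)"
  by (subst re_im_decomp[of z]) (simp only: lf_linear lf_cvec)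

text \<open>A real linear form that vanishes at a complex vector vanishes at its real and its
  imaginary part.\<close>

lemma complex_span_re_im:
  assumes U: "subspace U" and van: "\<And>l. (\<And>u. u \<in> U \<Longrightarrow> l \<bullet> u = 0) \<Longrightarrow> \<forall>z\<in>V. lf (cvec l) z = 0"
    and z: "z \<in> vec.span V"
  shows "re_vec z \<in> U" "im_vec z \<in> U"
proof -
  have "l \<bullet> re_vec z = 0 \<and> l \<bullet> im_vec z = 0" if l: "\<And>u. u \<in> U \<Longrightarrow> l \<bullet> u = 0" for l
  proof -
    have "lf (cvec l) z = 0" using z
    proof (induction rule: vec.span_induct)
      case base
      show ?case by (auto simp: vec.subspace_def lf_linear)
    qed (use van[OF l] in blast)
    then show ?thesis unfolding lf_cvec_re_im by (simp add: complex_eq_iff)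
  qed
  then show "re_vec z \<in> U" "im_vec z \<in> U" using in_subspace_if_orthogonal[OF U] by blast+
qed

text \<open>On the line from the real part in the direction of the imaginary part, a form of
  \<open>V\<close> is a polynomial that vanishes at all but finitely many real parameters. It is
  therefore 0, in particular at the imaginary unit.\<close>

lemma real_subspace_complexify:
  assumes V: "proj_closed V" and U: "subspace U" and sub: "\<And>x. x \<in> U \<Longrightarrow> x \<noteq> 0 \<Longrightarrow> cvec x \<in> V"
    and z: "re_vec z \<in> U" "im_vec z \<in> U" "z \<noteq> 0"
  shows "z \<in> V"
proof (rule forms_cut_closed[OF V z(3)])
  fix d f assume f: "hom_poly d f" "\<And>x. x \<in> V \<Longrightarrow> f x = 0"
  let ?a = "re_vec z" and ?b = "im_vec z"
  obtain p where p: "\<And>t. f (cvec ?a + t *s cvec ?b) = poly p t" using hom_poly_line[OF f(1)] by blast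
  have "finite {t. ?a + t *\<^sub>R ?b = 0}"
  proof (cases "?b = 0")
    case True
    then have "?a \<noteq> 0" using re_im_decomp[of z] z(3) by (auto simp: cvec_simps)
    then show ?thesis using True by simp
  next
    case False
    have "t = s" if "?a + t *\<^sub>R ?b = 0" "?a + s *\<^sub>R ?b = 0" for t s
    proof -
      have "t *\<^sub>R ?b = s *\<^sub>R ?b" using that by (metis add_left_cancel)
      then show ?thesis using False by simp
    qed
    then have "{t. ?a + t *\<^sub>R ?b = 0} \<subseteq> {s}" if "?a + s *\<^sub>R ?b = 0" for s using that by blast
    then show ?thesis by (cases "\<exists>s. ?a + s *\<^sub>R ?b = 0") (auto intro: finite_subset)
  qed
  then have inf: "infinite (- {t. ?a + t *\<^sub>R ?b = 0})" by (simp add: infinite_UNIV_char_0 Compl_eq_Diff_UNIV)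
  have "poly p (of_real t) = 0" if t: "t \<in> - {t. ?a + t *\<^sub>R ?b = 0}" for t
  proof -
    have "?a + t *\<^sub>R ?b \<in> U" using z(1,2) U by (simp add: subspace_add subspace_scale)
    then have "cvec (?a + t *\<^sub>R ?b) \<in> V" using sub t by simp
    then show ?thesis using f(2) p[of "of_real t"] by (simp add: cvec_simps)
  qed
  then have "- {t. ?a + t *\<^sub>R ?b = 0} \<subseteq> {t. poly p (of_real t) = 0}" by blast
  then have "infinite {t. poly p (of_real t) = 0}" using inf by (rule infinite_super)
  then have "p = 0" by (rule poly_zero_of_infinite_reals)
  then have "f (cvec ?a + \<i> *s cvec ?b) = 0" using p[of \<i>] by simp
  then show "f z = 0" unfolding re_im_decomp[symmetric] .
qed

lemma cqform_outer_sq: "cqform (outer_sq l) z = (lf (cvec l) z)\<^sup>2"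
  unfolding cqform_def lf_def power2_eq_square sum_product
  by (intro sum.cong refl) (simp add: outer_sq_def cvec_simps)

text \<open>The nonzero points of the real intersection of the spans lie both in \<open>V\<close>
  and in the single closed set \<open>W\<close>, so its complexification lies in both.\<close>

lemma pspan_leaf:
  assumes "proj_closed V" "proj_closed Y" and W: "proj_closed W" "W \<subseteq> Y"
    and V: "\<And>l. (\<And>u. u \<in> span (real_points V) \<Longrightarrow> l \<bullet> u = 0) \<Longrightarrow> \<forall>z\<in>V. lf (cvec l) z = 0"
    and Y: "\<And>l. (\<And>u. u \<in> span (real_points Y) \<Longrightarrow> l \<bullet> u = 0) \<Longrightarrow> \<forall>z\<in>Y. lf (cvec l) z = 0"
    and leaf: "\<And>x. x \<noteq> 0 \<Longrightarrow> x \<in> span (real_points V) \<Longrightarrow> x \<in> span (real_points Y) \<Longrightarrow> cvec x \<in> W \<and> cvec x \<in> V"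
  shows "V \<inter> Y = pspan V \<inter> pspan Y"
proof
  show "V \<inter> Y \<subseteq> pspan V \<inter> pspan Y"
    using proj_closed_nonzero[OF assms(1)] by (auto simp: pspan_def vec.span_base)
  show "pspan V \<inter> pspan Y \<subseteq> V \<inter> Y"
  proof
    fix z assume z: "z \<in> pspan V \<inter> pspan Y"
    let ?U = "span (real_points V) \<inter> span (real_points Y)"
    have U: "subspace ?U" by (intro subspace_inter subspace_span)
    have z': "z \<noteq> 0" "re_vec z \<in> ?U" "im_vec z \<in> ?U"
      using z complex_span_re_im[OF subspace_span V] complex_span_re_im[OF subspace_span Y] by (auto simp: pspan_def)
    have "z \<in> V" by (rule real_subspace_complexify[OF assms(1) U _ z'(2,3,1)]) (use leaf in blast)
    moreover have "z \<in> W" by (rule real_subspace_complexify[OF W(1) U _ z'(2,3,1)]) (use leaf in blast)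
    ultimately show "z \<in> V \<inter> Y" using W(2) by blast
  qed
qed

lemma totally_real_linear:
  assumes "totally_real X" "\<And>u. u \<in> span (real_points X) \<Longrightarrow> l \<bullet> u = 0"
  shows "\<forall>z\<in>X. lf (cvec l) z = 0"
proof -
  have "\<forall>x\<in>real_points X. lf (cvec l) (cvec x) = 0" using assms(2) by (auto simp: lf_cvec span_base)
  with hom_poly_lf have "hom_poly 1 (lf (cvec l)) \<and> (\<forall>x\<in>real_points X. lf (cvec l) (cvec x) = 0)" by (rule conjI)
  from assms(1)[unfolded totally_real_def, THEN spec, THEN spec, THEN mp, OF this] show ?thesis .
qed

context sos
begin

text \<open>A matrix admissible for the smaller union is admissible for \<open>X\<close>, and its
  decomposition stays in the real span of that union. Points on the removed component then lie on
  \<open>V1\<close> by the leaf condition, so the hypothesis is inherited.\<close>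

lemma sos_without_leaf:
  assumes V2: "V2 \<in> CC" and V1: "V1 \<in> CC - {V2}"
    and leaf: "\<And>x. x \<noteq> 0 \<Longrightarrow> x \<in> Sp V2 \<Longrightarrow> x \<in> span (RB (CC - {V2})) \<Longrightarrow> x \<in> real_points V1 \<and> x \<in> real_points V2"
  shows "sos (\<Union>(CC - {V2}))" "irr_components (\<Union>(CC - {V2})) = CC - {V2}"
    "V2 \<inter> \<Union>(CC - {V2}) = pspan V2 \<inter> pspan (\<Union>(CC - {V2}))"
proof -
  let ?Y = "\<Union>(CC - {V2})"
  have RY: "real_points ?Y = RB (CC - {V2})" by (auto simp: RB_def real_points_def)
  have YX: "?Y \<subseteq> X" using Union_irr_components[OF closed] by blast
  show irr: "irr_components ?Y = CC - {V2}"
  proof (rule irr_components_of_union)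
    show "finite (CC - {V2})" using finite_CC by simp
    show "proj_irreducible V" if "V \<in> CC - {V2}" for V using that by (simp add: irr_components_def)
    show "V = W" if "V \<in> CC - {V2}" "W \<in> CC - {V2}" "V \<subseteq> W" for V W
      using that by (auto simp: irr_components_def)
  qed
  have clY: "proj_closed ?Y" by (rule proj_closed_Union) (use finite_CC comp_closed in auto)
  have trY: "totally_real ?Y"
    unfolding totally_real_def
  proof (intro allI impI ballI, elim conjE)
    fix d f z assume f: "hom_poly d f" "\<forall>x\<in>real_points ?Y. f (cvec x) = 0" and z: "z \<in> ?Y"
    then obtain V where V: "V \<in> CC - {V2}" "z \<in> V" by blast
    show "f z = 0"
    proof (rule component.RV_dense[OF comp f(1) _ V(2)])
      show "V \<in> CC" using V by simp
      fix y assume "y \<in> real_points V"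
      then show "f (cvec y) = 0" using f(2) V(1) unfolding RY by (auto simp: RB_def)
    qed
  qed
  show sosY: "sos ?Y"
  proof
    fix M assume I: "\<And>A. A \<in> ideal2 ?Y \<Longrightarrow> A \<bullet> M = 0" and ps: "\<And>l. outer_sq l \<bullet> M \<ge> 0"
    have "\<exists>xs. set xs \<subseteq> RX \<inter> span (real_points ?Y) \<and> M = sum_list (map outer_sq xs)"
    proof (rule psd_in_subspace[OF _ ps subspace_span])
      show "A \<bullet> M = 0" if "A \<in> ideal2 X" for A using I that YX by (auto simp: ideal2_def)
      show "outer_sq l \<bullet> M = 0" if l: "\<And>u. u \<in> span (real_points ?Y) \<Longrightarrow> l \<bullet> u = 0" for l
        using I totally_real_linear[OF trY l] by (simp add: ideal2_def cqform_outer_sq)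
    qed
    then obtain xs where xs: "set xs \<subseteq> RX \<inter> span (real_points ?Y)" "M = sum_list (map outer_sq xs)" by blast
    have "x \<in> real_points ?Y" if x: "x \<in> set xs" for x
    proof -
      obtain k where k: "k \<in> CC" "x \<in> real_points k" using x xs(1) RX_RB by (auto simp: RB_def)
      show ?thesis
      proof (cases "k = V2")
        case True
        have "x \<in> Sp V2" unfolding Sp_def using k True by (auto intro: span_base)
        moreover have "x \<noteq> 0" using k by (simp add: real_points_def)
        moreover have "x \<in> span (RB (CC - {V2}))" using x xs(1) unfolding RY by blast
        ultimately have "x \<in> real_points V1" using leaf by blast
        then show ?thesis unfolding RY using V1 by (auto simp: RB_def)
      next
        case False
        then show ?thesis unfolding RY using k by (auto simp: RB_def)
      qed
    qed
    then show "M \<in> sq_sums ?Y" unfolding sq_sums_def using xs(2) by blast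
  qed (use clY trY in auto)
  show "V2 \<inter> ?Y = pspan V2 \<inter> pspan ?Y"
  proof (rule pspan_leaf[OF comp_closed[OF V2] clY, of V1])
    show "proj_closed V1" "V1 \<subseteq> ?Y" using V1 comp_closed by auto
    show "\<forall>z\<in>?Y. lf (cvec l) z = 0" if "\<And>u. u \<in> span (real_points ?Y) \<Longrightarrow> l \<bullet> u = 0" for l
      by (rule totally_real_linear[OF trY that])
    show "\<forall>z\<in>V2. lf (cvec l) z = 0" if "\<And>u. u \<in> span (real_points V2) \<Longrightarrow> l \<bullet> u = 0" for l
      using component.S_form[OF comp[OF V2], of l] that unfolding component.S_def[OF comp[OF V2]] by blast
    fix x assume "x \<noteq> 0" "x \<in> span (real_points V2)" "x \<in> span (real_points ?Y)"
    then show "cvec x \<in> V1 \<and> cvec x \<in> V2" using leaf[of x] unfolding RY Sp_def by (simp add: real_points_def)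
  qed
qed

end

text \<open>The removable component is put last; the union of the others is again a
  \<open>sos\<close> and is ordered by induction.\<close>

lemma sos_linearly_joined: "sos X \<Longrightarrow> linearly_joined X"
proof (induction "card (irr_components X)" arbitrary: X rule: less_induct)
  case (less X)
  interpret sos X by (rule less(2))
  show ?case
  proof (cases "card CC \<ge> 2")
    case False
    obtain Xs where Xs: "distinct Xs" "set Xs = CC" using finite_distinct_list[OF finite_CC] by blast
    then have "length Xs < 2" using False distinct_card[OF Xs(1)] by simp
    then show ?thesis unfolding linearly_joined_def using Xs by (intro exI[of _ Xs]) auto
  next
    case True
    from leaf_exists[OF True] obtain V2 V1 where V: "V2 \<in> CC" "V1 \<in> CC - {V2}"
      "\<forall>x. x \<noteq> 0 \<longrightarrow> x \<in> Sp V2 \<longrightarrow> x \<in> span (RB (CC - {V2})) \<longrightarrow> x \<in> real_points V1 \<and> x \<in> real_points V2" by blast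
    let ?Y = "\<Union>(CC - {V2})"
    have Y: "sos ?Y" "irr_components ?Y = CC - {V2}" "V2 \<inter> ?Y = pspan V2 \<inter> pspan ?Y"
      using sos_without_leaf[OF V(1,2)] V(3) by blast+
    have "card (irr_components ?Y) < card CC" unfolding Y(2) using V(1) finite_CC by (intro psubset_card_mono) auto
    from less(1)[OF this Y(1), unfolded linearly_joined_def Y(2)] obtain Xs where Xs: "distinct Xs" "set Xs = CC - {V2}"
      "\<forall>j. 0 < j \<and> j < length Xs \<longrightarrow> Xs ! j \<inter> \<Union>(set (take j Xs)) = pspan (Xs ! j) \<inter> pspan (\<Union>(set (take j Xs)))"
      by (elim exE conjE)
    show ?thesis unfolding linearly_joined_def
    proof (intro exI[of _ "Xs @ [V2]"] conjI allI impI)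
      show "distinct (Xs @ [V2])" "set (Xs @ [V2]) = CC" using Xs V(1) by auto
      fix j assume j: "0 < j \<and> j < length (Xs @ [V2])"
      show "(Xs @ [V2]) ! j \<inter> \<Union>(set (take j (Xs @ [V2]))) = pspan ((Xs @ [V2]) ! j) \<inter> pspan (\<Union>(set (take j (Xs @ [V2]))))"
      proof (cases "j < length Xs")
        case True
        then show ?thesis using Xs(3)[rule_format, of j] j by (simp add: nth_append)
      next
        case False
        then have "j = length Xs" using j by simp
        then show ?thesis using Y(3) Xs(2) by (simp add: nth_append)
      qed
    qed
  qed
qed

section \<open>Linear algebra of functions restricted to a set\<close>

lemma underdetermined:
  fixes a :: "'i \<Rightarrow> 'j \<Rightarrow> complex"
  assumes "finite J" "finite I" "card J < card I"
  shows "\<exists>\<gamma>. (\<exists>i\<in>I. \<gamma> i \<noteq> 0) \<and> (\<forall>j\<in>J. (\<Sum>i\<in>I. \<gamma> i * a i j) = 0)"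
  using assms
proof (induction J arbitrary: I a rule: finite_induct)
  case empty
  then have "I \<noteq> {}" by auto
  then show ?case by (intro exI[of _ "\<lambda>_. 1"]) auto
next
  case (insert j J)
  show ?case
  proof (cases "\<forall>i\<in>I. a i j = 0")
    case True
    have "card J < card I" using insert by simp
    from insert(3)[OF insert(4) this, of a] obtain \<gamma> where "\<exists>i\<in>I. \<gamma> i \<noteq> 0" "\<forall>k\<in>J. (\<Sum>i\<in>I. \<gamma> i * a i k) = 0"
      by (elim exE conjE)
    then show ?thesis using True by (intro exI[of _ \<gamma>]) simp
  next
    case False
    then obtain i0 where i0: "i0 \<in> I" "a i0 j \<noteq> 0" by blast
    define a' where "a' i k = a i k - (a i j / a i0 j) * a i0 k" for i k
    have "card J < card (I - {i0})" using insert i0 by simp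
    from insert(3)[of "I - {i0}" a', OF _ this] insert(4) obtain \<gamma> where \<gamma>: "\<exists>i\<in>I - {i0}. \<gamma> i \<noteq> 0" "\<forall>k\<in>J. (\<Sum>i\<in>I - {i0}. \<gamma> i * a' i k) = 0"
      by auto
    define \<delta> where "\<delta> i = (if i = i0 then - (\<Sum>i\<in>I - {i0}. \<gamma> i * (a i j / a i0 j)) else \<gamma> i)" for i
    have sum: "(\<Sum>i\<in>I. \<delta> i * a i k) = (\<Sum>i\<in>I - {i0}. \<gamma> i * a' i k)" for k
    proof -
      have "(\<Sum>i\<in>I. \<delta> i * a i k) = \<delta> i0 * a i0 k + (\<Sum>i\<in>I - {i0}. \<delta> i * a i k)" by (rule sum.remove[OF insert(4) i0(1)])
      also have "(\<Sum>i\<in>I - {i0}. \<delta> i * a i k) = (\<Sum>i\<in>I - {i0}. \<gamma> i * a i k)" by (rule sum.cong) (auto simp: \<delta>_def)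
      also have "\<delta> i0 * a i0 k = - (\<Sum>i\<in>I - {i0}. \<gamma> i * ((a i j / a i0 j) * a i0 k))"
        by (simp add: \<delta>_def sum_distrib_right mult.assoc)
      finally show ?thesis by (simp add: a'_def right_diff_distrib sum_subtractf)
    qed
    have "(\<Sum>i\<in>I. \<delta> i * a i k) = 0" if "k \<in> insert j J" for k
    proof (cases "k = j")
      case True
      have "a' i j = 0" for i using i0(2) by (simp add: a'_def)
      then show ?thesis unfolding sum True by simp
    next
      case False
      then show ?thesis unfolding sum using \<gamma>(2) that by simp
    qed
    moreover have "\<exists>i\<in>I. \<delta> i \<noteq> 0" using \<gamma>(1) unfolding \<delta>_def by auto
    ultimately show ?thesis by (intro exI[of _ \<delta>]) simp
  qed
qed

text \<open>Independence and span of residue classes modulo the functions that vanish on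
  \<open>V\<close>. The graded pieces of the coordinate ring are handled through such
  families.\<close>

definition fam_indep :: "'a set \<Rightarrow> 'i set \<Rightarrow> ('i \<Rightarrow> 'a \<Rightarrow> complex) \<Rightarrow> bool" where
  "fam_indep V I f \<longleftrightarrow> (\<forall>\<gamma>. (\<forall>z\<in>V. (\<Sum>i\<in>I. \<gamma> i * f i z) = 0) \<longrightarrow> (\<forall>i\<in>I. \<gamma> i = 0))"

definition in_fam :: "'a set \<Rightarrow> 'j set \<Rightarrow> ('j \<Rightarrow> 'a \<Rightarrow> complex) \<Rightarrow> ('a \<Rightarrow> complex) \<Rightarrow> bool" where
  "in_fam V J g h \<longleftrightarrow> (\<exists>a. \<forall>z\<in>V. h z = (\<Sum>j\<in>J. a j * g j z))"

lemma fam_indepD: "fam_indep V I f \<Longrightarrow> (\<And>z. z \<in> V \<Longrightarrow> (\<Sum>i\<in>I. \<gamma> i * f i z) = 0) \<Longrightarrow> i \<in> I \<Longrightarrow> \<gamma> i = 0"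
  unfolding fam_indep_def by blast

lemma fam_bound:
  assumes "finite I" "finite J" "fam_indep V I f" "\<And>i. i \<in> I \<Longrightarrow> in_fam V J g (f i)"
  shows "card I \<le> card J"
proof (rule ccontr)
  assume "\<not> card I \<le> card J"
  then have lt: "card J < card I" by simp
  have "\<forall>i\<in>I. \<exists>a. \<forall>z\<in>V. f i z = (\<Sum>j\<in>J. a j * g j z)" using assms(4) unfolding in_fam_def by blast
  from bchoice[OF this] obtain a where a: "\<forall>i\<in>I. \<forall>z\<in>V. f i z = (\<Sum>j\<in>J. a i j * g j z)" by (elim exE)
  from underdetermined[OF assms(2,1) lt, of a] obtain \<gamma> where \<gamma>: "\<exists>i\<in>I. \<gamma> i \<noteq> 0" "\<forall>j\<in>J. (\<Sum>i\<in>I. \<gamma> i * a i j) = 0"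
    by (elim exE conjE)
  have "(\<Sum>i\<in>I. \<gamma> i * f i z) = 0" if "z \<in> V" for z
  proof -
    have "(\<Sum>i\<in>I. \<gamma> i * f i z) = (\<Sum>i\<in>I. \<Sum>j\<in>J. \<gamma> i * a i j * g j z)"
      using a that by (intro sum.cong) (auto simp: sum_distrib_left mult.assoc)
    also have "\<dots> = (\<Sum>j\<in>J. (\<Sum>i\<in>I. \<gamma> i * a i j) * g j z)" by (subst sum.swap) (simp add: sum_distrib_right)
    also have "\<dots> = 0" using \<gamma>(2) by simp
    finally show ?thesis .
  qed
  then have "\<forall>i\<in>I. \<gamma> i = 0" using fam_indepD[OF assms(3), of \<gamma>] by simp
  then show False using \<gamma>(1) by blast
qed

text \<open>A dependent member could be dropped from the spanning family, which would then be
  smaller than an independent family in its span.\<close>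

lemma fam_exchange:
  assumes "finite I" "finite J" "fam_indep V I f" "\<And>i. i \<in> I \<Longrightarrow> in_fam V J g (f i)" "card J \<le> card I"
  shows "fam_indep V J g"
  unfolding fam_indep_def
proof (intro allI impI ballI, rule ccontr)
  fix \<delta> j0 assume \<delta>: "\<forall>z\<in>V. (\<Sum>j\<in>J. \<delta> j * g j z) = 0" and j0: "j0 \<in> J" "\<delta> j0 \<noteq> 0"
  have g0: "g j0 z = (\<Sum>j\<in>J - {j0}. (- \<delta> j / \<delta> j0) * g j z)" if "z \<in> V" for z
  proof -
    have "\<delta> j0 * g j0 z + (\<Sum>j\<in>J - {j0}. \<delta> j * g j z) = 0"
      using \<delta> that by (simp add: sum.remove[OF assms(2) j0(1)])
    then have "g j0 z = - (\<Sum>j\<in>J - {j0}. \<delta> j * g j z) / \<delta> j0" using j0(2) by (simp add: field_simps eq_neg_iff_add_eq_0)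
    then show ?thesis by (simp add: sum_divide_distrib sum_negf[symmetric])
  qed
  have "in_fam V (J - {j0}) g (f i)" if "i \<in> I" for i
  proof -
    obtain a where a: "\<forall>z\<in>V. f i z = (\<Sum>j\<in>J. a j * g j z)" using assms(4)[OF \<open>i \<in> I\<close>] unfolding in_fam_def by blast
    have "f i z = (\<Sum>j\<in>J - {j0}. (a j0 * (- \<delta> j / \<delta> j0) + a j) * g j z)" if "z \<in> V" for z
    proof -
      have "f i z = a j0 * g j0 z + (\<Sum>j\<in>J - {j0}. a j * g j z)" using a that by (simp add: sum.remove[OF assms(2) j0(1)])
      also have "a j0 * g j0 z = (\<Sum>j\<in>J - {j0}. a j0 * (- \<delta> j / \<delta> j0) * g j z)" unfolding g0[OF that] sum_distrib_left
        by (simp add: mult.assoc)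
      finally show ?thesis unfolding distrib_right sum.distrib .
    qed
    then show ?thesis unfolding in_fam_def by (intro exI[of _ "\<lambda>j. a j0 * (- \<delta> j / \<delta> j0) + a j"]) blast
  qed
  from fam_bound[OF assms(1) _ assms(3) this] have "card I \<le> card (J - {j0})" using assms(2) by simp
  then show False using assms(2,5) j0(1) by (metis card_Diff1_less leD order_trans)
qed

lemma kronecker_digits_unique:
  fixes a b :: "nat \<Rightarrow> nat"
  assumes "(\<Sum>k<n. a k * M ^ k) = (\<Sum>k<n. b k * M ^ k)" "\<And>k. k < n \<Longrightarrow> a k < M" "\<And>k. k < n \<Longrightarrow> b k < M" "k < n"
  shows "a k = b k"
  using assms
proof (induction n arbitrary: a b k)
  case (Suc n)
  have sh: "(\<Sum>k<Suc n. c k * M ^ k) = c 0 + M * (\<Sum>k<n. c (Suc k) * M ^ k)" for c :: "nat \<Rightarrow> nat"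
    unfolding sum.lessThan_Suc_shift by (simp add: sum_distrib_left mult_ac)
  have ab: "a 0 < M" "b 0 < M" using Suc(3)[of 0] Suc(4)[of 0] by simp_all
  have eq: "a 0 + M * (\<Sum>k<n. a (Suc k) * M ^ k) = b 0 + M * (\<Sum>k<n. b (Suc k) * M ^ k)" using Suc(2) unfolding sh .
  then have "(a 0 + M * (\<Sum>k<n. a (Suc k) * M ^ k)) mod M = (b 0 + M * (\<Sum>k<n. b (Suc k) * M ^ k)) mod M" by simp
  then have 0: "a 0 = b 0" using ab by simp
  then have "(\<Sum>k<n. a (Suc k) * M ^ k) = (\<Sum>k<n. b (Suc k) * M ^ k)" using eq ab by simp
  from Suc(1)[OF this] have "a (Suc k) = b (Suc k)" if "k < n" for k using Suc(3,4) that by simp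
  then show ?case using 0 Suc(5) by (cases k) auto
qed simp

section \<open>Local parametrization of the component and an adapted frame\<close>

context chart
begin

text \<open>\<open>F j\<close> vanishes at \<open>Y 0\<close> and is polar to tangent vectors there,
  so at \<open>Y 0 + w\<close> it is of second order in \<open>w\<close>. The shift that repairs it
  divides by \<open>h j\<close>, which is near 1.\<close>

lemma local_points:
  "\<exists>C e0. C \<ge> 0 \<and> e0 > 0 \<and> (\<forall>w\<in>T1 (Y 0). norm w < e0 \<longrightarrow> (\<exists>s. (\<forall>j\<in>J. \<bar>s j\<bar> \<le> C * (norm w)\<^sup>2) \<and> Y 0 + w + (\<Sum>j\<in>J. s j *\<^sub>R Y j) \<in> RV))"
proof -
  have "\<forall>j. \<exists>K. K > 0 \<and> (\<forall>x. norm (h j x) \<le> K * norm x)" using linear_bounded_pos[OF linear_h] by blast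
  from choice[OF this] obtain K where K: "\<And>j. K j > 0" "\<And>j x. norm (h j x) \<le> K j * norm x" by blast
  define KK where "KK = 1 + (\<Sum>j\<in>J. K j)"
  define C where "C = 2 * (\<Sum>j\<in>J. norm (F j))"
  have KKpos: "KK > 0" unfolding KK_def using K(1) by (simp add: add_pos_nonneg sum_nonneg less_imp_le)
  \<comment> \<open>Within this radius each \<open>h j\<close> is at least 1/2. The bound by
    \<open>norm (Y 0)\<close> keeps the point nonzero when \<open>J\<close> is empty.\<close>
  define e0 where "e0 = min (1 / (2 * KK)) (norm (Y 0))"
  have Y0: "Y 0 \<noteq> 0" using P_nonzero Y_P[of 0] by simp
  have e0: "e0 > 0" using KKpos Y0 by (simp add: e0_def)
  have main: "\<exists>s. (\<forall>j\<in>J. \<bar>s j\<bar> \<le> C * (norm w)\<^sup>2) \<and> Y 0 + w + (\<Sum>j\<in>J. s j *\<^sub>R Y j) \<in> RV" if w: "w \<in> T1 (Y 0)" "norm w < e0" for w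
  proof -
    define v where "v = Y 0 + w"
    have vS: "v \<in> S" unfolding v_def using w(1) T1_S Y_S[of 0] subspace_add[OF subspace_S] by blast
    have hv: "h j v \<ge> 1 / 2" if j: "j \<in> J" for j
    proof -
      have "K j \<le> KK" unfolding KK_def using member_le_sum[of j J K] j K(1) by (simp add: less_imp_le)
      then have "norm (h j w) \<le> KK * norm w" using K(2)[of j w] by (meson mult_right_mono norm_ge_zero order_trans)
      also have "\<dots> \<le> KK * (1 / (2 * KK))" using w(2) KKpos by (intro mult_left_mono) (auto simp: e0_def)
      also have "\<dots> = 1 / 2" using KKpos by simp
      finally have "\<bar>h j w\<bar> \<le> 1 / 2" by simp
      then show ?thesis unfolding v_def using h_Y(2)[OF j] by (simp add: linear_add[OF linear_h])
    qed
    have qv: "\<bar>rqform (F j) v\<bar> \<le> norm (F j) * (norm w)\<^sup>2" if j: "j \<in> J" for j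
    proof -
      have "rqform (F j) (Y 0) = 0" using ideal2_real_points[OF F[OF j], of "Y 0"] Y_P[of 0] P_subset by auto
      moreover have "rbf (F j) (Y 0) w = 0" using w(1) T1_T2 F[OF j] by (auto simp: T2_def)
      ultimately have "rqform (F j) v = F j \<bullet> outer_sq w" unfolding v_def rqform_add by (simp add: inner_outer_sq)
      moreover have "norm (outer_sq w) = (norm w)\<^sup>2" using inner_outer_sq2[of w w] by (simp add: norm_eq_sqrt_inner)
      ultimately show ?thesis using Cauchy_Schwarz_ineq2[of "F j" "outer_sq w"] by simp
    qed
    define s where "s j = - rqform (F j) v / h j v" for j
    define z where "z = v + (\<Sum>j\<in>J. s j *\<^sub>R Y j)"
    have "\<bar>s j\<bar> \<le> C * (norm w)\<^sup>2" if j: "j \<in> J" for j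
    proof -
      have "\<bar>s j\<bar> = \<bar>rqform (F j) v\<bar> / h j v" using hv[OF j] by (simp add: s_def)
      also have "\<dots> \<le> \<bar>rqform (F j) v\<bar> / (1 / 2)" using hv[OF j] by (intro divide_left_mono) auto
      also have "\<dots> \<le> 2 * (norm (F j) * (norm w)\<^sup>2)" using qv[OF j] by simp
      also have "\<dots> \<le> C * (norm w)\<^sup>2"
      proof -
        have "norm (F j) \<le> (\<Sum>j\<in>J. norm (F j))" by (rule member_le_sum[OF j]) auto
        then show ?thesis unfolding C_def by (simp add: mult_right_mono)
      qed
      finally show ?thesis .
    qed
    moreover have "z \<in> RV"
    proof (rule graph)
      have "(\<Sum>j\<in>J. s j *\<^sub>R Y j) \<in> S" using Y_S by (intro subspace_sum[OF subspace_S] subspace_scale[OF subspace_S]) auto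
      then show "z \<in> S" unfolding z_def using vS subspace_add[OF subspace_S] by blast
      fix i assume i: "i \<in> J"
      show "rqform (F i) z = 0" unfolding z_def rqform_shift[OF i vS] s_def using hv[OF i] by simp
      show "h i z \<noteq> 0" unfolding z_def h_shift[OF i] using hv[OF i] by simp
    next
      show "z \<noteq> 0"
      proof (cases "J = {}")
        case True
        have "norm w < norm (Y 0)" using w(2) by (simp add: e0_def)
        then have "Y 0 + w \<noteq> 0" by (metis add_eq_0_iff less_irrefl norm_minus_cancel)
        then show ?thesis unfolding z_def v_def True by simp
      next
        case False
        then obtain i where i: "i \<in> J" by blast
        have "h i z = h i v" unfolding z_def by (rule h_shift[OF i])
        then show ?thesis using hv[OF i] linear_0[OF linear_h, of i] by auto
      qed
    qed
    ultimately show ?thesis unfolding z_def v_def by (intro exI[of _ s]) simp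
  qed
  have "C \<ge> 0" by (simp add: C_def sum_nonneg)
  then show ?thesis using e0 main by (intro exI[of _ C] exI[of _ e0] conjI ballI impI) simp_all
qed

lemma local_points_at:
  assumes i: "i \<le> cm"
  shows "\<exists>C e0. C \<ge> 0 \<and> e0 > 0 \<and> (\<forall>w\<in>T1 (Y i). norm w < e0 \<longrightarrow> (\<exists>s. (\<forall>j\<le>cm. \<bar>s j\<bar> \<le> C * (norm w)\<^sup>2) \<and> Y i + w + (\<Sum>j\<le>cm. s j *\<^sub>R Y j) \<in> RV))"
proof -
  define \<pi> where "\<pi> k = (if k = 0 then i else if k = i then 0 else k)" for k
  have pp: "\<pi> (\<pi> k) = k" for k by (simp add: \<pi>_def)
  have le: "\<pi> k \<le> cm" if "k \<le> cm" for k using that i by (simp add: \<pi>_def)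
  have inj: "inj_on \<pi> {..cm}" by (rule inj_on_inverseI[of _ \<pi>]) (rule pp)
  have sur: "\<pi> ` {..cm} = {..cm}"
  proof
    show "\<pi> ` {..cm} \<subseteq> {..cm}" using le by auto
    show "{..cm} \<subseteq> \<pi> ` {..cm}"
    proof
      fix k assume "k \<in> {..cm}"
      then show "k \<in> \<pi> ` {..cm}" using le[of k] by (intro image_eqI[of _ _ "\<pi> k"]) (simp_all add: pp)
    qed
  qed
  interpret pc: chart X V "Y \<circ> \<pi>" by unfold_locales (rule strong_reindex[OF strong inj sur])
  have Y0: "(Y \<circ> \<pi>) 0 = Y i" by (simp add: \<pi>_def)
  from pc.local_points[unfolded Y0] obtain C e0 where C: "C \<ge> 0" "e0 > 0"
    "\<forall>w\<in>T1 (Y i). norm w < e0 \<longrightarrow> (\<exists>s. (\<forall>j\<in>J. \<bar>s j\<bar> \<le> C * (norm w)\<^sup>2) \<and> Y i + w + (\<Sum>j\<in>J. s j *\<^sub>R (Y \<circ> \<pi>) j) \<in> RV)"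
    by (elim exE conjE)
  have "\<exists>s. (\<forall>j\<le>cm. \<bar>s j\<bar> \<le> C * (norm w)\<^sup>2) \<and> Y i + w + (\<Sum>j\<le>cm. s j *\<^sub>R Y j) \<in> RV" if w: "w \<in> T1 (Y i)" "norm w < e0" for w
  proof -
    from C(3)[rule_format, OF w] obtain s where s: "\<forall>j\<in>J. \<bar>s j\<bar> \<le> C * (norm w)\<^sup>2" "Y i + w + (\<Sum>j\<in>J. s j *\<^sub>R (Y \<circ> \<pi>) j) \<in> RV"
      by (elim exE conjE)
    define s' where "s' m = (if m = i then 0 else s (\<pi> m))" for m
    have Jm: "\<pi> m \<in> J" if "m \<le> cm" "m \<noteq> i" for m
    proof -
      have "\<pi> m \<noteq> 0" using that(2) pp[of m] by (auto simp: \<pi>_def)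
      then show ?thesis using le[OF that(1)] by simp
    qed
    have "(\<Sum>j\<in>J. s j *\<^sub>R (Y \<circ> \<pi>) j) = (\<Sum>m\<in>{..cm} - {i}. s (\<pi> m) *\<^sub>R Y m)"
    proof (rule sum.reindex_bij_witness[of _ \<pi> \<pi>])
      fix j assume j: "j \<in> J"
      have "\<pi> j \<noteq> i" using j by (auto simp: \<pi>_def)
      then show "\<pi> j \<in> {..cm} - {i}" using j le[of j] by auto
    qed (use pp Jm in auto)
    also have "\<dots> = (\<Sum>m\<in>{..cm} - {i}. s' m *\<^sub>R Y m)" by (rule sum.cong) (auto simp: s'_def)
    also have "\<dots> = (\<Sum>m\<le>cm. s' m *\<^sub>R Y m)" by (rule sum.mono_neutral_left) (auto simp: s'_def)
    finally have eq: "(\<Sum>j\<in>J. s j *\<^sub>R (Y \<circ> \<pi>) j) = (\<Sum>m\<le>cm. s' m *\<^sub>R Y m)" .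
    have "\<bar>s' m\<bar> \<le> C * (norm w)\<^sup>2" if "m \<le> cm" for m
      using s(1) Jm[OF that] C(1) by (cases "m = i") (simp_all add: s'_def)
    then show ?thesis using s(2) unfolding eq by (intro exI[of _ s']) simp
  qed
  then show ?thesis using C(1,2) by (intro exI[of _ C] exI[of _ e0] conjI ballI impI) simp_all
qed

text \<open>\<open>D\<close> is introduced as the number of basis vectors of \<open>S\<close>
  besides the \<open>Y j\<close>; only later is it identified with the dimension of
  \<open>V\<close>.\<close>

lemma frame_exists:
  "\<exists>bs pb D. (\<forall>j\<le>cm. bs j = Y j) \<and> dim S = Suc cm + D \<and> S = span (bs ` {..<Suc cm + D}) \<and>
    (\<forall>i<Suc cm + D. \<forall>j<Suc cm + D. pb i \<bullet> bs j = (if j = i then 1 else 0))"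
proof -
  have indY: "indmod {0} Y {..cm}" by (rule flagged_independent[OF fl])
  note iY = indmod_zero_independent[OF indY finite_atMost]
  have "Y ` {..cm} \<subseteq> S" using Y_S by auto
  from maximal_independent_subset_extend[OF this iY(2)] obtain C where C: "Y ` {..cm} \<subseteq> C" "C \<subseteq> S" "independent C" "S \<subseteq> span C" by blast
  have finC: "finite C" using C(3) independent_imp_finite by blast
  have spC: "span C = S" using C(2,4) span_minimal[OF _ subspace_S] by blast
  define M where "M = C - Y ` {..cm}"
  define D where "D = card M"
  have cY: "card (Y ` {..cm}) = Suc cm" using card_image[OF iY(1)] by simp
  have cC: "card C = Suc cm + D"
    using card_Diff_subset[of "Y ` {..cm}" C] C(1) cY card_mono[OF finC C(1)] by (simp add: D_def M_def)
  have dimS: "dim S = Suc cm + D" using dim_eq_card[OF spC[symmetric, THEN arg_cong[of _ _ span], unfolded span_span, symmetric] C(3)] cC spC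
    by (metis C(2) C(3) C(4) basis_card_eq_dim)
  obtain g where g: "bij_betw g {0..<D} M" using ex_bij_betw_nat_finite[of M] finC by (auto simp: D_def M_def)
  define bs where "bs j = (if j \<le> cm then Y j else g (j - Suc cm))" for j
  have im: "bs ` {..<Suc cm + D} = C"
  proof -
    have "{..<Suc cm + D} = {..cm} \<union> {Suc cm..<Suc cm + D}" by auto
    moreover have "bs ` {..cm} = Y ` {..cm}" by (rule image_cong) (auto simp: bs_def)
    moreover have "bs ` {Suc cm..<Suc cm + D} = g ` {0..<D}"
    proof -
      have "j \<in> (\<lambda>k. Suc cm + k) ` {0..<D}" if "j \<in> {Suc cm..<Suc cm + D}" for j
        using that by (intro image_eqI[of _ _ "j - Suc cm"]) auto
      then have eq: "{Suc cm..<Suc cm + D} = (\<lambda>k. Suc cm + k) ` {0..<D}" by auto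
      have "bs (Suc cm + k) = g k" for k by (simp add: bs_def)
      then show ?thesis unfolding eq image_image by simp
    qed
    moreover have "g ` {0..<D} = C - Y ` {..cm}" using g unfolding bij_betw_def M_def by simp
    ultimately have "bs ` {..<Suc cm + D} = Y ` {..cm} \<union> (C - Y ` {..cm})" by (simp only: image_Un)
    then show ?thesis using C(1) by blast
  qed
  have injb: "inj_on bs {..<Suc cm + D}" using cC im by (intro eq_card_imp_inj_on) auto
  have "indmod {0} bs {..<Suc cm + D}"
    unfolding indmod_def
  proof (intro allI impI ballI)
    fix a j assume a: "(\<Sum>j<Suc cm + D. a j *\<^sub>R bs j) \<in> {0}" and j: "j \<in> {..<Suc cm + D}"
    have "(\<Sum>v\<in>C. a (inv_into {..<Suc cm + D} bs v) *\<^sub>R v) = (\<Sum>j<Suc cm + D. a j *\<^sub>R bs j)"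
      unfolding im[symmetric] sum.reindex[OF injb] o_def
      by (rule sum.cong[OF refl]) (simp only: inv_into_f_f[OF injb])
    then have "(\<Sum>v\<in>C. a (inv_into {..<Suc cm + D} bs v) *\<^sub>R v) = 0" using a by (simp only: singleton_iff)
    with C(3)[unfolded independent_explicit, THEN conjunct2, THEN spec, of "\<lambda>v. a (inv_into {..<Suc cm + D} bs v)"]
    have "\<forall>v\<in>C. a (inv_into {..<Suc cm + D} bs v) = 0" by (rule mp)
    moreover have "bs j \<in> C" using im j by blast
    ultimately have "a (inv_into {..<Suc cm + D} bs (bs j)) = 0" by (rule bspec)
    then show "a j = 0" using inv_into_f_f[OF injb j] by simp
  qed
  from indmod_dual[OF subspace_single_0 finite_lessThan this] obtain pb where
    pb: "\<forall>i\<in>{..<Suc cm + D}. (\<forall>u\<in>{0}. pb i \<bullet> u = 0) \<and> (\<forall>k\<in>{..<Suc cm + D}. pb i \<bullet> bs k = (if k = i then 1 else 0))" by (elim exE)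
  show ?thesis
    by (intro exI[of _ bs] exI[of _ pb] exI[of _ D] conjI) (use pb dimS spC im in \<open>auto simp: bs_def\<close>)
qed

end

lemma linear_functional_inner:
  fixes g :: "real^'n \<Rightarrow> real"
  assumes "linear g" shows "\<exists>q. \<forall>x. g x = q \<bullet> x"
proof -
  have "g x = adjoint g 1 \<bullet> x" for x using adjoint_works[OF assms, of x 1] by (simp add: inner_commute)
  then show ?thesis by blast
qed

section \<open>Degree by degree generation of the coordinate ring\<close>

locale frame = chart X V Y for X V :: "(complex^'n::finite) set" and Y +
  fixes bs pb :: "nat \<Rightarrow> real^'n" and D :: nat
  assumes bs_Y: "\<And>j. j \<le> cm \<Longrightarrow> bs j = Y j"
    and dim_S: "dim S = Suc cm + D"
    and S_span: "S = span (bs ` {..<Suc cm + D})"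
    and pb: "\<And>i j. i < Suc cm + D \<Longrightarrow> j < Suc cm + D \<Longrightarrow> pb i \<bullet> bs j = (if j = i then 1 else 0)"
begin

definition "NN = Suc cm + D"

lemma S_spanN: "S = span (bs ` {..<NN})" using S_span by (simp only: NN_def)

lemma pbN: "i < NN \<Longrightarrow> j < NN \<Longrightarrow> pb i \<bullet> bs j = (if j = i then 1 else 0)" unfolding NN_def by (rule pb)

lemma bs_S: "j < NN \<Longrightarrow> bs j \<in> S" unfolding S_spanN by (auto intro: span_base)

lemma S_decomp: assumes "v \<in> S" shows "v = (\<Sum>j<NN. (pb j \<bullet> v) *\<^sub>R bs j)"
proof -
  obtain a where a: "v = (\<Sum>j<NN. a j *\<^sub>R bs j)" using span_image_sum[of "{..<NN}" v bs] assms S_spanN by auto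
  have "pb i \<bullet> v = a i" if i: "i < NN" for i
  proof -
    have "pb i \<bullet> v = (\<Sum>j<NN. a j * (pb i \<bullet> bs j))" unfolding a by (simp add: inner_sum_right)
    also have "\<dots> = (\<Sum>j<NN. if j = i then a i else 0)" using pbN[OF i] by (intro sum.cong) auto
    finally show ?thesis using i by simp
  qed
  then have "(\<Sum>j<NN. (pb j \<bullet> v) *\<^sub>R bs j) = (\<Sum>j<NN. a j *\<^sub>R bs j)" by (intro sum.cong) auto
  then show ?thesis using a by simp
qed

definition "xc j = lf (cvec (pb j))"

lemma xc_cvec: "xc j (cvec v) = of_real (pb j \<bullet> v)" by (simp add: xc_def lf_cvec)

lemma hom_poly_xc: "hom_poly 1 (xc j)" unfolding xc_def by (rule hom_poly_lf)

lemma lf_decomp: assumes "z \<in> V" shows "lf a z = (\<Sum>j<NN. lf a (cvec (bs j)) * xc j z)"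
proof -
  have h: "hom_poly 1 (\<lambda>z. lf a z - (\<Sum>j<NN. lf a (cvec (bs j)) * xc j z))"
    by (intro hom_poly_diff hom_poly_lf hom_poly_sum hom_poly_smult hom_poly_xc)
  have "lf a z - (\<Sum>j<NN. lf a (cvec (bs j)) * xc j z) = 0"
  proof (rule RV_dense[OF h _ assms])
    fix y assume "y \<in> RV"
    then have "y \<in> S" using RV_subset by blast
    from S_decomp[OF this] have "cvec y = (\<Sum>j<NN. of_real (pb j \<bullet> y) *s cvec (bs j))"
      by (metis (no_types, lifting) cvec_simps(2) cvec_sum sum.cong)
    then have "lf a (cvec y) = (\<Sum>j<NN. of_real (pb j \<bullet> y) * lf a (cvec (bs j)))"
      using lf_sum[of a "\<lambda>j. of_real (pb j \<bullet> y) *s cvec (bs j)" "{..<NN}"] by (simp only: lf_linear)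
    then show "lf a (cvec y) - (\<Sum>j<NN. lf a (cvec (bs j)) * xc j (cvec y)) = 0" by (simp add: xc_cvec mult.commute)
  qed
  then show ?thesis by simp
qed

lemma lf_vanish_S: assumes "\<And>z. z \<in> V \<Longrightarrow> lf a z = 0" "v \<in> S" shows "lf a (cvec v) = 0"
proof -
  have "v \<in> span RV" using assms(2) by (simp add: S_def)
  then show ?thesis
  proof (induction rule: span_induct)
    case base
    show ?case by (auto simp: subspace_def cvec_simps lf_linear)
  qed (use assms(1) in \<open>auto simp: real_points_def\<close>)
qed

lemma xc_indep: "fam_indep V {..<NN} xc"
  unfolding fam_indep_def
proof (intro allI impI ballI)
  fix \<gamma> i assume \<gamma>: "\<forall>z\<in>V. (\<Sum>j<NN. \<gamma> j * xc j z) = 0" and i: "i \<in> {..<NN}"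
  let ?a = "\<Sum>j<NN. \<gamma> j *s cvec (pb j)"
  have a: "lf ?a z = (\<Sum>j<NN. \<gamma> j * xc j z)" for z by (simp add: lf_sum_left lf_linear xc_def)
  then have "lf ?a (cvec (bs i)) = 0" using \<gamma> lf_vanish_S[of ?a, OF _ bs_S[of i]] i by simp
  moreover have "(\<Sum>j<NN. \<gamma> j * xc j (cvec (bs i))) = (\<Sum>j<NN. if j = i then \<gamma> i else 0)"
    using pbN i by (intro sum.cong) (auto simp: xc_cvec)
  ultimately show "\<gamma> i = 0" unfolding a using i by simp
qed

text \<open>\<open>goodL L\<close> says that the coordinate ring \<open>R\<close> of \<open>V\<close> satisfies \<open>R\<^sub>2 = (L 0, \<dots>, L D) R\<^sub>1\<close>.\<close>

definition "inI L q \<longleftrightarrow> (\<exists>r. \<forall>z\<in>V. q z = (\<Sum>k\<le>D. lf (L k) z * lf (r k) z))"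
definition "goodL L \<longleftrightarrow> (\<forall>a b. inI L (\<lambda>z. lf a z * lf b z))"

lemma inI_add: assumes "inI L p" "inI L q" shows "inI L (\<lambda>z. p z + q z)"
proof -
  from assms obtain r s where "\<forall>z\<in>V. p z = (\<Sum>k\<le>D. lf (L k) z * lf (r k) z)" "\<forall>z\<in>V. q z = (\<Sum>k\<le>D. lf (L k) z * lf (s k) z)"
    unfolding inI_def by blast
  then have "\<forall>z\<in>V. p z + q z = (\<Sum>k\<le>D. lf (L k) z * lf (r k + s k) z)"
    by (simp add: lf_linear distrib_left sum.distrib)
  then show ?thesis unfolding inI_def by (intro exI[of _ "\<lambda>k. r k + s k"])
qed

lemma inI_smult: assumes "inI L p" shows "inI L (\<lambda>z. c * p z)"
proof -
  from assms obtain r where "\<forall>z\<in>V. p z = (\<Sum>k\<le>D. lf (L k) z * lf (r k) z)" unfolding inI_def by blast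
  then have "\<forall>z\<in>V. c * p z = (\<Sum>k\<le>D. lf (L k) z * lf (c *s r k) z)"
    by (simp add: lf_linear sum_distrib_left mult.left_commute)
  then show ?thesis unfolding inI_def by (intro exI[of _ "\<lambda>k. c *s r k"])
qed

lemma inI_gen: assumes "k \<le> D" shows "inI L (\<lambda>z. lf (L k) z * lf b z)"
proof -
  have "(\<Sum>j\<le>D. lf (L j) z * lf (if j = k then b else 0) z) = lf (L k) z * lf b z" for z
  proof -
    have "(\<Sum>j\<le>D. lf (L j) z * lf (if j = k then b else 0) z) = (\<Sum>j\<le>D. if j = k then lf (L k) z * lf b z else 0)"
      by (rule sum.cong) (auto simp: lf_linear)
    then show ?thesis using assms by simp
  qed
  then show ?thesis unfolding inI_def by (intro exI[of _ "\<lambda>j. if j = k then b else 0"]) simp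
qed

lemma inI_sum: "finite I \<Longrightarrow> (\<And>i. i \<in> I \<Longrightarrow> inI L (p i)) \<Longrightarrow> inI L (\<lambda>z. \<Sum>i\<in>I. p i z)"
proof (induction I rule: finite_induct)
  case empty
  show ?case using inI_smult[OF inI_gen[of 0 L 0], of 0] by simp
next
  case (insert i I)
  then show ?case using inI_add[of L "p i"] by simp
qed

lemma inI_cong: "inI L p \<Longrightarrow> (\<And>z. z \<in> V \<Longrightarrow> q z = p z) \<Longrightarrow> inI L q"
  unfolding inI_def by simp

text \<open>The first \<open>D\<close> forms vanish at every \<open>Y i\<close>; the last one takes
  the value 1 at each of them.\<close>

definition "L0 k = (if k < D then cvec (pb (Suc cm + k)) else (\<Sum>i\<le>cm. cvec (pb i)))"

lemma L0: "k < D \<Longrightarrow> lf (L0 k) = xc (Suc cm + k)" "lf (L0 D) z = (\<Sum>i\<le>cm. xc i z)"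
  by (auto simp: L0_def xc_def lf_sum_left)

text \<open>Restricted to \<open>S\<close>, the dual quadric \<open>Fq i j\<close> has
  \<open>xc i * xc j\<close> as its only term in the coordinates along the \<open>Y k\<close>. All
  other terms contain one of the remaining coordinates.\<close>

lemma quadric_L0:
  assumes ij: "i \<le> cm" "j \<le> cm" "i \<noteq> j" shows "inI L0 (\<lambda>z. xc i z * xc j z)"
proof -
  let ?F = "Fq i j"
  define u where "u y = (\<Sum>a\<le>cm. (pb a \<bullet> y) *\<^sub>R Y a)" for y
  define w where "w y = (\<Sum>k<D. (pb (Suc cm + k) \<bullet> y) *\<^sub>R bs (Suc cm + k))" for y
  have linu: "linear u" "linear w" unfolding u_def w_def
    by (auto intro!: linearI simp: inner_add_right scaleR_add_left sum.distrib scaleR_sum_right)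
  \<comment> \<open>With \<open>y = u + w\<close>, the value of the quadric is its value at
    \<open>u\<close> plus the polar form of \<open>u + w / 2\<close> and \<open>w\<close>; the half
    compensates for \<open>rbf\<close> being twice the quadratic form on the diagonal.\<close>
  have linr: "linear (\<lambda>y. rbf ?F (u y + (1/2) *\<^sub>R w y) v)" for v
    by (rule linearI) (simp_all add: linear_add[OF linu(1)] linear_add[OF linu(2)] linear_scale[OF linu(1)] linear_scale[OF linu(2)]
        linear_add[OF linear_rbf_left] linear_scale[OF linear_rbf_left] algebra_simps)
  have "\<forall>k. \<exists>q. \<forall>x. rbf ?F (u x + (1/2) *\<^sub>R w x) (bs (Suc cm + k)) = q \<bullet> x"
    using linear_functional_inner[OF linr] by blast
  from choice[OF this] obtain q where q: "\<And>k x. rbf ?F (u x + (1/2) *\<^sub>R w x) (bs (Suc cm + k)) = q k \<bullet> x" by blast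
  have real: "(pb i \<bullet> y) * (pb j \<bullet> y) + (\<Sum>k<D. (pb (Suc cm + k) \<bullet> y) * (q k \<bullet> y)) = 0" if y: "y \<in> RV" for y
  proof -
    have yS: "y \<in> S" using y RV_subset by blast
    have split: "{..<NN} = {..cm} \<union> {Suc cm..<NN}" by (auto simp: NN_def)
    have "(\<Sum>j<NN. (pb j \<bullet> y) *\<^sub>R bs j) = (\<Sum>j\<le>cm. (pb j \<bullet> y) *\<^sub>R bs j) + (\<Sum>j\<in>{Suc cm..<NN}. (pb j \<bullet> y) *\<^sub>R bs j)"
      unfolding split by (rule sum.union_disjoint) auto
    also have "(\<Sum>j\<in>{Suc cm..<NN}. (pb j \<bullet> y) *\<^sub>R bs j) = w y"
      unfolding w_def by (rule sum.reindex_bij_witness[of _ "\<lambda>k. Suc cm + k" "\<lambda>j. j - Suc cm"]) (auto simp: NN_def)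
    also have "(\<Sum>j\<le>cm. (pb j \<bullet> y) *\<^sub>R bs j) = u y" unfolding u_def by (rule sum.cong) (auto simp: bs_Y)
    finally have yuw: "y = u y + w y" using S_decomp[OF yS] by simp
    have "rbf ?F (u y) (u y) = (\<Sum>a\<le>cm. \<Sum>b\<le>cm. (pb a \<bullet> y) * ((pb b \<bullet> y) * rbf ?F (Y a) (Y b)))"
    proof -
      have e1: "rbf ?F (u y) v = (\<Sum>a\<le>cm. (pb a \<bullet> y) * rbf ?F (Y a) v)" for v
        unfolding u_def by (simp add: linear_sum[OF linear_rbf_left] linear_scale[OF linear_rbf_left])
      have e2: "rbf ?F v (u y) = (\<Sum>b\<le>cm. (pb b \<bullet> y) * rbf ?F v (Y b))" for v
        unfolding u_def by (simp add: linear_sum[OF linear_rbf] linear_scale[OF linear_rbf])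
      have "rbf ?F (u y) (u y) = (\<Sum>a\<le>cm. (pb a \<bullet> y) * rbf ?F (Y a) (u y))" by (rule e1)
      also have "\<dots> = (\<Sum>a\<le>cm. \<Sum>b\<le>cm. (pb a \<bullet> y) * ((pb b \<bullet> y) * rbf ?F (Y a) (Y b)))"
        by (subst e2) (simp add: sum_distrib_left)
      finally show ?thesis .
    qed
    also have "\<dots> = (\<Sum>a\<le>cm. \<Sum>b\<le>cm. (if a = i \<and> b = j then (pb i \<bullet> y) * (pb j \<bullet> y) else 0) + (if a = j \<and> b = i then (pb i \<bullet> y) * (pb j \<bullet> y) else 0))"
    proof (intro sum.cong refl)
      fix a b assume ab: "a \<in> {..cm}" "b \<in> {..cm}"
      have "rbf ?F (Y j) (Y i) = 1" using Fq(2)[OF ij] by (simp add: rbf_commute)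
      then show "(pb a \<bullet> y) * ((pb b \<bullet> y) * rbf ?F (Y a) (Y b)) = (if a = i \<and> b = j then (pb i \<bullet> y) * (pb j \<bullet> y) else 0) + (if a = j \<and> b = i then (pb i \<bullet> y) * (pb j \<bullet> y) else 0)"
        using Fq(2)[OF ij] Fq(3)[OF ij, of a b] ab ij(3) by (cases "{a, b} = {i, j}") (auto simp: doubleton_eq_iff)
    qed
    also have "\<dots> = 2 * ((pb i \<bullet> y) * (pb j \<bullet> y))"
    proof -
      have "(\<Sum>a\<le>cm. \<Sum>b\<le>cm. if a = p \<and> b = r then c else 0) = c" if "p \<le> cm" "r \<le> cm" for p r and c :: real
      proof -
        have "(\<Sum>a\<le>cm. \<Sum>b\<le>cm. if a = p \<and> b = r then c else 0) = (\<Sum>a\<le>cm. if a = p then c else 0)"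
          using that(2) by (intro sum.cong) auto
        then show ?thesis using that(1) by simp
      qed
      then show ?thesis using ij by (simp add: sum.distrib)
    qed
    finally have uu: "rqform ?F (u y) = (pb i \<bullet> y) * (pb j \<bullet> y)" by (simp add: rbf_diag)
    have "rbf ?F (u y + (1/2) *\<^sub>R w y) (w y) = (\<Sum>k<D. (pb (Suc cm + k) \<bullet> y) * (q k \<bullet> y))"
      by (subst (2) w_def) (simp only: linear_sum[OF linear_rbf] linear_scale[OF linear_rbf] q real_scaleR_def)
    moreover have "rbf ?F (u y + (1/2) *\<^sub>R w y) (w y) = rbf ?F (u y) (w y) + rqform ?F (w y)"
      by (simp add: linear_add[OF linear_rbf_left] linear_scale[OF linear_rbf_left] rbf_diag)
    moreover have "rqform ?F y = 0" using ideal2_real_points[OF Fq(1)[OF ij]] y RV_subset by blast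
    then have "rqform ?F (u y) + rbf ?F (u y) (w y) + rqform ?F (w y) = 0" using rqform_add[of ?F "u y" "w y"] yuw by simp
    ultimately show ?thesis using uu by linarith
  qed
  have h: "hom_poly 2 (\<lambda>z. xc i z * xc j z + (\<Sum>k<D. xc (Suc cm + k) z * lf (cvec (q k)) z))"
    using hom_poly_mult[OF hom_poly_xc hom_poly_xc] hom_poly_mult[OF hom_poly_xc hom_poly_lf]
    by (intro hom_poly_add hom_poly_sum) (simp_all add: numeral_2_eq_2)
  have zero: "xc i z * xc j z + (\<Sum>k<D. xc (Suc cm + k) z * lf (cvec (q k)) z) = 0" if z: "z \<in> V" for z
  proof (rule RV_dense[OF h _ z])
    fix y assume "y \<in> RV"
    from real[OF this] have "complex_of_real ((pb i \<bullet> y) * (pb j \<bullet> y) + (\<Sum>k<D. (pb (Suc cm + k) \<bullet> y) * (q k \<bullet> y))) = of_real 0" by (rule arg_cong)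
    then show "xc i (cvec y) * xc j (cvec y) + (\<Sum>k<D. xc (Suc cm + k) (cvec y) * lf (cvec (q k)) (cvec y)) = 0"
      by (simp add: xc_cvec lf_cvec)
  qed
  have "inI L0 (\<lambda>z. - 1 * (\<Sum>k<D. lf (L0 k) z * lf (cvec (q k)) z))"
    by (intro inI_smult inI_sum inI_gen) auto
  then show ?thesis
  proof (rule inI_cong)
    fix z assume "z \<in> V"
    from zero[OF this] show "xc i z * xc j z = - 1 * (\<Sum>k<D. lf (L0 k) z * lf (cvec (q k)) z)"
      by (simp add: L0(1) eq_neg_iff_add_eq_0)
  qed
qed

lemma goodL_L0: "goodL L0"
  unfolding goodL_def
proof (intro allI)
  fix a b
  have prod: "inI L0 (\<lambda>z. xc i z * xc j z)" if "i < NN" "j < NN" for i j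
  proof -
    have t: "inI L0 (\<lambda>z. xc i z * xc j z)" if "Suc cm \<le> i" "i < NN" for i j
    proof -
      have "i - Suc cm < D" "Suc cm + (i - Suc cm) = i" using that by (auto simp: NN_def)
      then show ?thesis using inI_gen[of "i - Suc cm" L0 "cvec (pb j)"] L0(1)[of "i - Suc cm"] by (simp add: xc_def)
    qed
    have t': "inI L0 (\<lambda>z. xc i z * xc j z)" if "Suc cm \<le> j" "j < NN" for i j
      using t[OF that, of i] by (simp add: mult.commute)
    \<comment> \<open>A square equals the coordinate times the last parameter, minus its products
      with the other coordinates, which are covered by \<open>quadric_L0\<close>.\<close>
    have sq: "inI L0 (\<lambda>z. xc i z * xc i z)" if i: "i \<le> cm" for i
    proof -
      have "inI L0 (\<lambda>z. lf (L0 D) z * lf (cvec (pb i)) z + - 1 * (\<Sum>k\<in>{..cm} - {i}. xc i z * xc k z))"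
        by (intro inI_add inI_gen inI_smult inI_sum quadric_L0) (use i in auto)
      then show ?thesis
      proof (rule inI_cong)
        fix z
        have "(\<Sum>k\<le>cm. xc k z) = xc i z + (\<Sum>k\<in>{..cm} - {i}. xc k z)" by (rule sum.remove) (use i in auto)
        then show "xc i z * xc i z = lf (L0 D) z * lf (cvec (pb i)) z + - 1 * (\<Sum>k\<in>{..cm} - {i}. xc i z * xc k z)"
          unfolding L0(2) xc_def[symmetric] sum_distrib_left[symmetric] by (simp add: distrib_right distrib_left mult.commute)
      qed
    qed
    show ?thesis using t[of i j] t'[of j i] quadric_L0[of i j] sq[of i] that by (cases "i \<le> cm"; cases "j \<le> cm"; cases "i = j") auto
  qed
  have "inI L0 (\<lambda>z. \<Sum>i<NN. \<Sum>j<NN. (lf a (cvec (bs i)) * lf b (cvec (bs j))) * (xc i z * xc j z))"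
    by (intro inI_sum inI_smult prod) auto
  then show "inI L0 (\<lambda>z. lf a z * lf b z)"
  proof (rule inI_cong)
    fix z assume z: "z \<in> V"
    show "lf a z * lf b z = (\<Sum>i<NN. \<Sum>j<NN. (lf a (cvec (bs i)) * lf b (cvec (bs j))) * (xc i z * xc j z))"
      unfolding lf_decomp[OF z, of a] lf_decomp[OF z, of b] sum_product by (intro sum.cong refl) (simp add: mult_ac)
  qed
qed

definition "Idx t = {\<alpha> :: nat \<Rightarrow> nat. (\<forall>k. k \<notin> {..D} \<longrightarrow> \<alpha> k = 0) \<and> sum \<alpha> {..D} = t}"

lemma finite_Idx: "finite (Idx t)"
proof -
  have "\<alpha> k \<le> sum \<alpha> {..D}" if "k \<le> D" for \<alpha> :: "nat \<Rightarrow> nat" and k using that by (intro member_le_sum) auto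
  then have "Idx t \<subseteq> {f. \<forall>x. (x \<in> {..D} \<longrightarrow> f x \<in> {..t}) \<and> (x \<notin> {..D} \<longrightarrow> f x = 0)}" by (auto simp: Idx_def)
  then show ?thesis by (rule finite_subset) (rule finite_set_of_finite_funs; simp)
qed

lemma Idx_eqI:
  assumes a: "\<alpha> \<in> Idx s" "\<beta> \<in> Idx s" and eq: "\<And>k. k < D \<Longrightarrow> \<alpha> k = \<beta> k" shows "\<alpha> = \<beta>"
proof
  fix k
  have "sum \<alpha> {..D} = sum \<alpha> {..<D} + \<alpha> D" for \<alpha> :: "nat \<Rightarrow> nat" by (simp add: lessThan_Suc_atMost[symmetric])
  moreover have "sum \<alpha> {..<D} = sum \<beta> {..<D}" by (rule sum.cong) (auto simp: eq)
  ultimately have "\<alpha> D = \<beta> D" using a by (simp add: Idx_def)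
  then show "\<alpha> k = \<beta> k" using eq[of k] a by (cases "k < D"; cases "k = D") (auto simp: Idx_def)
qed

definition "mon L \<alpha> z = (\<Prod>k\<le>D. lf (L k) z ^ \<alpha> k)" for L :: "nat \<Rightarrow> complex^'n" and \<alpha> :: "nat \<Rightarrow> nat"

lemma hom_poly_mon: "\<alpha> \<in> Idx t \<Longrightarrow> hom_poly t (mon L \<alpha>)"
proof -
  assume \<alpha>: "\<alpha> \<in> Idx t"
  have "hom_poly (\<Sum>k\<le>D. 1 * \<alpha> k) (mon L \<alpha>)" unfolding mon_def[abs_def] by (intro hom_poly_prod hom_poly_power hom_poly_lf)
  then show ?thesis using \<alpha> by (simp add: Idx_def)
qed

lemma mon_Suc: assumes "k \<le> D" shows "mon L (\<alpha>(k := Suc (\<alpha> k))) z = lf (L k) z * mon L \<alpha> z"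
proof -
  have "mon L (\<alpha>(k := Suc (\<alpha> k))) z = lf (L k) z ^ Suc (\<alpha> k) * (\<Prod>j\<in>{..D} - {k}. lf (L j) z ^ \<alpha> j)"
    unfolding mon_def using assms by (subst prod.remove[of _ k]) (auto intro!: prod.cong)
  also have "\<dots> = lf (L k) z * mon L \<alpha> z"
    unfolding mon_def using assms by (subst (2) prod.remove[of _ k]) (auto simp: mult.assoc)
  finally show ?thesis .
qed

lemma Idx_Suc: assumes "\<alpha> \<in> Idx t" "k \<le> D" shows "\<alpha>(k := Suc (\<alpha> k)) \<in> Idx (Suc t)"
proof -
  have "sum (\<alpha>(k := Suc (\<alpha> k))) {..D} = Suc (\<alpha> k) + sum \<alpha> ({..D} - {k})"
    using assms(2) by (subst sum.remove[of _ k]) (auto intro!: sum.cong)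
  also have "\<dots> = Suc (sum \<alpha> {..D})" using assms(2) by (subst (2) sum.remove[of _ k]) auto
  finally show ?thesis using assms by (auto simp: Idx_def)
qed

definition "Rep L t f \<longleftrightarrow> (\<exists>c. \<forall>z\<in>V. f z = (\<Sum>\<alpha>\<in>Idx t. mon L \<alpha> z * lf (c \<alpha>) z))"

lemma Rep_add: assumes "Rep L t f" "Rep L t g" shows "Rep L t (\<lambda>z. f z + g z)"
proof -
  from assms obtain c d where "\<forall>z\<in>V. f z = (\<Sum>\<alpha>\<in>Idx t. mon L \<alpha> z * lf (c \<alpha>) z)" "\<forall>z\<in>V. g z = (\<Sum>\<alpha>\<in>Idx t. mon L \<alpha> z * lf (d \<alpha>) z)"
    unfolding Rep_def by (elim exE)
  then have "\<forall>z\<in>V. f z + g z = (\<Sum>\<alpha>\<in>Idx t. mon L \<alpha> z * lf (c \<alpha> + d \<alpha>) z)" by (simp add: lf_linear distrib_left sum.distrib)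
  then show ?thesis unfolding Rep_def by (rule exI[of _ "\<lambda>\<alpha>. c \<alpha> + d \<alpha>"])
qed

lemma Rep_single: assumes "\<alpha> \<in> Idx t" shows "Rep L t (\<lambda>z. mon L \<alpha> z * lf b z)"
proof -
  have "(\<Sum>\<beta>\<in>Idx t. mon L \<beta> z * lf (if \<beta> = \<alpha> then b else 0) z) = mon L \<alpha> z * lf b z" for z
  proof -
    have "(\<Sum>\<beta>\<in>Idx t. mon L \<beta> z * lf (if \<beta> = \<alpha> then b else 0) z) = (\<Sum>\<beta>\<in>Idx t. if \<beta> = \<alpha> then mon L \<alpha> z * lf b z else 0)"
      by (rule sum.cong) (auto simp: lf_linear)
    then show ?thesis using assms finite_Idx by simp
  qed
  then show ?thesis unfolding Rep_def by (intro exI[of _ "\<lambda>\<beta>. if \<beta> = \<alpha> then b else 0"]) simp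
qed

lemma Rep_sum: "finite I \<Longrightarrow> (\<And>i. i \<in> I \<Longrightarrow> Rep L t (p i)) \<Longrightarrow> Rep L t (\<lambda>z. \<Sum>i\<in>I. p i z)"
proof (induction I rule: finite_induct)
  case empty
  show ?case unfolding Rep_def by (rule exI[of _ "\<lambda>_. 0"]) (simp add: lf_linear)
next
  case (insert i I)
  then show ?case using Rep_add[of L t "p i"] by simp
qed

lemma Rep_cong: "Rep L t p \<Longrightarrow> (\<And>z. z \<in> V \<Longrightarrow> q z = p z) \<Longrightarrow> Rep L t q"
  unfolding Rep_def by simp

text \<open>Split off a coordinate and apply induction; \<open>goodL\<close> then trades the product
  of two linear forms for a parameter times a linear form.\<close>

lemma goodL_Rep:
  assumes L: "goodL L" and "hom_poly (Suc t) f" shows "Rep L t f"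
  using assms(2)
proof (induction t arbitrary: f)
  case 0
  obtain a where a: "f = lf a" using hom_poly_1_lf[of f] 0 by auto
  have "(\<lambda>_. 0) \<in> Idx 0" by (simp add: Idx_def)
  from Rep_single[OF this, of L a] show ?case unfolding a by (simp add: mon_def)
next
  case (Suc t)
  from hom_poly_Suc_coords[OF Suc(2)] obtain g where g: "\<forall>i. hom_poly (Suc t) (g i)" "f = (\<lambda>z. \<Sum>i\<in>UNIV. z $ i * g i z)"
    by (elim exE conjE)
  have "Rep L (Suc t) (\<lambda>z. z $ i * g i z)" for i
  proof -
    from Suc(1)[OF g(1)[rule_format, of i]] obtain c where c: "\<forall>z\<in>V. g i z = (\<Sum>\<alpha>\<in>Idx t. mon L \<alpha> z * lf (c \<alpha>) z)"
      unfolding Rep_def by (elim exE)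
    have "\<forall>\<alpha>. \<exists>r. \<forall>z\<in>V. lf (axis i 1) z * lf (c \<alpha>) z = (\<Sum>k\<le>D. lf (L k) z * lf (r k) z)"
      using L unfolding goodL_def inI_def by (intro allI) simp
    from choice[OF this] obtain r where r: "\<forall>\<alpha>. \<forall>z\<in>V. lf (axis i 1) z * lf (c \<alpha>) z = (\<Sum>k\<le>D. lf (L k) z * lf (r \<alpha> k) z)"
      by (elim exE)
    have "Rep L (Suc t) (\<lambda>z. \<Sum>\<alpha>\<in>Idx t. \<Sum>k\<le>D. mon L (\<alpha>(k := Suc (\<alpha> k))) z * lf (r \<alpha> k) z)"
      by (intro Rep_sum finite_Idx finite_atMost Rep_single Idx_Suc) auto
    then show ?thesis
    proof (rule Rep_cong)
      fix z assume z: "z \<in> V"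
      have "z $ i * g i z = (\<Sum>\<alpha>\<in>Idx t. mon L \<alpha> z * (lf (axis i 1) z * lf (c \<alpha>) z))"
        using c z by (simp add: sum_distrib_left lf_axis mult_ac)
      also have "\<dots> = (\<Sum>\<alpha>\<in>Idx t. \<Sum>k\<le>D. mon L (\<alpha>(k := Suc (\<alpha> k))) z * lf (r \<alpha> k) z)"
        using r z by (intro sum.cong refl) (simp add: sum_distrib_left mon_Suc mult_ac del: fun_upd_apply)
      finally show "z $ i * g i z = (\<Sum>\<alpha>\<in>Idx t. \<Sum>k\<le>D. mon L (\<alpha>(k := Suc (\<alpha> k))) z * lf (r \<alpha> k) z)" .
    qed
  qed
  then show ?case unfolding g(2) by (intro Rep_sum) auto
qed

end

lemma in_fam_add: assumes "in_fam V J g p" "in_fam V J g q" shows "in_fam V J g (\<lambda>z. p z + q z)"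
proof -
  from assms obtain a b where "\<forall>z\<in>V. p z = (\<Sum>j\<in>J. a j * g j z)" "\<forall>z\<in>V. q z = (\<Sum>j\<in>J. b j * g j z)"
    unfolding in_fam_def by (elim exE)
  then have "\<forall>z\<in>V. p z + q z = (\<Sum>j\<in>J. (a j + b j) * g j z)" by (simp add: distrib_right sum.distrib)
  then show ?thesis unfolding in_fam_def by (rule exI[of _ "\<lambda>j. a j + b j"])
qed

lemma in_fam_smult: assumes "in_fam V J g p" shows "in_fam V J g (\<lambda>z. c * p z)"
proof -
  from assms obtain a where "\<forall>z\<in>V. p z = (\<Sum>j\<in>J. a j * g j z)" unfolding in_fam_def by (elim exE)
  then have "\<forall>z\<in>V. c * p z = (\<Sum>j\<in>J. (c * a j) * g j z)" by (simp add: sum_distrib_left mult.assoc)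
  then show ?thesis unfolding in_fam_def by (rule exI[of _ "\<lambda>j. c * a j"])
qed

lemma in_fam_zero: "in_fam V J g (\<lambda>z. 0)"
  unfolding in_fam_def by (rule exI[of _ "\<lambda>_. 0"]) simp

lemma in_fam_sum: "(\<And>i. i \<in> I \<Longrightarrow> in_fam V J g (p i)) \<Longrightarrow> in_fam V J g (\<lambda>z. \<Sum>i\<in>I. p i z)"
proof (induction I rule: infinite_finite_induct)
  case (insert i I)
  then show ?case using in_fam_add[of V J g "p i"] by simp
qed (simp_all add: in_fam_zero)

lemma in_fam_single: assumes "finite J" "j \<in> J" shows "in_fam V J g (g j)"
proof -
  have "(\<Sum>i\<in>J. (if i = j then 1 else 0) * g i z) = g j z" for z
    using assms by (simp add: if_distrib if_distribR cong: if_cong)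
  then show ?thesis unfolding in_fam_def by (intro exI[of _ "\<lambda>i. if i = j then 1 else 0"]) simp
qed

lemma in_fam_cong: "in_fam V J g p \<Longrightarrow> (\<And>z. z \<in> V \<Longrightarrow> q z = p z) \<Longrightarrow> in_fam V J g q"
  unfolding in_fam_def by simp

lemma in_fam_trans:
  assumes "in_fam V J g p" "\<And>j. j \<in> J \<Longrightarrow> in_fam V K k (g j)" shows "in_fam V K k p"
proof -
  from assms(1) obtain a where a: "\<forall>z\<in>V. p z = (\<Sum>j\<in>J. a j * g j z)" unfolding in_fam_def by (elim exE)
  have "in_fam V K k (\<lambda>z. \<Sum>j\<in>J. a j * g j z)" by (intro in_fam_sum in_fam_smult assms(2))
  then show ?thesis by (rule in_fam_cong) (use a in simp)
qed

lemma fam_indep_insert_fails: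
  assumes "finite I" "j \<notin> I" "fam_indep V I f" "\<not> fam_indep V (insert j I) f" shows "in_fam V I f (f j)"
proof -
  from assms(4) obtain \<gamma> i where \<gamma>: "\<forall>z\<in>V. (\<Sum>i\<in>insert j I. \<gamma> i * f i z) = 0" "i \<in> insert j I" "\<gamma> i \<noteq> 0"
    unfolding fam_indep_def by blast
  have rel: "\<gamma> j * f j z + (\<Sum>i\<in>I. \<gamma> i * f i z) = 0" if "z \<in> V" for z using \<gamma>(1) that assms(1,2) by simp
  have "\<gamma> j \<noteq> 0"
  proof
    assume 0: "\<gamma> j = 0"
    then have "\<forall>i\<in>I. \<gamma> i = 0" using fam_indepD[OF assms(3), of \<gamma>] rel by simp
    then show False using \<gamma>(2,3) 0 by auto
  qed
  then have "f j z = (\<Sum>i\<in>I. (- \<gamma> i / \<gamma> j) * f i z)" if "z \<in> V" for z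
  proof -
    have "f j z = - (\<Sum>i\<in>I. \<gamma> i * f i z) / \<gamma> j" using rel[OF that] \<open>\<gamma> j \<noteq> 0\<close> by (simp add: field_simps eq_neg_iff_add_eq_0)
    then show ?thesis by (simp add: sum_divide_distrib sum_negf[symmetric])
  qed
  then show ?thesis unfolding in_fam_def by (intro exI[of _ "\<lambda>i. - \<gamma> i / \<gamma> j"]) simp
qed

section \<open>Freeness for the special parameters, by orders of vanishing along curves\<close>

context frame
begin

text \<open>The expected basis in degree \<open>Suc t\<close> of a free module over the polynomial
  ring in the parameters, with generators 1 and the \<open>cm\<close> linear forms
  \<open>u j\<close>.\<close>

definition "Fam t = Idx (Suc t) <+> (J \<times> Idx t)"
definition "famf L u x z = (case x of Inl \<alpha> \<Rightarrow> mon L \<alpha> z | Inr p \<Rightarrow> lf (u (fst p)) z * mon L (snd p) z)"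
  for L :: "nat \<Rightarrow> complex^'n" and u :: "nat \<Rightarrow> complex^'n"

lemma finite_Fam: "finite (Fam t)" by (simp add: Fam_def finite_Idx)

lemma Fam_sum: "(\<Sum>x\<in>Fam t. \<gamma> x * famf L u x z) =
    (\<Sum>\<alpha>\<in>Idx (Suc t). \<gamma> (Inl \<alpha>) * mon L \<alpha> z) + (\<Sum>j\<in>J. \<Sum>\<beta>\<in>Idx t. \<gamma> (Inr (j, \<beta>)) * (lf (u j) z * mon L \<beta> z))"
  unfolding Fam_def by (simp add: sum.Plus finite_Idx famf_def sum.cartesian_product case_prod_unfold)

text \<open>The order of a monomial on a curve whose \<open>k\<close>-th transversal coordinate is
  the power \<open>(t + 2) ^ k\<close> of the parameter. Exponents are at most \<open>t + 1\<close>,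
  so they are digits in base \<open>t + 2\<close>. The exponent at \<open>D\<close> is left out
  since the last parameter tends to 1; the total degree determines it.\<close>

definition "ord t \<alpha> = (\<Sum>k<D. \<alpha> k * (t + 2) ^ k)" for \<alpha> :: "nat \<Rightarrow> nat"

lemma ord_inj:
  assumes "\<alpha> \<in> Idx s" "\<beta> \<in> Idx s" "s \<le> Suc t" "ord t \<alpha> = ord t \<beta>" shows "\<alpha> = \<beta>"
proof -
  have lt: "\<alpha> k < t + 2" if "\<alpha> \<in> Idx s" "k \<le> D" for \<alpha> k
  proof -
    have "\<alpha> k \<le> sum \<alpha> {..D}" using that(2) by (intro member_le_sum) auto
    then show ?thesis using that(1) assms(3) by (simp add: Idx_def)
  qed
  show ?thesis
  proof (rule Idx_eqI[OF assms(1,2)])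
    fix k assume "k < D"
    then show "\<alpha> k = \<beta> k"
      by (intro kronecker_digits_unique[of \<alpha> "t + 2" D \<beta>]) (use assms lt in \<open>auto simp: ord_def\<close>)
  qed
qed

lemma bs_Y_dual: "j \<le> cm \<Longrightarrow> a < NN \<Longrightarrow> pb a \<bullet> Y j = (if j = a then 1 else 0)"
  using pbN[of a j] bs_Y[of j] by (auto simp: NN_def)

lemma tangent_frame:
  assumes i: "i \<le> cm" and k: "k < D"
  shows "\<exists>w. w \<in> T1 (Y i) \<and> (\<forall>l<D. pb (Suc cm + l) \<bullet> w = (if l = k then 1 else 0))"
proof -
  have kN: "Suc cm + k < NN" using k by (simp add: NN_def)
  from strong_max_spans[OF strong i bs_S[OF kN]] obtain w a where w: "w \<in> T1 (Y i)" "bs (Suc cm + k) = w + (\<Sum>j\<in>{..cm} - {i}. a j *\<^sub>R Y j)"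
    by blast
  have "pb (Suc cm + l) \<bullet> w = (if l = k then 1 else 0)" if l: "l < D" for l
  proof -
    have lN: "Suc cm + l < NN" using l by (simp add: NN_def)
    have "pb (Suc cm + l) \<bullet> (\<Sum>j\<in>{..cm} - {i}. a j *\<^sub>R Y j) = 0"
      using bs_Y_dual[OF _ lN] by (simp add: inner_sum_right)
    moreover have "pb (Suc cm + l) \<bullet> bs (Suc cm + k) = (if l = k then 1 else 0)" using pbN[OF lN kN] by auto
    ultimately show ?thesis unfolding w(2) by (simp add: inner_add_right)
  qed
  then show ?thesis using w(1) by blast
qed

text \<open>A small tangent vector at \<open>Y i\<close> with the prescribed transversal coordinates
  is corrected to a point of \<open>V\<close> by multiples of the \<open>Y j\<close>, which do not
  affect these coordinates.\<close>

lemma chart_curve: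
  assumes i: "i \<le> cm" and M: "M \<noteq> 0"
  shows "\<exists>z. (\<forall>\<^sub>F e in at_right 0. z e \<in> RV) \<and> (\<forall>k<D. \<forall>e. pb (Suc cm + k) \<bullet> z e = e ^ (M ^ k)) \<and>
    (\<forall>j\<le>cm. ((\<lambda>e. pb j \<bullet> z e) \<longlongrightarrow> (if j = i then 1 else 0)) (at_right (0::real)))"
proof -
  from local_points_at[OF i] obtain C e0 where C: "C \<ge> 0" "e0 > 0"
    "\<forall>w\<in>T1 (Y i). norm w < e0 \<longrightarrow> (\<exists>s. (\<forall>j\<le>cm. \<bar>s j\<bar> \<le> C * (norm w)\<^sup>2) \<and> Y i + w + (\<Sum>j\<le>cm. s j *\<^sub>R Y j) \<in> RV)"
    by (elim exE conjE)
  have "\<forall>k. \<exists>w. k < D \<longrightarrow> w \<in> T1 (Y i) \<and> (\<forall>l<D. pb (Suc cm + l) \<bullet> w = (if l = k then 1 else 0))"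
    using tangent_frame[OF i] by blast
  from choice[OF this] obtain w where w: "\<And>k. k < D \<Longrightarrow> w k \<in> T1 (Y i)" "\<And>k l. k < D \<Longrightarrow> l < D \<Longrightarrow> pb (Suc cm + l) \<bullet> w k = (if l = k then 1 else 0)"
    by blast
  define W where "W e = (\<Sum>k<D. e ^ (M ^ k) *\<^sub>R w k)" for e :: real
  have WT: "W e \<in> T1 (Y i)" for e unfolding W_def
    using w(1) by (intro subspace_sum[OF subspace_T1] subspace_scale[OF subspace_T1]) auto
  have W0: "(W \<longlongrightarrow> 0) (at_right 0)"
  proof -
    have "(W \<longlongrightarrow> (\<Sum>k<D. 0 ^ (M ^ k) *\<^sub>R w k)) (at_right 0)" unfolding W_def[abs_def] by (intro tendsto_intros)
    moreover have "(\<Sum>k<D. (0::real) ^ (M ^ k) *\<^sub>R w k) = 0" using M by (intro sum.neutral) auto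
    ultimately show ?thesis by simp
  qed
  \<comment> \<open>The corrections are picked separately for each parameter value; the quadratic
    bound alone makes them tend to 0.\<close>
  define s where "s e = (SOME s. (\<forall>j\<le>cm. \<bar>s j\<bar> \<le> C * (norm (W e))\<^sup>2) \<and> Y i + W e + (\<Sum>j\<le>cm. s j *\<^sub>R Y j) \<in> RV)" for e
  have ev: "\<forall>\<^sub>F e in at_right 0. (\<forall>j\<le>cm. \<bar>s e j\<bar> \<le> C * (norm (W e))\<^sup>2) \<and> Y i + W e + (\<Sum>j\<le>cm. s e j *\<^sub>R Y j) \<in> RV"
  proof -
    have "\<forall>\<^sub>F e in at_right 0. norm (W e) < e0"
      using tendsto_norm_zero[OF W0] C(2) by (rule order_tendstoD(2))
    then show ?thesis
    proof eventually_elim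
      case (elim e)
      from C(3)[rule_format, OF WT elim] show ?case unfolding s_def by (rule someI_ex)
    qed
  qed
  have s0: "((\<lambda>e. s e j) \<longlongrightarrow> 0) (at_right 0)" if j: "j \<le> cm" for j
  proof (rule Lim_null_comparison)
    show "\<forall>\<^sub>F e in at_right 0. norm (s e j) \<le> C * (norm (W e))\<^sup>2" using ev by eventually_elim (use j in simp)
    have "((\<lambda>e. C * (norm (W e))\<^sup>2) \<longlongrightarrow> C * (norm (0::real^'n))\<^sup>2) (at_right 0)" by (intro tendsto_intros W0)
    then show "((\<lambda>e. C * (norm (W e))\<^sup>2) \<longlongrightarrow> 0) (at_right 0)" by simp
  qed
  define z where "z e = Y i + W e + (\<Sum>j\<le>cm. s e j *\<^sub>R Y j)" for e
  have "\<forall>\<^sub>F e in at_right 0. z e \<in> RV" using ev by eventually_elim (simp add: z_def)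
  moreover have "pb (Suc cm + k) \<bullet> z e = e ^ (M ^ k)" if k: "k < D" for k e
  proof -
    have kN: "Suc cm + k < NN" using k by (simp add: NN_def)
    have "pb (Suc cm + k) \<bullet> W e = (\<Sum>l<D. if l = k then e ^ (M ^ k) else 0)"
      unfolding W_def inner_sum_right using w(2)[OF _ k] by (intro sum.cong) auto
    then show ?thesis unfolding z_def using bs_Y_dual[OF _ kN] i k by (simp add: inner_add_right inner_sum_right)
  qed
  moreover have "((\<lambda>e. pb j \<bullet> z e) \<longlongrightarrow> (if j = i then 1 else 0)) (at_right 0)" if j: "j \<le> cm" for j
  proof -
    have jN: "j < NN" using j by (simp add: NN_def)
    have "pb j \<bullet> z e = (if j = i then 1 else 0) + pb j \<bullet> W e + s e j" for e
    proof -
      have "pb j \<bullet> (\<Sum>l\<le>cm. s e l *\<^sub>R Y l) = (\<Sum>l\<le>cm. if l = j then s e j else 0)"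
        unfolding inner_sum_right using bs_Y_dual[OF _ jN] by (intro sum.cong) auto
      then show ?thesis unfolding z_def using bs_Y_dual[OF i jN] j by (simp add: inner_add_right)
    qed
    moreover have "((\<lambda>e. (if j = i then 1 else 0) + pb j \<bullet> W e + s e j) \<longlongrightarrow> (if j = i then 1 else 0) + pb j \<bullet> 0 + 0) (at_right 0)"
      by (intro tendsto_intros W0 s0[OF j])
    ultimately show ?thesis by simp
  qed
  ultimately show ?thesis by (intro exI[of _ z]) simp
qed

text \<open>Evaluate the relation on the curve at \<open>Y i\<close>, divide by the
  \<open>m\<close>-th power of the parameter and let it tend to 0. Only terms of order exactly
  \<open>m\<close> survive, encoded by \<open>0 ^ 0 = 1\<close>.\<close>

lemma chart_limit:
  assumes i: "i \<le> cm"
    and rel: "\<And>z. z \<in> V \<Longrightarrow> (\<Sum>\<alpha>\<in>Idx (Suc t). c \<alpha> * mon L0 \<alpha> z) + (\<Sum>j\<in>J. \<Sum>\<beta>\<in>Idx t. d j \<beta> * (xc j z * mon L0 \<beta> z)) = 0"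
    and m: "\<And>\<alpha>. \<alpha> \<in> Idx (Suc t) \<Longrightarrow> c \<alpha> \<noteq> 0 \<Longrightarrow> m \<le> ord t \<alpha>" "\<And>j \<beta>. j \<in> J \<Longrightarrow> \<beta> \<in> Idx t \<Longrightarrow> d j \<beta> \<noteq> 0 \<Longrightarrow> m \<le> ord t \<beta>"
  shows "(\<Sum>\<alpha>\<in>Idx (Suc t). c \<alpha> * 0 ^ (ord t \<alpha> - m)) + (\<Sum>j\<in>J. \<Sum>\<beta>\<in>Idx t. d j \<beta> * ((if j = i then 1 else 0) * 0 ^ (ord t \<beta> - m))) = 0"
proof -
  have "t + 2 \<noteq> 0" by simp
  from chart_curve[OF i this] obtain z where z: "\<forall>\<^sub>F e in at_right 0. z e \<in> RV" "\<forall>k<D. \<forall>e. pb (Suc cm + k) \<bullet> z e = e ^ ((t + 2) ^ k)"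
    "\<forall>j\<le>cm. ((\<lambda>e. pb j \<bullet> z e) \<longlongrightarrow> (if j = i then 1 else 0)) (at_right (0::real))" by (elim exE conjE)
  define \<sigma> where "\<sigma> e = (\<Sum>j\<le>cm. pb j \<bullet> z e)" for e
  have \<sigma>: "(\<sigma> \<longlongrightarrow> 1) (at_right 0)"
  proof -
    have "(\<sigma> \<longlongrightarrow> (\<Sum>j\<le>cm. if j = i then 1 else 0)) (at_right 0)" unfolding \<sigma>_def[abs_def] using z(3) by (intro tendsto_sum) auto
    then show ?thesis using i by simp
  qed
  have mon: "mon L0 \<alpha> (cvec (z e)) = of_real (e ^ ord t \<alpha> * \<sigma> e ^ \<alpha> D)" for \<alpha> e
  proof -
    have "(\<Prod>k<D. lf (L0 k) (cvec (z e)) ^ \<alpha> k) = (\<Prod>k<D. of_real (e ^ (\<alpha> k * (t + 2) ^ k)))"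
    proof (rule prod.cong[OF refl])
      fix k assume "k \<in> {..<D}"
      then have "lf (L0 k) (cvec (z e)) = of_real (e ^ ((t + 2) ^ k))" using z(2) by (simp add: L0(1) xc_cvec del: add_Suc)
      then show "lf (L0 k) (cvec (z e)) ^ \<alpha> k = of_real (e ^ (\<alpha> k * (t + 2) ^ k))" by (simp add: power_mult[symmetric] mult.commute)
    qed
    also have "\<dots> = of_real (e ^ ord t \<alpha>)" by (simp add: ord_def power_sum)
    finally show ?thesis unfolding mon_def lessThan_Suc_atMost[symmetric] by (simp add: L0(2) xc_cvec \<sigma>_def)
  qed
  define A where "A e = (\<Sum>\<alpha>\<in>Idx (Suc t). c \<alpha> * of_real (e ^ (ord t \<alpha> - m) * \<sigma> e ^ \<alpha> D)) +
     (\<Sum>j\<in>J. \<Sum>\<beta>\<in>Idx t. d j \<beta> * (of_real (pb j \<bullet> z e) * of_real (e ^ (ord t \<beta> - m) * \<sigma> e ^ \<beta> D)))" for e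
  have pw: "of_real (e ^ m) * (x * of_real (e ^ (n - m) * r)) = x * of_real (e ^ n * r)" if "x \<noteq> 0 \<longrightarrow> m \<le> n" for e r n and x :: complex
  proof (cases "x = 0")
    case False
    then have "e ^ n = e ^ m * e ^ (n - m)" using that by (simp add: power_add[symmetric])
    then show ?thesis by simp
  qed simp
  have "\<forall>\<^sub>F e in at_right 0. A e = 0"
    using z(1) eventually_at_right_less[of 0]
  proof eventually_elim
    case (elim e)
    then have "cvec (z e) \<in> V" by (simp add: real_points_def)
    from rel[OF this] have r: "(\<Sum>\<alpha>\<in>Idx (Suc t). c \<alpha> * of_real (e ^ ord t \<alpha> * \<sigma> e ^ \<alpha> D)) +
        (\<Sum>j\<in>J. \<Sum>\<beta>\<in>Idx t. d j \<beta> * (of_real (pb j \<bullet> z e) * of_real (e ^ ord t \<beta> * \<sigma> e ^ \<beta> D))) = 0"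
      unfolding mon xc_cvec .
    have t1: "of_real (e ^ m) * (\<Sum>\<alpha>\<in>Idx (Suc t). c \<alpha> * of_real (e ^ (ord t \<alpha> - m) * \<sigma> e ^ \<alpha> D)) = (\<Sum>\<alpha>\<in>Idx (Suc t). c \<alpha> * of_real (e ^ ord t \<alpha> * \<sigma> e ^ \<alpha> D))"
      unfolding sum_distrib_left by (intro sum.cong refl pw) (use m(1) in blast)
    have t2: "of_real (e ^ m) * (\<Sum>j\<in>J. \<Sum>\<beta>\<in>Idx t. d j \<beta> * (of_real (pb j \<bullet> z e) * of_real (e ^ (ord t \<beta> - m) * \<sigma> e ^ \<beta> D)))
        = (\<Sum>j\<in>J. \<Sum>\<beta>\<in>Idx t. d j \<beta> * (of_real (pb j \<bullet> z e) * of_real (e ^ ord t \<beta> * \<sigma> e ^ \<beta> D)))"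
      unfolding sum_distrib_left
    proof (intro sum.cong refl)
      fix j \<beta> assume j: "j \<in> J" "\<beta> \<in> Idx t"
      have "of_real (e ^ m) * (d j \<beta> * of_real (pb j \<bullet> z e) * of_real (e ^ (ord t \<beta> - m) * \<sigma> e ^ \<beta> D))
          = d j \<beta> * of_real (pb j \<bullet> z e) * of_real (e ^ ord t \<beta> * \<sigma> e ^ \<beta> D)"
        by (rule pw) (use m(2)[OF j] in auto)
      then show "of_real (e ^ m) * (d j \<beta> * (of_real (pb j \<bullet> z e) * of_real (e ^ (ord t \<beta> - m) * \<sigma> e ^ \<beta> D)))
          = d j \<beta> * (of_real (pb j \<bullet> z e) * of_real (e ^ ord t \<beta> * \<sigma> e ^ \<beta> D))" by (simp only: mult.assoc)
    qed
    have "of_real (e ^ m) * A e = 0" unfolding A_def distrib_left t1 t2 by (rule r)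
    then show ?case using elim(2) by simp
  qed
  then have "(A \<longlongrightarrow> 0) (at_right 0)" by (rule tendsto_eventually)
  moreover have "(A \<longlongrightarrow> (\<Sum>\<alpha>\<in>Idx (Suc t). c \<alpha> * of_real (0 ^ (ord t \<alpha> - m) * 1 ^ \<alpha> D)) +
     (\<Sum>j\<in>J. \<Sum>\<beta>\<in>Idx t. d j \<beta> * (of_real (if j = i then 1 else 0) * of_real (0 ^ (ord t \<beta> - m) * 1 ^ \<beta> D)))) (at_right 0)"
    unfolding A_def[abs_def] using z(3) by (intro tendsto_intros \<sigma>) auto
  ultimately have "(\<Sum>\<alpha>\<in>Idx (Suc t). c \<alpha> * of_real (0 ^ (ord t \<alpha> - m) * 1 ^ \<alpha> D)) +
     (\<Sum>j\<in>J. \<Sum>\<beta>\<in>Idx t. d j \<beta> * (of_real (if j = i then 1 else 0) * of_real (0 ^ (ord t \<beta> - m) * 1 ^ \<beta> D))) = (0 :: complex)"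
    by (intro tendsto_unique[OF trivial_limit_at_right_real])
  moreover have "(of_real (if j = i then 1 else 0) :: complex) = (if j = i then 1 else 0)" for j by simp
  ultimately show ?thesis by (simp only: of_real_mult of_real_power of_real_0 of_real_1 power_one mult_1_right)
qed

text \<open>Let \<open>m\<close> be the least order with a nonzero coefficient. Within one block
  orders are distinct, so one term at most survives. At \<open>Y 0\<close> the coordinates with
  index in \<open>J\<close> tend to 0, which isolates the pure monomials; at \<open>Y i\<close> the
  terms with \<open>xc i\<close> are then isolated.\<close>

lemma fam_L0_indep: "fam_indep V (Fam t) (famf L0 (\<lambda>i. cvec (pb i)))"
  unfolding fam_indep_def
proof (intro allI impI, rule ccontr)
  fix \<gamma> assume g: "\<forall>z\<in>V. (\<Sum>x\<in>Fam t. \<gamma> x * famf L0 (\<lambda>i. cvec (pb i)) x z) = 0" and n: "\<not> (\<forall>x\<in>Fam t. \<gamma> x = 0)"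
  define c where "c \<alpha> = \<gamma> (Inl \<alpha>)" for \<alpha>
  define d where "d j \<beta> = \<gamma> (Inr (j, \<beta>))" for j \<beta>
  have rel: "(\<Sum>\<alpha>\<in>Idx (Suc t). c \<alpha> * mon L0 \<alpha> z) + (\<Sum>j\<in>J. \<Sum>\<beta>\<in>Idx t. d j \<beta> * (xc j z * mon L0 \<beta> z)) = 0" if "z \<in> V" for z
    using g that unfolding Fam_sum c_def d_def xc_def by simp
  define Q where "Q n \<longleftrightarrow> (\<exists>\<alpha>\<in>Idx (Suc t). c \<alpha> \<noteq> 0 \<and> ord t \<alpha> = n) \<or> (\<exists>j\<in>J. \<exists>\<beta>\<in>Idx t. d j \<beta> \<noteq> 0 \<and> ord t \<beta> = n)" for n
  have ex: "\<exists>n. Q n"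
  proof -
    obtain x where x: "x \<in> Fam t" "\<gamma> x \<noteq> 0" using n by blast
    then show ?thesis unfolding Fam_def Q_def c_def d_def by (cases x) auto
  qed
  define m where "m = (LEAST n. Q n)"
  have Qm: "Q m" unfolding m_def by (rule LeastI_ex[of Q, OF ex])
  have least: "m \<le> n" if "Q n" for n unfolding m_def by (rule Least_le[of Q n, OF that])
  have m1: "m \<le> ord t \<alpha>" if "\<alpha> \<in> Idx (Suc t)" "c \<alpha> \<noteq> 0" for \<alpha> by (rule least) (use that in \<open>auto simp: Q_def\<close>)
  have m2: "m \<le> ord t \<beta>" if "j \<in> J" "\<beta> \<in> Idx t" "d j \<beta> \<noteq> 0" for j \<beta> by (rule least) (use that in \<open>auto simp: Q_def\<close>)
  have lim: "(\<Sum>\<alpha>\<in>Idx (Suc t). c \<alpha> * 0 ^ (ord t \<alpha> - m)) + (\<Sum>j\<in>J. \<Sum>\<beta>\<in>Idx t. d j \<beta> * ((if j = i then 1 else 0) * 0 ^ (ord t \<beta> - m))) = 0"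
    if "i \<le> cm" for i by (rule chart_limit[OF that rel m1 m2])
  have c0: "c \<alpha> * 0 ^ (ord t \<alpha> - m) = 0" if \<alpha>: "\<alpha> \<in> Idx (Suc t)" for \<alpha>
  proof (rule ccontr)
    assume a: "c \<alpha> * 0 ^ (ord t \<alpha> - m) \<noteq> 0"
    then have om: "ord t \<alpha> = m" using m1[OF \<alpha>] by (cases "ord t \<alpha> - m") auto
    have "(\<Sum>\<beta>\<in>Idx (Suc t). c \<beta> * 0 ^ (ord t \<beta> - m)) = (\<Sum>\<beta>\<in>Idx (Suc t). if \<beta> = \<alpha> then c \<alpha> else 0)"
    proof (rule sum.cong[OF refl])
      fix \<beta> assume \<beta>: "\<beta> \<in> Idx (Suc t)"
      show "c \<beta> * 0 ^ (ord t \<beta> - m) = (if \<beta> = \<alpha> then c \<alpha> else 0)"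
      proof (cases "\<beta> = \<alpha> \<or> c \<beta> = 0")
        case True then show ?thesis using om by auto
      next
        case False
        then have "ord t \<beta> \<noteq> m" using ord_inj[OF \<beta> \<alpha>] om by auto
        then have "ord t \<beta> - m \<noteq> 0" using m1[OF \<beta>] False by simp
        then show ?thesis using False by simp
      qed
    qed
    then have s: "(\<Sum>\<beta>\<in>Idx (Suc t). c \<beta> * 0 ^ (ord t \<beta> - m)) = c \<alpha>" using finite_Idx \<alpha> by simp
    have "(\<Sum>j\<in>J. \<Sum>\<beta>\<in>Idx t. d j \<beta> * ((if j = 0 then 1 else 0) * 0 ^ (ord t \<beta> - m))) = 0"
      by (intro sum.neutral ballI) auto
    then show False using lim[of 0] s a by simp
  qed
  then have sc: "(\<Sum>\<alpha>\<in>Idx (Suc t). c \<alpha> * 0 ^ (ord t \<alpha> - m)) = 0" by (intro sum.neutral) simp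
  have "\<not> (\<exists>\<alpha>\<in>Idx (Suc t). c \<alpha> \<noteq> 0 \<and> ord t \<alpha> = m)" using c0 by fastforce
  then obtain i b where ib: "i \<in> J" "b \<in> Idx t" "d i b \<noteq> 0" "ord t b = m" using Qm unfolding Q_def by blast
  have "(\<Sum>j\<in>J. \<Sum>\<beta>\<in>Idx t. d j \<beta> * ((if j = i then 1 else 0) * 0 ^ (ord t \<beta> - m))) = (\<Sum>j\<in>J. if j = i then d i b else 0)"
  proof (rule sum.cong[OF refl])
    fix j assume j: "j \<in> J"
    show "(\<Sum>\<beta>\<in>Idx t. d j \<beta> * ((if j = i then 1 else 0) * 0 ^ (ord t \<beta> - m))) = (if j = i then d i b else 0)"
    proof (cases "j = i")
      case True
      have "(\<Sum>\<beta>\<in>Idx t. d j \<beta> * ((if j = i then 1 else 0) * 0 ^ (ord t \<beta> - m))) = (\<Sum>\<beta>\<in>Idx t. if \<beta> = b then d i b else 0)"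
      proof (rule sum.cong[OF refl])
        fix \<beta> assume \<beta>: "\<beta> \<in> Idx t"
        show "d j \<beta> * ((if j = i then 1 else 0) * 0 ^ (ord t \<beta> - m)) = (if \<beta> = b then d i b else 0)"
        proof (cases "\<beta> = b \<or> d j \<beta> = 0")
          case True then show ?thesis using ib \<open>j = i\<close> by auto
        next
          case False
          then have "ord t \<beta> \<noteq> m" using ord_inj[OF \<beta> ib(2), of t] ib(4) by auto
          then have "ord t \<beta> - m \<noteq> 0" using m2[OF j \<beta>] False by simp
          then show ?thesis using False by simp
        qed
      qed
      then show ?thesis using finite_Idx ib True by simp
    qed simp
  qed
  then show False using lim[of i] sc ib by simp
qed

end

lemma fam_indep_disjoint:
  assumes "finite F" "fam_indep V F f" "A \<subseteq> F" "B \<subseteq> F" "A \<inter> B = {}"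
    and q: "in_fam V A f q" "\<And>z. z \<in> V \<Longrightarrow> q z = (\<Sum>x\<in>B. c x * f x z)" and x: "x \<in> B"
  shows "c x = 0"
proof -
  from q(1) obtain a where a: "\<forall>z\<in>V. q z = (\<Sum>x\<in>A. a x * f x z)" unfolding in_fam_def by (elim exE)
  define \<gamma> where "\<gamma> y = (if y \<in> A then a y else if y \<in> B then - c y else 0)" for y
  have "(\<Sum>y\<in>F. \<gamma> y * f y z) = 0" if z: "z \<in> V" for z
  proof -
    have fin: "finite A" "finite B" using assms(1,3,4) finite_subset by auto
    have "(\<Sum>y\<in>F. \<gamma> y * f y z) = (\<Sum>y\<in>A \<union> B. \<gamma> y * f y z)"
      using assms(1,3,4) by (intro sum.mono_neutral_right) (auto simp: \<gamma>_def)
    also have "\<dots> = (\<Sum>y\<in>A. \<gamma> y * f y z) + (\<Sum>y\<in>B. \<gamma> y * f y z)" using fin assms(5) by (rule sum.union_disjoint)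
    also have "(\<Sum>y\<in>A. \<gamma> y * f y z) = q z" using a z by (auto simp: \<gamma>_def intro!: sum.cong)
    also have "(\<Sum>y\<in>B. \<gamma> y * f y z) = (\<Sum>y\<in>B. - (c y * f y z))" using assms(5) by (intro sum.cong) (auto simp: \<gamma>_def)
    also have "\<dots> = - q z" using q(2)[OF z] by (simp add: sum_negf)
    finally show ?thesis by simp
  qed
  from fam_indepD[OF assms(2), of \<gamma>, OF this] have "\<gamma> x = 0" using x assms(4) by blast
  moreover have "x \<notin> A" using x assms(5) by blast
  ultimately show ?thesis using x by (simp add: \<gamma>_def)
qed

section \<open>Freeness and cancellation for arbitrary good parameters\<close>

context frame
begin

definition "indL L \<longleftrightarrow> fam_indep V {..D} (\<lambda>k. lf (L k))"

abbreviation "Lu L u x \<equiv> lf (case_sum L u x)" for L u :: "nat \<Rightarrow> complex^'n" and x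

lemma in_fam_xc: "in_fam V {..<NN} xc (lf a)"
  unfolding in_fam_def by (rule exI[of _ "\<lambda>j. lf a (cvec (bs j))"]) (use lf_decomp in blast)

text \<open>Extend the parameters to a basis of the linear forms on \<open>V\<close>. Their number
  is \<open>NN = (D + 1) + cm\<close>, so exactly \<open>cm\<close> further forms are used and can
  be indexed by \<open>J\<close>.\<close>

lemma complement:
  assumes L: "indL L"
  shows "\<exists>u. \<forall>a. in_fam V ({..D} <+> J) (Lu L u) (lf a)"
proof -
  define g where "g i = cvec (pb i)" for i
  let ?ind = "\<lambda>I. I \<subseteq> {..<NN} \<and> fam_indep V ({..D} <+> I) (Lu L g)"
  have e: "?ind {}"
  proof -
    have "fam_indep V ({..D} <+> {}) (Lu L g)"
      unfolding fam_indep_def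
    proof (intro allI impI ballI)
      fix \<gamma> x assume g: "\<forall>z\<in>V. (\<Sum>x\<in>{..D} <+> {}. \<gamma> x * Lu L g x z) = 0" and x: "x \<in> {..D} <+> ({} :: nat set)"
      have "(\<Sum>k\<le>D. \<gamma> (Inl k) * lf (L k) z) = 0" if "z \<in> V" for z using g that by (simp add: sum.Plus)
      from fam_indepD[OF L[unfolded indL_def], of "\<lambda>k. \<gamma> (Inl k)", OF this] show "\<gamma> x = 0" using x by auto
    qed
    then show ?thesis by simp
  qed
  have "\<exists>I. ?ind I \<and> (\<forall>I'. ?ind I' \<longrightarrow> card I' \<le> card I)"
    by (rule ex_has_greatest_nat[of ?ind "{}" card "Suc NN"]) (use e in \<open>auto intro: le_imp_less_Suc dest: card_mono[rotated]\<close>)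
  then obtain I where I: "I \<subseteq> {..<NN}" "fam_indep V ({..D} <+> I) (Lu L g)" "\<And>I'. ?ind I' \<Longrightarrow> card I' \<le> card I" by blast
  have fin: "finite I" using I(1) finite_subset by blast
  have gi: "in_fam V ({..D} <+> I) (Lu L g) (lf (g i))" if i: "i < NN" for i
  proof (cases "i \<in> I")
    case True
    then show ?thesis using in_fam_single[of "{..D} <+> I" "Inr i" V "Lu L g"] fin by auto
  next
    case False
    have "\<not> ?ind (insert i I)" using I(3)[of "insert i I"] False fin by auto
    then have "\<not> fam_indep V ({..D} <+> insert i I) (Lu L g)" using I(1) i by auto
    moreover have "{..D} <+> insert i I = insert (Inr i) ({..D} <+> I)" by auto
    ultimately show ?thesis
      using fam_indep_insert_fails[of "{..D} <+> I" "Inr i" V "Lu L g"] fin False I(2) by auto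
  qed
  have all: "in_fam V ({..D} <+> I) (Lu L g) (lf a)" for a
    by (rule in_fam_trans[OF in_fam_xc]) (use gi in \<open>auto simp: xc_def g_def\<close>)
  have 1: "card ({..D} <+> I) \<le> card {..<NN}"
    by (rule fam_bound[OF _ _ I(2), where g = xc]) (use fin in_fam_xc in auto)
  have 2: "card {..<NN} \<le> card ({..D} <+> I)"
    by (rule fam_bound[OF _ _ xc_indep, where g = "Lu L g"]) (use fin all in \<open>auto simp: xc_def\<close>)
  have "card I = card J" using 1 2 fin by (simp add: card_Plus NN_def)
  then obtain \<phi> where \<phi>: "bij_betw \<phi> J I" using finite_same_card_bij[of J I] fin by auto
  have "in_fam V ({..D} <+> J) (Lu L (\<lambda>j. g (\<phi> j))) (lf a)" for a
  proof (rule in_fam_trans[OF all])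
    fix x assume x: "x \<in> {..D} <+> I"
    show "in_fam V ({..D} <+> J) (Lu L (\<lambda>j. g (\<phi> j))) (Lu L g x)"
    proof (cases x)
      case (Inl k)
      then show ?thesis using in_fam_single[of "{..D} <+> J" "Inl k" V "Lu L (\<lambda>j. g (\<phi> j))"] x by auto
    next
      case (Inr i)
      then obtain j where "j \<in> J" "i = \<phi> j" using x \<phi> by (auto simp: bij_betw_def)
      then have "Inr j \<in> {..D} <+> J" "Lu L g x = Lu L (\<lambda>j. g (\<phi> j)) (Inr j)" using Inr by auto
      then show ?thesis using in_fam_single[of "{..D} <+> J" "Inr j" V "Lu L (\<lambda>j. g (\<phi> j))"] by simp
    qed
  qed
  then show ?thesis by (intro exI[of _ "\<lambda>j. g (\<phi> j)"]) simp
qed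

text \<open>For a set \<open>Q\<close> of exponents closed under increasing an entry, this part of
  the basis spans a piece of a monomial ideal in the parameters.\<close>

definition "FamP Q t = {\<alpha>\<in>Idx (Suc t). Q \<alpha>} <+> (J \<times> {\<beta>\<in>Idx t. Q \<beta>})"

lemma finite_FamP: "finite (FamP Q t)" by (simp add: FamP_def finite_Idx)

lemma FamP_subset: "FamP Q t \<subseteq> Fam t" unfolding FamP_def Fam_def by auto

lemma FamP_True: "FamP (\<lambda>_. True) t = Fam t" by (simp add: FamP_def Fam_def)

lemma mon_lf_in_FamP:
  assumes u: "\<And>a. in_fam V ({..D} <+> J) (Lu L u) (lf a)" and \<alpha>: "\<alpha> \<in> Idx t" "Q \<alpha>"
    and up: "\<And>\<alpha> k. Q \<alpha> \<Longrightarrow> k \<le> D \<Longrightarrow> Q (\<alpha>(k := Suc (\<alpha> k)))"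
  shows "in_fam V (FamP Q t) (famf L u) (\<lambda>z. mon L \<alpha> z * lf a z)"
proof -
  from u[of a] obtain c where c: "\<forall>z\<in>V. lf a z = (\<Sum>x\<in>{..D} <+> J. c x * Lu L u x z)" unfolding in_fam_def by (elim exE)
  have "in_fam V (FamP Q t) (famf L u) (\<lambda>z. \<Sum>x\<in>{..D} <+> J. c x * (mon L \<alpha> z * Lu L u x z))"
  proof (intro in_fam_sum in_fam_smult)
    fix x assume x: "x \<in> {..D} <+> J"
    show "in_fam V (FamP Q t) (famf L u) (\<lambda>z. mon L \<alpha> z * Lu L u x z)"
    proof (cases x)
      case (Inl k)
      then have k: "k \<le> D" using x by auto
      have "Inl (\<alpha>(k := Suc (\<alpha> k))) \<in> FamP Q t" unfolding FamP_def using Idx_Suc[OF \<alpha>(1) k] up[OF \<alpha>(2) k] by auto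
      from in_fam_single[OF finite_FamP this, of V "famf L u"] show ?thesis
        by (rule in_fam_cong) (simp add: famf_def mon_Suc[OF k] Inl mult.commute del: fun_upd_apply)
    next
      case (Inr j)
      then have "Inr (j, \<alpha>) \<in> FamP Q t" unfolding FamP_def using \<alpha> x by auto
      from in_fam_single[OF finite_FamP this, of V "famf L u"] show ?thesis
        by (rule in_fam_cong) (simp add: famf_def Inr mult.commute)
    qed
  qed
  then show ?thesis by (rule in_fam_cong) (simp add: c sum_distrib_left mult_ac)
qed

lemma forms_in_Fam:
  assumes L: "goodL L" and u: "\<And>a. in_fam V ({..D} <+> J) (Lu L u) (lf a)" and f: "hom_poly (Suc t) f"
  shows "in_fam V (Fam t) (famf L u) f"
proof -
  from goodL_Rep[OF L f] obtain c where c: "\<forall>z\<in>V. f z = (\<Sum>\<alpha>\<in>Idx t. mon L \<alpha> z * lf (c \<alpha>) z)" unfolding Rep_def by (elim exE)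
  have "in_fam V (FamP (\<lambda>_. True) t) (famf L u) (\<lambda>z. \<Sum>\<alpha>\<in>Idx t. mon L \<alpha> z * lf (c \<alpha>) z)"
    by (intro in_fam_sum mon_lf_in_FamP u) auto
  then show ?thesis unfolding FamP_True by (rule in_fam_cong) (use c in simp)
qed

lemma hom_poly_famf: assumes "x \<in> Fam t" shows "hom_poly (Suc t) (famf L u x)"
proof (cases x)
  case (Inl \<alpha>)
  then show ?thesis using assms hom_poly_mon[of \<alpha> "Suc t" L] by (auto simp: Fam_def famf_def[abs_def])
next
  case (Inr p)
  then have "snd p \<in> Idx t" using assms by (auto simp: Fam_def)
  from hom_poly_mult[OF hom_poly_lf hom_poly_mon[OF this], of "u (fst p)" L] show ?thesis by (simp add: Inr famf_def[abs_def])
qed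

text \<open>The family spans all forms of degree \<open>Suc t\<close>, among them the independent
  family for \<open>L0\<close>, which has the same index set.\<close>

lemma Fam_indep:
  assumes L: "goodL L" and u: "\<And>a. in_fam V ({..D} <+> J) (Lu L u) (lf a)"
  shows "fam_indep V (Fam t) (famf L u)"
  by (rule fam_exchange[OF finite_Fam finite_Fam fam_L0_indep]) (use forms_in_Fam[OF L u] hom_poly_famf in auto)

text \<open>Membership of a form of degree \<open>d + 1\<close> in the ideal of the parameters other
  than \<open>L \<kappa>\<close>, with coefficients of degree \<open>d\<close>. For
  \<open>d = 0\<close> this is the span of those parameters.\<close>

definition "inC L \<kappa> d q \<longleftrightarrow> (\<exists>g. (\<forall>k. hom_poly d (g k)) \<and> (\<forall>z\<in>V. q z = (\<Sum>k\<in>{..D} - {\<kappa>}. lf (L k) z * g k z)))"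

lemma inC_add: assumes "inC L \<kappa> d p" "inC L \<kappa> d q" shows "inC L \<kappa> d (\<lambda>z. p z + q z)"
proof -
  from assms obtain g h where "\<forall>k. hom_poly d (g k)" "\<forall>z\<in>V. p z = (\<Sum>k\<in>{..D} - {\<kappa>}. lf (L k) z * g k z)"
    "\<forall>k. hom_poly d (h k)" "\<forall>z\<in>V. q z = (\<Sum>k\<in>{..D} - {\<kappa>}. lf (L k) z * h k z)" unfolding inC_def by (elim exE conjE)
  then show ?thesis unfolding inC_def
    by (intro exI[of _ "\<lambda>k z. g k z + h k z"]) (auto intro: hom_poly_add simp: distrib_left sum.distrib)
qed

lemma inC_mult: assumes "inC L \<kappa> d q" "hom_poly e f" shows "inC L \<kappa> (d + e) (\<lambda>z. f z * q z)"
proof -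
  from assms obtain g where "\<forall>k. hom_poly d (g k)" "\<forall>z\<in>V. q z = (\<Sum>k\<in>{..D} - {\<kappa>}. lf (L k) z * g k z)"
    unfolding inC_def by (elim exE conjE)
  then show ?thesis unfolding inC_def
    by (intro exI[of _ "\<lambda>k z. g k z * f z"] conjI allI hom_poly_mult assms(2)) (simp_all add: sum_distrib_left mult_ac)
qed

lemma inC_smult: "inC L \<kappa> d q \<Longrightarrow> inC L \<kappa> d (\<lambda>z. c * q z)"
  using inC_mult[OF _ hom_poly_const[of c]] by simp

lemma inC_zero: "inC L \<kappa> d (\<lambda>z. 0)"
  unfolding inC_def by (rule exI[of _ "\<lambda>k z. 0"]) (simp add: hom_poly_zero)

lemma inC_sum: "(\<And>i. i \<in> I \<Longrightarrow> inC L \<kappa> d (p i)) \<Longrightarrow> inC L \<kappa> d (\<lambda>z. \<Sum>i\<in>I. p i z)"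
proof (induction I rule: infinite_finite_induct)
  case (insert i I)
  then show ?case using inC_add[of L \<kappa> d "p i"] by simp
qed (simp_all add: inC_zero)

lemma inC_cong: "inC L \<kappa> d p \<Longrightarrow> (\<And>z. z \<in> V \<Longrightarrow> q z = p z) \<Longrightarrow> inC L \<kappa> d q"
  unfolding inC_def by simp

lemma inC_diff: "inC L \<kappa> d p \<Longrightarrow> inC L \<kappa> d q \<Longrightarrow> inC L \<kappa> d (\<lambda>z. p z - q z)"
  using inC_add[OF _ inC_smult[of L \<kappa> d q "-1"]] by simp

lemma inC_gen: assumes "k \<le> D" "k \<noteq> \<kappa>" "hom_poly d f" shows "inC L \<kappa> d (\<lambda>z. lf (L k) z * f z)"
proof -
  have "(\<Sum>j\<in>{..D} - {\<kappa>}. lf (L j) z * (if j = k then f z else 0)) = lf (L k) z * f z" for z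
    using assms(1,2) by (simp add: if_distrib cong: if_cong)
  then show ?thesis unfolding inC_def
    by (intro exI[of _ "\<lambda>j. if j = k then f else (\<lambda>z. 0)"])
       (use assms(3) in \<open>simp add: hom_poly_zero if_distribR cong: if_cong\<close>)
qed

text \<open>\<open>L \<kappa>\<close> is not a zero divisor modulo the other parameters, tested on
  linear forms. In the free basis the ideal of the others uses only exponents that involve them,
  while the product with a power of \<open>L \<kappa>\<close> leaves terms with pure powers;
  independence makes the latter vanish.\<close>

lemma inC_cancel_power:
  assumes L: "goodL L" "indL L" and \<kappa>: "\<kappa> \<le> D" and C: "inC L \<kappa> d (\<lambda>z. lf (L \<kappa>) z ^ d * lf v z)"
  shows "inC L \<kappa> 0 (lf v)"
proof (cases d)
  case 0
  then show ?thesis using C by simp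
next
  case (Suc e)
  from complement[OF L(2)] obtain u where u: "\<And>a. in_fam V ({..D} <+> J) (Lu L u) (lf a)" by blast
  \<comment> \<open>Exponents that involve a parameter other than \<open>L \<kappa>\<close>;
    \<open>sg m\<close> is the exponent of the pure power of degree \<open>m\<close>.\<close>
  define Q where "Q \<alpha> \<longleftrightarrow> (\<exists>k. k \<noteq> \<kappa> \<and> \<alpha> k \<noteq> 0)" for \<alpha> :: "nat \<Rightarrow> nat"
  have up: "Q (\<alpha>(k := Suc (\<alpha> k)))" if "Q \<alpha>" for \<alpha> k using that by (auto simp: Q_def)
  have upk: "Q (\<alpha>(k := Suc (\<alpha> k)))" if "k \<noteq> \<kappa>" for \<alpha> k using that by (auto simp: Q_def)
  define sg where "sg m = (\<lambda>k. if k = \<kappa> then m else (0::nat))" for m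
  have sgI: "sg m \<in> Idx m" for m using \<kappa> by (auto simp: Idx_def sg_def)
  have sgQ: "\<not> Q (sg m)" for m by (auto simp: Q_def sg_def)
  have sgm: "mon L (sg m) z = lf (L \<kappa>) z ^ m" for m z
  proof -
    have "mon L (sg m) z = (\<Prod>k\<le>D. if k = \<kappa> then lf (L \<kappa>) z ^ m else 1)" unfolding mon_def sg_def by (rule prod.cong) auto
    then show ?thesis using \<kappa> by simp
  qed
  from u[of v] obtain c where c: "\<forall>z\<in>V. lf v z = (\<Sum>x\<in>{..D} <+> J. c x * Lu L u x z)" unfolding in_fam_def by (elim exE)
  have v: "lf v z = (\<Sum>k\<in>{..D} - {\<kappa>}. c (Inl k) * lf (L k) z) + c (Inl \<kappa>) * lf (L \<kappa>) z + (\<Sum>j\<in>J. c (Inr j) * lf (u j) z)" if "z \<in> V" for z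
  proof -
    have "lf v z = (\<Sum>k\<le>D. c (Inl k) * lf (L k) z) + (\<Sum>j\<in>J. c (Inr j) * lf (u j) z)" using c that by (simp add: sum.Plus)
    also have "(\<Sum>k\<le>D. c (Inl k) * lf (L k) z) = c (Inl \<kappa>) * lf (L \<kappa>) z + (\<Sum>k\<in>{..D} - {\<kappa>}. c (Inl k) * lf (L k) z)"
      using \<kappa> by (intro sum.remove) auto
    finally show ?thesis by simp
  qed
  define q where "q z = lf (L \<kappa>) z ^ d * (c (Inl \<kappa>) * lf (L \<kappa>) z + (\<Sum>j\<in>J. c (Inr j) * lf (u j) z))" for z
  have Lk: "in_fam V (FamP Q d) (famf L u) (\<lambda>z. lf (L k) z * g z)" if k: "k \<in> {..D} - {\<kappa>}" and g: "hom_poly d g" for k g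
  proof -
    from goodL_Rep[OF L(1) g[unfolded Suc]] obtain r where r: "\<forall>z\<in>V. g z = (\<Sum>\<alpha>\<in>Idx e. mon L \<alpha> z * lf (r \<alpha>) z)"
      unfolding Rep_def by (elim exE)
    have kD: "k \<le> D" "k \<noteq> \<kappa>" using k by auto
    have "in_fam V (FamP Q d) (famf L u) (\<lambda>z. \<Sum>\<alpha>\<in>Idx e. mon L (\<alpha>(k := Suc (\<alpha> k))) z * lf (r \<alpha>) z)"
      by (intro in_fam_sum mon_lf_in_FamP u upk kD up) (use Idx_Suc kD Suc in auto)
    then show ?thesis
      by (rule in_fam_cong) (simp add: r mon_Suc[OF kD(1)] sum_distrib_left mult.assoc del: fun_upd_apply)
  qed
  from C obtain g where g: "\<forall>k. hom_poly d (g k)" "\<forall>z\<in>V. lf (L \<kappa>) z ^ d * lf v z = (\<Sum>k\<in>{..D} - {\<kappa>}. lf (L k) z * g k z)"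
    unfolding inC_def by (elim exE conjE)
  have qeq: "q z = (\<Sum>k\<in>{..D} - {\<kappa>}. lf (L k) z * (g k z - c (Inl k) * lf (L \<kappa>) z ^ d))" if z: "z \<in> V" for z
  proof -
    have "q z = lf (L \<kappa>) z ^ d * lf v z - lf (L \<kappa>) z ^ d * (\<Sum>k\<in>{..D} - {\<kappa>}. c (Inl k) * lf (L k) z)"
      unfolding v[OF z] q_def by (simp add: algebra_simps)
    also have "\<dots> = (\<Sum>k\<in>{..D} - {\<kappa>}. lf (L k) z * g k z - lf (L \<kappa>) z ^ d * (c (Inl k) * lf (L k) z))"
      using g(2) z by (simp add: sum_distrib_left sum_subtractf)
    finally show ?thesis by (simp add: algebra_simps)
  qed
  have "hom_poly d (\<lambda>z. g k z - c (Inl k) * lf (L \<kappa>) z ^ d)" for k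
    using hom_poly_power[OF hom_poly_lf[of "L \<kappa>"], of d] g(1) by (intro hom_poly_diff hom_poly_smult) auto
  then have "in_fam V (FamP Q d) (famf L u) (\<lambda>z. \<Sum>k\<in>{..D} - {\<kappa>}. lf (L k) z * (g k z - c (Inl k) * lf (L \<kappa>) z ^ d))"
    by (intro in_fam_sum Lk)
  then have qin: "in_fam V (FamP Q d) (famf L u) q" by (rule in_fam_cong) (rule qeq)
  define B where "B = {sg (Suc d)} <+> (J \<times> {sg d})"
  define c' where "c' x = (case x of Inl \<alpha> \<Rightarrow> c (Inl \<kappa>) | Inr p \<Rightarrow> c (Inr (fst p)))" for x :: "(nat \<Rightarrow> nat) + (nat \<times> (nat \<Rightarrow> nat))"
  have BF: "B \<subseteq> Fam d" unfolding B_def Fam_def using sgI by auto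
  have dis: "FamP Q d \<inter> B = {}" unfolding B_def FamP_def using sgQ by auto
  have qB: "q z = (\<Sum>x\<in>B. c' x * famf L u x z)" for z
  proof -
    have "(\<Sum>x\<in>B. c' x * famf L u x z) = c (Inl \<kappa>) * lf (L \<kappa>) z ^ Suc d + (\<Sum>p\<in>J \<times> {sg d}. c (Inr (fst p)) * (lf (u (fst p)) z * mon L (snd p) z))"
      unfolding B_def by (simp add: sum.Plus c'_def famf_def sgm)
    also have "(\<Sum>p\<in>J \<times> {sg d}. c (Inr (fst p)) * (lf (u (fst p)) z * mon L (snd p) z)) = (\<Sum>j\<in>J. c (Inr j) * (lf (u j) z * lf (L \<kappa>) z ^ d))"
      using sum.cartesian_product[of "\<lambda>j \<beta>. c (Inr j) * (lf (u j) z * mon L \<beta> z)" "{sg d}" J] by (simp add: case_prod_unfold sgm)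
    finally show ?thesis unfolding q_def by (simp add: algebra_simps sum_distrib_left)
  qed
  have c'0: "c' x = 0" if "x \<in> B" for x
    by (rule fam_indep_disjoint[OF finite_Fam Fam_indep[OF L(1) u] FamP_subset BF dis qin qB that])
  have "Inl (sg (Suc d)) \<in> B" "Inr (j, sg d) \<in> B" if "j \<in> J" for j using that by (auto simp: B_def)
  moreover have "Inl (sg (Suc d)) \<in> B" by (auto simp: B_def)
  ultimately have "c (Inl \<kappa>) = 0" "c (Inr j) = 0" if "j \<in> J" for j using that c'0 by (force simp: c'_def)+
  moreover have "c (Inl \<kappa>) = 0" using c'0[OF \<open>Inl (sg (Suc d)) \<in> B\<close>] by (simp add: c'_def)
  ultimately have "lf v z = (\<Sum>k\<in>{..D} - {\<kappa>}. lf (L k) z * c (Inl k))" if "z \<in> V" for z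
    unfolding v[OF that] by (simp add: mult.commute)
  then show ?thesis unfolding inC_def by (intro exI[of _ "\<lambda>k z. c (Inl k)"]) (simp add: hom_poly_const)
qed

end

text \<open>If \<open>w i\<close> is the \<open>i\<close>-th iterate of an operator on a start
  vector, this is the polynomial in the operator applied to that vector. Sequences replace operators
  because the iterates are determined only modulo a subspace.\<close>

definition pev :: "(nat \<Rightarrow> complex^'n::finite) \<Rightarrow> complex poly \<Rightarrow> complex^'n" where
  "pev w p = (\<Sum>i\<le>degree p. coeff p i *s w i)"

lemma pev_bound: assumes "degree p \<le> m" shows "pev w p = (\<Sum>i\<le>m. coeff p i *s w i)"
  unfolding pev_def using assms by (intro sum.mono_neutral_left) (auto simp: coeff_eq_0)

lemma pev_diff: "pev w (p - q) = pev w p - pev w q"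
  using pev_bound[of p "max (degree p) (degree q)" w] pev_bound[of q "max (degree p) (degree q)" w]
    pev_bound[of "p - q" "max (degree p) (degree q)" w] degree_diff_le_max[of p q]
  by (simp add: sum_subtractf vec.scale_left_diff_distrib)

lemma pev_smult: "pev w (Polynomial.smult c p) = c *s pev w p"
  using pev_bound[of p "degree p" w] pev_bound[of "Polynomial.smult c p" "degree p" w] degree_smult_le[of c p]
  by (simp add: vec.scale_sum_right)

lemma pev_pCons: "pev w (pCons c p) = c *s w 0 + pev (\<lambda>i. w (Suc i)) p"
proof -
  have "degree (pCons c p) \<le> Suc (degree p)" by (rule degree_pCons_le)
  from pev_bound[OF this, of w] show ?thesis unfolding sum.atMost_Suc_shift by (simp add: pev_def)
qed

text \<open>More vectors than the dimension satisfy a linear relation, so some nonzero polynomial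
  gives 0. Minimality is taken with respect to \<open>Q\<close>, later membership in the span of the
  other parameters.\<close>

lemma annihilating_polynomial:
  fixes w :: "nat \<Rightarrow> complex^'n::finite"
  assumes "Q 0"
  shows "\<exists>p. p \<noteq> 0 \<and> Q (pev w p) \<and> (\<forall>q. q \<noteq> 0 \<longrightarrow> Q (pev w q) \<longrightarrow> degree p \<le> degree q)"
proof -
  let ?n = "CARD('n)"
  have "card (UNIV :: 'n set) < card {..?n}" by simp
  from underdetermined[OF _ _ this, of "\<lambda>i j. w i $ j"] obtain \<gamma> where \<gamma>: "\<exists>i\<in>{..?n}. \<gamma> i \<noteq> 0" "\<forall>j. (\<Sum>i\<le>?n. \<gamma> i * w i $ j) = 0"
    by auto
  define p where "p = Poly (map \<gamma> [0..<Suc ?n])"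
  have cp: "coeff p i = (if i \<le> ?n then \<gamma> i else 0)" for i
    unfolding p_def coeff_Poly_eq nth_default_def by (auto simp: less_Suc_eq_le simp del: upt_Suc)
  have d: "degree p \<le> ?n" by (rule degree_le) (simp add: cp)
  have "p \<noteq> 0" using \<gamma>(1) cp by (metis atMost_iff coeff_0)
  moreover have "pev w p = 0" unfolding pev_bound[OF d] using \<gamma>(2) by (simp add: vec_eq_iff cp)
  ultimately have "p \<noteq> 0 \<and> Q (pev w p)" using assms by simp
  from ex_has_least_nat[of "\<lambda>p. p \<noteq> 0 \<and> Q (pev w p)" p degree, OF this] show ?thesis by blast
qed

lemma complex_poly_linear_factor:
  fixes p :: "complex poly"
  assumes "degree p \<noteq> 0" shows "\<exists>\<mu> q. p = pCons 0 q - Polynomial.smult \<mu> q"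
proof -
  have "\<not> constant (poly p)" using assms by (simp add: constant_degree)
  then obtain \<mu> where "poly p \<mu> = 0" using fundamental_theorem_of_algebra by blast
  then obtain q where "p = [:- \<mu>, 1:] * q" unfolding poly_eq_0_iff_dvd by (elim dvdE)
  then have "p = pCons 0 q - Polynomial.smult \<mu> q" by simp
  then show ?thesis by blast
qed

section \<open>Exchange of one parameter\<close>

locale regular_tuple = frame X V Y bs pb D for X V :: "(complex^'n::finite) set" and Y bs pb D +
  fixes L :: "nat \<Rightarrow> complex^'n" and \<kappa> :: nat
  assumes goodL: "goodL L" and indL: "indL L" and \<kappa>: "\<kappa> \<le> D"
begin

abbreviation "C \<equiv> inC L \<kappa>"
abbreviation "b \<equiv> L \<kappa>"

lemma lf_diff: "lf (x - y) z = lf x z - lf y z"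
  using lf_linear(3)[of x "-1 *s y" z] lf_linear(4)[of "-1" y z] by simp

text \<open>Modulo the other parameters, products of linear forms are multiples of \<open>b\<close>,
  and \<open>b\<close> can be cancelled. So \<open>w\<close> is determined modulo
  \<open>C 0\<close>, and \<open>a\<close> to \<open>w\<close> is the operator of multiplication by
  \<open>x\<close> over \<open>b\<close>.\<close>

lemma reduce: "\<exists>w. C 1 (\<lambda>z. lf x z * lf a z - lf b z * lf w z)"
proof -
  from goodL have "inI L (\<lambda>z. lf x z * lf a z)" unfolding goodL_def by blast
  then obtain r where r: "\<forall>z\<in>V. lf x z * lf a z = (\<Sum>k\<le>D. lf (L k) z * lf (r k) z)" unfolding inI_def by (elim exE)
  have "lf x z * lf a z - lf b z * lf (r \<kappa>) z = (\<Sum>k\<in>{..D} - {\<kappa>}. lf (L k) z * lf (r k) z)" if "z \<in> V" for z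
  proof -
    have "(\<Sum>k\<le>D. lf (L k) z * lf (r k) z) = lf b z * lf (r \<kappa>) z + (\<Sum>k\<in>{..D} - {\<kappa>}. lf (L k) z * lf (r k) z)"
      using \<kappa> by (intro sum.remove) auto
    then show ?thesis using r that by simp
  qed
  then have "C 1 (\<lambda>z. lf x z * lf a z - lf b z * lf (r \<kappa>) z)"
    unfolding inC_def by (intro exI[of _ "\<lambda>k. lf (r k)"]) (use hom_poly_lf in auto)
  then show ?thesis by blast
qed

lemma cancel_power: "C d (\<lambda>z. lf b z ^ d * lf v z) \<Longrightarrow> C 0 (lf v)"
  by (rule inC_cancel_power[OF goodL indL \<kappa>])

lemma C0_mult: "C 0 (lf v) \<Longrightarrow> C 1 (\<lambda>z. lf x z * lf v z)"
  using inC_mult[OF _ hom_poly_lf[of x], of L \<kappa> 0 "lf v"] by simp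

lemma cancel: assumes "C 2 (\<lambda>z. lf b z * (lf x z * lf a z))" shows "C 1 (\<lambda>z. lf x z * lf a z)"
proof -
  from reduce[of x a] obtain w where w: "C 1 (\<lambda>z. lf x z * lf a z - lf b z * lf w z)" by (elim exE)
  from inC_mult[OF w hom_poly_lf[of b]] have "C 2 (\<lambda>z. lf b z * (lf x z * lf a z - lf b z * lf w z))"
    by (simp only: one_add_one)
  from inC_diff[OF assms this] have "C 2 (\<lambda>z. lf b z ^ 2 * lf w z)"
    by (rule inC_cong) (simp add: algebra_simps power2_eq_square)
  from C0_mult[OF cancel_power[OF this], of b] w have "C 1 (\<lambda>z. lf b z * lf w z + (lf x z * lf a z - lf b z * lf w z))"
    by (rule inC_add)
  then show ?thesis by simp
qed

text \<open>These operators commute: after multiplication by \<open>b\<close> both orders give the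
  same product, and \<open>b\<close> cancels.\<close>

lemma kernel_invariant:
  assumes "C 1 (\<lambda>z. lf x z * lf a z)" "C 1 (\<lambda>z. lf y z * lf a z - lf b z * lf w z)"
  shows "C 1 (\<lambda>z. lf x z * lf w z)"
proof (rule cancel)
  have "C 2 (\<lambda>z. lf y z * (lf x z * lf a z))" using inC_mult[OF assms(1) hom_poly_lf[of y]] by (simp only: one_add_one)
  moreover have "C 2 (\<lambda>z. lf x z * (lf y z * lf a z - lf b z * lf w z))" using inC_mult[OF assms(2) hom_poly_lf[of x]] by (simp only: one_add_one)
  ultimately have "C 2 (\<lambda>z. lf y z * (lf x z * lf a z) - lf x z * (lf y z * lf a z - lf b z * lf w z))" by (rule inC_diff)
  then show "C 2 (\<lambda>z. lf b z * (lf x z * lf w z))" by (rule inC_cong) (simp add: algebra_simps)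
qed

lemma lf_pev: "lf (pev w p) z = (\<Sum>i\<le>degree p. coeff p i * lf (w i) z)"
  by (simp add: pev_def lf_sum_left lf_linear)

text \<open>The iterates are chosen one after the other, without a linear choice of the operator;
  modulo \<open>C 0\<close> they are nevertheless the iterates of a linear map.\<close>

lemma orbit_ex: "\<exists>w. w 0 = v \<and> (\<forall>i. C 1 (\<lambda>z. lf x z * lf (w i) z - lf b z * lf (w (Suc i)) z))"
proof -
  have "\<forall>a. \<exists>w. C 1 (\<lambda>z. lf x z * lf a z - lf b z * lf w z)" using reduce by blast
  from choice[OF this] obtain T where T: "\<forall>a. C 1 (\<lambda>z. lf x z * lf a z - lf b z * lf (T a) z)" by (elim exE)
  show ?thesis by (rule exI[of _ "\<lambda>i. (T ^^ i) v"]) (use T in simp)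
qed

lemma orbit_shift:
  assumes "\<And>i. C 1 (\<lambda>z. lf x z * lf (w i) z - lf b z * lf (w (Suc i)) z)"
  shows "C 1 (\<lambda>z. lf x z * lf (pev w p) z - lf b z * lf (pev (\<lambda>i. w (Suc i)) p) z)"
proof -
  have "C 1 (\<lambda>z. \<Sum>i\<le>degree p. coeff p i * (lf x z * lf (w i) z - lf b z * lf (w (Suc i)) z))"
    by (intro inC_sum inC_smult assms)
  then show ?thesis
    by (rule inC_cong) (simp add: lf_pev sum_distrib_left right_diff_distrib sum_subtractf mult.left_commute)
qed

lemma C0_zero: "C 0 (lf 0)" by (rule inC_cong[OF inC_zero]) (simp add: lf_linear)

lemma C0_scale: "C 0 (lf (c *s v)) \<Longrightarrow> c \<noteq> 0 \<Longrightarrow> C 0 (lf v)"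
  by (rule inC_cong[OF inC_smult[of L \<kappa> 0 "lf (c *s v)" "1 / c"]]) (simp_all add: lf_linear)

text \<open>Split a linear factor with root \<open>\<mu>\<close> off a minimal annihilating
  polynomial; the cofactor applied to \<open>v\<close> is an eigenvector, nonzero by minimality. The
  whole orbit stays annihilated by the forms in \<open>M\<close>.\<close>

lemma eigenvector_step:
  assumes v: "\<not> C 0 (lf v)" "\<And>y. y \<in> M \<Longrightarrow> C 1 (\<lambda>z. lf y z * lf v z)"
  shows "\<exists>\<mu> v'. \<not> C 0 (lf v') \<and> (\<forall>y\<in>insert (x - \<mu> *s b) M. C 1 (\<lambda>z. lf y z * lf v' z))"
proof -
  from orbit_ex[of v x] obtain w where w: "w 0 = v" "\<And>i. C 1 (\<lambda>z. lf x z * lf (w i) z - lf b z * lf (w (Suc i)) z)" by blast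
  from annihilating_polynomial[of "\<lambda>a. C 0 (lf a)" w, OF C0_zero] obtain p where
    p: "p \<noteq> 0" "C 0 (lf (pev w p))" "\<And>q. q \<noteq> 0 \<Longrightarrow> C 0 (lf (pev w q)) \<Longrightarrow> degree p \<le> degree q" by blast
  have "degree p \<noteq> 0"
  proof
    assume 0: "degree p = 0"
    then have "pev w p = coeff p 0 *s v" "coeff p 0 \<noteq> 0" using p(1) w(1) by (auto simp: pev_def) (metis leading_coeff_0_iff)
    then show False using p(2) C0_scale v(1) by metis
  qed
  from complex_poly_linear_factor[OF this] obtain \<mu> q where q: "p = pCons 0 q - Polynomial.smult \<mu> q" by blast
  have q0: "q \<noteq> 0" using p(1) q by auto
  have dq: "degree q < degree p"
  proof -
    have "coeff p (Suc (degree q)) = lead_coeff q" unfolding q by (simp add: coeff_eq_0)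
    then have "coeff p (Suc (degree q)) \<noteq> 0" using q0 by simp
    then show ?thesis using le_degree by fastforce
  qed
  then have nq: "\<not> C 0 (lf (pev w q))" using p(3)[OF q0] by auto
  have inv: "C 1 (\<lambda>z. lf y z * lf (w i) z)" if y: "y \<in> M" for y i
  proof (induction i)
    case 0
    then show ?case using v(2)[OF y] w(1) by simp
  next
    case (Suc i)
    then show ?case using w(2)[of i] by (rule kernel_invariant)
  qed
  have "C 1 (\<lambda>z. lf y z * lf (pev w q) z)" if y: "y \<in> M" for y
  proof -
    have "C 1 (\<lambda>z. \<Sum>i\<le>degree q. coeff q i * (lf y z * lf (w i) z))" by (intro inC_sum inC_smult inv y)
    then show ?thesis by (rule inC_cong) (simp add: lf_pev sum_distrib_left mult.left_commute)
  qed
  moreover have "C 1 (\<lambda>z. lf (x - \<mu> *s b) z * lf (pev w q) z)"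
  proof -
    have pq: "pev w p = pev (\<lambda>i. w (Suc i)) q - \<mu> *s pev w q" unfolding q pev_diff pev_smult pev_pCons by simp
    from orbit_shift[of x w q, OF w(2)] C0_mult[OF p(2), of b]
    have "C 1 (\<lambda>z. (lf x z * lf (pev w q) z - lf b z * lf (pev (\<lambda>i. w (Suc i)) q) z) + lf b z * lf (pev w p) z)" by (rule inC_add)
    then show ?thesis by (rule inC_cong) (simp add: pq lf_diff lf_linear algebra_simps)
  qed
  ultimately show ?thesis using nq by (intro exI[of _ \<mu>] exI[of _ "pev w q"]) auto
qed

lemma common_eigenvector:
  fixes I :: "'n set"
  assumes v: "\<not> C 0 (lf v)" "C 1 (\<lambda>z. lf b' z * lf v z)" and "finite I"
  shows "\<exists>\<mu> v'. \<not> C 0 (lf v') \<and> C 1 (\<lambda>z. lf b' z * lf v' z) \<and> (\<forall>i\<in>I. C 1 (\<lambda>z. lf (axis i 1 - \<mu> i *s b) z * lf v' z))"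
  using \<open>finite I\<close>
proof (induction I rule: finite_induct)
  case empty
  then show ?case using v by blast
next
  case (insert i I)
  from insert(3) obtain \<mu> v' where m: "\<not> C 0 (lf v')" "C 1 (\<lambda>z. lf b' z * lf v' z)" "\<forall>i\<in>I. C 1 (\<lambda>z. lf (axis i 1 - \<mu> i *s b) z * lf v' z)"
    by (elim exE conjE)
  from eigenvector_step[of v' "insert b' ((\<lambda>i. axis i 1 - \<mu> i *s b) ` I)" "axis i 1", OF m(1)] m(2,3)
  obtain \<nu> y where y: "\<not> C 0 (lf y)" "\<forall>x\<in>insert (axis i 1 - \<nu> *s b) (insert b' ((\<lambda>i. axis i 1 - \<mu> i *s b) ` I)). C 1 (\<lambda>z. lf x z * lf y z)"
    by auto
  have "\<forall>j\<in>insert i I. C 1 (\<lambda>z. lf (axis j 1 - (\<mu>(i := \<nu>)) j *s b) z * lf y z)"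
    using y(2) insert(2) by auto
  then show ?case using y by (intro exI[of _ "\<mu>(i := \<nu>)"] exI[of _ y]) simp
qed

text \<open>A common eigenvector of the multiplications by linear forms on the Artinian reduction is evaluation at a point of \<open>V\<close>.\<close>

lemma kernel_trivial:
  assumes nz: "\<And>z. z \<in> V \<Longrightarrow> lf b' z = 0 \<Longrightarrow> \<exists>k\<in>{..D} - {\<kappa>}. lf (L k) z \<noteq> 0"
    and v: "C 1 (\<lambda>z. lf b' z * lf v z)"
  shows "C 0 (lf v)"
proof (rule ccontr)
  assume "\<not> C 0 (lf v)"
  from common_eigenvector[OF this v, of UNIV] obtain \<mu> y where
    y: "\<not> C 0 (lf y)" "C 1 (\<lambda>z. lf b' z * lf y z)" "\<And>i. C 1 (\<lambda>z. lf (axis i 1 - \<mu> i *s b) z * lf y z)" by auto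
  define p where "p = (\<chi> i. \<mu> i)"
  \<comment> \<open>On the eigenvector a form of degree \<open>t\<close> acts as its value at the
    point \<open>p\<close> of eigenvalues times the \<open>t\<close>-th power of
    \<open>b\<close>.\<close>
  have ev: "C t (\<lambda>z. f z * lf y z - f p * (lf b z ^ t * lf y z))" if "hom_poly t f" for t f
    using that
  proof (induction rule: hom_poly_induct)
    case (const c)
    then show ?case using inC_zero by simp
  next
    case (coord t f i)
    have "C (Suc t) (\<lambda>z. z $ i * (f z * lf y z - f p * (lf b z ^ t * lf y z)))"
      using inC_mult[OF coord(2) hom_poly_nth[of i]] by simp
    moreover have "hom_poly t (\<lambda>z. f p * lf b z ^ t)" using hom_poly_smult[OF hom_poly_power[OF hom_poly_lf[of b], of t], of "f p"] by simp
    from inC_mult[OF y(3)[of i] this] have "C (Suc t) (\<lambda>z. f p * lf b z ^ t * (lf (axis i 1 - \<mu> i *s b) z * lf y z))" by simp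
    ultimately have "C (Suc t) (\<lambda>z. z $ i * (f z * lf y z - f p * (lf b z ^ t * lf y z)) + f p * lf b z ^ t * (lf (axis i 1 - \<mu> i *s b) z * lf y z))"
      by (rule inC_add)
    then show ?case by (rule inC_cong) (simp add: lf_diff lf_axis lf_linear p_def algebra_simps)
  next
    case (add t f g)
    from inC_add[OF add(3,4)] show ?case by (rule inC_cong) (simp add: algebra_simps)
  qed
  have ev0: "f p = 0" if f: "hom_poly t f" "C t (\<lambda>z. f z * lf y z)" for f t
  proof (rule ccontr)
    assume n: "f p \<noteq> 0"
    from inC_diff[OF f(2) ev[OF f(1)]] have "C t (\<lambda>z. lf b z ^ t * lf (f p *s y) z)"
      by (rule inC_cong) (simp add: algebra_simps lf_linear)
    from C0_scale[OF cancel_power[OF this] n] show False using y(1) by simp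
  qed
  have "p \<noteq> 0"
  proof
    assume "p = 0"
    then have "lf b p = 0" by (simp add: lf_linear)
    then have "C 1 (\<lambda>z. lf b z ^ 1 * lf y z)" using ev[OF hom_poly_lf[of b]] by simp
    from cancel_power[OF this] show False using y(1) by simp
  qed
  have "p \<in> V"
  proof (rule forms_cut_closed[OF V_closed \<open>p \<noteq> 0\<close>])
    fix d f assume f: "hom_poly d f" "\<And>x. x \<in> V \<Longrightarrow> f x = 0"
    show "f p = 0" by (rule ev0[OF f(1)]) (rule inC_cong[OF inC_zero], simp add: f(2))
  qed
  moreover have "lf b' p = 0" by (rule ev0[OF hom_poly_lf y(2)])
  moreover have "lf (L k) p = 0" if "k \<in> {..D} - {\<kappa>}" for k
    by (rule ev0[OF hom_poly_lf inC_gen[OF _ _ hom_poly_lf]]) (use that in auto)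
  ultimately show False using nz[of p] by auto
qed

text \<open>Injectivity of \<open>b'\<close> gives surjectivity in finite dimension: a minimal
  annihilating polynomial of \<open>a\<close> has nonzero constant term, since otherwise
  \<open>kernel_trivial\<close> would allow a smaller degree. Solving for that term writes
  \<open>b\<close> times \<open>a\<close> as \<open>b'\<close> times a linear form.\<close>

lemma exchange_surj:
  assumes nz: "\<And>z. z \<in> V \<Longrightarrow> lf b' z = 0 \<Longrightarrow> \<exists>k\<in>{..D} - {\<kappa>}. lf (L k) z \<noteq> 0"
  shows "\<exists>y. C 1 (\<lambda>z. lf b z * lf a z - lf b' z * lf y z)"
proof -
  from orbit_ex[of a b'] obtain w where w: "w 0 = a" "\<And>i. C 1 (\<lambda>z. lf b' z * lf (w i) z - lf b z * lf (w (Suc i)) z)" by blast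
  from annihilating_polynomial[of "\<lambda>a. C 0 (lf a)" w, OF C0_zero] obtain p where
    p: "p \<noteq> 0" "C 0 (lf (pev w p))" "\<And>q. q \<noteq> 0 \<Longrightarrow> C 0 (lf (pev w q)) \<Longrightarrow> degree p \<le> degree q" by blast
  obtain c q where q: "p = pCons c q" by (cases p)
  have pq: "pev w p = c *s a + pev (\<lambda>i. w (Suc i)) q" unfolding q pev_pCons w(1) ..
  have sh: "C 1 (\<lambda>z. (lf b' z * lf (pev w q) z - lf b z * lf (pev (\<lambda>i. w (Suc i)) q) z) + lf b z * lf (pev w p) z)"
    by (rule inC_add[OF orbit_shift[of b' w q, OF w(2)] C0_mult[OF p(2), of b]])
  have "c \<noteq> 0"
  proof
    assume 0: "c = 0"
    have "C 1 (\<lambda>z. lf b' z * lf (pev w q) z)" by (rule inC_cong[OF sh]) (simp add: pq 0)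
    from kernel_trivial[OF nz this] have "C 0 (lf (pev w q))" by simp
    moreover have "q \<noteq> 0" using p(1) q 0 by auto
    ultimately show False using p(3)[of q] unfolding q by (simp add: degree_pCons_eq)
  qed
  obtain e where e: "e * c = - 1" using \<open>c \<noteq> 0\<close> by (metis divide_eq_eq)
  have "C 1 (\<lambda>z. lf b z * lf a z - lf b' z * lf (e *s pev w q) z)"
  proof (rule inC_cong[OF inC_smult[OF sh, of "- e"]])
    fix z
    show "lf b z * lf a z - lf b' z * lf (e *s pev w q) z =
      - e * (lf b' z * lf (pev w q) z - lf b z * lf (pev (\<lambda>i. w (Suc i)) q) z + lf b z * lf (pev w p) z)"
      unfolding pq lf_linear using e by algebra
  qed
  then show ?thesis by blast
qed

text \<open>Surjectivity replaces the multiples of \<open>b\<close> by multiples of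
  \<open>b'\<close>. If the new tuple were dependent, \<open>b'\<close> would lie in the span of the
  others, so it would annihilate \<open>b\<close> in the quotient and put \<open>b\<close> into that
  span as well.\<close>

lemma exchange:
  assumes nz: "\<And>z. z \<in> V \<Longrightarrow> lf b' z = 0 \<Longrightarrow> \<exists>k\<in>{..D} - {\<kappa>}. lf (L k) z \<noteq> 0"
  shows "goodL (L(\<kappa> := b'))" "indL (L(\<kappa> := b'))"
proof -
  let ?L = "L(\<kappa> := b')"
  have CI: "inI ?L q" if "C 1 q" for q
  proof -
    from that obtain g where g: "\<forall>k. hom_poly 1 (g k)" "\<forall>z\<in>V. q z = (\<Sum>k\<in>{..D} - {\<kappa>}. lf (L k) z * g k z)"
      unfolding inC_def by (elim exE conjE)
    have "\<forall>k. \<exists>a. g k = lf a" using g(1) hom_poly_1_lf by blast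
    from choice[OF this] obtain r where r: "\<forall>k. g k = lf (r k)" by (elim exE)
    have "inI ?L (\<lambda>z. \<Sum>k\<in>{..D} - {\<kappa>}. lf (?L k) z * lf (r k) z)" by (intro inI_sum inI_gen) auto
    then show ?thesis by (rule inI_cong) (use g(2) r in simp)
  qed
  show "goodL ?L" unfolding goodL_def
  proof (intro allI)
    fix a x
    from reduce[of a x] obtain w where w: "C 1 (\<lambda>z. lf a z * lf x z - lf b z * lf w z)" by (elim exE)
    from exchange_surj[of b' w, OF nz] obtain y where y: "C 1 (\<lambda>z. lf b z * lf w z - lf b' z * lf y z)" by blast
    have "inI ?L (\<lambda>z. (lf a z * lf x z - lf b z * lf w z) + ((lf b z * lf w z - lf b' z * lf y z) + lf (?L \<kappa>) z * lf y z))"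
      by (intro inI_add CI w y inI_gen \<kappa>)
    then show "inI ?L (\<lambda>z. lf a z * lf x z)" by (rule inI_cong) simp
  qed
  show "indL ?L" unfolding indL_def fam_indep_def
  proof (intro allI impI, rule ccontr)
    fix \<gamma> assume g: "\<forall>z\<in>V. (\<Sum>k\<le>D. \<gamma> k * lf (?L k) z) = 0" and n: "\<not> (\<forall>k\<in>{..D}. \<gamma> k = 0)"
    have rel: "\<gamma> \<kappa> * lf b' z + (\<Sum>k\<in>{..D} - {\<kappa>}. \<gamma> k * lf (L k) z) = 0" if "z \<in> V" for z
    proof -
      have "(\<Sum>k\<le>D. \<gamma> k * lf (?L k) z) = \<gamma> \<kappa> * lf (?L \<kappa>) z + (\<Sum>k\<in>{..D} - {\<kappa>}. \<gamma> k * lf (?L k) z)" using \<kappa> by (intro sum.remove) auto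
      also have "(\<Sum>k\<in>{..D} - {\<kappa>}. \<gamma> k * lf (?L k) z) = (\<Sum>k\<in>{..D} - {\<kappa>}. \<gamma> k * lf (L k) z)" by (rule sum.cong) auto
      finally show ?thesis using g that by simp
    qed
    have k0: "\<gamma> \<kappa> \<noteq> 0"
    proof
      assume 0: "\<gamma> \<kappa> = 0"
      have "(\<Sum>k\<le>D. \<gamma> k * lf (L k) z) = 0" if "z \<in> V" for z
        using rel[OF that] 0 sum.remove[of "{..D}" \<kappa> "\<lambda>k. \<gamma> k * lf (L k) z"] \<kappa> by simp
      from fam_indepD[OF indL[unfolded indL_def], of \<gamma>, OF this] show False using n by blast
    qed
    have "C 0 (\<lambda>z. \<Sum>k\<in>{..D} - {\<kappa>}. (- 1 / \<gamma> \<kappa>) * (lf (L k) z * \<gamma> k))"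
      by (intro inC_sum inC_smult inC_gen hom_poly_const) auto
    then have "C 0 (lf b')"
    proof (rule inC_cong)
      fix z assume "z \<in> V"
      from rel[OF this] have "lf b' z = (- 1 / \<gamma> \<kappa>) * (\<Sum>k\<in>{..D} - {\<kappa>}. \<gamma> k * lf (L k) z)"
        using k0 by (simp add: field_simps eq_neg_iff_add_eq_0)
      then show "lf b' z = (\<Sum>k\<in>{..D} - {\<kappa>}. (- 1 / \<gamma> \<kappa>) * (lf (L k) z * \<gamma> k))" by (simp add: sum_distrib_left mult.commute)
    qed
    from C0_mult[OF this, of b] have "C 1 (\<lambda>z. lf b' z * lf b z)" by (simp add: mult.commute)
    from kernel_trivial[OF nz this] have "C 0 (lf b)" by simp
    then obtain h where h: "\<forall>k. hom_poly 0 (h k)" "\<forall>z\<in>V. lf b z = (\<Sum>k\<in>{..D} - {\<kappa>}. lf (L k) z * h k z)" unfolding inC_def by (elim exE conjE)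
    define \<delta> where "\<delta> k = (if k = \<kappa> then - 1 else h k 0)" for k
    have hc: "h k z = h k 0" for k z using hom_poly_scale[OF h(1)[rule_format, of k], of 0 z] by simp
    have "(\<Sum>k\<le>D. \<delta> k * lf (L k) z) = 0" if z: "z \<in> V" for z
    proof -
      have "(\<Sum>k\<le>D. \<delta> k * lf (L k) z) = \<delta> \<kappa> * lf b z + (\<Sum>k\<in>{..D} - {\<kappa>}. \<delta> k * lf (L k) z)" using \<kappa> by (intro sum.remove) auto
      also have "(\<Sum>k\<in>{..D} - {\<kappa>}. \<delta> k * lf (L k) z) = (\<Sum>k\<in>{..D} - {\<kappa>}. lf (L k) z * h k z)"
        by (rule sum.cong) (auto simp: \<delta>_def hc[of _ z])
      finally show ?thesis using h(2) z by (simp add: \<delta>_def)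
    qed
    from fam_indepD[OF indL[unfolded indL_def], of \<delta>, OF this] have "\<delta> \<kappa> = 0" using \<kappa> by blast
    then show False by (simp add: \<delta>_def)
  qed
qed

end

section \<open>Finite linear sections and the degree\<close>

definition pclass :: "complex^'n::finite \<Rightarrow> (complex^'n) set" where
  "pclass z = {c *s z | c. c \<noteq> 0}"

lemma proj_points_pclass: "proj_points S = pclass ` S"
  by (simp add: proj_points_def pclass_def[abs_def])

lemma pclass_self: "z \<in> pclass z"
  unfolding pclass_def by (rule CollectI, rule exI[of _ 1]) simp

lemma pclass_eqD: assumes "pclass x = pclass y" shows "\<exists>c. c \<noteq> 0 \<and> x = c *s y"
  using pclass_self[of x] unfolding assms by (auto simp: pclass_def)

lemma pclass_scale: assumes "c \<noteq> 0" shows "pclass (c *s x) = pclass x"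
proof -
  have "d *s x \<in> pclass (c *s x)" if "d \<noteq> 0" for d
    unfolding pclass_def using assms that by (intro CollectI exI[of _ "d / c"]) simp
  moreover have "d *s (c *s x) \<in> pclass x" if "d \<noteq> 0" for d
    unfolding pclass_def using assms that by (intro CollectI exI[of _ "d * c"]) simp
  ultimately show ?thesis unfolding pclass_def[of x] pclass_def[of "c *s x"] by (auto simp: pclass_def)
qed

lemma finite_proj_points_representatives:
  assumes "finite (proj_points Z)"
  shows "\<exists>W\<subseteq>Z. finite W \<and> (\<forall>z\<in>Z. \<exists>w\<in>W. \<exists>c. c \<noteq> 0 \<and> z = c *s w)"
proof -
  from finite_subset_image[OF assms, of pclass Z] obtain W where W: "W \<subseteq> Z" "finite W" "proj_points Z = pclass ` W"
    by (auto simp: proj_points_pclass)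
  have "\<exists>w\<in>W. \<exists>c. c \<noteq> 0 \<and> z = c *s w" if z: "z \<in> Z" for z
  proof -
    have "pclass z \<in> pclass ` W" using W(3) z by (auto simp: proj_points_pclass)
    then obtain w where "w \<in> W" "pclass z = pclass w" by auto
    then show ?thesis using pclass_eqD by blast
  qed
  then show ?thesis using W by blast
qed

lemma separating_form:
  assumes "y \<noteq> 0" "\<And>c. x \<noteq> c *s y" shows "\<exists>a. lf a y = 0 \<and> lf a x \<noteq> 0"
proof -
  obtain i where i: "y $ i \<noteq> 0" using assms(1) by (auto simp: vec_eq_iff)
  have "\<exists>j. x $ j * y $ i \<noteq> x $ i * y $ j"
  proof (rule ccontr)
    assume "\<not> ?thesis"
    then have "x = (x $ i / y $ i) *s y" using i by (auto simp: vec_eq_iff field_simps)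
    then show False using assms(2) by blast
  qed
  then obtain j where j: "x $ j * y $ i \<noteq> x $ i * y $ j" by blast
  have "lf (y $ i *s axis j 1 + (- y $ j) *s axis i 1) z = y $ i * z $ j - y $ j * z $ i" for z
    unfolding lf_linear lf_axis by simp
  then show ?thesis using j by (intro exI[of _ "y $ i *s axis j 1 + (- y $ j) *s axis i 1"]) (auto simp: mult.commute)
qed

text \<open>At each point the combination is a nonzero polynomial in \<open>\<tau>\<close>, so only
  finitely many values are excluded.\<close>

lemma generic_combination:
  fixes a :: "nat \<Rightarrow> complex^'n::finite"
  assumes "finite W" "\<And>z. z \<in> W \<Longrightarrow> \<exists>k\<le>m. lf (a k) z \<noteq> 0"
  shows "\<exists>\<tau>. \<forall>z\<in>W. lf (\<Sum>k\<le>m. \<tau> ^ k *s a k) z \<noteq> 0"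
proof -
  have e: "lf (\<Sum>k\<le>m. \<tau> ^ k *s a k) z = (\<Sum>k\<le>m. lf (a k) z * \<tau> ^ k)" for \<tau> z
    by (simp add: lf_sum_left lf_linear mult.commute)
  have "finite {\<tau>. (\<Sum>k\<le>m. lf (a k) z * \<tau> ^ k) = 0}" if "z \<in> W" for z
    using assms(2)[OF that] by (subst polyfun_finite_roots)
  then have "finite (\<Union>z\<in>W. {\<tau>. (\<Sum>k\<le>m. lf (a k) z * \<tau> ^ k) = 0})" using assms(1) by blast
  then obtain \<tau> where "\<tau> \<notin> (\<Union>z\<in>W. {\<tau>. (\<Sum>k\<le>m. lf (a k) z * \<tau> ^ k) = 0})"
    using ex_new_if_finite[OF infinite_UNIV_char_0] by blast
  then show ?thesis unfolding e by (intro exI[of _ \<tau>]) blast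
qed

lemma sum_lessThan_add: "(\<Sum>j<m + n. f j) = (\<Sum>j<m. f j) + (\<Sum>k<n. f (m + k :: nat) :: 'a::comm_monoid_add)"
  by (induction n) (simp_all add: add.assoc)

context regular_tuple
begin

definition "lin_section = V \<inter> {z. \<forall>k\<in>{..D} - {\<kappa>}. lf (L k) z = 0}"

text \<open>Forms of degree \<open>card W - 1\<close> separate the points. On the section the other
  parameters vanish, so every form of that degree reduces to a combination of \<open>cm + 1\<close>
  functions: a power of \<open>b\<close> times \<open>b\<close> or one of the
  \<open>u j\<close>.\<close>

lemma section_nonproportional_bound:
  assumes W: "finite W" "W \<subseteq> lin_section" and np: "\<And>x y c. x \<in> W \<Longrightarrow> y \<in> W \<Longrightarrow> x \<noteq> y \<Longrightarrow> x \<noteq> c *s y"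
  shows "card W \<le> Suc cm"
proof (cases "card W - 1")
  case 0
  then show ?thesis by simp
next
  case (Suc e)
  have WV: "z \<in> V" "k \<in> {..D} - {\<kappa>} \<Longrightarrow> lf (L k) z = 0" if "z \<in> W" for z k using that W(2) by (auto simp: lin_section_def)
  have "\<forall>x. \<forall>y. \<exists>a. x \<in> W \<and> y \<in> W \<and> x \<noteq> y \<longrightarrow> lf a y = 0 \<and> lf a x \<noteq> 0"
    using separating_form proj_closed_nonzero[OF V_closed WV(1)] np by metis
  then have "\<forall>x. \<exists>a. \<forall>y. x \<in> W \<and> y \<in> W \<and> x \<noteq> y \<longrightarrow> lf (a y) y = 0 \<and> lf (a y) x \<noteq> 0" by (intro allI choice) simp
  from choice[OF this] obtain a where a: "\<forall>x y. x \<in> W \<and> y \<in> W \<and> x \<noteq> y \<longrightarrow> lf (a x y) y = 0 \<and> lf (a x y) x \<noteq> 0" by (elim exE)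
  define f where "f x z = (\<Prod>y\<in>W - {x}. lf (a x y) z)" for x z
  have hf: "hom_poly (Suc e) (f x)" if "x \<in> W" for x
  proof -
    have "hom_poly (\<Sum>y\<in>W - {x}. 1) (f x)" unfolding f_def[abs_def] by (intro hom_poly_prod hom_poly_lf)
    then show ?thesis using that Suc W(1) by simp
  qed
  have f0: "f x w = 0" if "x \<in> W" "w \<in> W" "w \<noteq> x" for x w
    unfolding f_def using that a W(1) by (intro prod_zero) auto
  have f1: "f x x \<noteq> 0" if "x \<in> W" for x unfolding f_def using that a W(1) by auto
  have ind: "fam_indep W W f" unfolding fam_indep_def
  proof (intro allI impI ballI)
    fix \<gamma> x assume g: "\<forall>z\<in>W. (\<Sum>i\<in>W. \<gamma> i * f i z) = 0" and x: "x \<in> W"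
    have "(\<Sum>i\<in>W. \<gamma> i * f i x) = (\<Sum>i\<in>W. if i = x then \<gamma> x * f x x else 0)" using f0 x by (intro sum.cong) auto
    then have "\<gamma> x * f x x = 0" using g x W(1) by simp
    then show "\<gamma> x = 0" using f1[OF x] by simp
  qed
  from complement[OF indL] obtain u where u: "\<And>a. in_fam V ({..D} <+> J) (Lu L u) (lf a)" by blast
  define g where "g j z = lf b z ^ e * (if j = 0 then lf b z else lf (u j) z)" for j z
  have "in_fam W {..cm} g (f x)" if x: "x \<in> W" for x
  proof -
    from goodL_Rep[OF goodL hf[OF x]] obtain c where c: "\<forall>z\<in>V. f x z = (\<Sum>\<alpha>\<in>Idx e. mon L \<alpha> z * lf (c \<alpha>) z)"
      unfolding Rep_def by (elim exE)
    define sg where "sg = (\<lambda>k. if k = \<kappa> then e else (0::nat))"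
    have sgI: "sg \<in> Idx e" using \<kappa> by (auto simp: Idx_def sg_def)
    have fz: "f x z = lf b z ^ e * lf (c sg) z" if z: "z \<in> W" for z
    proof -
      have "mon L \<alpha> z = (if \<alpha> = sg then lf b z ^ e else 0)" if \<alpha>: "\<alpha> \<in> Idx e" for \<alpha>
      proof (cases "\<forall>k\<in>{..D} - {\<kappa>}. \<alpha> k = 0")
        case True
        then have "sum \<alpha> {..D} = \<alpha> \<kappa>" using \<kappa> by (subst sum.remove[of _ \<kappa>]) auto
        then have "\<alpha> \<kappa> = e" using \<alpha> by (simp add: Idx_def)
        then have "\<alpha> = sg" unfolding sg_def using True \<alpha> by (intro ext) (auto simp: Idx_def)
        moreover have "mon L sg z = (\<Prod>k\<le>D. if k = \<kappa> then lf b z ^ e else 1)" unfolding mon_def sg_def by (rule prod.cong) auto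
        ultimately show ?thesis using \<kappa> by simp
      next
        case False
        then obtain k where k: "k \<in> {..D} - {\<kappa>}" "\<alpha> k \<noteq> 0" by blast
        then have "\<alpha> \<noteq> sg" by (auto simp: sg_def)
        moreover have "mon L \<alpha> z = 0" unfolding mon_def
          using k WV(2)[OF z k(1)] by (intro prod_zero) (auto intro!: bexI[of _ k])
        ultimately show ?thesis by simp
      qed
      then have "(\<Sum>\<alpha>\<in>Idx e. mon L \<alpha> z * lf (c \<alpha>) z) = (\<Sum>\<alpha>\<in>Idx e. if \<alpha> = sg then lf b z ^ e * lf (c sg) z else 0)"
        by (intro sum.cong) auto
      then show ?thesis using c WV(1)[OF z] sgI finite_Idx by simp
    qed
    from u[of "c sg"] obtain d where d: "\<forall>z\<in>V. lf (c sg) z = (\<Sum>x\<in>{..D} <+> J. d x * Lu L u x z)" unfolding in_fam_def by (elim exE)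
    define d' where "d' j = (if j = 0 then d (Inl \<kappa>) else d (Inr j))" for j
    have "f x z = (\<Sum>j\<le>cm. d' j * g j z)" if z: "z \<in> W" for z
    proof -
      have "(\<Sum>k\<le>D. d (Inl k) * lf (L k) z) = (\<Sum>k\<le>D. if k = \<kappa> then d (Inl \<kappa>) * lf b z else 0)"
        using WV(2)[OF z] by (intro sum.cong) auto
      also have "\<dots> = d (Inl \<kappa>) * lf b z" using \<kappa> by simp
      finally have "lf (c sg) z = d (Inl \<kappa>) * lf b z + (\<Sum>j\<in>J. d (Inr j) * lf (u j) z)"
        using d WV(1)[OF z] by (simp add: sum.Plus)
      moreover have "(\<Sum>j\<le>cm. d' j * g j z) = d' 0 * g 0 z + (\<Sum>j\<in>J. d' j * g j z)"
        unfolding J_eq[symmetric] by (rule sum.remove) auto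
      moreover have "(\<Sum>j\<in>J. d' j * g j z) = (\<Sum>j\<in>J. lf b z ^ e * (d (Inr j) * lf (u j) z))"
        by (rule sum.cong) (auto simp: d'_def g_def)
      ultimately show ?thesis unfolding fz[OF z] by (simp add: d'_def g_def sum_distrib_left algebra_simps)
    qed
    then show ?thesis unfolding in_fam_def by (intro exI[of _ d']) simp
  qed
  from fam_bound[OF W(1) _ ind this] show ?thesis by simp
qed

lemma section_points: "finite (proj_points lin_section)" "card (proj_points lin_section) \<le> Suc cm"
proof -
  have bd: "card T \<le> Suc cm" if T: "finite T" "T \<subseteq> proj_points lin_section" for T
  proof -
    from T(2) obtain W where W: "W \<subseteq> lin_section" "inj_on pclass W" "T = pclass ` W"
      unfolding proj_points_pclass subset_image_inj by blast
    have fin: "finite W" using T(1) W(2,3) finite_image_iff by blast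
    have "card W \<le> Suc cm"
    proof (rule section_nonproportional_bound[OF fin W(1)])
      fix x y c assume xy: "x \<in> W" "y \<in> W" "x \<noteq> y"
      show "x \<noteq> c *s y"
      proof
        assume e: "x = c *s y"
        have "x \<noteq> 0" using xy(1) W(1) proj_closed_nonzero[OF V_closed] by (auto simp: lin_section_def)
        then have "c \<noteq> 0" using e by auto
        then have "pclass x = pclass y" unfolding e by (rule pclass_scale)
        then show False using W(2) xy by (auto dest: inj_onD)
      qed
    qed
    then show ?thesis using W(2,3) by (simp add: card_image)
  qed
  show f: "finite (proj_points lin_section)"
  proof (rule ccontr)
    assume "infinite (proj_points lin_section)"
    from infinite_arbitrarily_large[OF this, of "Suc (Suc cm)"] obtain T where "finite T" "card T = Suc (Suc cm)" "T \<subseteq> proj_points lin_section" by blast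
    then show False using bd[of T] by simp
  qed
  show "card (proj_points lin_section) \<le> Suc cm" by (rule bd[OF f]) simp
qed

end

context frame
begin

lemma indL_L0: "indL L0"
  unfolding indL_def fam_indep_def
proof (intro allI impI ballI)
  fix \<gamma> i assume g: "\<forall>z\<in>V. (\<Sum>k\<le>D. \<gamma> k * lf (L0 k) z) = 0" and i: "i \<in> {..D}"
  define \<delta> where "\<delta> j = (if j \<le> cm then \<gamma> D else \<gamma> (j - Suc cm))" for j
  have "(\<Sum>j<NN. \<delta> j * xc j z) = 0" if z: "z \<in> V" for z
  proof -
    have "(\<Sum>j<NN. \<delta> j * xc j z) = (\<Sum>j<Suc cm. \<delta> j * xc j z) + (\<Sum>k<D. \<delta> (Suc cm + k) * xc (Suc cm + k) z)"
      unfolding NN_def by (rule sum_lessThan_add)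
    also have "(\<Sum>j<Suc cm. \<delta> j * xc j z) = \<gamma> D * lf (L0 D) z"
      unfolding L0(2) lessThan_Suc_atMost sum_distrib_left by (rule sum.cong) (auto simp: \<delta>_def)
    also have "(\<Sum>k<D. \<delta> (Suc cm + k) * xc (Suc cm + k) z) = (\<Sum>k<D. \<gamma> k * lf (L0 k) z)"
      by (rule sum.cong) (auto simp: \<delta>_def L0(1))
    finally show ?thesis using g z by (simp add: lessThan_Suc_atMost[symmetric] add.commute)
  qed
  from fam_indepD[OF xc_indep, of \<delta>, OF this] have d: "\<delta> j = 0" if "j < NN" for j using that by blast
  show "\<gamma> i = 0"
  proof (cases "i = D")
    case True
    then show ?thesis using d[of 0] by (simp add: \<delta>_def NN_def)
  next
    case False
    then have "Suc cm + i < NN" using i by (simp add: NN_def)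
    from d[OF this] show ?thesis by (simp add: \<delta>_def)
  qed
qed

text \<open>Start from \<open>L0\<close> and exchange its members one by one for combinations of the
  \<open>a k\<close>. The section by the other parameters is finite, so some combination has no zero
  on it, as \<open>exchange\<close> demands. Finally the \<open>a k\<close> span the new parameters,
  which transfers both properties to them.\<close>

lemma no_common_zero_regular:
  assumes nz: "\<And>z. z \<in> V \<Longrightarrow> \<exists>k\<le>D. lf (a k) z \<noteq> 0"
  shows "goodL a \<and> indL a"
proof -
  have "\<exists>L. goodL L \<and> indL L \<and> (\<forall>k<m. \<exists>r. L k = (\<Sum>j\<le>D. r j *s a j))" if "m \<le> Suc D" for m
    using that
  proof (induction m)
    case 0
    then show ?case using goodL_L0 indL_L0 by blast
  next
    case (Suc m)
    then obtain L where L: "goodL L" "indL L" "\<forall>k<m. \<exists>r. L k = (\<Sum>j\<le>D. r j *s a j)" by auto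
    interpret T: regular_tuple X V Y bs pb D L m by unfold_locales (use L Suc in auto)
    from finite_proj_points_representatives[OF T.section_points(1)] obtain W where
      W: "W \<subseteq> T.lin_section" "finite W" "\<forall>z\<in>T.lin_section. \<exists>w\<in>W. \<exists>c. c \<noteq> 0 \<and> z = c *s w" by blast
    have "\<exists>k\<le>D. lf (a k) z \<noteq> 0" if "z \<in> W" for z using that W(1) nz by (auto simp: T.lin_section_def)
    from generic_combination[OF W(2) this] obtain \<tau> where \<tau>: "\<forall>z\<in>W. lf (\<Sum>k\<le>D. \<tau> ^ k *s a k) z \<noteq> 0" by blast
    define b' where "b' = (\<Sum>k\<le>D. \<tau> ^ k *s a k)"
    have "\<exists>k\<in>{..D} - {m}. lf (L k) z \<noteq> 0" if z: "z \<in> V" "lf b' z = 0" for z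
    proof (rule ccontr)
      assume "\<not> ?thesis"
      then have "z \<in> T.lin_section" using z(1) by (auto simp: T.lin_section_def)
      then obtain w c where "w \<in> W" "c \<noteq> 0" "z = c *s w" using W(3) by blast
      then show False using z(2) \<tau> by (simp add: b'_def[symmetric] lf_linear)
    qed
    from T.exchange[OF this] have e: "goodL (L(m := b'))" "indL (L(m := b'))" by blast+
    have "\<forall>k<Suc m. \<exists>r. (L(m := b')) k = (\<Sum>j\<le>D. r j *s a j)"
    proof (intro allI impI)
      fix k assume "k < Suc m"
      then show "\<exists>r. (L(m := b')) k = (\<Sum>j\<le>D. r j *s a j)"
        using L(3) by (cases "k = m") (auto simp: b'_def less_Suc_eq)
    qed
    with e show ?case by blast
  qed
  from this[OF order_refl] obtain L where L: "goodL L" "indL L" "\<forall>k<Suc D. \<exists>r. L k = (\<Sum>j\<le>D. r j *s a j)" by blast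
  have "\<forall>k. \<exists>r. k \<le> D \<longrightarrow> L k = (\<Sum>j\<le>D. r j *s a j)" using L(3) by (auto simp: less_Suc_eq_le)
  from choice[OF this] obtain r where r: "\<forall>k. k \<le> D \<longrightarrow> L k = (\<Sum>j\<le>D. r k j *s a j)" by (elim exE)
  have lfL: "lf (L k) z = (\<Sum>j\<le>D. r k j * lf (a j) z)" if "k \<le> D" for k z
    using r that by (simp add: lf_sum_left lf_linear)
  have "inI a q" if "inI L q" for q
  proof -
    from that obtain s where s: "\<forall>z\<in>V. q z = (\<Sum>k\<le>D. lf (L k) z * lf (s k) z)" unfolding inI_def by (elim exE)
    have "inI a (\<lambda>z. \<Sum>k\<le>D. \<Sum>j\<le>D. r k j * (lf (a j) z * lf (s k) z))"
      by (intro inI_sum inI_smult inI_gen finite_atMost) auto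
    then show ?thesis
      by (rule inI_cong) (use s in \<open>auto simp: lfL sum_distrib_right mult.assoc intro!: sum.cong\<close>)
  qed
  then have "goodL a" using L(1) unfolding goodL_def by blast
  moreover have "fam_indep V {..D} (\<lambda>k. lf (a k))"
  proof (rule fam_exchange[OF _ _ L(2)[unfolded indL_def]])
    fix i assume "i \<in> {..D}"
    then show "in_fam V {..D} (\<lambda>k. lf (a k)) (lf (L i))" unfolding in_fam_def
      by (intro exI[of _ "r i"]) (simp add: lfL)
  qed auto
  ultimately show ?thesis by (simp add: indL_def)
qed

text \<open>A further linear form that is nonzero at the finitely many points completes the
  \<open>D\<close> equations to \<open>D + 1\<close> forms without common zero on
  \<open>V\<close>.\<close>

lemma lin_cut_bound:
  assumes M: "lin_cut D M" and fin: "finite (proj_points (V \<inter> M))"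
  shows "card (proj_points (V \<inter> M)) \<le> Suc cm"
proof -
  from M obtain a where a: "M = {z. z \<noteq> 0 \<and> (\<forall>i<D. lf (a i) z = 0)}" unfolding lin_cut_def lf_def by (elim exE)
  from finite_proj_points_representatives[OF fin] obtain W where
    W: "W \<subseteq> V \<inter> M" "finite W" "\<forall>z\<in>V \<inter> M. \<exists>w\<in>W. \<exists>c. c \<noteq> 0 \<and> z = c *s w" by blast
  obtain e where e: "bij_betw e {0..<CARD('n)} (UNIV :: 'n set)" using ex_bij_betw_nat_finite[of "UNIV :: 'n set"] by auto
  have "\<exists>k\<le>CARD('n). lf (axis (e k) 1) z \<noteq> 0" if "z \<in> W" for z
  proof -
    have "z \<noteq> 0" using that W(1) a by auto
    then obtain i where "z $ i \<noteq> 0" by (auto simp: vec_eq_iff)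
    moreover obtain k where "k < CARD('n)" "i = e k" using e by (metis UNIV_I atLeastLessThan_iff bij_betw_def imageE)
    ultimately show ?thesis by (intro exI[of _ k]) (simp add: lf_axis)
  qed
  from generic_combination[OF W(2) this] obtain \<tau> where \<tau>: "\<forall>z\<in>W. lf (\<Sum>k\<le>CARD('n). \<tau> ^ k *s axis (e k) 1) z \<noteq> 0" by blast
  define b where "b = (\<Sum>k\<le>CARD('n). \<tau> ^ k *s axis (e k) 1)"
  define A where "A k = (if k < D then a k else b)" for k
  have "\<exists>k\<le>D. lf (A k) z \<noteq> 0" if z: "z \<in> V" for z
  proof (rule ccontr)
    assume n: "\<not> ?thesis"
    then have "lf (a k) z = 0" if "k < D" for k using that by (auto simp: A_def dest!: spec[of _ k])
    then have "z \<in> V \<inter> M" using z a proj_closed_nonzero[OF V_closed z] by auto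
    then obtain w c where "w \<in> W" "c \<noteq> 0" "z = c *s w" using W(3) by blast
    moreover have "lf b z = 0" using n by (auto simp: A_def dest!: spec[of _ D])
    ultimately show False using \<tau> by (simp add: b_def[symmetric] lf_linear)
  qed
  from no_common_zero_regular[of A, OF this] have g: "goodL A" "indL A" by blast+
  interpret T: regular_tuple X V Y bs pb D A D by unfold_locales (use g in auto)
  have "{..D} - {D} = {..<D}" by auto
  then have "T.lin_section = V \<inter> M" unfolding T.lin_section_def a using proj_closed_nonzero[OF V_closed] by (auto simp: A_def)
  then show ?thesis using T.section_points(2) by simp
qed

text \<open>The span of the \<open>Y i\<close> is cut out in \<open>S\<close> by the first
  \<open>D\<close> forms of \<open>L0\<close>. The \<open>cm + 1\<close> points \<open>Y i\<close>
  are distinct, and \<open>section_points\<close> admits no more.\<close>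

lemma vertex_section:
  "\<exists>M. lin_cut D M \<and> finite (proj_points (V \<inter> M)) \<and> card (proj_points (V \<inter> M)) = Suc cm"
proof -
  interpret T: regular_tuple X V Y bs pb D L0 D by unfold_locales (use goodL_L0 indL_L0 in auto)
  define M where "M = {z. z \<noteq> 0 \<and> (\<forall>i<D. lf (L0 i) z = 0)}"
  have lc: "lin_cut D M" unfolding lin_cut_def M_def lf_def by (rule exI[of _ L0]) simp
  have "{..D} - {D} = {..<D}" by auto
  then have sec: "T.lin_section = V \<inter> M" unfolding T.lin_section_def M_def using proj_closed_nonzero[OF V_closed] by auto
  have YV: "cvec (Y i) \<in> V \<inter> M" if i: "i \<le> cm" for i
  proof -
    have "Y i \<in> RV" by (rule Y_RV[OF i])
    then have "cvec (Y i) \<in> V" by (simp add: real_points_def)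
    moreover have "lf (L0 k) (cvec (Y i)) = 0" if k: "k < D" for k
      using bs_Y_dual[OF i, of "Suc cm + k"] k i by (simp add: L0(1)[OF k] xc_cvec NN_def)
    ultimately show ?thesis unfolding M_def using proj_closed_nonzero[OF V_closed] by auto
  qed
  have inj: "inj_on (\<lambda>i. pclass (cvec (Y i))) {..cm}"
  proof (rule inj_onI)
    fix i j assume ij: "i \<in> {..cm}" "j \<in> {..cm}" and eq: "pclass (cvec (Y i)) = pclass (cvec (Y j))"
    from pclass_eqD[OF eq] obtain c where c: "cvec (Y i) = c *s cvec (Y j)" by blast
    have iN: "i < NN" using ij by (simp add: NN_def)
    have "xc i (cvec (Y i)) = c * xc i (cvec (Y j))" unfolding c xc_def by (rule lf_linear)
    then have "1 = c * (if j = i then 1 else 0)" unfolding xc_cvec using bs_Y_dual[OF _ iN] ij by (simp split: if_splits)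
    then show "i = j" by (auto split: if_splits)
  qed
  have "(\<lambda>i. pclass (cvec (Y i))) ` {..cm} \<subseteq> proj_points (V \<inter> M)" unfolding proj_points_pclass using YV by auto
  from card_mono[OF _ this] have "Suc cm \<le> card (proj_points (V \<inter> M))"
    using T.section_points(1) card_image[OF inj] by (simp add: sec)
  then show ?thesis using lc T.section_points by (intro exI[of _ M]) (simp add: sec)
qed

lemma degree_eq: assumes "proj_dim V = D" shows "proj_degree V = Suc cm"
  unfolding proj_degree_def assms
proof (rule Max_eqI)
  let ?A = "{card (proj_points (V \<inter> L)) | L. lin_cut D L \<and> finite (proj_points (V \<inter> L))}"
  have le: "x \<le> Suc cm" if "x \<in> ?A" for x using that lin_cut_bound by auto
  then show "finite ?A" by (meson finite_nat_set_iff_bounded_le)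
  show "x \<le> Suc cm" if "x \<in> ?A" for x by (rule le[OF that])
  show "Suc cm \<in> ?A" using vertex_section by force
qed

end

section \<open>Dimension, and conclusion for a component\<close>

lemma nonzero_coordinate: assumes "proj_irreducible W" shows "\<exists>i. \<exists>z\<in>W. z $ i \<noteq> 0"
proof -
  obtain z where "z \<in> W" using assms by (auto simp: proj_irreducible_def)
  moreover then have "z \<noteq> 0" using assms proj_closed_nonzero by (auto simp: proj_irreducible_def)
  ultimately show ?thesis by (auto simp: vec_eq_iff)
qed

lemma proj_irreducible_cancel:
  assumes "proj_irreducible W" "hom_poly d f" "hom_poly e g" "\<exists>z\<in>W. f z \<noteq> 0" "\<And>z. z \<in> W \<Longrightarrow> f z ^ k * g z = 0" "z \<in> W"
  shows "g z = 0"
  using proj_irreducible_forms[OF assms(1) hom_poly_power[OF assms(2), of k] assms(3) assms(5)] assms(4,6) by auto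

text \<open>A chain of length \<open>k\<close> forces the Hilbert function to grow at least like a polynomial of degree \<open>k\<close>:
  on each step multiply by the powers of a form vanishing on the smaller variety only.\<close>

lemma chain_family:
  fixes C :: "nat \<Rightarrow> (complex^'n::finite) set"
  assumes "\<forall>i\<le>k. proj_irreducible (C i)" "\<forall>i<k. C i \<subset> C (Suc i)"
  shows "\<exists>e. \<forall>m. \<exists>(I :: nat list set) f. finite I \<and> card I = Suc m ^ k \<and> (\<forall>i\<in>I. hom_poly (Suc (e * m)) (f i)) \<and> fam_indep (C k) I f"
  using assms
proof (induction k)
  case 0
  then obtain i z where z: "z \<in> C 0" "z $ i \<noteq> 0" using nonzero_coordinate[of "C 0"] by auto
  have "fam_indep (C 0) {[] :: nat list} (\<lambda>_ z. z $ i)" unfolding fam_indep_def using z by auto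
  then have "finite {[] :: nat list} \<and> card {[] :: nat list} = Suc m ^ 0 \<and> (\<forall>j\<in>{[] :: nat list}. hom_poly (Suc (0 * m)) (\<lambda>z. z $ i)) \<and>
      fam_indep (C 0) {[] :: nat list} (\<lambda>_ z. z $ i)" for m using hom_poly_nth[of i] by simp
  then show ?case by (intro exI[of _ 0] allI exI[of _ "{[] :: nat list}"] exI[of _ "\<lambda>_ z. z $ i"])
next
  case (Suc k)
  then obtain e where e: "\<forall>m. \<exists>(I :: nat list set) f. finite I \<and> card I = Suc m ^ k \<and> (\<forall>i\<in>I. hom_poly (Suc (e * m)) (f i)) \<and> fam_indep (C k) I f"
    by auto
  have irr: "proj_irreducible (C k)" "proj_irreducible (C (Suc k))" using Suc(2) by auto
  have sub: "C k \<subset> C (Suc k)" using Suc(3) by blast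
  then obtain x where x: "x \<in> C (Suc k)" "x \<notin> C k" by blast
  have "x \<noteq> 0" using irr(2) x(1) proj_closed_nonzero by (auto simp: proj_irreducible_def)
  from proj_closed_form_separates[OF _ x(2) this] irr(1) obtain d g where
    g: "hom_poly d g" "\<forall>z\<in>C k. g z = 0" "g x \<noteq> 0" by (auto simp: proj_irreducible_def)
  obtain j y where y: "y \<in> C k" "y $ j \<noteq> 0" using nonzero_coordinate[OF irr(1)] by blast
  have "\<exists>(I :: nat list set) f. finite I \<and> card I = Suc m ^ Suc k \<and> (\<forall>i\<in>I. hom_poly (Suc ((e + d) * m)) (f i)) \<and> fam_indep (C (Suc k)) I f" for m
  proof -
    from e obtain I :: "nat list set" and f where I: "finite I" "card I = Suc m ^ k" "\<forall>i\<in>I. hom_poly (Suc (e * m)) (f i)" "fam_indep (C k) I f"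
      by (elim allE[of _ m] exE conjE)
    \<comment> \<open>The power of a coordinate that is nonzero somewhere on \<open>C k\<close> pads
      the degree, making it the same for all \<open>s\<close>.\<close>
    define F where "F s i z = g z ^ s * (z $ j ^ (d * (m - s)) * f i z)" for s i z
    have hF: "hom_poly (d * (t + (m - s)) + Suc (e * m)) (\<lambda>z. g z ^ t * (z $ j ^ (d * (m - s)) * f i z))" if "i \<in> I" for s t i
    proof -
      have "hom_poly (d * t + (1 * (d * (m - s)) + Suc (e * m))) (\<lambda>z. g z ^ t * (z $ j ^ (d * (m - s)) * f i z))"
        using I(3) that by (intro hom_poly_mult hom_poly_power g(1) hom_poly_nth) auto
      then show ?thesis by (simp add: algebra_simps)
    qed
    define I' where "I' = (\<lambda>(s, i). s # i) ` ({..m} \<times> I)"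
    have inj: "inj_on (\<lambda>(s, i). s # i) ({..m} \<times> I)" by (auto simp: inj_on_def)
    have c: "finite I'" "card I' = Suc m ^ Suc k" unfolding I'_def using I(1,2) by (auto simp: card_image[OF inj])
    define f' where "f' x = F (hd x) (tl x)" for x
    have h: "hom_poly (Suc ((e + d) * m)) (f' x)" if x: "x \<in> I'" for x
    proof -
      obtain s i where si: "s \<le> m" "i \<in> I" "x = s # i" using x by (auto simp: I'_def)
      from hF[OF si(2), of s s] si show ?thesis by (simp add: f'_def F_def[abs_def] algebra_simps)
    qed
    have "fam_indep (C (Suc k)) I' f'" unfolding fam_indep_def
    proof (intro allI impI, rule ccontr)
      fix \<gamma> assume r: "\<forall>z\<in>C (Suc k). (\<Sum>x\<in>I'. \<gamma> x * f' x z) = 0" and n: "\<not> (\<forall>x\<in>I'. \<gamma> x = 0)"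
      have r': "(\<Sum>s\<le>m. \<Sum>i\<in>I. \<gamma> (s # i) * F s i z) = 0" if "z \<in> C (Suc k)" for z
      proof -
        have "(\<Sum>x\<in>I'. \<gamma> x * f' x z) = (\<Sum>(s, i)\<in>{..m} \<times> I. \<gamma> (s # i) * F s i z)"
          unfolding I'_def by (subst sum.reindex[OF inj]) (simp add: f'_def case_prod_unfold)
        then show ?thesis using r that by (simp add: sum.cartesian_product)
      qed
      \<comment> \<open>In a relation take the least power of \<open>g\<close> that occurs. It
        cancels on the larger variety, and restriction to \<open>C k\<close>, where \<open>g\<close>
        vanishes, leaves a relation among the old forms.\<close>
      define Q where "Q s \<longleftrightarrow> s \<le> m \<and> (\<exists>i\<in>I. \<gamma> (s # i) \<noteq> 0)" for s
      have "\<exists>s. Q s" using n by (auto simp: Q_def I'_def)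
      define s0 where "s0 = (LEAST s. Q s)"
      have Qs: "Q s0" unfolding s0_def by (rule LeastI_ex[of Q]) fact
      have below: "\<not> Q s" if "s < s0" for s using not_less_Least[of s Q] that by (simp add: s0_def)
      have s0m: "s0 \<le> m" using Qs by (simp add: Q_def)
      define H where "H z = (\<Sum>s\<in>{s0..m}. \<Sum>i\<in>I. \<gamma> (s # i) * (g z ^ (s - s0) * (z $ j ^ (d * (m - s)) * f i z)))" for z
      have hH: "hom_poly (d * (m - s0) + Suc (e * m)) H" unfolding H_def[abs_def]
      proof (intro hom_poly_sum hom_poly_smult)
        fix s i assume "s \<in> {s0..m}" "i \<in> I"
        then show "hom_poly (d * (m - s0) + Suc (e * m)) (\<lambda>z. g z ^ (s - s0) * (z $ j ^ (d * (m - s)) * f i z))"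
          using hF[of i "s - s0" s] by simp
      qed
      have gH: "g z ^ s0 * H z = 0" if z: "z \<in> C (Suc k)" for z
      proof -
        have "(\<Sum>s\<le>m. \<Sum>i\<in>I. \<gamma> (s # i) * F s i z) = (\<Sum>s\<in>{s0..m}. \<Sum>i\<in>I. \<gamma> (s # i) * F s i z)"
        proof (rule sum.mono_neutral_right)
          show "\<forall>s\<in>{..m} - {s0..m}. (\<Sum>i\<in>I. \<gamma> (s # i) * F s i z) = 0"
          proof
            fix s assume "s \<in> {..m} - {s0..m}"
            then have "s \<le> m" "\<not> Q s" using below by auto
            then show "(\<Sum>i\<in>I. \<gamma> (s # i) * F s i z) = 0" by (intro sum.neutral) (auto simp: Q_def)
          qed
        qed auto
        also have "\<dots> = g z ^ s0 * H z" unfolding H_def sum_distrib_left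
        proof (intro sum.cong refl)
          fix s i assume "s \<in> {s0..m}" "i \<in> I"
          then have "g z ^ s = g z ^ s0 * g z ^ (s - s0)" by (simp add: power_add[symmetric])
          then show "\<gamma> (s # i) * F s i z = g z ^ s0 * (\<gamma> (s # i) * (g z ^ (s - s0) * (z $ j ^ (d * (m - s)) * f i z)))"
            unfolding F_def by simp
        qed
        finally show ?thesis using r'[OF z] by simp
      qed
      have H0: "H z = 0" if "z \<in> C k" for z
        by (rule proj_irreducible_cancel[OF irr(2) g(1) hH _ gH]) (use x(1) g(3) sub that in auto)
      have Hk: "H z = z $ j ^ (d * (m - s0)) * (\<Sum>i\<in>I. \<gamma> (s0 # i) * f i z)" if z: "z \<in> C k" for z
      proof -
        have "H z = (\<Sum>s\<in>{s0..m}. if s = s0 then (\<Sum>i\<in>I. \<gamma> (s0 # i) * (z $ j ^ (d * (m - s0)) * f i z)) else 0)"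
          unfolding H_def
        proof (rule sum.cong[OF refl])
          fix s assume "s \<in> {s0..m}"
          then show "(\<Sum>i\<in>I. \<gamma> (s # i) * (g z ^ (s - s0) * (z $ j ^ (d * (m - s)) * f i z))) =
              (if s = s0 then (\<Sum>i\<in>I. \<gamma> (s0 # i) * (z $ j ^ (d * (m - s0)) * f i z)) else 0)"
            using g(2) z by (cases "s = s0") (auto simp: zero_power)
        qed
        also have "\<dots> = (\<Sum>i\<in>I. \<gamma> (s0 # i) * (z $ j ^ (d * (m - s0)) * f i z))" using s0m by simp
        finally show ?thesis by (simp add: sum_distrib_left mult.left_commute)
      qed
      have hs: "hom_poly (Suc (e * m)) (\<lambda>z. \<Sum>i\<in>I. \<gamma> (s0 # i) * f i z)" using I(3) by (intro hom_poly_sum hom_poly_smult) blast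
      have "z $ j ^ (d * (m - s0)) * (\<Sum>i\<in>I. \<gamma> (s0 # i) * f i z) = 0" if z: "z \<in> C k" for z using H0[OF z] Hk[OF z] by simp
      from proj_irreducible_cancel[OF irr(1) hom_poly_nth[of j] hs _ this]
      have "(\<Sum>i\<in>I. \<gamma> (s0 # i) * f i z) = 0" if z: "z \<in> C k" for z using y z by blast
      from fam_indepD[OF I(4), of "\<lambda>i. \<gamma> (s0 # i)", OF this] show False using Qs by (auto simp: Q_def)
    qed
    then show ?thesis using c h by (intro exI[of _ I'] exI[of _ f']) simp
  qed
  then show ?case by (intro exI[of _ "e + d"] allI)
qed

context frame
begin

lemma card_Idx: "card (Idx t) \<le> Suc t ^ D"
proof -
  let ?r = "\<lambda>\<alpha>. restrict \<alpha> {..<D}"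
  have inj: "inj_on ?r (Idx t)"
  proof (rule inj_onI)
    fix \<alpha> \<beta> assume a: "\<alpha> \<in> Idx t" "\<beta> \<in> Idx t" and eq: "?r \<alpha> = ?r \<beta>"
    show "\<alpha> = \<beta>" using fun_cong[OF eq] by (intro Idx_eqI[OF a]) (metis lessThan_iff restrict_apply')
  qed
  have "?r ` Idx t \<subseteq> (\<Pi>\<^sub>E k\<in>{..<D}. {..t})"
  proof
    fix x assume "x \<in> ?r ` Idx t"
    then obtain \<alpha> where \<alpha>: "\<alpha> \<in> Idx t" "x = ?r \<alpha>" by blast
    have "\<alpha> k \<le> t" if "k < D" for k using member_le_sum[of k "{..D}" \<alpha>] that \<alpha>(1) by (simp add: Idx_def)
    then show "x \<in> (\<Pi>\<^sub>E k\<in>{..<D}. {..t})" using \<alpha>(2) by auto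
  qed
  from card_mono[OF _ this] show ?thesis by (simp add: card_image[OF inj] card_PiE finite_PiE)
qed

text \<open>Over the parameters \<open>L0\<close> the forms of degree \<open>Suc t\<close> span a
  space of dimension at most \<open>Suc t ^ D * NN\<close>, so the Hilbert function grows with
  exponent at most \<open>D\<close>, while a chain of length \<open>k\<close> forces exponent
  \<open>k\<close>.\<close>

lemma chain_length:
  assumes "\<forall>i\<le>k. proj_irreducible (C i)" "\<forall>i<k. C i \<subset> C (Suc i)" "C k = V" shows "k \<le> D"
proof (rule ccontr)
  assume "\<not> k \<le> D"
  from chain_family[OF assms(1,2)] obtain e where
    e: "\<forall>m. \<exists>(I :: nat list set) f. finite I \<and> card I = Suc m ^ k \<and> (\<forall>i\<in>I. hom_poly (Suc (e * m)) (f i)) \<and> fam_indep (C k) I f" by (elim exE)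
  \<comment> \<open>Chosen so that the upper bound for degree \<open>Suc (e * m)\<close> is at most
    \<open>m * Suc m ^ D\<close>, just below \<open>Suc m ^ Suc D\<close>.\<close>
  define m where "m = Suc e ^ D * NN"
  from e obtain I :: "nat list set" and f where I: "finite I" "card I = Suc m ^ k" "\<forall>i\<in>I. hom_poly (Suc (e * m)) (f i)" "fam_indep (C k) I f"
    by (elim allE[of _ m] exE conjE)
  define g where "g p z = mon L0 (fst p) z * xc (snd p) z" for p z
  have fin: "finite (Idx (e * m) \<times> {..<NN})" using finite_Idx by simp
  have "card I \<le> card (Idx (e * m) \<times> {..<NN})"
  proof (rule fam_bound[OF I(1) fin I(4)[unfolded assms(3)], where g = g])
    fix i assume i: "i \<in> I"
    from goodL_Rep[OF goodL_L0 I(3)[rule_format, OF i]] obtain c where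
      c: "\<forall>z\<in>V. f i z = (\<Sum>\<alpha>\<in>Idx (e * m). mon L0 \<alpha> z * lf (c \<alpha>) z)" unfolding Rep_def by (elim exE)
    have "in_fam V (Idx (e * m) \<times> {..<NN}) g (\<lambda>z. \<Sum>\<alpha>\<in>Idx (e * m). \<Sum>j<NN. lf (c \<alpha>) (cvec (bs j)) * g (\<alpha>, j) z)"
      by (intro in_fam_sum in_fam_smult in_fam_single fin) auto
    then show "in_fam V (Idx (e * m) \<times> {..<NN}) g (f i)"
    proof (rule in_fam_cong)
      fix z assume z: "z \<in> V"
      show "f i z = (\<Sum>\<alpha>\<in>Idx (e * m). \<Sum>j<NN. lf (c \<alpha>) (cvec (bs j)) * g (\<alpha>, j) z)"
        using c z by (simp add: lf_decomp[OF z] g_def sum_distrib_left mult.left_commute)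
    qed
  qed
  also have "\<dots> \<le> Suc (e * m) ^ D * NN" using card_Idx[of "e * m"] by (simp add: card_cartesian_product)
  also have "\<dots> \<le> (Suc e * Suc m) ^ D * NN" by (intro mult_right_mono power_mono) auto
  also have "\<dots> = m * Suc m ^ D" by (simp only: m_def power_mult_distrib mult_ac)
  also have "\<dots> < Suc m ^ Suc D" by simp
  also have "\<dots> \<le> Suc m ^ k" using \<open>\<not> k \<le> D\<close> by (intro power_increasing) auto
  finally show False using I(2) by simp
qed

text \<open>The Zariski closure of the image of a real linear space under
  \<open>psi\<close>.\<close>

definition "Zc U = {z. z \<noteq> 0 \<and> (\<forall>d f. hom_poly d f \<and> (\<forall>u\<in>U. f (cvec (psi u)) = 0) \<longrightarrow> f z = 0)}"

lemma psi_Y0: "psi (Y 0) = Y 0"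
proof -
  have "Xi (Y 0) = Y 0" by (rule Xi_id) (rule self_T1[OF Y_RV], simp)
  moreover have "rqform (F i) (Y 0) = 0" if "i \<in> J" for i using ideal2_real_points[OF F[OF that]] Y_RV[of 0] RV_subset by auto
  ultimately show ?thesis using psi_Xi[of "Y 0"] Y_S[of 0] h_Y(2) by simp
qed

lemma psi_Zc: assumes "u \<in> U" "psi u \<noteq> 0" shows "cvec (psi u) \<in> Zc U"
  unfolding Zc_def using assms by (auto simp: cvec_inj[of _ 0, unfolded cvec_simps])

text \<open>Forms pulled back along \<open>psi\<close> are forms on the real space \<open>U\<close>,
  where a product vanishes only if a factor does.\<close>

lemma Zc_irreducible:
  assumes U: "subspace U" "Y 0 \<in> U" shows "proj_irreducible (Zc U)"
proof -
  have Y0: "Y 0 \<noteq> 0" using P_nonzero Y_P[of 0] by simp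
  have y: "cvec (Y 0) \<in> Zc U" using psi_Zc[OF U(2)] Y0 by (simp add: psi_Y0)
  have cl: "proj_closed (Zc U)" unfolding proj_closed_def Zc_def
    by (rule exI[of _ "{f. \<exists>d. hom_poly d f \<and> (\<forall>u\<in>U. f (cvec (psi u)) = 0)}"]) blast
  have "Zc U \<subseteq> A \<or> Zc U \<subseteq> B" if AB: "proj_closed A" "proj_closed B" "Zc U \<subseteq> A \<union> B" for A B
  proof (rule ccontr)
    assume "\<not> ?thesis"
    then obtain z w where zw: "z \<in> Zc U" "z \<notin> A" "w \<in> Zc U" "w \<notin> B" by blast
    have nz: "z \<noteq> 0" "w \<noteq> 0" using zw by (auto simp: Zc_def)
    obtain d f where f: "hom_poly d f" "\<forall>x\<in>A. f x = 0" "f z \<noteq> 0" using proj_closed_form_separates[OF AB(1) zw(2) nz(1)] by blast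
    obtain e g where g: "hom_poly e g" "\<forall>x\<in>B. g x = 0" "g w \<noteq> 0" using proj_closed_form_separates[OF AB(2) zw(4) nz(2)] by blast
    have fg: "f x * g x = 0" if "x \<in> Zc U" for x using that AB(3) f(2) g(2) by auto
    have "f (psiC (cvec u)) * g (psiC (cvec u)) = 0" if u: "u \<in> U" for u
    proof (cases "psi u = 0")
      case True
      have "f 0 * g 0 = 0 ^ (d + e) * (f (cvec (Y 0)) * g (cvec (Y 0)))"
        using hom_poly_scale[OF hom_poly_mult[OF f(1) g(1)], of 0 "cvec (Y 0)"] by simp
      then show ?thesis using fg[OF y] True by (simp add: psiC_cvec cvec_simps)
    next
      case False
      then show ?thesis using fg[OF psi_Zc[OF u]] by (simp add: psiC_cvec)
    qed
    from subspace_forms_no_zero_divisors[OF hom_poly_comp[OF f(1) hom_poly_psiC] hom_poly_comp[OF g(1) hom_poly_psiC] U(1) this]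
    have "(\<forall>u\<in>U. f (cvec (psi u)) = 0) \<or> (\<forall>u\<in>U. g (cvec (psi u)) = 0)" by (simp add: psiC_cvec)
    then show False using zw f g unfolding Zc_def by blast
  qed
  then show ?thesis unfolding proj_irreducible_def using cl y by blast
qed

definition "hp z = (\<Prod>j\<in>J. cbf (F j) z (Y j))"

lemma hom_poly_hp: "hom_poly (\<Sum>j\<in>J. 1) hp" unfolding hp_def[abs_def] by (intro hom_poly_prod hom_poly_cbf)

lemma hp_cvec: "hp (cvec x) = of_real (\<Prod>j\<in>J. h j x)" by (simp add: hp_def cbf_cvec h_def)

lemma hp_Y0: "hp (cvec (Y 0)) = 1" by (simp add: hp_cvec h_Y)

text \<open>One inclusion is \<open>psi_forms\<close>. Conversely a real point \<open>y\<close> of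
  \<open>V\<close> satisfies \<open>psi (Xi y) = y\<close> up to the factor \<open>hp\<close>, a
  form that is not identically 0 on \<open>V\<close> and can be cancelled.\<close>

lemma Zc_T1: "Zc (T1 (Y 0)) = V"
proof
  show "Zc (T1 (Y 0)) \<subseteq> V"
  proof
    fix z assume z: "z \<in> Zc (T1 (Y 0))"
    show "z \<in> V"
    proof (rule forms_cut_closed[OF V_closed])
      show "z \<noteq> 0" using z by (simp add: Zc_def)
      fix d f assume f: "hom_poly d f" "\<And>x. x \<in> V \<Longrightarrow> f x = 0"
      then have "\<forall>u\<in>T1 (Y 0). f (cvec (psi u)) = 0" using psi_forms by blast
      then show "f z = 0" using z f(1) unfolding Zc_def by blast
    qed
  qed
  show "V \<subseteq> Zc (T1 (Y 0))"
  proof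
    fix z assume z: "z \<in> V"
    have "f z = 0" if f: "hom_poly d f" "\<forall>u\<in>T1 (Y 0). f (cvec (psi u)) = 0" for d f
    proof (rule proj_irreducible_cancel[OF V_irr hom_poly_hp f(1) _ _ z])
      have "cvec (Y 0) \<in> V" using Y_RV[of 0] by (simp add: real_points_def)
      then show "\<exists>z\<in>V. hp z \<noteq> 0" using hp_Y0 by force
      fix w assume w: "w \<in> V"
      show "hp w ^ d * f w = 0"
      proof (rule RV_dense[OF hom_poly_mult[OF hom_poly_power[OF hom_poly_hp] f(1)] _ w])
        fix y assume y: "y \<in> RV"
        then have yS: "y \<in> S" using RV_subset by blast
        have "rqform (F i) y = 0" if "i \<in> J" for i using ideal2_real_points[OF F[OF that]] y RV_subset by auto
        from psi_Xi[OF yS this] have p: "psi (Xi y) = (\<Prod>j\<in>J. h j y) *\<^sub>R y" by simp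
        have "f (cvec (psi (Xi y))) = 0" using f(2) Xi_S[OF yS] by blast
        then have "f (hp (cvec y) *s cvec y) = 0" unfolding p cvec_simps hp_cvec .
        then show "hp (cvec y) ^ d * f (cvec y) = 0" unfolding hom_poly_scale[OF f(1)] .
      qed
    qed
    then show "z \<in> Zc (T1 (Y 0))" unfolding Zc_def using proj_closed_nonzero[OF V_closed z] by blast
  qed
qed

text \<open>Apply \<open>psi\<close> to a flag of subspaces of the tangent space at
  \<open>Y 0\<close>, each containing \<open>Y 0\<close> and each releasing one more of the
  \<open>D\<close> transversal coordinates.\<close>

lemma chain_exists: "\<exists>C. (\<forall>i\<le>D. proj_irreducible (C i)) \<and> (\<forall>i<D. C i \<subset> C (Suc i)) \<and> C D = V"
proof -
  define U where "U i = {u\<in>T1 (Y 0). \<forall>l<D. i \<le> l \<longrightarrow> pb (Suc cm + l) \<bullet> u = 0}" for i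
  have Y0: "Y 0 \<in> T1 (Y 0)" by (rule self_T1[OF Y_RV]) simp
  have pY: "pb (Suc cm + l) \<bullet> Y j = 0" if "l < D" "j \<le> cm" for l j
    using bs_Y_dual[OF that(2), of "Suc cm + l"] that by (simp add: NN_def)
  have sub: "subspace (U i)" for i
    using subspace_T1[of "Y 0"] by (auto simp: U_def subspace_def inner_add_right)
  have Y0U: "Y 0 \<in> U i" for i using Y0 pY by (simp add: U_def)
  have irr: "proj_irreducible (Zc (U i))" for i by (rule Zc_irreducible[OF sub Y0U])
  \<comment> \<open>\<open>psi\<close> multiplies the transversal coordinates by the common factor
    \<open>hp\<close>, so the coordinate released at step \<open>i\<close> vanishes on one member of
    the chain and not on the next.\<close>
  have px: "xc (Suc cm + l) (cvec (psi u)) = hp (cvec u) * xc (Suc cm + l) (cvec u)" if l: "l < D" for l u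
  proof -
    have "pb (Suc cm + l) \<bullet> psi u = (\<Prod>j\<in>J. h j u) * (pb (Suc cm + l) \<bullet> u)"
      unfolding psi_def using pY[OF l] by (simp add: inner_diff_right inner_sum_right)
    then show ?thesis by (simp only: xc_cvec hp_cvec of_real_mult)
  qed
  have "Zc (U i) \<subset> Zc (U (Suc i))" if i: "i < D" for i
  proof
    have "U i \<subseteq> U (Suc i)" by (auto simp: U_def)
    then show "Zc (U i) \<subseteq> Zc (U (Suc i))" unfolding Zc_def by blast
    have "\<forall>u\<in>U i. xc (Suc cm + i) (cvec (psi u)) = 0" unfolding px[OF i] using i by (simp add: U_def xc_cvec)
    then have 0: "xc (Suc cm + i) z = 0" if "z \<in> Zc (U i)" for z using that hom_poly_xc unfolding Zc_def by blast
    show "Zc (U i) \<noteq> Zc (U (Suc i))"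
    proof
      assume eq: "Zc (U i) = Zc (U (Suc i))"
      have "hp (cvec u) * xc (Suc cm + i) (cvec u) = 0" if u: "u \<in> U (Suc i)" for u
      proof (cases "psi u = 0")
        case True
        then show ?thesis unfolding px[OF i, symmetric] by (simp only: xc_cvec inner_zero_right of_real_0)
      next
        case False
        then show ?thesis unfolding px[OF i, symmetric] using 0 psi_Zc[OF u] eq by blast
      qed
      from subspace_forms_no_zero_divisors[OF hom_poly_hp hom_poly_xc sub this]
      have "\<forall>u\<in>U (Suc i). xc (Suc cm + i) (cvec u) = 0" using hp_Y0 Y0U[of "Suc i"] by force
      moreover from tangent_frame[of 0, OF _ i] obtain w where
        w: "w \<in> T1 (Y 0)" "\<forall>l<D. pb (Suc cm + l) \<bullet> w = (if l = i then 1 else 0)" by auto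
      then have "w \<in> U (Suc i)" by (auto simp: U_def)
      ultimately have "xc (Suc cm + i) (cvec w) = 0" by blast
      then show False using w(2) i by (simp only: xc_cvec) simp
    qed
  qed
  moreover have "U D = T1 (Y 0)" by (auto simp: U_def)
  ultimately show ?thesis using irr Zc_T1 by (intro exI[of _ "\<lambda>i. Zc (U i)"]) simp
qed

lemma proj_dim_eq: "proj_dim V = D"
  unfolding proj_dim_def
proof (rule Greatest_equality)
  show "\<exists>C. (\<forall>i\<le>D. proj_irreducible (C i)) \<and> (\<forall>i<D. C i \<subset> C (Suc i)) \<and> C D = V" by (rule chain_exists)
  fix k assume "\<exists>C. (\<forall>i\<le>k. proj_irreducible (C i)) \<and> (\<forall>i<k. C i \<subset> C (Suc i)) \<and> C k = V"
  then show "k \<le> D" by (elim exE conjE) (rule chain_length)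
qed

lemma dim_complex_span: "vec.dim (vec.span V) = NN"
proof -
  let ?B = "(\<lambda>j. cvec (bs j)) ` {..<NN}"
  have dual: "xc i (cvec (bs j)) = (if j = i then 1 else 0)" if "i < NN" "j < NN" for i j
    using pbN[OF that] by (simp add: xc_cvec)
  have inj: "inj_on (\<lambda>j. cvec (bs j)) {..<NN}"
  proof (rule inj_onI)
    fix i j assume ij: "i \<in> {..<NN}" "j \<in> {..<NN}" and eq: "cvec (bs i) = cvec (bs j)"
    have "xc i (cvec (bs i)) = xc i (cvec (bs j))" unfolding eq ..
    then show "i = j" using dual ij by (auto split: if_splits)
  qed
  have "cvec v \<in> vec.span V" if "v \<in> S" for v
  proof -
    have "v \<in> span RV" using that by (simp add: S_def)
    then show ?thesis
    proof (induction rule: span_induct)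
      case base
      show ?case by (auto simp: subspace_def cvec_simps intro: vec.span_add vec.span_scale vec.span_zero)
    qed (auto simp: real_points_def intro: vec.span_base)
  qed
  then have "?B \<subseteq> vec.span V" using bs_S by auto
  moreover have "vec.span V \<subseteq> vec.span ?B"
  proof (rule vec.span_minimal[OF _ vec.subspace_span], rule subsetI)
    fix z assume z: "z \<in> V"
    have "z $ i = (\<Sum>j<NN. xc j z *s cvec (bs j)) $ i" for i
      using lf_decomp[OF z, of "axis i 1"] by (simp add: lf_axis mult.commute)
    then have "z = (\<Sum>j<NN. xc j z *s cvec (bs j))" by (simp only: vec_eq_iff) simp
    also have "\<dots> \<in> vec.span ?B" by (intro vec.span_sum vec.span_scale vec.span_base) auto
    finally show "z \<in> vec.span ?B" .
  qed
  moreover have "vec.independent ?B"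
  proof (rule vec.independent_if_scalars_zero)
    show "finite ?B" by simp
    fix f x assume 0: "(\<Sum>x\<in>?B. f x *s x) = 0" and "x \<in> ?B"
    then obtain i where i: "i < NN" "x = cvec (bs i)" by auto
    have "(\<Sum>j<NN. f (cvec (bs j)) *s cvec (bs j)) = 0" using 0 by (simp add: sum.reindex[OF inj])
    then have "xc i (\<Sum>j<NN. f (cvec (bs j)) *s cvec (bs j)) = 0" by (simp add: xc_def lf_linear)
    then have "(\<Sum>j<NN. f (cvec (bs j)) * xc i (cvec (bs j))) = 0" by (simp add: xc_def lf_sum lf_linear)
    moreover have "(\<Sum>j<NN. f (cvec (bs j)) * xc i (cvec (bs j))) = (\<Sum>j<NN. if j = i then f x else 0)"
      using dual[OF i(1)] i(2) by (intro sum.cong) auto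
    ultimately show "f x = 0" using i(1) by simp
  qed
  ultimately show ?thesis using card_image[OF inj] by (intro vec.dim_unique) auto
qed

lemma minimal_degree_component: "minimal_degree V"
  unfolding minimal_degree_def degree_eq[OF proj_dim_eq] proj_dim_eq dim_complex_span by (simp add: NN_def)

end

lemma (in component) minimal_degree: "minimal_degree V"
proof -
  interpret chart X V Ys by unfold_locales (rule strong_Ys)
  from frame_exists obtain bs pb D where f: "\<forall>j\<le>cm. bs j = Ys j" "dim S = Suc cm + D" "S = span (bs ` {..<Suc cm + D})"
    "\<forall>i<Suc cm + D. \<forall>j<Suc cm + D. pb i \<bullet> bs j = (if j = i then 1 else 0)" by (elim exE conjE)
  interpret frame X V Ys bs pb D by unfold_locales (use f in auto)
  show ?thesis by (rule minimal_degree_component)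
qed

lemma real_proj_closed_proj_closed: assumes "real_proj_closed X" shows "proj_closed X"
proof -
  have "hom_poly d f" if "real_hom_poly d f" for d and f :: "complex^'a \<Rightarrow> complex"
  proof -
    from that obtain A c where A: "finite A" "\<forall>\<alpha>\<in>A. sum \<alpha> UNIV = d" "f = (\<lambda>z. \<Sum>\<alpha>\<in>A. complex_of_real (c \<alpha>) * monom \<alpha> z)"
      unfolding real_hom_poly_def by (elim exE conjE)
    show ?thesis unfolding hom_poly_def
      by (rule exI[of _ A], rule exI[of _ "\<lambda>\<alpha>. complex_of_real (c \<alpha>)"], intro conjI) (fact A)+
  qed
  moreover from assms obtain F where "\<forall>f\<in>F. \<exists>d. real_hom_poly d f" "X = {z. z \<noteq> 0 \<and> (\<forall>f\<in>F. f z = 0)}"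
    unfolding real_proj_closed_def by (elim exE conjE)
  ultimately have "(\<forall>f\<in>F. \<exists>d. hom_poly d f) \<and> X = {z. z \<noteq> 0 \<and> (\<forall>f\<in>F. f z = 0)}" by meson
  then show ?thesis unfolding proj_closed_def by (rule exI[of _ F])
qed

theorem theorem3p7:
  fixes X :: "(complex^'n::finite) set"
  assumes "real_proj_closed X"
    and "totally_real X"
    and "SigmaX_dual X = PX_dual X"
  shows "linearly_joined X \<and> (\<forall>V\<in>irr_components X. minimal_degree V)"
proof -
  have closed: "proj_closed X" by (rule real_proj_closed_proj_closed[OF assms(1)])
  interpret sos X
  proof
    show "proj_closed X" "totally_real X" by fact+
    fix M :: "real^'n^'n"
    assume "\<And>A. A \<in> ideal2 X \<Longrightarrow> A \<bullet> M = 0" "\<And>l. outer_sq l \<bullet> M \<ge> 0"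
    then show "M \<in> sq_sums X" by (rule psd_decomposition_of_duals[OF closed assms(3)])
  qed
  have "minimal_degree V" if "V \<in> irr_components X" for V
    by (rule component.minimal_degree[OF component.intro[OF sos_axioms component_axioms.intro[OF that]]])
  moreover have "linearly_joined X" by (rule sos_linearly_joined[OF sos_axioms])
  ultimately show ?thesis by blast
qed

end
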